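(* Fix $m,n\in\mathbb N$. For every convex body $K\subseteq\mathbb R^n$, \[\operatorname{vol}_{nm}\big(D^{m,\circ}(K)\big)\,\operatorname{vol}_n(K)^m \;\leq\; \operatorname{vol}_{nm}\big(D^{m,\circ}(B_2^n)\big)\,\operatorname{vol}_n(B_2^n)^m,\] with equality if and only if $K$ is an ellipsoid.
   Context: A convex body is a compact convex set with non-empty interior. $\operatorname{vol}_d$ denotes $d$-dimensional Lebesgue measure and $B_2^n$ the centered closed unit Euclidean ball of $\mathbb R^n$. For a convex body $K\subseteq\mathbb R^n$, its $m$th-order difference body is \[D^m(K)=\Big\{(x_1,\dots,x_m)\in(\mathbb R^n)^m=\mathbb R^{nm}:\ K\cap\bigcap_{i=1}^m (K+x_i)\neq\emptyset\Big\},\] a convex body in $\mathbb R^{nm}$ containing the origin in its interior. For a convex body $L\subseteq\mathbb R^d$ containing the origin, $L^\circ=\{x\in\mathbb R^d:\langle x,y\rangle\le 1\ \forall y\in L\}$ is its polar, and $D^{m,\circ}(K):=(D^m(K))^\circ$. *)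

theory Defs
  imports "HOL-Analysis.Analysis"
begin

definition convex_body :: "'a::euclidean_space set \<Rightarrow> bool" where
  "convex_body K \<longleftrightarrow> compact K \<and> convex K \<and> interior K \<noteq> {}"

text \<open>The m-th order difference body; (R^n)^m is modelled as real^'n^'m,
  with m = CARD('m). Its inner product is the sum of the componentwise ones,
  i.e. the standard inner product of R^{nm}.\<close>
definition diff_body :: "(real^'n) set \<Rightarrow> (real^'n^'m) set" where
  "diff_body K = {x. K \<inter> (\<Inter>i. (\<lambda>y. y + x $ i) ` K) \<noteq> {}}"

definition polar :: "'a::real_inner set \<Rightarrow> 'a set" where
  "polar L = {x. \<forall>y\<in>L. inner x y \<le> 1}"

definition ellipsoid :: "(real^'n) set \<Rightarrow> bool" where
  "ellipsoid E \<longleftrightarrow> (\<exists>(A::real^'n^'n) b. invertible A \<and> E = (\<lambda>x. A *v x + b) ` cball 0 1)"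

end

theory Submission
  imports Defs "HOL-Complex_Analysis.Great_Picard" "HOL-Probability.Distributions"
    "HOL-Probability.Distribution_Functions"
begin

text \<open>
  The polar of \<open>D\<^sup>m K\<close> is \<open>{\<theta>. h (\<theta>\<^sub>1 + \<dots> + \<theta>\<^sub>m) + h (- \<theta>\<^sub>1) + \<dots> + h (- \<theta>\<^sub>m) \<le> 1}\<close>, where \<open>h\<close> is the
  support function of \<open>K\<close>. The volume product is affine invariant, so normalising a largest inscribed
  simplex and extracting a convergent sequence of support functions yields a maximizer; it suffices
  to show that every maximizer is an ellipsoid.

  Translate a maximizer \<open>K\<close> so that the hyperplane orthogonal to a basis vector \<open>b\<close> through the origin
  bisects its volume, and let \<open>K'\<close> be the polar of the Steiner symmetral of the polar of \<open>K\<close> in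
  direction \<open>b\<close>. By the Brunn--Minkowski inequality on the fibres in direction \<open>b\<close>, the volume of the
  polar of \<open>D\<^sup>m\<close> does not decrease when \<open>K\<close> is replaced by \<open>K'\<close>. If \<open>x, y \<in> K\<close> have \<open>b\<close>-coordinates
  \<open>s\<close> and \<open>- t\<close>, then \<open>K'\<close> contains a point with \<open>b\<close>-coordinate the harmonic mean \<open>2 s t / (s + t)\<close> whose
  other coordinates are a convex combination of those of \<open>x\<close> and \<open>y\<close>; transporting one half of \<open>K\<close>
  monotonically to the other shows that the volume does not decrease either. Maximality forces
  equality, and this makes every two-dimensional marginal of \<open>K\<close> containing the direction \<open>b\<close>
  invariant under a skew reflection. By affine invariance \<open>b\<close> can be any direction, so for centered
  \<open>K\<close> the support function depends only on the second-moment form, and \<open>K\<close> is an ellipsoid.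
\<close>

section \<open>One-dimensional Brunn--Minkowski and Prekopa--Leindler inequalities\<close>

text \<open>The gauge of the polar is a sum of \<open>m + 1\<close> support functions, while
  symmetrizing controls each summand only by a maximum: the support function of \<open>K'\<close> at
  the symmetrized point is at most the larger of the two values for \<open>K\<close>. A sum of such
  maxima can exceed both sums, so fibres of the polar itself cannot be compared. Instead the volume
  is replaced by the integral of \<open>exp (- diff_norm K \<theta>)\<close>, whose factors have
  separate levels: a set on which each summand lies below its own threshold can be symmetrized.

  The halves of \<open>K\<close> are compared by transport, which needs equal masses; this is why
  the hyperplane bisects. It may pass through the origin because translating \<open>K\<close> does
  not change its difference body.

  Strictness enters twice. Across slices, the entropy of the weights \<open>t / (s + t)\<close> and
  \<open>s / (s + t)\<close> is maximal only for \<open>s = t\<close>, so slice volumes are even in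
  \<open>s\<close>. Inside slices, the densities at \<open>s\<close> and \<open>- s\<close> differ
  by a shift; passing to reciprocals turns harmonic means into arithmetic ones and shows that the
  shift is linear in \<open>s\<close>, which is what makes the symmetry a skew reflection.\<close>

lemma emeasure_translation_vimage:
  fixes A :: "real set"
  assumes "A \<in> sets borel"
  shows "emeasure lborel ((\<lambda>x. x - c) -` A) = emeasure lborel A"
proof -
  have "emeasure lborel A = emeasure (distr lborel borel (\<lambda>x. -c + x)) A"
    by (subst lborel_distr_plus) simp
  also have "\<dots> = emeasure lborel ((\<lambda>x. x - c) -` A)"
    using assms by (subst emeasure_distr) (auto simp: vimage_def algebra_simps)
  finally show ?thesis ..
qed

text \<open>Inner regularity may return the empty set, for which Brunn--Minkowski fails. Inserting
  one point of \<open>A\<close> keeps the approximation nonempty and inside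
  \<open>A\<close>.\<close>

lemma compact_inner_approx_nonempty:
  fixes A :: "real set"
  assumes "A \<in> sets borel" "bounded A" "A \<noteq> {}" "e > 0"
  obtains A' where "compact A'" "A' \<subseteq> A" "A' \<noteq> {}" "emeasure lborel A \<le> emeasure lborel A' + ennreal e"
proof -
  obtain a where a: "a \<in> A" using assms by auto
  have "A \<in> sets lebesgue" using assms by auto
  from sets_lebesgue_inner_closed[OF this \<open>e>0\<close>] obtain T where
    T: "closed T" "T \<subseteq> A" "emeasure lebesgue (A - T) < ennreal e" by metis
  have Tb: "T \<in> sets borel" using T(1) by auto
  have c: "compact (insert a T)"
    using T assms(2) by (meson bounded_subset compact_eq_bounded_closed compact_insert)
  have "emeasure lborel A \<le> emeasure lborel (insert a T \<union> (A - T))"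
    using assms(1) Tb by (intro emeasure_mono) auto
  also have "\<dots> \<le> emeasure lborel (insert a T) + emeasure lborel (A - T)"
    using assms(1) Tb by (intro emeasure_subadditive) auto
  also have "emeasure lborel (A - T) \<le> ennreal e"
    using T(3) assms(1) Tb by (simp add: less_imp_le)
  finally show ?thesis using that[OF c] a T(2) by (auto simp: add_left_mono)
qed

text \<open>The translates of \<open>A\<close> by the minimum of \<open>B\<close> and of
  \<open>B\<close> by the maximum of \<open>A\<close> lie end to end inside the sum set and meet
  only in the point \<open>a1 + b0\<close>, which is removed from the first one.\<close>

lemma brunn_minkowski_real_compact:
  fixes A B C :: "real set"
  assumes "compact A" "compact B" "A \<noteq> {}" "B \<noteq> {}" "C \<in> sets borel"
    and C: "\<And>a b. a \<in> A \<Longrightarrow> b \<in> B \<Longrightarrow> a + b \<in> C"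
  shows "emeasure lborel A + emeasure lborel B \<le> emeasure lborel C"
proof -
  obtain a1 where a1: "a1 \<in> A" "\<And>a. a \<in> A \<Longrightarrow> a \<le> a1"
    using compact_attains_sup[OF assms(1,3)] by blast
  obtain b0 where b0: "b0 \<in> B" "\<And>b. b \<in> B \<Longrightarrow> b0 \<le> b"
    using compact_attains_inf[OF assms(2,4)] by blast
  have [measurable]: "A \<in> sets borel" "B \<in> sets borel" using assms by (auto simp: compact_imp_closed)
  let ?A = "(\<lambda>x. x - b0) -` (A - {a1})" and ?B = "(\<lambda>x. x - a1) -` B"
  have [measurable]: "?A \<in> sets borel" "?B \<in> sets borel"
    using measurable_sets[of "\<lambda>x. x - b0" borel borel "A - {a1}"]
          measurable_sets[of "\<lambda>x. x - a1" borel borel B] by auto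
  have "emeasure lborel A \<le> emeasure lborel (A - {a1})"
    by (simp add: emeasure_Diff_null_set finite_imp_null_set_lborel)
  then have "emeasure lborel A + emeasure lborel B \<le> emeasure lborel ?A + emeasure lborel ?B"
    by (simp add: emeasure_translation_vimage add_mono)
  also have "\<dots> = emeasure lborel (?A \<union> ?B)"
  proof (rule plus_emeasure)
    show "?A \<inter> ?B = {}"
    proof -
      have False if "x - b0 \<in> A" "x - b0 \<noteq> a1" "x - a1 \<in> B" for x
        using that a1(2)[of "x - b0"] b0(2)[of "x - a1"] by auto
      then show ?thesis by auto
    qed
  qed auto
  also have "\<dots> \<le> emeasure lborel C"
  proof (rule emeasure_mono)
    show "?A \<union> ?B \<subseteq> C"
    proof
      fix x assume "x \<in> ?A \<union> ?B"
      then show "x \<in> C" using C[of "x - b0" b0] C[of a1 "x - a1"] a1(1) b0(1) by auto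
    qed
  qed (use assms in auto)
  finally show ?thesis .
qed

text \<open>The sum set enters only through a Borel superset \<open>C\<close>, since a sum of Borel
  sets need not be Borel.\<close>

lemma brunn_minkowski_real:
  fixes A B C :: "real set"
  assumes "A \<in> sets borel" "B \<in> sets borel" "bounded A" "bounded B" "A \<noteq> {}" "B \<noteq> {}" "C \<in> sets borel"
    and C: "\<And>a b. a \<in> A \<Longrightarrow> b \<in> B \<Longrightarrow> a + b \<in> C"
  shows "emeasure lborel A + emeasure lborel B \<le> emeasure lborel C"
proof (rule ennreal_le_epsilon)
  fix e :: real assume "e > 0"
  then have e: "e/2 > 0" by simp
  obtain A' where A': "compact A'" "A' \<subseteq> A" "A' \<noteq> {}" "emeasure lborel A \<le> emeasure lborel A' + ennreal (e/2)"
    using compact_inner_approx_nonempty[OF assms(1,3,5) e] .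
  obtain B' where B': "compact B'" "B' \<subseteq> B" "B' \<noteq> {}" "emeasure lborel B \<le> emeasure lborel B' + ennreal (e/2)"
    using compact_inner_approx_nonempty[OF assms(2,4,6) e] .
  have "emeasure lborel A + emeasure lborel B
      \<le> (emeasure lborel A' + ennreal (e/2)) + (emeasure lborel B' + ennreal (e/2))"
    by (intro add_mono A' B')
  also have "\<dots> = (emeasure lborel A' + emeasure lborel B') + (ennreal (e/2) + ennreal (e/2))"
    by (simp add: add_ac)
  also have "ennreal (e/2) + ennreal (e/2) = ennreal e"
    using \<open>e>0\<close> by (simp flip: ennreal_plus)
  also have "emeasure lborel A' + emeasure lborel B' \<le> emeasure lborel C"
    using A' B' C by (intro brunn_minkowski_real_compact assms) auto
  finally show "emeasure lborel A + emeasure lborel B \<le> emeasure lborel C + ennreal e"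
    by (simp add: add_right_mono)
qed

lemma emeasure_dilation_vimage:
  fixes A :: "real set"
  assumes [measurable]: "A \<in> sets borel" and l: "l > 0"
  shows "emeasure lborel ((\<lambda>x. x / l) -` A) = ennreal l * emeasure lborel A"
proof -
  have [measurable]: "(\<lambda>x. x / l) -` A \<in> sets borel"
    using measurable_sets[of "\<lambda>x. x / l" borel borel A] by auto
  have "emeasure lborel ((\<lambda>x. x / l) -` A) = (\<integral>\<^sup>+x. indicator ((\<lambda>x. x / l) -` A) x \<partial>lborel)"
    by simp
  also have "\<dots> = ennreal \<bar>l\<bar> * (\<integral>\<^sup>+x. indicator ((\<lambda>x. x / l) -` A) (0 + l * x) \<partial>lborel)"
    using l by (intro nn_integral_real_affine) auto
  also have "(\<integral>\<^sup>+x. indicator ((\<lambda>x. x / l) -` A) (0 + l * x) \<partial>lborel) = (\<integral>\<^sup>+x. indicator A x \<partial>lborel)"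
    using l by (intro nn_integral_cong) (auto split: split_indicator)
  finally show ?thesis using l by simp
qed

lemma brunn_minkowski_real_weighted:
  fixes A B C :: "real set"
  assumes "A \<in> sets borel" "B \<in> sets borel" "bounded A" "bounded B" "A \<noteq> {}" "B \<noteq> {}" "C \<in> sets borel"
    and l: "0 < l" "l < 1"
    and C: "\<And>a b. a \<in> A \<Longrightarrow> b \<in> B \<Longrightarrow> l * a + (1 - l) * b \<in> C"
  shows "ennreal l * emeasure lborel A + ennreal (1 - l) * emeasure lborel B \<le> emeasure lborel C"
proof -
  have dil: "(\<lambda>x. x / r) -` X = (\<lambda>x. r * x) ` X" if "r > 0" for r and X :: "real set"
    using that by (force simp: image_iff)
  have bd: "bounded ((\<lambda>x. x / r) -` X)" if "r > 0" "bounded X" for r and X :: "real set"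
    using bounded_scaling[OF that(2), of r] by (simp add: dil[OF that(1)])
  have ne: "(\<lambda>x. x / r) -` X \<noteq> {}" if "r > 0" "X \<noteq> {}" for r and X :: "real set"
    using that by (simp add: dil)
  have ms: "(\<lambda>x. x / r) -` X \<in> sets borel" if "X \<in> sets borel" for r and X :: "real set"
    using measurable_sets[of "\<lambda>x. x / r" borel borel X] that by auto
  have "emeasure lborel ((\<lambda>x. x / l) -` A) + emeasure lborel ((\<lambda>x. x / (1-l)) -` B) \<le> emeasure lborel C"
    using assms C[of "x / l" "y / (1 - l)" for x y] by (intro brunn_minkowski_real ms bd ne) auto
  then show ?thesis using assms by (simp add: emeasure_dilation_vimage)
qed

text \<open>The levels are normalised to \<open>t * c\<close> with \<open>t\<close> in the unit
  interval, so that functions with different suprema can be compared at the same \<open>t\<close>.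
  Integrating the levels at a point gives \<open>u x\<close> capped at \<open>c\<close>: an
  inequality in general, an equality if \<open>c\<close> bounds \<open>u\<close>.\<close>

lemma layer_cake_le:
  fixes u :: "real \<Rightarrow> ennreal"
  assumes [measurable]: "u \<in> borel_measurable borel" and c: "c > 0"
  shows "ennreal c * (\<integral>\<^sup>+t. indicator {0<..<1} t * emeasure lborel {x. ennreal (t * c) < u x} \<partial>lborel)
     \<le> (\<integral>\<^sup>+x. u x \<partial>lborel)"
    and "(\<And>x. u x \<le> ennreal c) \<Longrightarrow>
      ennreal c * (\<integral>\<^sup>+t. indicator {0<..<1} t * emeasure lborel {x. ennreal (t * c) < u x} \<partial>lborel)
     = (\<integral>\<^sup>+x. u x \<partial>lborel)"
proof -
  have "(\<integral>\<^sup>+t. indicator {0<..<1} t * emeasure lborel {x. ennreal (t * c) < u x} \<partial>lborel)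
     = (\<integral>\<^sup>+t. (\<integral>\<^sup>+x. indicator {0<..<1::real} t * indicator {x. ennreal (t * c) < u x} x \<partial>lborel) \<partial>lborel)"
    by (intro nn_integral_cong) (simp add: nn_integral_cmult)
  also have "\<dots> = (\<integral>\<^sup>+x. (\<integral>\<^sup>+t. indicator {0<..<1::real} t * indicator {x. ennreal (t * c) < u x} x \<partial>lborel) \<partial>lborel)"
    by (rule lborel_pair.Fubini') measurable
  finally have eq: "ennreal c * (\<integral>\<^sup>+t. indicator {0<..<1} t * emeasure lborel {x. ennreal (t * c) < u x} \<partial>lborel)
     = (\<integral>\<^sup>+x. ennreal c * (\<integral>\<^sup>+t. indicator {0<..<1::real} t * indicator {x. ennreal (t * c) < u x} x \<partial>lborel) \<partial>lborel)"
    by (simp add: nn_integral_cmult)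
  have pt: "ennreal c * (\<integral>\<^sup>+t. indicator {0<..<1::real} t * indicator {x. ennreal (t * c) < u x} x \<partial>lborel)
      = min (ennreal c) (u x)" for x
  proof (cases "u x" rule: ennreal_cases)
    case (real r)
    have "(\<integral>\<^sup>+t. indicator {0<..<1::real} t * indicator {x. ennreal (t * c) < u x} x \<partial>lborel)
      = (\<integral>\<^sup>+t. indicator {0<..<min 1 (r/c)} t \<partial>lborel)"
      using real c by (intro nn_integral_cong)
        (auto split: split_indicator simp: ennreal_less_iff pos_less_divide_eq)
    also have "\<dots> = ennreal (min 1 (r/c))" using real c by simp
    finally have "ennreal c * (\<integral>\<^sup>+t. indicator {0<..<1::real} t * indicator {x. ennreal (t * c) < u x} x \<partial>lborel)
       = ennreal (c * min 1 (r/c))" using real c by (simp add: ennreal_mult)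
    also have "c * min 1 (r/c) = min c r" using c by (auto simp: min_def field_simps)
    also have "ennreal \<dots> = min (ennreal c) (u x)"
      using real c by (auto simp: min_def ennreal_le_iff2)
    finally show ?thesis .
  next
    case top
    have "(\<integral>\<^sup>+t. indicator {0<..<1::real} t * indicator {x. ennreal (t * c) < u x} x \<partial>lborel)
      = (\<integral>\<^sup>+t. indicator {0<..<1::real} t \<partial>lborel)"
      using top by (intro nn_integral_cong) (auto split: split_indicator)
    then show ?thesis using top by simp
  qed
  show "ennreal c * (\<integral>\<^sup>+t. indicator {0<..<1} t * emeasure lborel {x. ennreal (t * c) < u x} \<partial>lborel)
     \<le> (\<integral>\<^sup>+x. u x \<partial>lborel)"
    unfolding eq pt by (intro nn_integral_mono) auto
  show "ennreal c * (\<integral>\<^sup>+t. indicator {0<..<1} t * emeasure lborel {x. ennreal (t * c) < u x} \<partial>lborel)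
     = (\<integral>\<^sup>+x. u x \<partial>lborel)" if "\<And>x. u x \<le> ennreal c"
    unfolding eq pt using that by (simp add: min_absorb2)
qed

text \<open>Brunn--Minkowski is applied to the level sets of \<open>f\<close> and \<open>g\<close>
  at the same fraction \<open>t\<close> of their suprema. Relative levels guarantee that both sets
  are nonempty for \<open>t < 1\<close>. Integrating over \<open>t\<close> gives a weighted
  arithmetic mean, which Young's inequality lowers to the geometric one. The target \<open>h\<close>
  takes extended values so that it may itself be an integral of unknown size.\<close>

lemma prekopa_leindler_real:
  fixes f g :: "real \<Rightarrow> real" and h :: "real \<Rightarrow> ennreal"
  assumes [measurable]: "f \<in> borel_measurable borel" "g \<in> borel_measurable borel" "h \<in> borel_measurable borel"
    and nn: "\<And>x. 0 \<le> f x" "\<And>x. 0 \<le> g x"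
    and bd: "\<And>x. f x \<le> M" "\<And>x. g x \<le> M"
    and supp: "\<And>x. R < \<bar>x\<bar> \<Longrightarrow> f x = 0" "\<And>x. R < \<bar>x\<bar> \<Longrightarrow> g x = 0"
    and l: "0 < l" "l < 1"
    and h: "\<And>x y. ennreal (f x powr l * g y powr (1 - l)) \<le> h (l * x + (1 - l) * y)"
  shows "ennreal (enn2real (\<integral>\<^sup>+x. f x \<partial>lborel) powr l * enn2real (\<integral>\<^sup>+x. g x \<partial>lborel) powr (1 - l))
    \<le> (\<integral>\<^sup>+x. h x \<partial>lborel)"
proof (cases "(\<forall>x. f x = 0) \<or> (\<forall>x. g x = 0)")
  case True
  then show ?thesis by auto
next
  case False
  define S where "S = (SUP x. f x)"
  define T where "T = (SUP x. g x)"
  have bdd: "bdd_above (range f)" "bdd_above (range g)" using bd by (auto intro!: bdd_aboveI)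
  have fS: "f x \<le> S" "g x \<le> T" for x unfolding S_def T_def using bdd by (auto intro: cSUP_upper)
  have S: "0 < S" and T: "0 < T"
    using False nn fS by (metis order_le_less_trans order_less_le)+
  define c where "c = S powr l * T powr (1 - l)"
  have c: "c > 0" using S T by (simp add: c_def)
  define A where "A t = {x. ennreal (t * S) < ennreal (f x)}" for t
  define B where "B t = {x. ennreal (t * T) < ennreal (g x)}" for t
  define C where "C t = {x. ennreal (t * c) < h x}" for t
  have [measurable]: "A t \<in> sets borel" "B t \<in> sets borel" "C t \<in> sets borel" for t
    unfolding A_def B_def C_def by measurable
  have BM: "ennreal l * emeasure lborel (A t) + ennreal (1-l) * emeasure lborel (B t) \<le> emeasure lborel (C t)"
    if t: "0 < t" "t < 1" for t
  proof (rule brunn_minkowski_real_weighted[OF _ _ _ _ _ _ _ l])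
    have "A t \<subseteq> {-R..R}" "B t \<subseteq> {-R..R}"
      unfolding A_def B_def using supp abs_le_iff by (force simp: not_less[symmetric])+
    then show "bounded (A t)" "bounded (B t)" by (meson bounded_closed_interval bounded_subset)+
    have "t * S < S" using t S by simp
    then obtain x where "t * S < f x" unfolding S_def using bdd less_cSUP_iff[of UNIV f] by auto
    then show "A t \<noteq> {}" using t S by (auto simp: A_def ennreal_less_iff)
    have "t * T < T" using t T by simp
    then obtain x where "t * T < g x" unfolding T_def using bdd less_cSUP_iff[of UNIV g] by auto
    then show "B t \<noteq> {}" using t T by (auto simp: B_def ennreal_less_iff)
    show "l * a + (1 - l) * b \<in> C t" if "a \<in> A t" "b \<in> B t" for a b
    proof -
      have ab: "t * S < f a" "t * T < g b" using that t S T by (auto simp: A_def B_def ennreal_less_iff)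
      have "t * c = (t * S) powr l * (t * T) powr (1 - l)"
      proof -
        have "t powr l * t powr (1 - l) = t" using t by (simp flip: powr_add)
        then show ?thesis using t S T by (simp add: c_def powr_mult)
      qed
      also have "\<dots> < f a powr l * g b powr (1 - l)"
        using ab mult_pos_pos[OF t(1) S] mult_pos_pos[OF t(1) T] l
        by (intro mult_strict_mono powr_less_mono2) auto
      finally have "ennreal (t * c) < ennreal (f a powr l * g b powr (1 - l))"
        using t c by (simp add: ennreal_less_iff)
      also note h
      finally show ?thesis by (simp add: C_def)
    qed
  qed auto
  define I where "I = (\<integral>\<^sup>+t. indicator {0<..<1} t * emeasure lborel (A t) \<partial>lborel)"
  define J where "J = (\<integral>\<^sup>+t. indicator {0<..<1} t * emeasure lborel (B t) \<partial>lborel)"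
  have If: "(\<integral>\<^sup>+x. f x \<partial>lborel) = ennreal S * I"
    unfolding I_def A_def using fS S by (intro layer_cake_le(2)[symmetric]) (auto intro: ennreal_leI)
  have Ig: "(\<integral>\<^sup>+x. g x \<partial>lborel) = ennreal T * J"
    unfolding J_def B_def using fS T by (intro layer_cake_le(2)[symmetric]) (auto intro: ennreal_leI)
  have fin: "(\<integral>\<^sup>+x. ennreal (u x) \<partial>lborel) < \<infinity>"
    if "\<And>x. u x \<le> M" "\<And>x. R < \<bar>x\<bar> \<Longrightarrow> u x = 0" for u :: "real \<Rightarrow> real"
  proof -
    have "(\<integral>\<^sup>+x. ennreal (u x) \<partial>lborel) \<le> (\<integral>\<^sup>+x. ennreal M * indicator {-R..R} x \<partial>lborel)"
      using that by (intro nn_integral_mono) (auto split: split_indicator intro: ennreal_leI)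
    also have "\<dots> = ennreal M * emeasure lborel {-R..R}" by (subst nn_integral_cmult_indicator) auto
    also have "\<dots> < \<infinity>" by (simp add: ennreal_mult_less_top emeasure_lborel_Icc_eq)
    finally show ?thesis .
  qed
  have Ifin: "I < \<infinity>" "J < \<infinity>"
    using fin[of f, OF bd(1) supp(1)] fin[of g, OF bd(2) supp(2)] S T unfolding If Ig by (auto simp: ennreal_mult_less_top)
  obtain i where i: "I = ennreal i" "0 \<le> i" using Ifin by (cases I) auto
  obtain j where j: "J = ennreal j" "0 \<le> j" using Ifin by (cases J) auto
  have A_meas: "(\<lambda>t. emeasure lborel (A t)) \<in> borel_measurable borel"
    unfolding A_def by measurable
  have B_meas: "(\<lambda>t. emeasure lborel (B t)) \<in> borel_measurable borel"
    unfolding B_def by measurable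
  note [measurable] = A_meas B_meas
  have "ennreal l * I + ennreal (1 - l) * J
     = (\<integral>\<^sup>+t. ennreal l * (indicator {0<..<1} t * emeasure lborel (A t))
           + ennreal (1-l) * (indicator {0<..<1} t * emeasure lborel (B t)) \<partial>lborel)"
    unfolding I_def J_def by (subst nn_integral_add) (auto simp: nn_integral_cmult)
  also have "\<dots> \<le> (\<integral>\<^sup>+t. indicator {0<..<1} t * emeasure lborel (C t) \<partial>lborel)"
    using BM by (intro nn_integral_mono) (auto split: split_indicator)
  finally have "ennreal c * (ennreal l * I + ennreal (1 - l) * J)
    \<le> ennreal c * (\<integral>\<^sup>+t. indicator {0<..<1} t * emeasure lborel (C t) \<partial>lborel)"
    by (rule mult_left_mono) simp
  also have "\<dots> \<le> (\<integral>\<^sup>+x. h x \<partial>lborel)"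
    unfolding C_def using c by (intro layer_cake_le) auto
  finally have *: "ennreal (c * (l * i + (1 - l) * j)) \<le> (\<integral>\<^sup>+x. h x \<partial>lborel)"
    using i j l c by (simp add: ennreal_mult)
  have "enn2real (\<integral>\<^sup>+x. f x \<partial>lborel) powr l * enn2real (\<integral>\<^sup>+x. g x \<partial>lborel) powr (1 - l)
     = (S * i) powr l * (T * j) powr (1 - l)"
    unfolding If Ig using i j S T by (simp flip: ennreal_mult)
  also have "\<dots> = c * (i powr l * j powr (1 - l))"
    using i j S T by (simp add: powr_mult c_def)
  also have "\<dots> \<le> c * (l * i + (1 - l) * j)"
  proof (cases "i = 0 \<or> j = 0")
    case True
    then show ?thesis using c i j l by auto
  next
    case False
    then show ?thesis using c i j l by (intro mult_left_mono Youngs_inequality_0) auto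
  qed
  finally show ?thesis using * ennreal_leI order_trans by blast
qed

section \<open>Prekopa--Leindler on finite products of the line\<close>

lemma product_sigma_finite_lborel: "product_sigma_finite (\<lambda>_. lborel :: 'a::euclidean_space measure)"
  by (simp add: product_sigma_finite_def lborel.sigma_finite_measure_axioms)

text \<open>Keeps the partial integrals in the induction below finite and uniformly bounded, so that
  passing through \<open>enn2real\<close> loses nothing.\<close>

lemma nn_integral_PiM_le_box:
  fixes f :: "('i \<Rightarrow> real) \<Rightarrow> real"
  assumes I: "finite I" and R: "0 \<le> R"
    and bd: "\<And>x. f x \<le> M"
    and supp: "\<And>x i. x \<in> Pi\<^sub>E I (\<lambda>_. UNIV) \<Longrightarrow> i \<in> I \<Longrightarrow> R < \<bar>x i\<bar> \<Longrightarrow> f x = 0"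
  shows "(\<integral>\<^sup>+x. f x \<partial>Pi\<^sub>M I (\<lambda>_. lborel)) \<le> ennreal M * ennreal ((2 * R) ^ card I)"
proof -
  interpret product_sigma_finite "\<lambda>_::'i. lborel :: real measure" by (rule product_sigma_finite_lborel)
  have "(\<integral>\<^sup>+x. f x \<partial>Pi\<^sub>M I (\<lambda>_. lborel))
     \<le> (\<integral>\<^sup>+x. ennreal M * (\<Prod>i\<in>I. indicator {-R..R} (x i)) \<partial>Pi\<^sub>M I (\<lambda>_. lborel))"
  proof (rule nn_integral_mono)
    fix x :: "'i \<Rightarrow> real" assume x: "x \<in> space (Pi\<^sub>M I (\<lambda>_. lborel))"
    show "ennreal (f x) \<le> ennreal M * (\<Prod>i\<in>I. indicator {-R..R} (x i))"
    proof (cases "\<exists>i\<in>I. R < \<bar>x i\<bar>")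
      case True
      then have "f x = 0" using supp[of x] x by (auto simp: space_PiM)
      then show ?thesis by simp
    next
      case False
      then have "(\<Prod>i\<in>I. indicator {-R..R} (x i)) = (1::ennreal)"
        by (intro prod.neutral) (auto simp: abs_le_iff not_less)
      then show ?thesis using bd[of x] by (simp add: ennreal_leI)
    qed
  qed
  also have "\<dots> = ennreal M * (\<integral>\<^sup>+x. (\<Prod>i\<in>I. indicator {-R..R} (x i)) \<partial>Pi\<^sub>M I (\<lambda>_. lborel))"
    by (intro nn_integral_cmult) measurable
  also have "(\<integral>\<^sup>+x. (\<Prod>i\<in>I. indicator {-R..R} (x i)) \<partial>Pi\<^sub>M I (\<lambda>_. lborel)) = (\<Prod>i\<in>I. \<integral>\<^sup>+x. indicator {-R..R} x \<partial>lborel)"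
    using I by (intro product_nn_integral_prod) auto
  also have "\<dots> = ennreal ((2 * R) ^ card I)"
    using R by (simp add: ennreal_power)
  finally show ?thesis .
qed

text \<open>Induction on the index set. Freeze the new coordinate at \<open>a\<close> for
  \<open>f\<close>, at \<open>b\<close> for \<open>g\<close> and at their mean for \<open>h\<close>:
  the induction hypothesis then states precisely that the partial integrals \<open>F\<close>,
  \<open>G\<close>, \<open>H\<close> satisfy the hypothesis of the one-dimensional inequality.
  Boundedness and support in a box are inherited by \<open>F\<close> and \<open>G\<close>, with the
  bound growing to \<open>M'\<close>.\<close>

lemma prekopa_leindler_PiM:
  fixes f g :: "('i \<Rightarrow> real) \<Rightarrow> real" and h :: "('i \<Rightarrow> real) \<Rightarrow> ennreal"
  assumes "finite I"
    and "f \<in> borel_measurable (Pi\<^sub>M I (\<lambda>_. lborel))" "g \<in> borel_measurable (Pi\<^sub>M I (\<lambda>_. lborel))"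
        "h \<in> borel_measurable (Pi\<^sub>M I (\<lambda>_. lborel))"
    and "\<And>x. 0 \<le> f x" "\<And>x. 0 \<le> g x"
    and "\<And>x. f x \<le> M" "\<And>x. g x \<le> M"
    and R: "0 \<le> R"
    and "\<And>x i. x \<in> Pi\<^sub>E I (\<lambda>_. UNIV) \<Longrightarrow> i \<in> I \<Longrightarrow> R < \<bar>x i\<bar> \<Longrightarrow> f x = 0"
        "\<And>x i. x \<in> Pi\<^sub>E I (\<lambda>_. UNIV) \<Longrightarrow> i \<in> I \<Longrightarrow> R < \<bar>x i\<bar> \<Longrightarrow> g x = 0"
    and l: "0 < l" "l < 1"
    and "\<And>x y. x \<in> Pi\<^sub>E I (\<lambda>_. UNIV) \<Longrightarrow> y \<in> Pi\<^sub>E I (\<lambda>_. UNIV) \<Longrightarrow>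
           ennreal (f x powr l * g y powr (1 - l)) \<le> h (\<lambda>i\<in>I. l * x i + (1 - l) * y i)"
  shows "ennreal (enn2real (\<integral>\<^sup>+x. f x \<partial>Pi\<^sub>M I (\<lambda>_. lborel)) powr l
             * enn2real (\<integral>\<^sup>+x. g x \<partial>Pi\<^sub>M I (\<lambda>_. lborel)) powr (1 - l))
    \<le> (\<integral>\<^sup>+x. h x \<partial>Pi\<^sub>M I (\<lambda>_. lborel))"
  using assms(1-8,10-11,14)
proof (induction I arbitrary: f g h M rule: finite_induct)
  case empty
  interpret product_sigma_finite "\<lambda>_::'i. lborel :: real measure" by (rule product_sigma_finite_lborel)
  show ?case
    using empty(10)[of "\<lambda>_. undefined" "\<lambda>_. undefined"] empty(4)[of "\<lambda>_. undefined"] empty(5)[of "\<lambda>_. undefined"]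
    by (simp add: PiM_empty nn_integral_count_space_finite restrict_def)
next
  case (insert i I)
  interpret product_sigma_finite "\<lambda>_::'i. lborel :: real measure" by (rule product_sigma_finite_lborel)
  interpret P: sigma_finite_measure "Pi\<^sub>M I (\<lambda>_. lborel :: real measure)"
    using insert.hyps(1) by (rule sigma_finite)
  note [measurable] = insert.prems(1,2,3)
  let ?P = "Pi\<^sub>M I (\<lambda>_. lborel :: real measure)"
  have [measurable]: "(\<lambda>x. x(i := y)) \<in> ?P \<rightarrow>\<^sub>M Pi\<^sub>M (insert i I) (\<lambda>_. lborel)" for y
    by measurable
  define F where "F y = enn2real (\<integral>\<^sup>+x. f (x(i := y)) \<partial>?P)" for y
  define G where "G y = enn2real (\<integral>\<^sup>+x. g (x(i := y)) \<partial>?P)" for y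
  define H where "H y = (\<integral>\<^sup>+x. h (x(i := y)) \<partial>?P)" for y
  have M0: "0 \<le> M" using insert.prems(4,6) order_trans by blast
  define M' where "M' = M * (2 * R) ^ card I"
  have up: "x(i := y) \<in> Pi\<^sub>E (insert i I) (\<lambda>_. UNIV)" if "x \<in> Pi\<^sub>E I (\<lambda>_. UNIV)" for x :: "'i \<Rightarrow> real" and y
    using that by (auto simp: PiE_iff extensional_def)
  have suppf: "f (x(i := y)) = 0" if "x \<in> Pi\<^sub>E I (\<lambda>_. UNIV)" "j \<in> I" "R < \<bar>x j\<bar>" for x y j
    using insert.prems(8)[OF up[OF that(1)], of j y] that insert.hyps(2)
    by (metis fun_upd_other insertI2)
  have suppg: "g (x(i := y)) = 0" if "x \<in> Pi\<^sub>E I (\<lambda>_. UNIV)" "j \<in> I" "R < \<bar>x j\<bar>" for x y j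
    using insert.prems(9)[OF up[OF that(1)], of j y] that insert.hyps(2)
    by (metis fun_upd_other insertI2)
  have M': "ennreal M * ennreal ((2 * R) ^ card I) = ennreal M'" "0 \<le> M'"
    using M0 R by (auto simp: M'_def ennreal_mult)
  have Fle: "(\<integral>\<^sup>+x. f (x(i := y)) \<partial>?P) \<le> ennreal M'" for y
    unfolding M'(1)[symmetric] using insert.hyps(1) R insert.prems(6) suppf
    by (intro nn_integral_PiM_le_box)
  have Gle: "(\<integral>\<^sup>+x. g (x(i := y)) \<partial>?P) \<le> ennreal M'" for y
    unfolding M'(1)[symmetric] using insert.hyps(1) R insert.prems(7) suppg
    by (intro nn_integral_PiM_le_box)
  have eF: "(\<integral>\<^sup>+x. f (x(i := y)) \<partial>?P) = ennreal (F y)" for y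
    unfolding F_def using Fle[of y] by (intro ennreal_enn2real[symmetric]) (auto simp: top_unique intro: le_less_trans)
  have eG: "(\<integral>\<^sup>+x. g (x(i := y)) \<partial>?P) = ennreal (G y)" for y
    unfolding G_def using Gle[of y] by (intro ennreal_enn2real[symmetric]) (auto simp: top_unique intro: le_less_trans)
  have int: "(\<integral>\<^sup>+x. f x \<partial>Pi\<^sub>M (insert i I) (\<lambda>_. lborel)) = (\<integral>\<^sup>+y. F y \<partial>lborel)"
       "(\<integral>\<^sup>+x. g x \<partial>Pi\<^sub>M (insert i I) (\<lambda>_. lborel)) = (\<integral>\<^sup>+y. G y \<partial>lborel)"
       "(\<integral>\<^sup>+x. h x \<partial>Pi\<^sub>M (insert i I) (\<lambda>_. lborel)) = (\<integral>\<^sup>+y. H y \<partial>lborel)"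
    unfolding eF[symmetric] eG[symmetric] H_def
    using insert.hyps by (auto intro!: product_nn_integral_insert_rev)
  have [measurable]: "F \<in> borel_measurable borel" "G \<in> borel_measurable borel" "H \<in> borel_measurable borel"
    unfolding F_def G_def H_def by measurable
  show ?case unfolding int
  proof (rule prekopa_leindler_real[where M = M' and R = R])
    show "0 \<le> F x" "0 \<le> G x" for x by (auto simp: F_def G_def)
    show "F x \<le> M'" "G x \<le> M'" for x
      using Fle[of x] Gle[of x] M' unfolding eF eG by auto
    show "F y = 0" if "R < \<bar>y\<bar>" for y
    proof -
      have "f (x(i := y)) = 0" if "x \<in> Pi\<^sub>E I (\<lambda>_. UNIV)" for x
        using insert.prems(8)[OF up[OF that], of i y] \<open>R < \<bar>y\<bar>\<close> by (metis fun_upd_same insertI1)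
      then have "(\<integral>\<^sup>+x. f (x(i := y)) \<partial>?P) = (\<integral>\<^sup>+x. 0 \<partial>?P)"
        by (intro nn_integral_cong) (simp add: space_PiM)
      then show ?thesis by (simp add: F_def)
    qed
    show "G y = 0" if "R < \<bar>y\<bar>" for y
    proof -
      have "g (x(i := y)) = 0" if "x \<in> Pi\<^sub>E I (\<lambda>_. UNIV)" for x
        using insert.prems(9)[OF up[OF that], of i y] \<open>R < \<bar>y\<bar>\<close> by (metis fun_upd_same insertI1)
      then have "(\<integral>\<^sup>+x. g (x(i := y)) \<partial>?P) = (\<integral>\<^sup>+x. 0 \<partial>?P)"
        by (intro nn_integral_cong) (simp add: space_PiM)
      then show ?thesis by (simp add: G_def)
    qed
    show "ennreal (F a powr l * G b powr (1 - l)) \<le> H (l * a + (1 - l) * b)" for a b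
      unfolding F_def G_def H_def
    proof (rule insert.IH)
      show "ennreal (f (x(i := a)) powr l * g (y(i := b)) powr (1 - l))
        \<le> h ((\<lambda>j\<in>I. l * x j + (1 - l) * y j)(i := l * a + (1 - l) * b))"
        if "x \<in> Pi\<^sub>E I (\<lambda>_. UNIV)" "y \<in> Pi\<^sub>E I (\<lambda>_. UNIV)" for x y
      proof -
        have "(\<lambda>j\<in>I. l * x j + (1 - l) * y j)(i := l * a + (1 - l) * b)
           = (\<lambda>j\<in>insert i I. l * (x(i := a)) j + (1 - l) * (y(i := b)) j)"
          using insert.hyps(2) by (auto simp: restrict_def fun_eq_iff)
        then show ?thesis using insert.prems(10)[OF up[OF that(1), of a] up[OF that(2), of b]] by (simp only:)
      qed
      show "(\<lambda>x. f (x(i := a))) \<in> borel_measurable ?P" "(\<lambda>x. g (x(i := b))) \<in> borel_measurable ?P"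
        "(\<lambda>x. h (x(i := l * a + (1 - l) * b))) \<in> borel_measurable ?P" by measurable
    qed (fact insert.prems suppf suppg)+
  qed (use l in auto)
qed

text \<open>Needed for a sign change on the line, where \<open>c = 1\<close>, and for one matrix
  acting on each of the \<open>m\<close> vector components.\<close>

lemma nn_integral_PiM_map:
  fixes S :: "'a \<Rightarrow> 'a" and N :: "'a measure"
  assumes "product_sigma_finite (\<lambda>_::'i. N)"
    and [measurable]: "S \<in> N \<rightarrow>\<^sub>M N"
    and S: "\<And>f. f \<in> borel_measurable N \<Longrightarrow> (\<integral>\<^sup>+x. f (S x) \<partial>N) = c * (\<integral>\<^sup>+x. f x \<partial>N)"
    and I: "finite I" and F: "F \<in> borel_measurable (Pi\<^sub>M I (\<lambda>_::'i. N))"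
  shows "(\<integral>\<^sup>+x. F (\<lambda>i\<in>I. S (x i)) \<partial>Pi\<^sub>M I (\<lambda>_. N)) = c ^ card I * (\<integral>\<^sup>+x. F x \<partial>Pi\<^sub>M I (\<lambda>_. N))"
  using I F
proof (induction I arbitrary: F rule: finite_induct)
  case empty
  interpret product_sigma_finite "\<lambda>_::'i. N" by fact
  show ?case by (simp add: PiM_empty nn_integral_count_space_finite restrict_def)
next
  case (insert i I)
  interpret product_sigma_finite "\<lambda>_::'i. N" by fact
  interpret P: sigma_finite_measure "Pi\<^sub>M I (\<lambda>_::'i. N)"
    using insert.hyps(1) by (rule sigma_finite)
  note [measurable] = insert.prems(1)
  have upd: "(\<lambda>j\<in>insert i I. S ((x(i := y)) j)) = (\<lambda>j\<in>I. S (x j))(i := S y)" for x y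
    using insert.hyps(2) by (auto simp: restrict_def fun_eq_iff)
  have [measurable]: "(\<lambda>x. \<lambda>j\<in>insert i I. S (x j)) \<in> Pi\<^sub>M (insert i I) (\<lambda>_. N) \<rightarrow>\<^sub>M Pi\<^sub>M (insert i I) (\<lambda>_. N)"
    by (rule measurable_restrict) measurable
  have "(\<integral>\<^sup>+x. F (\<lambda>j\<in>insert i I. S (x j)) \<partial>Pi\<^sub>M (insert i I) (\<lambda>_. N))
    = (\<integral>\<^sup>+y. (\<integral>\<^sup>+x. F (\<lambda>j\<in>insert i I. S ((x(i := y)) j)) \<partial>Pi\<^sub>M I (\<lambda>_. N)) \<partial>N)"
    using insert.hyps by (intro product_nn_integral_insert_rev) auto
  also have "\<dots> = (\<integral>\<^sup>+y. (\<integral>\<^sup>+x. F ((\<lambda>j\<in>I. S (x j))(i := S y)) \<partial>Pi\<^sub>M I (\<lambda>_. N)) \<partial>N)"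
    unfolding upd ..
  also have "\<dots> = (\<integral>\<^sup>+y. c ^ card I * (\<integral>\<^sup>+x. F (x(i := S y)) \<partial>Pi\<^sub>M I (\<lambda>_. N)) \<partial>N)"
  proof (rule nn_integral_cong)
    fix y assume "y \<in> space N"
    then have "S y \<in> space N" using assms(2) by (auto simp: measurable_def)
    then have "(\<lambda>x. F (x(i := S y))) \<in> borel_measurable (Pi\<^sub>M I (\<lambda>_. N))" by measurable
    then show "(\<integral>\<^sup>+x. F ((\<lambda>j\<in>I. S (x j))(i := S y)) \<partial>Pi\<^sub>M I (\<lambda>_. N))
      = c ^ card I * (\<integral>\<^sup>+x. F (x(i := S y)) \<partial>Pi\<^sub>M I (\<lambda>_. N))"
      by (rule insert.IH)
  qed
  also have "\<dots> = c ^ card I * (\<integral>\<^sup>+y. (\<integral>\<^sup>+x. F (x(i := S y)) \<partial>Pi\<^sub>M I (\<lambda>_. N)) \<partial>N)"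
    by (intro nn_integral_cmult) measurable
  also have "(\<integral>\<^sup>+y. (\<integral>\<^sup>+x. F (x(i := S y)) \<partial>Pi\<^sub>M I (\<lambda>_. N)) \<partial>N)
     = c * (\<integral>\<^sup>+y. (\<integral>\<^sup>+x. F (x(i := y)) \<partial>Pi\<^sub>M I (\<lambda>_. N)) \<partial>N)"
    by (rule S) measurable
  also have "(\<integral>\<^sup>+y. (\<integral>\<^sup>+x. F (x(i := y)) \<partial>Pi\<^sub>M I (\<lambda>_. N)) \<partial>N) = (\<integral>\<^sup>+x. F x \<partial>Pi\<^sub>M (insert i I) (\<lambda>_. N))"
    using insert.hyps by (intro product_nn_integral_insert_rev[symmetric]) auto
  finally show ?case using insert.hyps by (simp add: mult_ac)
qed

section \<open>Sections of bodies\<close>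

text \<open>For an indicator function this is the volume of the slice through \<open>z\<close>
  parallel to the span of \<open>I\<close>, that is, a marginal density of the body in the
  coordinates outside \<open>I\<close>.\<close>

definition sec :: "'a::euclidean_space set \<Rightarrow> ('a \<Rightarrow> ennreal) \<Rightarrow> 'a \<Rightarrow> ennreal" where
  "sec I f z = (\<integral>\<^sup>+x. f (z + (\<Sum>b\<in>I. x b *\<^sub>R b)) \<partial>Pi\<^sub>M I (\<lambda>_. lborel))"

lemma inner_sum_Basis_subset:
  fixes z c :: "'a::euclidean_space"
  assumes "I \<subseteq> Basis" "c \<in> Basis"
  shows "(z + (\<Sum>b\<in>I. x b *\<^sub>R b)) \<bullet> c = z \<bullet> c + (if c \<in> I then x c else 0)"
proof -
  have "finite I" using assms finite_subset[OF _ finite_Basis] by auto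
  have "(\<Sum>b\<in>I. x b * (b \<bullet> c)) = (\<Sum>b\<in>I. if b = c then x b else 0)"
    using assms by (intro sum.cong) (auto simp: inner_Basis)
  then show ?thesis using \<open>finite I\<close> by (simp add: inner_add_left inner_sum_left)
qed

lemma borel_measurable_sec [measurable]:
  fixes f :: "'a::euclidean_space \<Rightarrow> ennreal"
  assumes "finite I" and [measurable]: "f \<in> borel_measurable borel"
  shows "sec I f \<in> borel_measurable borel"
proof -
  interpret product_sigma_finite "\<lambda>_::'a. lborel :: real measure" by (rule product_sigma_finite_lborel)
  interpret P: sigma_finite_measure "Pi\<^sub>M I (\<lambda>_. lborel :: real measure)"
    using assms(1) by (rule sigma_finite)
  show ?thesis unfolding sec_def by measurable
qed

lemma sec_empty [simp]: "sec {} f z = f z"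
  by (simp add: sec_def PiM_empty nn_integral_count_space_finite)

lemma sec_insert:
  fixes f :: "'a::euclidean_space \<Rightarrow> ennreal"
  assumes "finite I" "b \<notin> I" and [measurable]: "f \<in> borel_measurable borel"
  shows "sec (insert b I) f z = (\<integral>\<^sup>+s. sec I f (z + s *\<^sub>R b) \<partial>lborel)"
proof -
  interpret product_sigma_finite "\<lambda>_::'a. lborel :: real measure" by (rule product_sigma_finite_lborel)
  have eq: "z + (\<Sum>c\<in>insert b I. (x(b := s)) c *\<^sub>R c) = z + s *\<^sub>R b + (\<Sum>c\<in>I. x c *\<^sub>R c)" for x s
  proof -
    have "(\<Sum>c\<in>I. (x(b := s)) c *\<^sub>R c) = (\<Sum>c\<in>I. x c *\<^sub>R c)"
      using assms by (intro sum.cong) auto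
    then show ?thesis using assms by (simp add: add_ac)
  qed
  have "(\<lambda>x. f (z + (\<Sum>c\<in>insert b I. x c *\<^sub>R c))) \<in> borel_measurable (Pi\<^sub>M (insert b I) (\<lambda>_. lborel))"
    using assms(1) by measurable
  from product_nn_integral_insert_rev[OF assms(1,2) this] show ?thesis
    unfolding sec_def eq .
qed

lemma sec_Un:
  fixes f :: "'a::euclidean_space \<Rightarrow> ennreal"
  assumes "finite I" "finite J" "I \<inter> J = {}" and [measurable]: "f \<in> borel_measurable borel"
  shows "sec (I \<union> J) f z = sec I (sec J f) z"
  using assms(1,3)
proof (induction I arbitrary: z rule: finite_induct)
  case empty
  then show ?case by simp
next
  case (insert b I)
  have [measurable]: "sec J f \<in> borel_measurable borel" using assms by measurable
  show ?case using insert assms by (simp add: sec_insert)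
qed

lemma nn_integral_eq_sec_Basis:
  fixes f :: "'a::euclidean_space \<Rightarrow> ennreal"
  assumes [measurable]: "f \<in> borel_measurable borel"
  shows "(\<integral>\<^sup>+x. f x \<partial>lborel) = sec Basis f 0"
  by (subst lborel_eq) (simp add: sec_def nn_integral_distr)

lemma nn_integral_eq_sec1:
  fixes f :: "'a::euclidean_space \<Rightarrow> ennreal"
  assumes f: "f \<in> borel_measurable borel" and "b \<in> Basis"
  shows "(\<integral>\<^sup>+x. f x \<partial>lborel) = (\<integral>\<^sup>+s. sec (Basis - {b}) f (s *\<^sub>R b) \<partial>lborel)"
proof -
  have "insert b (Basis - {b}) = Basis" using assms by auto
  then show ?thesis using sec_insert[of "Basis - {b}" b f 0] f
    by (simp add: nn_integral_eq_sec_Basis del: insert_Diff_single)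
qed

lemma sec1_eq_sec2:
  fixes f :: "'a::euclidean_space \<Rightarrow> ennreal"
  assumes f: "f \<in> borel_measurable borel" and "c \<in> Basis" "b \<noteq> c"
  shows "sec (Basis - {b}) f z = (\<integral>\<^sup>+t. sec (Basis - {b, c}) f (z + t *\<^sub>R c) \<partial>lborel)"
proof -
  have "insert c (Basis - {b, c}) = Basis - {b}" using assms by auto
  then show ?thesis using sec_insert[of "Basis - {b, c}" c f z] f by simp
qed

lemma sec_cong:
  fixes z :: "'a::euclidean_space"
  assumes "I \<subseteq> Basis" "\<And>x. (\<And>b. b \<in> Basis - I \<Longrightarrow> x \<bullet> b = z \<bullet> b) \<Longrightarrow> f x = g x"
  shows "sec I f z = sec I g z"
  unfolding sec_def using assms(1)
  by (intro nn_integral_cong assms(2)) (subst inner_sum_Basis_subset, auto)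

lemma sec_cmult:
  assumes "finite I" and [measurable]: "f \<in> borel_measurable borel"
  shows "sec I (\<lambda>x. c * f x) z = c * sec I f z"
  unfolding sec_def by (intro nn_integral_cmult) measurable

lemma sec_bounded:
  fixes A :: "'a::euclidean_space set"
  assumes I: "I \<subseteq> Basis" and "bounded A"
  obtains r where "0 \<le> r" "\<And>z. (\<And>b. b \<in> I \<Longrightarrow> z \<bullet> b = 0) \<Longrightarrow> sec I (indicator A) z \<le> ennreal r"
proof -
  have finI: "finite I" using finite_subset[OF I finite_Basis] .
  obtain R where R: "\<And>x. x \<in> A \<Longrightarrow> norm x \<le> R" "R > 0"
    using assms(2) bounded_pos by blast
  have "sec I (indicator A) z \<le> ennreal ((2 * R) ^ card I)" if z: "\<And>b. b \<in> I \<Longrightarrow> z \<bullet> b = 0" for z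
  proof -
    have "sec I (indicator A) z = (\<integral>\<^sup>+x. ennreal (indicat_real A (z + (\<Sum>b\<in>I. x b *\<^sub>R b))) \<partial>Pi\<^sub>M I (\<lambda>_. lborel))"
      unfolding sec_def by (intro nn_integral_cong) (simp split: split_indicator)
    also have "\<dots> \<le> ennreal 1 * ennreal ((2 * R) ^ card I)"
    proof (rule nn_integral_PiM_le_box[OF finI])
      show "indicat_real A (z + (\<Sum>b\<in>I. x b *\<^sub>R b)) = 0" if "i \<in> I" "R < \<bar>x i\<bar>" for x i
      proof -
        let ?p = "z + (\<Sum>b\<in>I. x b *\<^sub>R b)"
        have "?p \<bullet> i = x i" using I that z by (subst inner_sum_Basis_subset) auto
        then have "R < norm ?p" using that I Basis_le_norm[of i ?p] by auto
        then show ?thesis using R(1)[of ?p] by (auto split: split_indicator)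
      qed
    qed (use R in auto)
    finally show ?thesis by simp
  qed
  then show ?thesis using that[of "(2 * R) ^ card I"] R(2) by simp
qed

text \<open>Only the coordinates in \<open>I\<close> have to combine linearly with weight
  \<open>l\<close>. The outer coordinates of the three slices are prescribed independently by
  \<open>z\<close>, \<open>w\<close> and \<open>u\<close>, which leaves room for slices whose
  positions combine by a harmonic instead of a convex mean.\<close>

lemma sec_prekopa_leindler:
  fixes A B C :: "'a::euclidean_space set"
  assumes I: "I \<subseteq> Basis"
    and [measurable]: "A \<in> sets borel" "B \<in> sets borel" "C \<in> sets borel"
    and bd: "bounded A" "bounded B"
    and l: "0 < l" "l < 1"
    and zwu: "\<And>b. b \<in> I \<Longrightarrow> z \<bullet> b = 0" "\<And>b. b \<in> I \<Longrightarrow> w \<bullet> b = 0" "\<And>b. b \<in> I \<Longrightarrow> u \<bullet> b = 0"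
    and C: "\<And>x y p. x \<in> A \<Longrightarrow> y \<in> B \<Longrightarrow>
       (\<And>b. b \<in> Basis - I \<Longrightarrow> x \<bullet> b = z \<bullet> b \<and> y \<bullet> b = w \<bullet> b \<and> p \<bullet> b = u \<bullet> b) \<Longrightarrow>
       (\<And>b. b \<in> I \<Longrightarrow> p \<bullet> b = l * (x \<bullet> b) + (1 - l) * (y \<bullet> b)) \<Longrightarrow> p \<in> C"
  shows "ennreal (enn2real (sec I (indicator A) z) powr l * enn2real (sec I (indicator B) w) powr (1 - l))
    \<le> sec I (indicator C) u"
proof -
  have finI: "finite I" using finite_subset[OF I finite_Basis] .
  obtain R1 where R1: "\<And>x. x \<in> A \<Longrightarrow> norm x \<le> R1" using bd bounded_iff by metis
  obtain R2 where R2: "\<And>x. x \<in> B \<Longrightarrow> norm x \<le> R2" using bd bounded_iff by metis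
  define R where "R = \<bar>R1\<bar> + \<bar>R2\<bar>"
  have R: "norm x \<le> R" if "x \<in> A \<or> x \<in> B" for x
    using that R1[of x] R2[of x] unfolding R_def by fastforce
  let ?p = "\<lambda>z x. z + (\<Sum>b\<in>I. x b *\<^sub>R b)"
  have eq: "sec I (indicator X) z = (\<integral>\<^sup>+x. ennreal (indicat_real X (?p z x)) \<partial>Pi\<^sub>M I (\<lambda>_. lborel))"
    for X and z :: 'a
    unfolding sec_def by (intro nn_integral_cong) (simp split: split_indicator)
  have zero: "indicat_real X (?p z x) = 0"
    if "\<And>x. x \<in> X \<Longrightarrow> norm x \<le> R" "i \<in> I" "R < \<bar>x i\<bar>" "\<And>b. b \<in> I \<Longrightarrow> z \<bullet> b = 0" for X x i and z :: 'a
  proof -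
    have "?p z x \<bullet> i = x i" using I that by (subst inner_sum_Basis_subset) auto
    then have "R < norm (?p z x)" using that I Basis_le_norm[of i "?p z x"] by auto
    then show ?thesis using that(1)[of "?p z x"] by (auto split: split_indicator)
  qed
  show ?thesis
    unfolding eq[of A] eq[of B] unfolding sec_def
  proof (rule prekopa_leindler_PiM[OF finI, where M = 1 and R = R])
    show "0 \<le> R" by (simp add: R_def)
    show "indicat_real A (?p z x) = 0" if "i \<in> I" "R < \<bar>x i\<bar>" for x i
      using that zwu R by (intro zero) auto
    show "indicat_real B (?p w x) = 0" if "i \<in> I" "R < \<bar>x i\<bar>" for x i
      using that zwu R by (intro zero) auto
    show "ennreal (indicat_real A (?p z x) powr l * indicat_real B (?p w y) powr (1 - l))
       \<le> indicator C (?p u (\<lambda>i\<in>I. l * x i + (1 - l) * y i))" for x y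
    proof (cases "?p z x \<in> A \<and> ?p w y \<in> B")
      case True
      have "?p u (\<lambda>i\<in>I. l * x i + (1 - l) * y i) \<in> C"
      proof (rule C)
        show "?p z x \<bullet> b = z \<bullet> b \<and> ?p w y \<bullet> b = w \<bullet> b \<and> ?p u (\<lambda>i\<in>I. l * x i + (1 - l) * y i) \<bullet> b = u \<bullet> b"
          if "b \<in> Basis - I" for b using that I by (simp add: inner_sum_Basis_subset)
        show "?p u (\<lambda>i\<in>I. l * x i + (1 - l) * y i) \<bullet> b = l * (?p z x \<bullet> b) + (1 - l) * (?p w y \<bullet> b)"
          if "b \<in> I" for b using that I zwu inner_sum_Basis_subset[OF I, of b] by auto
      qed (use True in auto)
      then show ?thesis using True by simp
    next
      case False
      then show ?thesis using l by auto
    qed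
  qed (use l in auto)
qed

text \<open>Compare the slice of \<open>A\<close> with its image \<open>B\<close> under the sign
  change of the coordinates in \<open>J\<close>. Both have the same volume, so the geometric mean
  with weight one half in Prekopa--Leindler is that volume, and the midpoints of the two slices lie
  in \<open>A'\<close>.\<close>

lemma sec_le_sec_symmetrization:
  fixes A A' :: "'a::euclidean_space set"
  assumes J: "J \<subseteq> Basis" and [measurable]: "A \<in> sets borel" "A' \<in> sets borel" and bd: "bounded A"
    and z: "\<And>b. b \<in> J \<Longrightarrow> z \<bullet> b = 0"
    and A': "\<And>x y p. x \<in> A \<Longrightarrow> y \<in> A \<Longrightarrow>
       (\<And>b. b \<in> Basis - J \<Longrightarrow> x \<bullet> b = y \<bullet> b \<and> p \<bullet> b = x \<bullet> b) \<Longrightarrow>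
       (\<And>b. b \<in> J \<Longrightarrow> p \<bullet> b = (x \<bullet> b - y \<bullet> b) / 2) \<Longrightarrow> p \<in> A'"
  shows "sec J (indicator A) z \<le> sec J (indicator A') z"
proof -
  have finJ: "finite J" using finite_subset[OF J finite_Basis] .
  define T where "T x = (\<Sum>b\<in>Basis. (if b \<in> J then - (x \<bullet> b) else x \<bullet> b) *\<^sub>R b)" for x :: 'a
  have T: "T x \<bullet> b = (if b \<in> J then - (x \<bullet> b) else x \<bullet> b)" if "b \<in> Basis" for x b
    using that by (simp add: T_def)
  have [measurable]: "T \<in> borel_measurable borel" unfolding T_def by measurable
  have TT: "T (T x) = x" for x by (rule euclidean_eqI) (auto simp: T)
  have nT: "norm (T x) = norm x" for x
    unfolding norm_eq_sqrt_inner by (subst (1 2) euclidean_inner) (auto simp: T intro!: sum.cong)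
  define B where "B = T -` A"
  have [measurable]: "B \<in> sets borel" unfolding B_def using measurable_sets[of T borel borel A] by auto
  have bdB: "bounded B" using bd unfolding B_def bounded_iff by (metis TT nT vimageE)
  have "sec J (indicator B) z = (\<integral>\<^sup>+x. indicator A (z + (\<Sum>b\<in>J. (\<lambda>i\<in>J. - x i) b *\<^sub>R b)) \<partial>Pi\<^sub>M J (\<lambda>_. lborel))"
    unfolding sec_def
  proof (rule nn_integral_cong)
    fix x :: "'a \<Rightarrow> real"
    have "T (z + (\<Sum>b\<in>J. x b *\<^sub>R b)) = z + (\<Sum>b\<in>J. (\<lambda>i\<in>J. - x i) b *\<^sub>R b)"
    proof (rule euclidean_eqI)
      fix b :: 'a assume b: "b \<in> Basis"
      show "T (z + (\<Sum>b\<in>J. x b *\<^sub>R b)) \<bullet> b = (z + (\<Sum>b\<in>J. (\<lambda>i\<in>J. - x i) b *\<^sub>R b)) \<bullet> b"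
        unfolding T[OF b] inner_sum_Basis_subset[OF J b] using z by auto
    qed
    then show "indicator B (z + (\<Sum>b\<in>J. x b *\<^sub>R b)) = (indicator A (z + (\<Sum>b\<in>J. (\<lambda>i\<in>J. - x i) b *\<^sub>R b)) :: ennreal)"
      by (simp add: B_def indicator_def)
  qed
  also have "\<dots> = 1 ^ card J * (\<integral>\<^sup>+x. indicator A (z + (\<Sum>b\<in>J. x b *\<^sub>R b)) \<partial>Pi\<^sub>M J (\<lambda>_. lborel))"
  proof (rule nn_integral_PiM_map)
    show "product_sigma_finite (\<lambda>_. lborel :: real measure)" by (rule product_sigma_finite_lborel)
    show "(\<integral>\<^sup>+x. f (- x) \<partial>lborel) = 1 * (\<integral>\<^sup>+x. f x \<partial>lborel)" if "f \<in> borel_measurable lborel"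
      for f :: "real \<Rightarrow> ennreal"
      using that nn_integral_real_affine[of f "-1" 0] by simp
  qed (use finJ in measurable)
  finally have BA: "sec J (indicator B) z = sec J (indicator A) z" by (simp add: sec_def)
  have "ennreal (enn2real (sec J (indicator A) z) powr (1/2) * enn2real (sec J (indicator B) z) powr (1 - 1/2))
    \<le> sec J (indicator A') z"
  proof (rule sec_prekopa_leindler[OF J _ _ _ bd bdB])
    show "p \<in> A'" if "x \<in> A" "y \<in> B" "\<And>b. b \<in> Basis - J \<Longrightarrow> x \<bullet> b = z \<bullet> b \<and> y \<bullet> b = z \<bullet> b \<and> p \<bullet> b = z \<bullet> b"
      "\<And>b. b \<in> J \<Longrightarrow> p \<bullet> b = 1/2 * (x \<bullet> b) + (1 - 1/2) * (y \<bullet> b)" for x y p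
      using that J by (intro A'[of x "T y" p]) (auto simp: B_def T subset_iff)
  qed (use z in auto)
  moreover have "sec J (indicator A) z < \<infinity>"
    using sec_bounded[OF J bd] z by (metis ennreal_less_top infinity_ennreal_def le_less_trans)
  ultimately show ?thesis unfolding BA by (simp flip: powr_add)
qed

lemma emeasure_le_symmetrization:
  fixes A A' :: "'a::euclidean_space set"
  assumes J: "J \<subseteq> Basis" and [measurable]: "A \<in> sets borel" "A' \<in> sets borel" and bd: "bounded A"
    and A': "\<And>x y p. x \<in> A \<Longrightarrow> y \<in> A \<Longrightarrow>
       (\<And>b. b \<in> Basis - J \<Longrightarrow> x \<bullet> b = y \<bullet> b \<and> p \<bullet> b = x \<bullet> b) \<Longrightarrow>
       (\<And>b. b \<in> J \<Longrightarrow> p \<bullet> b = (x \<bullet> b - y \<bullet> b) / 2) \<Longrightarrow> p \<in> A'"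
  shows "emeasure lborel A \<le> emeasure lborel A'"
proof -
  define I where "I = (Basis - J :: 'a set)"
  have IJ: "finite I" "finite J" "I \<inter> J = {}" "I \<union> J = Basis"
    using J finite_subset[OF J finite_Basis] by (auto simp: I_def)
  have eq: "emeasure lborel X = sec I (sec J (indicator X)) 0" if "X \<in> sets borel" for X :: "'a set"
    using that nn_integral_eq_sec_Basis[of "indicator X"] sec_Un[OF IJ(1-3), of "indicator X" 0]
    by (simp add: IJ(4))
  have "sec I (sec J (indicator A)) 0 \<le> sec I (sec J (indicator A')) 0"
    unfolding sec_def[of I]
  proof (intro nn_integral_mono sec_le_sec_symmetrization[OF J _ _ bd])
    show "(0 + (\<Sum>b\<in>I. x b *\<^sub>R b)) \<bullet> b = 0" if "b \<in> J" for b x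
      using that J by (subst inner_sum_Basis_subset) (auto simp: I_def)
  qed (use A' in auto)
  then show ?thesis by (simp add: eq)
qed

section \<open>Monotone transport and equality cases\<close>

lemma nn_integral_Ioo_le:
  fixes q :: "real \<Rightarrow> real"
  assumes q: "continuous_on {a<..<b} q" and "\<And>x. x \<in> {a<..<b} \<Longrightarrow> 0 \<le> q x"
    and le: "\<And>u v. a < u \<Longrightarrow> u < v \<Longrightarrow> v < b \<Longrightarrow> (\<integral>\<^sup>+x. q x * indicator {u..v} x \<partial>lborel) \<le> C"
  shows "(\<integral>\<^sup>+x. ennreal (q x) * indicator {a<..<b} x \<partial>lborel) \<le> C"
proof (cases "a < b")
  case False
  then show ?thesis by simp
next
  case True
  \<comment> \<open>With a denominator of at least 3, each endpoint moves by at most a third of the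
    length, so the closed interval is nondegenerate already for \<open>n = 0\<close>.\<close>
  define u where "u n = a + (b - a) / (real n + 3)" for n :: nat
  define v where "v n = b - (b - a) / (real n + 3)" for n :: nat
  have uv: "a < u n" "u n < v n" "v n < b" for n
  proof -
    define e where "e = (b - a) / (real n + 3)"
    have "0 < e" "e \<le> (b - a) / 3"
      using True divide_left_mono[of 3 "real n + 3" "b - a"] by (auto simp: e_def)
    then show "a < u n" "u n < v n" "v n < b"
      using True unfolding u_def v_def e_def[symmetric] by auto
  qed
  have mono: "u (Suc n) \<le> u n" "v n \<le> v (Suc n)" for n
    using True unfolding u_def v_def by (auto simp: divide_left_mono)
  have meas: "(\<lambda>x. ennreal (q x) * indicator {u n..v n} x) \<in> borel_measurable lborel" for n
  proof -
    have "continuous_on {u n..v n} q" using q by (rule continuous_on_subset) (use uv[of n] in auto)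
    then have [measurable]: "(\<lambda>x. indicator {u n..v n} x *\<^sub>R q x) \<in> borel_measurable borel"
      by (intro borel_measurable_continuous_on_indicator) auto
    have "(\<lambda>x. ennreal (indicator {u n..v n} x *\<^sub>R q x)) \<in> borel_measurable borel" by measurable
    also have "(\<lambda>x. ennreal (indicator {u n..v n} x *\<^sub>R q x)) = (\<lambda>x. ennreal (q x) * indicator {u n..v n} x)"
      by (auto split: split_indicator)
    finally show ?thesis by simp
  qed
  have conv: "(SUP n. ennreal (q x) * indicator {u n..v n} x) = ennreal (q x) * indicator {a<..<b} x" for x
  proof (cases "x \<in> {a<..<b}")
    case True
    have "\<exists>n. x \<in> {u n..v n}"
    proof -
      have "(\<lambda>n. (b - a) / (real n + 3)) \<longlonglongrightarrow> 0" by real_asymp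
      moreover have "0 < min (x - a) (b - x)" using True by auto
      ultimately have "\<forall>\<^sub>F n in sequentially. (b - a) / (real n + 3) < min (x - a) (b - x)"
        by (rule order_tendstoD)
      then obtain n where "(b - a) / (real n + 3) < min (x - a) (b - x)"
        using eventually_happens' sequentially_bot by blast
      then show ?thesis by (intro exI[of _ n]) (auto simp: u_def v_def)
    qed
    then obtain n where n: "x \<in> {u n..v n}" ..
    show ?thesis
    proof (rule antisym)
      show "(SUP n. ennreal (q x) * indicator {u n..v n} x) \<le> ennreal (q x) * indicator {a<..<b} x"
        using True by (intro SUP_least) (auto split: split_indicator)
      show "ennreal (q x) * indicator {a<..<b} x \<le> (SUP n. ennreal (q x) * indicator {u n..v n} x)"
        using n True by (intro SUP_upper2[of n]) auto
    qed
  next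
    case False
    have "x \<notin> {u n..v n}" for n using False uv[of n] by auto
    then show ?thesis using False by simp
  qed
  have "(\<integral>\<^sup>+x. ennreal (q x) * indicator {a<..<b} x \<partial>lborel)
     = (SUP n. (\<integral>\<^sup>+x. ennreal (q x) * indicator {u n..v n} x \<partial>lborel))"
    unfolding conv[symmetric]
  proof (rule nn_integral_monotone_convergence_SUP[OF _ meas])
    show "incseq (\<lambda>n x. ennreal (q x) * indicator {u n..v n} x)"
    proof (rule incseq_SucI, rule le_funI, rule mult_left_mono)
      show "indicator {u n..v n} x \<le> (indicator {u (Suc n)..v (Suc n)} x :: ennreal)" for n x
        using mono[of n] by (auto split: split_indicator)
    qed simp
  qed
  also have "\<dots> \<le> C"
  proof (rule SUP_least)
    fix n
    have "(\<integral>\<^sup>+x. ennreal (q x) * indicator {u n..v n} x \<partial>lborel)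
      = (\<integral>\<^sup>+x. q x * indicator {u n..v n} x \<partial>lborel)"
      by (intro nn_integral_cong) (auto split: split_indicator)
    then show "(\<integral>\<^sup>+x. ennreal (q x) * indicator {u n..v n} x \<partial>lborel) \<le> C"
      using le[OF uv] by simp
  qed
  finally show ?thesis .
qed

lemma borel_measurable_continuous_on_Ioo:
  fixes q :: "real \<Rightarrow> real"
  assumes q: "continuous_on {a<..<b} q"
  shows "(\<lambda>x. ennreal (q x) * indicator {a<..<b} x) \<in> borel_measurable borel"
proof -
  have [measurable]: "(\<lambda>x. indicator {a<..<b} x *\<^sub>R q x) \<in> borel_measurable borel"
    using q by (intro borel_measurable_continuous_on_indicator) auto
  have "(\<lambda>x. ennreal (indicator {a<..<b} x *\<^sub>R q x)) \<in> borel_measurable borel" by measurable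
  also have "(\<lambda>x. ennreal (indicator {a<..<b} x *\<^sub>R q x)) = (\<lambda>x. ennreal (q x) * indicator {a<..<b} x)"
    by (auto split: split_indicator)
  finally show ?thesis .
qed

text \<open>The set where \<open>q\<close> is positive is open and null, hence empty. Since
  \<open>ennreal\<close> cuts off negative values, nothing more than \<open>q x \<le> 0\<close> can
  be concluded.\<close>

lemma continuous_nn_integral_eq_0:
  fixes q :: "real \<Rightarrow> real"
  assumes q: "continuous_on {a<..<b} q"
    and z: "(\<integral>\<^sup>+x. ennreal (q x) * indicator {a<..<b} x \<partial>lborel) = 0"
    and x: "x \<in> {a<..<b}"
  shows "q x \<le> 0"
proof (rule ccontr)
  assume "\<not> q x \<le> 0"
  then have pos: "0 < q x" by simp
  let ?U = "{y \<in> {a<..<b}. 0 < q y}"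
  have "open ?U"
  proof -
    have "?U = q -` {0<..} \<inter> {a<..<b}" by auto
    then show ?thesis using continuous_on_open_vimage[of "{a<..<b}" q] q by (metis open_greaterThan open_greaterThanLessThan)
  qed
  moreover have "AE y in lborel. ennreal (q y) * indicator {a<..<b} y = 0"
    using z borel_measurable_continuous_on_Ioo[OF q] by (simp add: nn_integral_0_iff_AE)
  then have "AE y in lborel. y \<notin> ?U"
    by eventually_elim (auto split: split_indicator_asm)
  then have "emeasure lborel ?U = 0"
    using \<open>open ?U\<close> AE_iff_null_sets[of ?U lborel] by auto
  then have "negligible ?U"
    using \<open>open ?U\<close> by (simp add: negligible_iff_emeasure0)
  ultimately have "?U = {}" using open_not_negligible by blast
  then show False using x pos by auto
qed

text \<open>The excess \<open>f x * (w x - 1)\<close> is continuous and nonnegative, and cancelling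
  the finite mass of \<open>f\<close> leaves it with integral zero.\<close>

lemma nn_integral_weight_eq_1:
  fixes f w :: "real \<Rightarrow> real"
  assumes f: "continuous_on {a<..<b} f" "\<And>x. x \<in> {a<..<b} \<Longrightarrow> 0 < f x"
    and w: "continuous_on {a<..<b} w" "\<And>x. x \<in> {a<..<b} \<Longrightarrow> 1 \<le> w x"
    and le: "(\<integral>\<^sup>+x. ennreal (f x * w x) * indicator {a<..<b} x \<partial>lborel)
        \<le> (\<integral>\<^sup>+x. ennreal (f x) * indicator {a<..<b} x \<partial>lborel)"
    and fin: "(\<integral>\<^sup>+x. ennreal (f x) * indicator {a<..<b} x \<partial>lborel) < \<infinity>"
    and x: "x \<in> {a<..<b}"
  shows "w x = 1"
proof -
  let ?I = "\<lambda>f. (\<integral>\<^sup>+x. ennreal (f x) * indicator {a<..<b} x \<partial>lborel)"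
  define q where "q x = f x * (w x - 1)" for x
  have q: "continuous_on {a<..<b} q" unfolding q_def using f w by (intro continuous_intros)
  have "?I (\<lambda>x. f x * w x) = ?I f + ?I q"
  proof -
    have "?I (\<lambda>x. f x * w x) = (\<integral>\<^sup>+x. ennreal (f x) * indicator {a<..<b} x + ennreal (q x) * indicator {a<..<b} x \<partial>lborel)"
    proof (rule nn_integral_cong)
      fix x
      show "ennreal (f x * w x) * indicator {a<..<b} x
         = ennreal (f x) * indicator {a<..<b} x + ennreal (q x) * indicator {a<..<b} x"
      proof (cases "x \<in> {a<..<b}")
        case True
        then have "f x * w x = f x + q x" "0 \<le> f x" "0 \<le> q x"
          using f(2)[of x] w(2)[of x] by (auto simp: q_def algebra_simps)
        then show ?thesis using True by simp
      qed simp
    qed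
    also have "\<dots> = ?I f + ?I q"
      using borel_measurable_continuous_on_Ioo[OF q] borel_measurable_continuous_on_Ioo[OF f(1)]
      by (intro nn_integral_add) auto
    finally show ?thesis .
  qed
  then have "?I f + ?I q \<le> ?I f + 0" using le by simp
  then have "?I q = 0" using fin by (subst (asm) ennreal_add_left_cancel_le) (auto simp: less_top)
  from continuous_nn_integral_eq_0[OF q this x] show ?thesis
    using f(2)[OF x] w(2)[OF x] by (simp add: q_def mult_le_0_iff)
qed

text \<open>Only an inequality, because the values of \<open>z\<close> may fill just a part of the
  line.\<close>

lemma nn_integral_substitution_ge:
  fixes f w z z' :: "real \<Rightarrow> real" and h :: "real \<Rightarrow> ennreal"
  assumes h: "h \<in> borel_measurable borel"
    and z: "\<And>x. x \<in> {a<..<b} \<Longrightarrow> (z has_real_derivative z' x) (at x)"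
    and z': "continuous_on {a<..<b} z'" "\<And>x. x \<in> {a<..<b} \<Longrightarrow> 0 \<le> z' x"
    and q: "continuous_on {a<..<b} q" "\<And>x. x \<in> {a<..<b} \<Longrightarrow> 0 \<le> q x"
    and le: "\<And>x. x \<in> {a<..<b} \<Longrightarrow> ennreal (q x) \<le> h (z x) * ennreal (z' x)"
  shows "(\<integral>\<^sup>+x. ennreal (q x) * indicator {a<..<b} x \<partial>lborel) \<le> (\<integral>\<^sup>+x. h x \<partial>lborel)"
proof (rule nn_integral_Ioo_le[OF q])
  fix u v assume uv: "a < u" "u < v" "v < b"
  have "(\<integral>\<^sup>+x. ennreal (q x * indicator {u..v} x) \<partial>lborel)
     \<le> (\<integral>\<^sup>+x. h (z x) * ennreal (z' x) * indicator {u..v} x \<partial>lborel)"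
    using le uv by (intro nn_integral_mono) (auto split: split_indicator)
  also have "\<dots> = (\<integral>\<^sup>+x. h x * indicator {z u..z v} x \<partial>lborel)"
  proof (rule nn_integral_substitution_aux[symmetric, OF h])
    show "continuous_on {u..v} z'" using z'(1) by (rule continuous_on_subset) (use uv in auto)
  qed (use uv z z' in auto)
  also have "\<dots> \<le> (\<integral>\<^sup>+x. h x \<partial>lborel)"
    by (intro nn_integral_mono) (auto split: split_indicator)
  finally show "(\<integral>\<^sup>+x. ennreal (q x * indicator {u..v} x) \<partial>lborel) \<le> (\<integral>\<^sup>+x. h x \<partial>lborel)" .
qed

text \<open>The density may be unbounded near \<open>a\<close> and \<open>b\<close>, so the
  fundamental theorem is available only inside the interval. Taking the distribution function of the
  measure with density \<open>f\<close> gives continuity up to the endpoints, since that measure has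
  no atoms.\<close>

lemma cumulative_function:
  fixes f :: "real \<Rightarrow> real"
  assumes ab: "a < b" and f: "continuous_on {a<..<b} f" "\<And>x. x \<in> {a<..<b} \<Longrightarrow> 0 < f x"
    and V: "(\<integral>\<^sup>+x. ennreal (f x) * indicator {a<..<b} x \<partial>lborel) = ennreal V" "0 \<le> V"
  obtains F where "continuous_on {a..b} F" "F a = 0" "F b = V"
    "\<And>x. x \<in> {a<..<b} \<Longrightarrow> (F has_real_derivative f x) (at x)"
proof -
  let ?q = "\<lambda>x. ennreal (f x) * indicator {a<..<b} x"
  have [measurable]: "?q \<in> borel_measurable borel" by (rule borel_measurable_continuous_on_Ioo[OF f(1)])
  define M where "M = density lborel ?q"
  have em: "emeasure M A = (\<integral>\<^sup>+x. ?q x * indicator A x \<partial>lborel)" if "A \<in> sets borel" for A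
    unfolding M_def using that by (subst emeasure_density) auto
  have sM [simp]: "sets M = sets borel" "space M = UNIV" by (auto simp: M_def)
  have tot: "emeasure M UNIV = ennreal V" using em[of UNIV] V by simp
  interpret M: finite_borel_measure M
    by (intro finite_borel_measure.intro finite_borel_measure_axioms.intro finite_measureI) (simp_all add: tot)
  have isC: "isCont (cdf M) x" for x
  proof -
    have "emeasure M {x} = (\<integral>\<^sup>+y. ?q y * indicator {x} y \<partial>lborel)" by (rule em) simp
    also have "\<dots> = (\<integral>\<^sup>+y. 0 \<partial>(lborel::real measure))"
    proof (rule nn_integral_cong_AE)
      show "AE y in lborel. ?q y * indicator {x} y = 0"
        using AE_lborel_singleton[of x] by eventually_elim simp
    qed
    finally have "emeasure M {x} = 0" by simp
    then show ?thesis by (simp add: M.isCont_cdf measure_def)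
  qed
  have diff: "((\<lambda>x. cdf M x) has_real_derivative f x) (at x)" if x: "x \<in> {a<..<b}" for x
  proof -
    \<comment> \<open>A compact neighbourhood of \<open>x\<close> inside the interval, on which
      \<open>f\<close> is continuous and integrable.\<close>
    define u where "u = (a + x) / 2"
    define v where "v = (x + b) / 2"
    have uv: "a < u" "u < x" "x < v" "v < b" using x by (auto simp: u_def v_def)
    have fc: "continuous_on {u..v} f" using f(1) by (rule continuous_on_subset) (use uv in auto)
    have eq: "cdf M y = cdf M u + integral {u..y} f" if y: "y \<in> {u..v}" for y
    proof (cases "u = y")
      case False
      then have uy: "u < y" using y by auto
      have fcy: "continuous_on {u..y} f" using fc by (rule continuous_on_subset) (use y in auto)
      have "cdf M y - cdf M u = measure M {u<..y}" using uy by (rule M.cdf_diff_eq)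
      also have "emeasure M {u<..y} = (\<integral>\<^sup>+x. ennreal (f x) * indicator {u..y} x \<partial>lborel)"
      proof (subst em, simp, rule nn_integral_cong_AE)
        show "AE x in lborel. ?q x * indicator {u<..y} x = ennreal (f x) * indicator {u..y} x"
          using AE_lborel_singleton[of u] by eventually_elim (use uv y in \<open>auto split: split_indicator\<close>)
      qed
      then have "measure M {u<..y} = enn2real (\<integral>\<^sup>+x. ennreal (f x) * indicator {u..y} x \<partial>lborel)"
        by (simp add: measure_def)
      also have "(\<integral>\<^sup>+x. ennreal (f x) * indicator {u..y} x \<partial>lborel) = ennreal (integral {u..y} f)"
      proof -
        have nn: "0 \<le> f x" if "x \<in> {u..y}" for x using f(2)[of x] that uv y by auto
        have "set_integrable lborel {u..y} f" by (rule borel_integrable_atLeastAtMost'[OF fcy])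
        then have I: "integrable lborel (\<lambda>x. indicator {u..y} x *\<^sub>R f x)" by (simp add: set_integrable_def)
        have "(\<integral>\<^sup>+x. ennreal (f x) * indicator {u..y} x \<partial>lborel) = (\<integral>\<^sup>+x. ennreal (indicator {u..y} x *\<^sub>R f x) \<partial>lborel)"
          by (intro nn_integral_cong) (auto split: split_indicator)
        also have "\<dots> = ennreal (\<integral>x. indicator {u..y} x *\<^sub>R f x \<partial>lborel)"
          using nn by (intro nn_integral_eq_integral I) (auto split: split_indicator)
        also have "(\<integral>x. indicator {u..y} x *\<^sub>R f x \<partial>lborel) = integral {u..y} f"
          using set_borel_integral_eq_integral(2)[of "{u..y}" f] borel_integrable_atLeastAtMost'[OF fcy]
          by (simp add: set_lebesgue_integral_def)
        finally show ?thesis .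
      qed
      finally show ?thesis
        using f(2) uv y integral_nonneg[OF integrable_continuous_real[OF fcy]] by (fastforce simp: less_imp_le)
    qed simp
    have "((\<lambda>y. integral {u..y} f) has_real_derivative f x) (at x within {u..v})"
      using fc uv by (intro integral_has_real_derivative) auto
    then have "((\<lambda>y. integral {u..y} f) has_real_derivative f x) (at x within {u<..<v})"
      by (rule DERIV_subset) auto
    then have "((\<lambda>y. integral {u..y} f) has_real_derivative f x) (at x)"
      using uv by (subst (asm) at_within_open) auto
    from DERIV_add[OF DERIV_const[of "cdf M u"] this]
    have "((\<lambda>y. cdf M u + integral {u..y} f) has_real_derivative f x) (at x)" by simp
    note d = this
    have "\<forall>\<^sub>F y in nhds x. y \<in> {u<..<v}"
      using uv by (intro eventually_nhds_in_open) auto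
    then have ev: "\<forall>\<^sub>F y in nhds x. cdf M u + integral {u..y} f = cdf M y"
      by (rule eventually_mono) (rule eq[symmetric], simp)
    show ?thesis using DERIV_cong_ev[OF refl ev refl] d by simp
  qed
  have "emeasure M {..a} = 0" "emeasure M {..b} = ennreal V"
  proof -
    show "emeasure M {..a} = 0"
      by (subst em) (auto intro!: nn_integral_zero' split: split_indicator)
    have "emeasure M {..b} = (\<integral>\<^sup>+x. ?q x \<partial>lborel)"
      by (subst em) (auto intro!: nn_integral_cong split: split_indicator)
    then show "emeasure M {..b} = ennreal V" using V by simp
  qed
  then have "cdf M a = 0" "cdf M b = V" using V(2) by (auto simp: cdf_def measure_def)
  with diff isC show ?thesis using that[of "cdf M"] by (simp add: continuous_at_imp_continuous_on)
qed

text \<open>The map is the inverse of the cumulative function of \<open>g\<close> after that of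
  \<open>f\<close>; equal total mass makes it onto the second interval.\<close>

lemma monotone_transport:
  fixes f g :: "real \<Rightarrow> real"
  assumes ab: "a < b" and f: "continuous_on {a<..<b} f" "\<And>x. x \<in> {a<..<b} \<Longrightarrow> 0 < f x"
    and cd: "c < d" and g: "continuous_on {c<..<d} g" "\<And>x. x \<in> {c<..<d} \<Longrightarrow> 0 < g x"
    and V: "(\<integral>\<^sup>+x. ennreal (f x) * indicator {a<..<b} x \<partial>lborel) = ennreal V"
        "(\<integral>\<^sup>+x. ennreal (g x) * indicator {c<..<d} x \<partial>lborel) = ennreal V" "0 \<le> V"
  obtains \<phi> where "\<phi> ` {a<..<b} = {c<..<d}"
    "\<And>x. x \<in> {a<..<b} \<Longrightarrow> (\<phi> has_real_derivative f x / g (\<phi> x)) (at x)"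
proof -
  obtain F where F: "continuous_on {a..b} F" "F a = 0" "F b = V"
    "\<And>x. x \<in> {a<..<b} \<Longrightarrow> (F has_real_derivative f x) (at x)"
    using cumulative_function[OF ab f V(1,3)] by blast
  obtain G where G: "continuous_on {c..d} G" "G c = 0" "G d = V"
    "\<And>x. x \<in> {c<..<d} \<Longrightarrow> (G has_real_derivative g x) (at x)"
    using cumulative_function[OF cd g V(2,3)] by blast
  have Fmono: "F x < F y" if "a \<le> x" "x < y" "y \<le> b" for x y
  proof (rule DERIV_pos_imp_increasing_open[of x y F])
    show "\<exists>l. (F has_real_derivative l) (at u) \<and> 0 < l" if "x < u" "u < y" for u
      using that \<open>a \<le> x\<close> \<open>y \<le> b\<close> F(4)[of u] f(2)[of u] by auto
    show "continuous_on {x..y} F" using F(1) by (rule continuous_on_subset) (use that in auto)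
  qed fact
  have Gmono: "G x < G y" if "c \<le> x" "x < y" "y \<le> d" for x y
  proof (rule DERIV_pos_imp_increasing_open[of x y G])
    show "\<exists>l. (G has_real_derivative l) (at u) \<and> 0 < l" if "x < u" "u < y" for u
      using that \<open>c \<le> x\<close> \<open>y \<le> d\<close> G(4)[of u] g(2)[of u] by auto
    show "continuous_on {x..y} G" using G(1) by (rule continuous_on_subset) (use that in auto)
  qed fact
  have Ginj: "inj_on G {c..d}"
    by (rule inj_onI) (metis Gmono linorder_neqE atLeastAtMost_iff less_irrefl)
  define H where "H = the_inv_into {c..d} G"
  have HG: "H (G x) = x" if "x \<in> {c..d}" for x
    unfolding H_def using Ginj that by (rule the_inv_into_f_f)
  have Gim: "\<exists>x\<in>{c..d}. G x = y" if "y \<in> {0..V}" for y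
    using IVT'[of G c y d] G that cd by auto
  have GH: "G (H y) = y" "H y \<in> {c..d}" if y: "y \<in> {0..V}" for y
    using Gim[OF y] HG by auto
  have Gimage: "G ` {c..d} = {0..V}"
  proof
    show "G ` {c..d} \<subseteq> {0..V}"
    proof
      fix y assume "y \<in> G ` {c..d}"
      then obtain x where x: "x \<in> {c..d}" "y = G x" by auto
      then show "y \<in> {0..V}"
        using Gmono[of c x] Gmono[of x d] G(2,3) by (cases "x = c"; cases "x = d") auto
    qed
    show "{0..V} \<subseteq> G ` {c..d}" using Gim by force
  qed
  have Hc: "continuous_on {0..V} H"
    using continuous_on_inv[OF G(1) compact_Icc] HG unfolding Gimage by auto
  have Hin: "H y \<in> {c<..<d}" if y: "y \<in> {0<..<V}" for y
  proof -
    have "G (H y) = y" "H y \<in> {c..d}" using GH[of y] y by auto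
    then show ?thesis using G(2,3) y by (cases "H y = c"; cases "H y = d") auto
  qed
  have Hd: "(H has_real_derivative inverse (g (H y))) (at y)" if y: "y \<in> {0<..<V}" for y
  proof (rule DERIV_inverse_function)
    show "(G has_real_derivative g (H y)) (at (H y))" using G(4) Hin y by auto
    show "g (H y) \<noteq> 0" using g(2) Hin y by (metis less_irrefl)
    show "0 < y" "y < V" using y by auto
    show "isCont H y" using continuous_on_interior[OF Hc, of y] y by auto
  qed (use GH in auto)
  have Fin: "F x \<in> {0<..<V}" if "x \<in> {a<..<b}" for x
    using Fmono[of a x] Fmono[of x b] F that by auto
  show ?thesis
  proof (rule that[of "\<lambda>x. H (F x)"])
    show "((\<lambda>x. H (F x)) has_real_derivative f x / g (H (F x))) (at x)" if "x \<in> {a<..<b}" for x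
      using DERIV_chain2[OF Hd[OF Fin[OF that]] F(4)[OF that]] by (simp add: divide_inverse mult.commute)
    show "(\<lambda>x. H (F x)) ` {a<..<b} = {c<..<d}"
    proof
      show "(\<lambda>x. H (F x)) ` {a<..<b} \<subseteq> {c<..<d}" using Hin Fin by auto
      show "{c<..<d} \<subseteq> (\<lambda>x. H (F x)) ` {a<..<b}"
      proof
        fix y assume y: "y \<in> {c<..<d}"
        then have "0 < G y" "G y < V" using Gmono[of c y] Gmono[of y d] G by auto
        then obtain x where x: "a \<le> x" "x \<le> b" "F x = G y" using IVT'[of F a "G y" b] F ab by auto
        then have "x \<in> {a<..<b}" using F \<open>0 < G y\<close> \<open>G y < V\<close> by (cases "x = a"; cases "x = b") auto
        moreover have "y = H (F x)" using x HG y by auto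
        ultimately show "y \<in> (\<lambda>x. H (F x)) ` {a<..<b}" by auto
      qed
    qed
  qed
qed

text \<open>The common frame of the two mean inequalities below: \<open>z x\<close> is a mean of
  \<open>x\<close> and its transported point, and \<open>w\<close> measures the gain of density
  there. Substituting \<open>z\<close> gives a mass of \<open>h\<close> of at least that of
  \<open>f * w\<close>, hence of at least \<open>V\<close>; if \<open>h\<close> has no more mass
  than \<open>V\<close>, there is no gain anywhere.\<close>

lemma transport_mean_equality:
  fixes f g z' w :: "real \<Rightarrow> real" and h :: "real \<Rightarrow> ennreal"
  assumes h: "h \<in> borel_measurable borel"
    and f: "continuous_on {a<..<b} f" "\<And>x. x \<in> {a<..<b} \<Longrightarrow> 0 < f x"
    and z: "\<And>x. x \<in> {a<..<b} \<Longrightarrow> (z has_real_derivative z' x) (at x)"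
    and z': "continuous_on {a<..<b} z'" "\<And>x. x \<in> {a<..<b} \<Longrightarrow> 0 \<le> z' x"
    and w: "continuous_on {a<..<b} w" "\<And>x. x \<in> {a<..<b} \<Longrightarrow> 1 \<le> w x"
    and le: "\<And>x. x \<in> {a<..<b} \<Longrightarrow> ennreal (f x * w x) \<le> h (z x) * ennreal (z' x)"
    and V: "(\<integral>\<^sup>+x. ennreal (f x) * indicator {a<..<b} x \<partial>lborel) = ennreal V"
    and hV: "(\<integral>\<^sup>+x. h x \<partial>lborel) \<le> ennreal V"
    and x: "x \<in> {a<..<b}"
  shows "w x = 1"
proof (rule nn_integral_weight_eq_1[OF f w _ _ x])
  have "(\<integral>\<^sup>+x. ennreal (f x * w x) * indicator {a<..<b} x \<partial>lborel) \<le> (\<integral>\<^sup>+x. h x \<partial>lborel)"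
  proof (rule nn_integral_substitution_ge[OF h z z' _ _ le])
    show "continuous_on {a<..<b} (\<lambda>x. f x * w x)" using f w by (intro continuous_intros)
    show "0 \<le> f x * w x" if "x \<in> {a<..<b}" for x
      using f(2)[OF that] w(2)[OF that] by simp
  qed
  then show "(\<integral>\<^sup>+x. ennreal (f x * w x) * indicator {a<..<b} x \<partial>lborel)
    \<le> (\<integral>\<^sup>+x. ennreal (f x) * indicator {a<..<b} x \<partial>lborel)" using V hV by simp
qed (use V in auto)

text \<open>The logarithm of the product is the relative entropy of the distribution
  \<open>(l, 1 - l)\<close> with respect to the uniform one. Bounding each logarithm below by
  \<open>1 - 1 / x\<close> makes the two terms cancel, and the bound is strict unless
  \<open>x = 1\<close>.\<close>

lemma two_point_entropy:
  fixes l :: real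
  assumes l: "0 < l" "l < 1"
  shows "1 \<le> (2 * l) powr l * (2 * (1 - l)) powr (1 - l)"
    and "(2 * l) powr l * (2 * (1 - l)) powr (1 - l) = 1 \<Longrightarrow> l = 1/2"
proof -
  have E: "(2 * l) powr l * (2 * (1 - l)) powr (1 - l) = exp (l * ln (2 * l) + (1 - l) * ln (2 * (1 - l)))"
    using l by (simp add: powr_def exp_add)
  have ge: "1 - 1 / x \<le> ln x" if "0 < x" for x :: real
    using ln_le_minus_one[of "1 / x"] that by (simp add: ln_div)
  have gt: "1 - 1 / x < ln x" if "0 < x" "x \<noteq> 1" for x :: real
  proof -
    have "ln (1 / x) \<noteq> 1 / x - 1" using that ln_eq_minus_one[of "1 / x"] by auto
    then show ?thesis using ge[OF that(1)] that by (auto simp: ln_div)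
  qed
  have 1: "l * (1 - 1 / (2 * l)) = l - 1/2" "(1 - l) * (1 - 1 / (2 * (1 - l))) = 1/2 - l"
    using l by (auto simp: field_simps)
  have a: "l - 1/2 \<le> l * ln (2 * l)" "1/2 - l \<le> (1 - l) * ln (2 * (1 - l))"
    using mult_left_mono[OF ge[of "2 * l"], of l] mult_left_mono[OF ge[of "2 * (1 - l)"], of "1 - l"] l
    unfolding 1 by auto
  then show "1 \<le> (2 * l) powr l * (2 * (1 - l)) powr (1 - l)" unfolding E by simp
  assume "(2 * l) powr l * (2 * (1 - l)) powr (1 - l) = 1"
  then have s: "l * ln (2 * l) + (1 - l) * ln (2 * (1 - l)) = 0" unfolding E by simp
  show "l = 1/2"
  proof (rule ccontr)
    assume "l \<noteq> 1/2"
    then have "l * (1 - 1 / (2 * l)) < l * ln (2 * l)"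
      using gt[of "2 * l"] l by (intro mult_strict_left_mono) auto
    then show False using a s unfolding 1 by linarith
  qed
qed

text \<open>Here \<open>y\<close> is the transported point of \<open>x\<close>, and
  \<open>F / G\<close> is the derivative of the transport; the factor over \<open>(x + y)^2\<close>
  is then the derivative of the harmonic mean of \<open>x\<close> and \<open>y\<close>. With
  \<open>l = y / (x + y)\<close> that derivative is a mean, with weights \<open>l\<close> and
  \<open>1 - l\<close>, of \<open>2 * l\<close> and \<open>2 * (1 - l) * (F / G)\<close>. By Young's
  inequality the densities cancel and the entropy product remains.\<close>

lemma harmonic_weight_ge:
  fixes x y F G :: real
  assumes pos: "0 < x" "0 < y" "0 < F" "0 < G"
  defines "w \<equiv> F powr (y / (x + y)) * G powr (x / (x + y)) * (2 * (y^2 + x^2 * (F / G)) / (x + y)^2) / F"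
  shows "1 \<le> w" and "w = 1 \<Longrightarrow> x = y"
proof -
  define l where "l = y / (x + y)"
  have l: "0 < l" "l < 1" and l': "x / (x + y) = 1 - l"
    using pos by (auto simp: l_def field_simps)
  have sq: "2 * (y^2 + x^2 * (F / G)) / (x + y)^2 = l * (2 * l) + (1 - l) * (2 * (1 - l) * (F / G))"
    unfolding l'[symmetric] unfolding l_def using pos by (simp add: divide_simps power2_eq_square)
  have "(2 * l) powr l * (2 * (1 - l)) powr (1 - l) * (F / G) powr (1 - l)
      = (2 * l) powr l * (2 * (1 - l) * (F / G)) powr (1 - l)"
    using l pos by (subst powr_mult[of "2 * (1 - l)" "F / G"]) (auto simp: mult.assoc)
  also have "\<dots> \<le> l * (2 * l) + (1 - l) * (2 * (1 - l) * (F / G))"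
    using l pos by (intro Youngs_inequality_0) auto
  finally have Y: "(2 * l) powr l * (2 * (1 - l)) powr (1 - l) * (F / G) powr (1 - l)
     \<le> 2 * (y^2 + x^2 * (F / G)) / (x + y)^2" unfolding sq .
  have "F powr l * F powr (1 - l) = F" using pos by (simp flip: powr_add)
  then have c: "F powr l * G powr (1 - l) * (F / G) powr (1 - l) = F"
    using pos by (simp add: powr_divide)
  have "(2 * l) powr l * (2 * (1 - l)) powr (1 - l)
     = (F powr l * G powr (1 - l)) * ((2 * l) powr l * (2 * (1 - l)) powr (1 - l) * (F / G) powr (1 - l)) / F"
    using c pos by (simp add: field_simps)
  also have "\<dots> \<le> w" unfolding w_def l'  unfolding l_def[symmetric]
    using Y pos by (intro divide_right_mono mult_left_mono) auto
  finally have E: "(2 * l) powr l * (2 * (1 - l)) powr (1 - l) \<le> w" .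
  with two_point_entropy(1)[OF l] show "1 \<le> w" by linarith
  assume "w = 1"
  then have "l = 1/2" using E two_point_entropy[OF l] by linarith
  then show "x = y" using pos by (simp add: l_def field_simps)
qed

text \<open>Equality in the entropy bound happens only for weight one half, that is for
  \<open>p x = x\<close>. So the transport is the identity, and its derivative, the ratio of the
  densities, is 1.\<close>

lemma harmonic_mean_equality:
  fixes f g :: "real \<Rightarrow> real" and h :: "real \<Rightarrow> ennreal"
  assumes h[measurable]: "h \<in> borel_measurable borel"
    and a: "0 < a" and f: "continuous_on {0<..<a} f" "\<And>x. x \<in> {0<..<a} \<Longrightarrow> 0 < f x"
    and b: "0 < b" and g: "continuous_on {0<..<b} g" "\<And>x. x \<in> {0<..<b} \<Longrightarrow> 0 < g x"
    and V: "(\<integral>\<^sup>+x. ennreal (f x) * indicator {0<..<a} x \<partial>lborel) = ennreal V"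
        "(\<integral>\<^sup>+x. ennreal (g x) * indicator {0<..<b} x \<partial>lborel) = ennreal V" "0 \<le> V"
    and le: "\<And>s t. s \<in> {0<..<a} \<Longrightarrow> t \<in> {0<..<b} \<Longrightarrow>
       ennreal (f s powr (t / (s + t)) * g t powr (s / (s + t))) \<le> h (2 * s * t / (s + t))"
    and hV: "(\<integral>\<^sup>+x. h x \<partial>lborel) \<le> ennreal V"
  shows "a = b" and "\<And>x. x \<in> {0<..<a} \<Longrightarrow> f x = g x"
proof -
  obtain p where p: "p ` {0<..<a} = {0<..<b}"
    "\<And>x. x \<in> {0<..<a} \<Longrightarrow> (p has_real_derivative f x / g (p x)) (at x)"
    using monotone_transport[OF a f b g V] by blast
  have pin: "p x \<in> {0<..<b}" if "x \<in> {0<..<a}" for x using p(1) that by auto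
  have ppos: "0 < p x" if "x \<in> {0<..<a}" for x using pin[OF that] by auto
  have pc: "continuous_on {0<..<a} p"
    by (rule has_real_derivative_imp_continuous_on) (use p(2) in auto)
  have gpc: "continuous_on {0<..<a} (\<lambda>x. g (p x))"
    using continuous_on_compose2[OF g(1) pc] p(1) by auto
  have gpos: "0 < g (p x)" if "x \<in> {0<..<a}" for x using g(2) pin that by auto
  define z where "z x = 2 * x * p x / (x + p x)" for x
  define z' where "z' x = 2 * ((p x)^2 + x^2 * (f x / g (p x))) / (x + p x)^2" for x
  define w where "w x = f x powr (p x / (x + p x)) * g (p x) powr (x / (x + p x)) * z' x / f x" for x
  have ne: "x + p x \<noteq> 0" "g (p x) \<noteq> 0" "f x \<noteq> 0" if "x \<in> {0<..<a}" for x
    using ppos[OF that] gpos[OF that] f(2)[OF that] that by auto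
  have z'c: "continuous_on {0<..<a} z'"
    unfolding z'_def using pc gpc f(1) ne by (intro continuous_intros) auto
  have wc: "continuous_on {0<..<a} w"
    unfolding w_def using pc gpc f(1) z'c ne by (intro continuous_intros) auto
  have z'pos: "0 \<le> z' x" if "x \<in> {0<..<a}" for x
    unfolding z'_def using that ppos[OF that] gpos[OF that] f(2)[OF that] by auto
  have w1: "w x = 1" if x: "x \<in> {0<..<a}" for x
  proof (rule transport_mean_equality[OF h f _ z'c z'pos wc _ _ V(1) hV x])
    fix x assume x: "x \<in> {0<..<a}"
    show "(z has_real_derivative z' x) (at x)"
      unfolding z_def z'_def using ne[OF x]
      by (auto intro!: derivative_eq_intros p(2)[OF x] simp: divide_simps power2_eq_square) (simp add: algebra_simps)
    show "1 \<le> w x" unfolding w_def z'_def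
      using x ppos[OF x] gpos[OF x] f(2)[OF x] by (intro harmonic_weight_ge) auto
    have "ennreal (f x * w x) = ennreal (f x powr (p x / (x + p x)) * g (p x) powr (x / (x + p x))) * ennreal (z' x)"
      using ne[OF x] z'pos[OF x] by (simp add: w_def ennreal_mult[symmetric] del: ennreal_mult'' )
    also have "\<dots> \<le> h (z x) * ennreal (z' x)"
      unfolding z_def using le[OF x pin[OF x]] by (rule mult_right_mono) simp
    finally show "ennreal (f x * w x) \<le> h (z x) * ennreal (z' x)" .
  qed
  have px: "p x = x" if x: "x \<in> {0<..<a}" for x
  proof -
    have "x = p x"
      by (rule harmonic_weight_ge(2)[of x "p x" "f x" "g (p x)"])
         (use w1[OF x] x ppos[OF x] gpos[OF x] f(2)[OF x] in \<open>auto simp: w_def z'_def\<close>)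
    then show ?thesis ..
  qed
  have "{0<..<a} = {0<..<b}" using p(1) px by (metis (no_types, lifting) image_cong image_ident)
  then show "a = b" using a b by (metis greaterThanLessThan_eq_iff order_less_irrefl not_less)
  fix x assume x: "x \<in> {0<..<a}"
  have "(p has_real_derivative 1) (at x)"
  proof (rule has_field_derivative_transform_within_open[of "\<lambda>x. x" 1 x "{0<..<a}"])
    show "((\<lambda>x. x) has_real_derivative 1) (at x)" by (rule DERIV_ident)
  qed (use x px in auto)
  with p(2)[OF x] have "f x / g (p x) = 1" by (rule DERIV_unique)
  then show "f x = g x" using px[OF x] ne[OF x] by simp
qed

lemma arithmetic_weight_ge:
  fixes F G :: real
  assumes pos: "0 < F" "0 < G"
  defines "w \<equiv> sqrt (F * G) * ((1 + F / G) / 2) / F"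
  shows "1 \<le> w" and "w = 1 \<Longrightarrow> F = G"
proof -
  define s where "s = sqrt F"
  define t where "t = sqrt G"
  have st: "0 < s" "0 < t" "F = s^2" "G = t^2" using pos by (auto simp: s_def t_def)
  have "w = (s^2 + t^2) / (2 * s * t)"
    unfolding w_def st using st(1,2) by (simp add: real_sqrt_mult field_simps power2_eq_square)
  moreover have "(s^2 + t^2) / (2 * s * t) = 1 + (s - t)^2 / (2 * s * t)"
    using st(1,2) by (simp add: field_simps power2_eq_square)
  ultimately have w: "w = 1 + (s - t)^2 / (2 * s * t)" by simp
  show "1 \<le> w" unfolding w using st by auto
  show "F = G" if "w = 1" using that st unfolding w by auto
qed

text \<open>The weights are now fixed at one half, so equality says only that the transport has
  derivative 1. It does not locate the transported point, and a translation by \<open>e\<close>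
  remains free.\<close>

lemma arithmetic_mean_equality:
  fixes f g :: "real \<Rightarrow> real" and h :: "real \<Rightarrow> ennreal"
  assumes h[measurable]: "h \<in> borel_measurable borel"
    and a: "a < b" and f: "continuous_on {a<..<b} f" "\<And>x. x \<in> {a<..<b} \<Longrightarrow> 0 < f x"
    and b: "c < d" and g: "continuous_on {c<..<d} g" "\<And>x. x \<in> {c<..<d} \<Longrightarrow> 0 < g x"
    and V: "(\<integral>\<^sup>+x. ennreal (f x) * indicator {a<..<b} x \<partial>lborel) = ennreal V"
        "(\<integral>\<^sup>+x. ennreal (g x) * indicator {c<..<d} x \<partial>lborel) = ennreal V" "0 \<le> V"
    and le: "\<And>s t. s \<in> {a<..<b} \<Longrightarrow> t \<in> {c<..<d} \<Longrightarrow>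
       ennreal (sqrt (f s * g t)) \<le> h ((s + t) / 2)"
    and hV: "(\<integral>\<^sup>+x. h x \<partial>lborel) \<le> ennreal V"
  obtains e where "c = a + e" "d = b + e" "\<And>x. x \<in> {a<..<b} \<Longrightarrow> g (x + e) = f x"
proof -
  obtain p where p: "p ` {a<..<b} = {c<..<d}"
    "\<And>x. x \<in> {a<..<b} \<Longrightarrow> (p has_real_derivative f x / g (p x)) (at x)"
    using monotone_transport[OF a f b g V] by blast
  have pin: "p x \<in> {c<..<d}" if "x \<in> {a<..<b}" for x using p(1) that by auto
  have pc: "continuous_on {a<..<b} p"
    by (rule has_real_derivative_imp_continuous_on) (use p(2) in auto)
  have gpc: "continuous_on {a<..<b} (\<lambda>x. g (p x))"
    using continuous_on_compose2[OF g(1) pc] p(1) by auto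
  have gpos: "0 < g (p x)" if "x \<in> {a<..<b}" for x using g(2) pin that by auto
  define z where "z x = (x + p x) / 2" for x
  define z' where "z' x = (1 + f x / g (p x)) / 2" for x
  define w where "w x = sqrt (f x * g (p x)) * z' x / f x" for x
  have ne: "g (p x) \<noteq> 0" "f x \<noteq> 0" if "x \<in> {a<..<b}" for x
    using gpos[OF that] f(2)[OF that] that by auto
  have z'c: "continuous_on {a<..<b} z'"
    unfolding z'_def using gpc f(1) ne by (intro continuous_intros) auto
  have wc: "continuous_on {a<..<b} w"
    unfolding w_def using gpc f(1) z'c ne by (intro continuous_intros) auto
  have z'pos: "0 \<le> z' x" if "x \<in> {a<..<b}" for x
    unfolding z'_def using gpos[OF that] f(2)[OF that] by auto
  have w1: "w x = 1" if x: "x \<in> {a<..<b}" for x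
  proof (rule transport_mean_equality[OF h f _ z'c z'pos wc _ _ V(1) hV x])
    fix x assume x: "x \<in> {a<..<b}"
    show "(z has_real_derivative z' x) (at x)"
      unfolding z_def z'_def by (auto intro!: derivative_eq_intros p(2)[OF x])
    show "1 \<le> w x" unfolding w_def z'_def
      using gpos[OF x] f(2)[OF x] by (intro arithmetic_weight_ge) auto
    have "ennreal (f x * w x) = ennreal (sqrt (f x * g (p x))) * ennreal (z' x)"
      using ne[OF x] z'pos[OF x] f(2)[OF x] gpos[OF x] by (simp add: w_def ennreal_mult[symmetric] del: ennreal_mult'')
    also have "\<dots> \<le> h (z x) * ennreal (z' x)"
      unfolding z_def using le[OF x pin[OF x]] by (rule mult_right_mono) simp
    finally show "ennreal (f x * w x) \<le> h (z x) * ennreal (z' x)" .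
  qed
  have fg: "f x = g (p x)" if x: "x \<in> {a<..<b}" for x
    by (rule arithmetic_weight_ge(2)) (use w1[OF x] gpos[OF x] f(2)[OF x] in \<open>auto simp: w_def z'_def\<close>)
  have "\<exists>e. \<forall>x\<in>{a<..<b}. p x - x = e"
  proof (rule has_field_derivative_zero_constant)
    show "((\<lambda>x. p x - x) has_field_derivative 0) (at x within {a<..<b})" if x: "x \<in> {a<..<b}" for x
    proof -
      have "(p has_real_derivative 1) (at x)" using p(2)[OF x] fg[OF x] ne[OF x] by simp
      from DERIV_diff[OF this DERIV_ident] show ?thesis by (simp add: has_field_derivative_at_within)
    qed
  qed auto
  then obtain e where e: "p x = x + e" if "x \<in> {a<..<b}" for x by (auto simp: algebra_simps)
  have "{c<..<d} = (\<lambda>x. x + e) ` {a<..<b}" using p(1) e by (metis (no_types, lifting) image_cong)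
  also have "\<dots> = {a + e<..<b + e}" by (force simp: image_iff intro: exI[of _ "x - e" for x] bexI[of _ "x - e" for x])
  finally have eq: "{c<..<d} = {a + e<..<b + e}" .
  have "c = a + e" "d = b + e" using a b eq
    by (metis add_less_cancel_right greaterThanLessThan_eq_iff not_less order_less_irrefl)+
  with fg e that show ?thesis by auto
qed

text \<open>Subdivide \<open>[p, q]\<close>: the second differences telescope to boundary terms that vanish with the mesh.\<close>

lemma constant_of_second_difference_bound:
  fixes d w :: "real \<Rightarrow> real"
  assumes pq: "p < q" and w: "continuous_on {p..q} w"
    and le: "\<And>x y. x \<in> {p..q} \<Longrightarrow> y \<in> {p..q} \<Longrightarrow> \<bar>d x - d y\<bar> \<le> 2 * w ((x + y) / 2) - w x - w y"
  shows "d p = d q"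
proof -
  have bound: "\<bar>d q - d p\<bar> \<le> (w (p + (q - p) / (2 * N)) - w p) - (w q - w (q - (q - p) / (2 * N)))"
    if N: "N \<ge> 1" for N :: nat
  proof -
    define e where "e = (q - p) / (2 * N)"
    have e: "0 < e" "2 * N * e = q - p" using pq N by (auto simp: e_def)
    define z where "z j = p + j * e" for j :: nat
    have zin: "z j \<in> {p..q}" if "j \<le> 2 * N" for j
    proof -
      have "real j * e \<le> 2 * N * e" using that e by (intro mult_right_mono) auto
      moreover have "0 \<le> real j * e" using e by simp
      ultimately show ?thesis using e(2) unfolding z_def by auto
    qed
    \<comment> \<open>For mesh points two apart the hypothesis bounds the change of \<open>d\<close>
      by \<open>D j - D (Suc j)\<close>. In particular \<open>D\<close> decreases, so the
      differences skipped when moving in steps of two can be added for free and the sum telescopes.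
      An even number of subintervals makes these steps end at \<open>q\<close>.\<close>
    define D where "D j = w (z (Suc j)) - w (z j)" for j
    have step: "\<bar>d (z (j + 2)) - d (z j)\<bar> \<le> D j - D (Suc j)" if "j + 2 \<le> 2 * N" for j
    proof -
      have m: "(z (j + 2) + z j) / 2 = z (Suc j)" by (simp add: z_def field_simps)
      show ?thesis using le[OF zin[of "j + 2"] zin[of j]] that unfolding m D_def by simp
    qed
    have "\<bar>d (z (2 * n)) - d (z 0)\<bar> \<le> D 0 - D (2 * n - 1)" if "n \<ge> 1" "n \<le> N" for n
      using that
    proof (induction n rule: nat_induct_at_least)
      case base
      then show ?case using step[of 0] N by (simp add: numeral_2_eq_2)
    next
      case (Suc n)
      have s1: "\<bar>d (z (2 * n + 2)) - d (z (2 * n))\<bar> \<le> D (2 * n) - D (Suc (2 * n))"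
        using step[of "2 * n"] Suc by simp
      have s2: "0 \<le> D (2 * n - 1) - D (2 * n)"
        using step[of "2 * n - 1"] Suc by simp
      have "\<bar>d (z (2 * n)) - d (z 0)\<bar> \<le> D 0 - D (2 * n - 1)" using Suc by simp
      with s1 s2 show ?case by simp
    qed
    from this[of N] N have "\<bar>d (z (2 * N)) - d (z 0)\<bar> \<le> D 0 - D (2 * N - 1)" by simp
    moreover have "z (2 * N) = q" "z 0 = p" "z (Suc 0) = p + e" using e by (auto simp: z_def)
    moreover have "z (2 * N - 1) = q - e" using e N by (simp add: z_def of_nat_diff algebra_simps)
    moreover have "Suc (2 * N - 1) = 2 * N" using N by simp
    ultimately show ?thesis unfolding D_def e_def by simp
  qed
  have lim0: "(\<lambda>N. (q - p) / (2 * real N)) \<longlonglongrightarrow> 0" by real_asymp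
  have ev: "\<forall>\<^sub>F N in sequentially. (q - p) / (2 * real N) \<in> {0..q-p}"
    using eventually_ge_at_top[of 1]
  proof eventually_elim
    case (elim N)
    then have "(q - p) / (2 * real N) \<le> (q - p) / 1" using pq by (intro divide_left_mono) auto
    then show ?case using pq by auto
  qed
  have l1: "(\<lambda>N. w (p + (q - p) / (2 * real N))) \<longlonglongrightarrow> w (p + 0)"
  proof (rule continuous_on_tendsto_compose[OF w])
    show "(\<lambda>N. p + (q - p) / (2 * real N)) \<longlonglongrightarrow> p + 0" by (intro tendsto_intros lim0)
    show "\<forall>\<^sub>F N in sequentially. p + (q - p) / (2 * real N) \<in> {p..q}"
      using ev by eventually_elim auto
  qed (use pq in auto)
  have l2: "(\<lambda>N. w (q - (q - p) / (2 * real N))) \<longlonglongrightarrow> w (q - 0)"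
  proof (rule continuous_on_tendsto_compose[OF w])
    show "(\<lambda>N. q - (q - p) / (2 * real N)) \<longlonglongrightarrow> q - 0" by (intro tendsto_intros lim0)
    show "\<forall>\<^sub>F N in sequentially. q - (q - p) / (2 * real N) \<in> {p..q}"
      using ev by eventually_elim auto
  qed (use pq in auto)
  have "(\<lambda>N. (w (p + (q - p) / (2 * real N)) - w p) - (w q - w (q - (q - p) / (2 * real N)))) \<longlonglongrightarrow>
     (w (p + 0) - w p) - (w q - w (q - 0))"
    by (intro tendsto_intros l1 l2)
  then have "\<bar>d q - d p\<bar> \<le> (w (p + 0) - w p) - (w q - w (q - 0))"
    by (rule tendsto_lowerbound) (use bound in \<open>auto intro: eventually_sequentiallyI[of 1]\<close>)
  then show ?thesis by simp
qed

section \<open>Sections of a body and of a harmonic join\<close>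

text \<open>Log-concavity makes the positivity set an interval and \<open>- ln u\<close> convex,
  hence continuous, inside it. At \<open>a\<close> and \<open>b\<close> the function may jump; these
  two points are null, so everything is stated on the open interval.\<close>

lemma logconcave_support:
  fixes u :: "real \<Rightarrow> real"
  assumes nn: "\<And>x. 0 \<le> u x"
    and lc: "\<And>x y l. 0 < l \<Longrightarrow> l < 1 \<Longrightarrow> u x powr l * u y powr (1 - l) \<le> u (l * x + (1 - l) * y)"
    and supp: "\<And>x. R < \<bar>x\<bar> \<Longrightarrow> u x = 0"
    and pos: "(\<integral>\<^sup>+x. ennreal (u x) \<partial>lborel) \<noteq> 0"
  defines "a \<equiv> Inf {x. 0 < u x}" and "b \<equiv> Sup {x. 0 < u x}"
  shows "a < b" and "\<And>x. a < x \<Longrightarrow> x < b \<Longrightarrow> 0 < u x" and "\<And>x. x < a \<or> b < x \<Longrightarrow> u x = 0"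
    and "continuous_on {a<..<b} u"
    and "(\<integral>\<^sup>+x. ennreal (u x) \<partial>lborel) = (\<integral>\<^sup>+x. ennreal (u x) * indicator {a<..<b} x \<partial>lborel)"
proof -
  let ?P = "{x. 0 < u x}"
  have bd: "bdd_below ?P" "bdd_above ?P"
    using supp by (auto intro!: bdd_belowI[of _ "-R"] bdd_aboveI[of _ R])
       (metis abs_le_iff less_irrefl minus_le_iff not_less)+
  have ne: "?P \<noteq> {}"
  proof
    assume "?P = {}"
    then have "u x = 0" for x using nn[of x] by (auto simp: less_le)
    then show False using pos by simp
  qed
  have inab: "x \<in> {a..b}" if "0 < u x" for x
    using that bd by (auto simp: a_def b_def intro: cInf_lower cSup_upper)
  show out: "u x = 0" if "x < a \<or> b < x" for x
  proof -
    have "\<not> 0 < u x" using inab[of x] that by auto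
    then show ?thesis using nn[of x] by simp
  qed
  show ins: "0 < u x" if x: "a < x" "x < b" for x
  proof -
    obtain y where y: "0 < u y" "y < x" using x(1) ne bd unfolding a_def by (auto simp: cInf_less_iff)
    obtain w where w: "0 < u w" "x < w" using x(2) ne bd unfolding b_def by (auto simp: less_cSup_iff)
    define l where "l = (w - x) / (w - y)"
    have l: "0 < l" "l < 1" using y w by (auto simp: l_def field_simps)
    have "l * y + (1 - l) * w = w - l * (w - y)" by (simp add: algebra_simps)
    also have "\<dots> = x" using y w by (simp add: l_def)
    finally have "u y powr l * u w powr (1 - l) \<le> u x" using lc[OF l, of y w] by simp
    moreover have "0 < u y powr l * u w powr (1 - l)" using y w by simp
    ultimately show ?thesis by linarith
  qed
  have ae: "AE x in lborel. ennreal (u x) = ennreal (u x) * indicator {a<..<b} x"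
    using AE_lborel_singleton[of a] AE_lborel_singleton[of b]
  proof eventually_elim
    case (elim x)
    then show ?case using out[of x] by (cases "x \<in> {a<..<b}") auto
  qed
  show int: "(\<integral>\<^sup>+x. ennreal (u x) \<partial>lborel) = (\<integral>\<^sup>+x. ennreal (u x) * indicator {a<..<b} x \<partial>lborel)"
    by (rule nn_integral_cong_AE[OF ae])
  show "a < b"
  proof (rule ccontr)
    assume "\<not> a < b"
    then show False using int pos by simp
  qed
  have "convex_on {a<..<b} (\<lambda>x. - ln (u x))"
  proof (intro convex_onI)
    fix t x y :: real assume t: "0 < t" "t < 1" and xy: "x \<in> {a<..<b}" "y \<in> {a<..<b}"
    have up: "0 < u x" "0 < u y" using ins xy by auto
    have "u x powr (1 - t) * u y powr t \<le> u ((1 - t) * x + t * y)"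
      using lc[of "1 - t" x y] t by simp
    then have "ln (u x powr (1 - t) * u y powr t) \<le> ln (u ((1 - t) * x + t * y))"
      using up by (intro ln_mono) auto
    then show "- ln (u ((1 - t) *\<^sub>R x + t *\<^sub>R y)) \<le> (1 - t) * - ln (u x) + t * - ln (u y)"
      using up by (simp add: ln_mult)
  qed auto
  then have "continuous_on {a<..<b} (\<lambda>x. - ln (u x))" by (intro convex_on_continuous) auto
  from continuous_on_exp[OF continuous_on_minus[OF this]]
  have "continuous_on {a<..<b} (\<lambda>x. exp (- (- ln (u x))))" .
  then show "continuous_on {a<..<b} u"
    by (rule continuous_on_eq) (use ins in auto)
qed

definition rsec :: "'a::euclidean_space set \<Rightarrow> 'a set \<Rightarrow> 'a \<Rightarrow> real" where
  "rsec I K z = enn2real (sec I (indicator K) z)"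

lemma rsec_nonneg [simp]: "0 \<le> rsec I K z"
  by (simp add: rsec_def)

lemma ennreal_rsec:
  fixes K :: "'a::euclidean_space set"
  assumes "I \<subseteq> Basis" "bounded K" "\<And>b. b \<in> I \<Longrightarrow> z \<bullet> b = 0"
  shows "ennreal (rsec I K z) = sec I (indicator K) z"
proof -
  obtain r where "0 \<le> r" "sec I (indicator K) z \<le> ennreal r"
    using sec_bounded[OF assms(1,2)] assms(3) by metis
  then have "sec I (indicator K) z < \<infinity>" by (metis ennreal_less_top infinity_ennreal_def le_less_trans)
  then show ?thesis unfolding rsec_def by (intro ennreal_enn2real) simp
qed

lemma rsec_logconcave:
  fixes K :: "'a::euclidean_space set"
  assumes I: "I \<subseteq> Basis" and K: "K \<in> sets borel" "bounded K" "convex K"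
    and l: "0 < l" "l < 1" and zw: "\<And>b. b \<in> I \<Longrightarrow> z \<bullet> b = 0" "\<And>b. b \<in> I \<Longrightarrow> w \<bullet> b = 0"
  shows "rsec I K z powr l * rsec I K w powr (1 - l) \<le> rsec I K (l *\<^sub>R z + (1 - l) *\<^sub>R w)"
proof -
  have "ennreal (rsec I K z powr l * rsec I K w powr (1 - l)) \<le> sec I (indicator K) (l *\<^sub>R z + (1 - l) *\<^sub>R w)"
    unfolding rsec_def
  proof (rule sec_prekopa_leindler[OF I K(1) K(1) K(1) K(2) K(2) l])
    fix x y p assume xy: "x \<in> K" "y \<in> K"
      and 1: "\<And>b. b \<in> Basis - I \<Longrightarrow> x \<bullet> b = z \<bullet> b \<and> y \<bullet> b = w \<bullet> b \<and> p \<bullet> b = (l *\<^sub>R z + (1 - l) *\<^sub>R w) \<bullet> b"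
      and 2: "\<And>b. b \<in> I \<Longrightarrow> p \<bullet> b = l * (x \<bullet> b) + (1 - l) * (y \<bullet> b)"
    have "p = l *\<^sub>R x + (1 - l) *\<^sub>R y"
    proof (rule euclidean_eqI)
      fix b :: 'a assume "b \<in> Basis"
      then show "p \<bullet> b = (l *\<^sub>R x + (1 - l) *\<^sub>R y) \<bullet> b"
        using 1[of b] 2[of b] by (cases "b \<in> I") (auto simp: inner_add_left)
    qed
    then show "p \<in> K" using convexD[OF K(3) xy, of l "1 - l"] l by simp
  qed (use zw in \<open>auto simp: inner_add_left\<close>)
  also have "\<dots> = ennreal (rsec I K (l *\<^sub>R z + (1 - l) *\<^sub>R w))"
    using zw by (intro ennreal_rsec[symmetric] I K) (auto simp: inner_add_left)
  finally show ?thesis by simp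
qed

lemma rsec_eq_0_outside:
  fixes K :: "'a::euclidean_space set"
  assumes I: "I \<subseteq> Basis" and R: "\<And>x. x \<in> K \<Longrightarrow> norm x \<le> R" and b: "b \<in> Basis - I" and z: "R < \<bar>z \<bullet> b\<bar>"
  shows "rsec I K z = 0"
proof -
  have "sec I (indicator K) z = sec I (\<lambda>_. 0) z"
  proof (rule sec_cong[OF I])
    fix x :: 'a assume "\<And>b. b \<in> Basis - I \<Longrightarrow> x \<bullet> b = z \<bullet> b"
    then have "R < \<bar>x \<bullet> b\<bar>" using b z by auto
    also have "\<dots> \<le> norm x" using b by (intro Basis_le_norm) auto
    finally show "indicator K x = (0 :: ennreal)" using R[of x] by (auto split: split_indicator)
  qed
  then show ?thesis by (simp add: rsec_def sec_def)
qed

lemma nn_integral_sec1: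
  fixes K :: "'a::euclidean_space set"
  assumes [measurable]: "K \<in> sets borel" "g \<in> borel_measurable borel" and b: "b \<in> Basis"
  shows "(\<integral>\<^sup>+x. g (x \<bullet> b) * indicator K x \<partial>lborel)
     = (\<integral>\<^sup>+s. g s * sec (Basis - {b}) (indicator K) (s *\<^sub>R b) \<partial>lborel)"
proof -
  have "(\<integral>\<^sup>+x. g (x \<bullet> b) * indicator K x \<partial>lborel)
    = (\<integral>\<^sup>+s. sec (Basis - {b}) (\<lambda>x. g (x \<bullet> b) * indicator K x) (s *\<^sub>R b) \<partial>lborel)"
    using b by (intro nn_integral_eq_sec1) measurable
  also have "\<dots> = (\<integral>\<^sup>+s. sec (Basis - {b}) (\<lambda>x. g s * indicator K x) (s *\<^sub>R b) \<partial>lborel)"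
    using b by (intro nn_integral_cong sec_cong) auto
  also have "\<dots> = (\<integral>\<^sup>+s. g s * sec (Basis - {b}) (indicator K) (s *\<^sub>R b) \<partial>lborel)"
    by (intro nn_integral_cong sec_cmult) auto
  finally show ?thesis .
qed

lemma nn_integral_sec2:
  fixes K :: "'a::euclidean_space set" and G :: "real \<Rightarrow> real \<Rightarrow> ennreal"
  assumes [measurable]: "K \<in> sets borel" "case_prod G \<in> borel_measurable borel"
    and b: "b \<in> Basis" "c \<in> Basis" "b \<noteq> c"
  shows "(\<integral>\<^sup>+x. G (x \<bullet> b) (x \<bullet> c) * indicator K x \<partial>lborel)
     = (\<integral>\<^sup>+s. (\<integral>\<^sup>+t. G s t * sec (Basis - {b, c}) (indicator K) (s *\<^sub>R b + t *\<^sub>R c) \<partial>lborel) \<partial>lborel)"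
proof -
  have [measurable]: "(\<lambda>x. G (x \<bullet> b) (x \<bullet> c)) \<in> borel_measurable borel"
  proof -
    have "(\<lambda>x. case_prod G (x \<bullet> b, x \<bullet> c)) \<in> borel_measurable borel" by measurable
    then show ?thesis by simp
  qed
  have "(\<integral>\<^sup>+x. G (x \<bullet> b) (x \<bullet> c) * indicator K x \<partial>lborel)
    = (\<integral>\<^sup>+s. sec (Basis - {b}) (\<lambda>x. G (x \<bullet> b) (x \<bullet> c) * indicator K x) (s *\<^sub>R b) \<partial>lborel)"
    using b by (intro nn_integral_eq_sec1) measurable
  also have "\<dots> = (\<integral>\<^sup>+s. (\<integral>\<^sup>+t. sec (Basis - {b, c}) (\<lambda>x. G (x \<bullet> b) (x \<bullet> c) * indicator K x) (s *\<^sub>R b + t *\<^sub>R c) \<partial>lborel) \<partial>lborel)"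
    using b by (intro nn_integral_cong sec1_eq_sec2) auto
  also have "\<dots> = (\<integral>\<^sup>+s. (\<integral>\<^sup>+t. sec (Basis - {b, c}) (\<lambda>x. G s t * indicator K x) (s *\<^sub>R b + t *\<^sub>R c) \<partial>lborel) \<partial>lborel)"
  proof (intro nn_integral_cong sec_cong)
    fix s t x assume "\<And>d. d \<in> Basis - (Basis - {b, c}) \<Longrightarrow> x \<bullet> d = (s *\<^sub>R b + t *\<^sub>R c) \<bullet> d"
    from this[of b] this[of c] have "x \<bullet> b = s" "x \<bullet> c = t"
      using b by (auto simp: inner_add_left inner_Basis)
    then show "G (x \<bullet> b) (x \<bullet> c) * indicator K x = G s t * indicator K x" by simp
  qed auto
  also have "\<dots> = (\<integral>\<^sup>+s. (\<integral>\<^sup>+t. G s t * sec (Basis - {b, c}) (indicator K) (s *\<^sub>R b + t *\<^sub>R c) \<partial>lborel) \<partial>lborel)"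
    by (intro nn_integral_cong sec_cmult) auto
  finally show ?thesis .
qed

text \<open>For \<open>u\<close>, \<open>v\<close> in the polar of \<open>K\<close> that differ only in direction \<open>b\<close>, and \<open>w\<close> the corresponding point
  of the Steiner symmetral, the point \<open>p\<close> is chosen so that
  \<open>p \<bullet> w = (t (x \<bullet> u) + s (y \<bullet> v)) / (s + t)\<close>; hence \<open>K'\<close> can be the polar of that symmetral.\<close>

definition harmonic_join :: "'a::euclidean_space \<Rightarrow> 'a set \<Rightarrow> 'a set \<Rightarrow> bool" where
  "harmonic_join b K K' \<longleftrightarrow> (\<forall>x\<in>K. \<forall>y\<in>K. \<forall>s t p. x \<bullet> b = s \<and> y \<bullet> b = - t \<and> 0 < s \<and> 0 < t
     \<and> p \<bullet> b = 2 * s * t / (s + t)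
     \<and> (\<forall>d\<in>Basis - {b}. p \<bullet> d = t / (s + t) * (x \<bullet> d) + s / (s + t) * (y \<bullet> d)) \<longrightarrow> p \<in> K')"

text \<open>Prekopa--Leindler with weight \<open>t / (s + t)\<close>: inside the slices points
  combine convexly, while the slices at heights \<open>s\<close> and \<open>- t\<close> are sent to
  the height of their harmonic mean.\<close>

lemma harmonic_join_rsec1:
  fixes K K' :: "'a::euclidean_space set"
  assumes K: "K \<in> sets borel" "bounded K" and K': "K' \<in> sets borel" "bounded K'"
    and j: "harmonic_join b K K'" and b: "b \<in> Basis" and st: "0 < s" "0 < t"
  shows "rsec (Basis - {b}) K (s *\<^sub>R b) powr (t / (s + t)) * rsec (Basis - {b}) K ((- t) *\<^sub>R b) powr (s / (s + t))
    \<le> rsec (Basis - {b}) K' ((2 * s * t / (s + t)) *\<^sub>R b)"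
proof -
  let ?I = "Basis - {b}"
  have l: "0 < t / (s + t)" "t / (s + t) < 1" "1 - t / (s + t) = s / (s + t)"
    using st by (auto simp: field_simps)
  have "ennreal (rsec ?I K (s *\<^sub>R b) powr (t / (s + t)) * rsec ?I K ((- t) *\<^sub>R b) powr (1 - t / (s + t)))
     \<le> sec ?I (indicator K') ((2 * s * t / (s + t)) *\<^sub>R b)"
    unfolding rsec_def
  proof (rule sec_prekopa_leindler[OF _ K(1) K(1) K'(1) K(2) K(2) l(1,2)])
    fix x y p assume xy: "x \<in> K" "y \<in> K"
      and 1: "\<And>d. d \<in> Basis - ?I \<Longrightarrow> x \<bullet> d = (s *\<^sub>R b) \<bullet> d \<and> y \<bullet> d = ((- t) *\<^sub>R b) \<bullet> d
          \<and> p \<bullet> d = ((2 * s * t / (s + t)) *\<^sub>R b) \<bullet> d"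
      and 2: "\<And>d. d \<in> ?I \<Longrightarrow> p \<bullet> d = t / (s + t) * (x \<bullet> d) + (1 - t / (s + t)) * (y \<bullet> d)"
    have "x \<bullet> b = s \<and> y \<bullet> b = - t \<and> p \<bullet> b = 2 * s * t / (s + t)"
      using 1[of b] b by (auto simp: inner_Basis)
    with j xy 2 st show "p \<in> K'" unfolding harmonic_join_def l(3) by blast
  qed (use b in \<open>auto simp: inner_not_same_Basis\<close>)
  also have "\<dots> = ennreal (rsec ?I K' ((2 * s * t / (s + t)) *\<^sub>R b))"
    using b by (intro ennreal_rsec[symmetric] K') (auto simp: inner_not_same_Basis)
  finally show ?thesis unfolding l(3) by simp
qed

lemma harmonic_join_rsec2:
  fixes K K' :: "'a::euclidean_space set"
  assumes K: "K \<in> sets borel" "bounded K" and K': "K' \<in> sets borel" "bounded K'"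
    and j: "harmonic_join b K K'" and b: "b \<in> Basis" "c \<in> Basis" "b \<noteq> c" and st: "0 < s" "0 < t"
  shows "rsec (Basis - {b, c}) K (s *\<^sub>R b + x *\<^sub>R c) powr (t / (s + t))
       * rsec (Basis - {b, c}) K ((- t) *\<^sub>R b + y *\<^sub>R c) powr (s / (s + t))
    \<le> rsec (Basis - {b, c}) K' ((2 * s * t / (s + t)) *\<^sub>R b + (t / (s + t) * x + s / (s + t) * y) *\<^sub>R c)"
proof -
  let ?I = "Basis - {b, c}"
  let ?z = "(2 * s * t / (s + t)) *\<^sub>R b + (t / (s + t) * x + s / (s + t) * y) *\<^sub>R c"
  have l: "0 < t / (s + t)" "t / (s + t) < 1" "1 - t / (s + t) = s / (s + t)"
    using st by (auto simp: field_simps)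
  have bc: "b \<bullet> b = 1" "c \<bullet> c = 1" "b \<bullet> c = 0" "c \<bullet> b = 0" using b by (auto simp: inner_Basis)
  have "ennreal (rsec ?I K (s *\<^sub>R b + x *\<^sub>R c) powr (t / (s + t))
       * rsec ?I K ((- t) *\<^sub>R b + y *\<^sub>R c) powr (1 - t / (s + t))) \<le> sec ?I (indicator K') ?z"
    unfolding rsec_def
  proof (rule sec_prekopa_leindler[OF _ K(1) K(1) K'(1) K(2) K(2) l(1,2)])
    fix x' y' p assume xy: "x' \<in> K" "y' \<in> K"
      and 1: "\<And>d. d \<in> Basis - ?I \<Longrightarrow> x' \<bullet> d = (s *\<^sub>R b + x *\<^sub>R c) \<bullet> d \<and> y' \<bullet> d = ((- t) *\<^sub>R b + y *\<^sub>R c) \<bullet> d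
          \<and> p \<bullet> d = ?z \<bullet> d"
      and 2: "\<And>d. d \<in> ?I \<Longrightarrow> p \<bullet> d = t / (s + t) * (x' \<bullet> d) + (1 - t / (s + t)) * (y' \<bullet> d)"
    have b1: "x' \<bullet> b = s \<and> y' \<bullet> b = - t \<and> p \<bullet> b = 2 * s * t / (s + t)"
      using 1[of b] b bc by (auto simp: inner_add_left inner_diff_left)
    have c1: "p \<bullet> c = t / (s + t) * (x' \<bullet> c) + s / (s + t) * (y' \<bullet> c)"
      using 1[of c] b bc by (auto simp: inner_add_left inner_diff_left)
    have "p \<bullet> d = t / (s + t) * (x' \<bullet> d) + s / (s + t) * (y' \<bullet> d)" if "d \<in> Basis - {b}" for d
      using 2[of d] c1 that unfolding l(3) by (cases "d = c") auto
    with j xy b1 st show "p \<in> K'" unfolding harmonic_join_def by blast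
  qed (use b in \<open>auto simp: inner_not_same_Basis inner_add_left inner_diff_left\<close>)
  also have "\<dots> = ennreal (rsec ?I K' ?z)"
    using b by (intro ennreal_rsec[symmetric] K') (auto simp: inner_not_same_Basis inner_add_left inner_diff_left)
  finally show ?thesis unfolding l(3) by simp
qed

section \<open>Rigidity of slices when the harmonic join does not gain volume\<close>

lemma rsec1_support:
  fixes K :: "'a::euclidean_space set"
  assumes K: "K \<in> sets borel" "bounded K" "convex K" and b: "b \<in> Basis" and V: "emeasure lborel K \<noteq> 0"
    and u_def: "\<And>s. u s = rsec (Basis - {b}) K (s *\<^sub>R b)"
  obtains \<alpha> \<beta> where "\<alpha> < \<beta>" "\<And>x. \<alpha> < x \<Longrightarrow> x < \<beta> \<Longrightarrow> 0 < u x" "\<And>x. x < \<alpha> \<or> \<beta> < x \<Longrightarrow> u x = 0"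
    "continuous_on {\<alpha><..<\<beta>} u"
    "u \<in> borel_measurable borel"
    "\<And>g. g \<in> borel_measurable borel \<Longrightarrow> (\<integral>\<^sup>+x. g (x \<bullet> b) * indicator K x \<partial>lborel) = (\<integral>\<^sup>+s. g s * ennreal (u s) \<partial>lborel)"
proof -
  obtain R where R: "\<And>x. x \<in> K \<Longrightarrow> norm x \<le> R" using K(2) bounded_iff by metis
  have eu: "ennreal (u s) = sec (Basis - {b}) (indicator K) (s *\<^sub>R b)" for s
    unfolding u_def using b K by (intro ennreal_rsec) (auto simp: inner_not_same_Basis)
  have int: "(\<integral>\<^sup>+x. g (x \<bullet> b) * indicator K x \<partial>lborel) = (\<integral>\<^sup>+s. g s * ennreal (u s) \<partial>lborel)"
    if "g \<in> borel_measurable borel" for g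
    unfolding eu using that K(1) b by (intro nn_integral_sec1)
  have meas: "u \<in> borel_measurable borel"
  proof -
    have [measurable]: "sec (Basis - {b}) (indicator K) \<in> borel_measurable borel" using K by measurable
    have "(\<lambda>s. rsec (Basis - {b}) K (s *\<^sub>R b)) \<in> borel_measurable borel" unfolding rsec_def by measurable
    then show ?thesis by (simp add: u_def[abs_def])
  qed
  have pos: "(\<integral>\<^sup>+x. ennreal (u x) \<partial>lborel) \<noteq> 0"
    using int[of "\<lambda>_. 1"] V K by simp
  have lc: "u x powr l * u y powr (1 - l) \<le> u (l * x + (1 - l) * y)" if "0 < l" "l < 1" for l x y
  proof -
    have "l *\<^sub>R (x *\<^sub>R b) + (1 - l) *\<^sub>R (y *\<^sub>R b) = (l * x + (1 - l) * y) *\<^sub>R b"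
      by (simp add: scaleR_add_left)
    moreover have "rsec (Basis - {b}) K (x *\<^sub>R b) powr l * rsec (Basis - {b}) K (y *\<^sub>R b) powr (1 - l)
      \<le> rsec (Basis - {b}) K (l *\<^sub>R (x *\<^sub>R b) + (1 - l) *\<^sub>R (y *\<^sub>R b))"
      using b by (intro rsec_logconcave K that) (auto simp: inner_not_same_Basis)
    ultimately show ?thesis by (simp only: u_def)
  qed
  have out: "u x = 0" if "R < \<bar>x\<bar>" for x
    unfolding u_def using b that by (intro rsec_eq_0_outside[OF _ R]) auto
  note S = logconcave_support[of u R, OF _ lc out pos]
  show ?thesis
    by (rule that[OF S(1-4) meas int]) (auto simp: u_def)
qed

text \<open>This is the equality case of the harmonic mean inequality, with the slice volumes of the
  two halves of \<open>K\<close> as \<open>f\<close> and \<open>g\<close> and those of the upper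
  half of \<open>K'\<close> as \<open>h\<close>. It makes the slice volumes of \<open>K\<close>
  even. At \<open>s = t\<close> the harmonic mean is \<open>s\<close>, so the slices of
  \<open>K'\<close> are at least as large as those of \<open>K\<close>, and the bound on the
  half-volume then makes them equal.\<close>

lemma sections_eq_of_harmonic_join:
  fixes K K' :: "'a::euclidean_space set"
  assumes K: "K \<in> sets borel" "bounded K" "convex K" and K': "K' \<in> sets borel" "bounded K'" "convex K'"
    and j: "harmonic_join b K K'" and b: "b \<in> Basis"
    and V: "emeasure lborel (K \<inter> {x. 0 < x \<bullet> b}) = ennreal V" "emeasure lborel (K \<inter> {x. x \<bullet> b < 0}) = ennreal V" "0 < V"
    and V': "emeasure lborel (K' \<inter> {x. 0 < x \<bullet> b}) \<le> ennreal V"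
  obtains a where "0 < a"
    "\<And>s. 0 < s \<Longrightarrow> s < a \<Longrightarrow> rsec (Basis - {b}) K ((-s) *\<^sub>R b) = rsec (Basis - {b}) K (s *\<^sub>R b)"
    "\<And>s. 0 < s \<Longrightarrow> s < a \<Longrightarrow> rsec (Basis - {b}) K' (s *\<^sub>R b) = rsec (Basis - {b}) K (s *\<^sub>R b)"
    "\<And>s. \<bar>s\<bar> < a \<Longrightarrow> 0 < rsec (Basis - {b}) K (s *\<^sub>R b)"
    "\<And>s. a < \<bar>s\<bar> \<Longrightarrow> rsec (Basis - {b}) K (s *\<^sub>R b) = 0"
proof -
  define u where "u s = rsec (Basis - {b}) K (s *\<^sub>R b)" for s
  define u' where "u' s = rsec (Basis - {b}) K' (s *\<^sub>R b)" for s
  have "emeasure lborel (K \<inter> {x. 0 < x \<bullet> b}) \<noteq> 0" using V by auto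
  moreover have "emeasure lborel (K \<inter> {x. 0 < x \<bullet> b}) \<le> emeasure lborel K" using K by (intro emeasure_mono) auto
  ultimately have V0: "emeasure lborel K \<noteq> 0" by auto
  obtain \<alpha> \<beta> where u: "\<alpha> < \<beta>" "\<And>x. \<alpha> < x \<Longrightarrow> x < \<beta> \<Longrightarrow> 0 < u x" "\<And>x. x < \<alpha> \<or> \<beta> < x \<Longrightarrow> u x = 0"
    "continuous_on {\<alpha><..<\<beta>} u" and um[measurable]: "u \<in> borel_measurable borel" and
    ui: "\<And>g. g \<in> borel_measurable borel \<Longrightarrow> (\<integral>\<^sup>+x. g (x \<bullet> b) * indicator K x \<partial>lborel) = (\<integral>\<^sup>+s. g s * ennreal (u s) \<partial>lborel)"
    by (rule rsec1_support[OF K b V0 u_def]) (rule that; assumption)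
  have half: "emeasure lborel (X \<inter> {x. 0 < x \<bullet> b}) = (\<integral>\<^sup>+x. indicator {0<..} (x \<bullet> b) * indicator X x \<partial>lborel)"
    "emeasure lborel (X \<inter> {x. x \<bullet> b < 0}) = (\<integral>\<^sup>+x. indicator {..<0} (x \<bullet> b) * indicator X x \<partial>lborel)"
    if [measurable]: "X \<in> sets borel" for X
  proof -
    have "emeasure lborel (X \<inter> {x. 0 < x \<bullet> b}) = (\<integral>\<^sup>+x. indicator (X \<inter> {x. 0 < x \<bullet> b}) x \<partial>lborel)"
      by (intro nn_integral_indicator[symmetric]) measurable
    also have "\<dots> = (\<integral>\<^sup>+x. indicator {0<..} (x \<bullet> b) * indicator X x \<partial>lborel)"
      by (intro nn_integral_cong) (auto simp: indicator_def)
    finally show "emeasure lborel (X \<inter> {x. 0 < x \<bullet> b}) = (\<integral>\<^sup>+x. indicator {0<..} (x \<bullet> b) * indicator X x \<partial>lborel)" .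
    have "emeasure lborel (X \<inter> {x. x \<bullet> b < 0}) = (\<integral>\<^sup>+x. indicator (X \<inter> {x. x \<bullet> b < 0}) x \<partial>lborel)"
      by (intro nn_integral_indicator[symmetric]) measurable
    also have "\<dots> = (\<integral>\<^sup>+x. indicator {..<0} (x \<bullet> b) * indicator X x \<partial>lborel)"
      by (intro nn_integral_cong) (auto simp: indicator_def)
    finally show "emeasure lborel (X \<inter> {x. x \<bullet> b < 0}) = (\<integral>\<^sup>+x. indicator {..<0} (x \<bullet> b) * indicator X x \<partial>lborel)" .
  qed
  have Vp: "(\<integral>\<^sup>+s. indicator {0<..} s * ennreal (u s) \<partial>lborel) = ennreal V"
    using half(1)[OF K(1)] ui[of "indicator {0<..}"] V(1) by simp
  have Vn: "(\<integral>\<^sup>+s. indicator {..<0} s * ennreal (u s) \<partial>lborel) = ennreal V"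
    using half(2)[OF K(1)] ui[of "indicator {..<0}"] V(2) by simp
  have b0: "0 < \<beta>"
  proof (rule ccontr)
    assume "\<not> 0 < \<beta>"
    then have z: "(\<lambda>s. indicator {0<..} s * ennreal (u s)) = (\<lambda>_. 0)"
      by (intro ext) (use u(3) in \<open>auto split: split_indicator\<close>)
    show False using Vp V(3) unfolding z by simp
  qed
  have a0: "\<alpha> < 0"
  proof (rule ccontr)
    assume "\<not> \<alpha> < 0"
    then have z: "(\<lambda>s. indicator {..<0} s * ennreal (u s)) = (\<lambda>_. 0)"
      by (intro ext) (use u(3) in \<open>auto split: split_indicator\<close>)
    show False using Vn V(3) unfolding z by simp
  qed
  have Vf: "(\<integral>\<^sup>+x. ennreal (u x) * indicator {0<..<\<beta>} x \<partial>lborel) = ennreal V"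
    unfolding Vp[symmetric]
  proof (rule nn_integral_cong_AE)
    show "AE x in lborel. ennreal (u x) * indicator {0<..<\<beta>} x = indicator {0<..} x * ennreal (u x)"
      using AE_lborel_singleton[of \<beta>]
    proof eventually_elim
      case (elim x)
      then show ?case using u(3)[of x] by (auto split: split_indicator)
    qed
  qed
  have Vg: "(\<integral>\<^sup>+x. ennreal (u (- x)) * indicator {0<..<-\<alpha>} x \<partial>lborel) = ennreal V"
  proof -
    have "(\<integral>\<^sup>+x. ennreal (u (- x)) * indicator {0<..<-\<alpha>} x \<partial>lborel) = (\<integral>\<^sup>+s. indicator {..<0} (-s) * ennreal (u (-s)) \<partial>lborel)"
    proof (rule nn_integral_cong_AE)
      show "AE x in lborel. ennreal (u (- x)) * indicator {0<..<-\<alpha>} x = indicator {..<0} (-x) * ennreal (u (-x))"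
        using AE_lborel_singleton[of "-\<alpha>"]
      proof eventually_elim
        case (elim x)
        then show ?case using u(3)[of "-x"] by (auto split: split_indicator)
      qed
    qed
    also have "\<dots> = (\<integral>\<^sup>+s. indicator {..<0} s * ennreal (u s) \<partial>lborel)"
      using nn_integral_real_affine[of "\<lambda>s. indicator {..<0} s * ennreal (u s)" "-1" 0] by simp
    finally show ?thesis using Vn by simp
  qed
  define h where "h s = indicator {0<..} s * ennreal (u' s)" for s
  have eu': "ennreal (u' s) = sec (Basis - {b}) (indicator K') (s *\<^sub>R b)" for s
    unfolding u'_def using b K' by (intro ennreal_rsec) (auto simp: inner_not_same_Basis)
  have [measurable]: "u' \<in> borel_measurable borel"
  proof -
    have [measurable]: "sec (Basis - {b}) (indicator K') \<in> borel_measurable borel" using K' by measurable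
    show ?thesis unfolding u'_def rsec_def by measurable
  qed
  have hm[measurable]: "h \<in> borel_measurable borel" unfolding h_def by measurable
  have hV: "(\<integral>\<^sup>+x. h x \<partial>lborel) \<le> ennreal V"
    unfolding h_def eu' using nn_integral_sec1[OF K'(1) _ b, of "indicator {0<..}"] half(1)[OF K'(1)] V' by simp
  have hle: "ennreal (u s powr (t / (s + t)) * u (- t) powr (s / (s + t))) \<le> h (2 * s * t / (s + t))"
    if "s \<in> {0<..<\<beta>}" "t \<in> {0<..<-\<alpha>}" for s t
  proof -
    have "u s powr (t / (s + t)) * u (- t) powr (s / (s + t)) \<le> u' (2 * s * t / (s + t))"
      unfolding u_def u'_def using that by (intro harmonic_join_rsec1 K K' j b) auto
    then show ?thesis using that by (simp add: h_def ennreal_leI)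
  qed
  have fc: "continuous_on {0<..<\<beta>} u" using u(4) by (rule continuous_on_subset) (use a0 in auto)
  have gc: "continuous_on {0<..<-\<alpha>} (\<lambda>x. u (- x))"
    by (rule continuous_on_compose2[OF u(4)]) (use b0 in \<open>auto intro: continuous_intros\<close>)
  have E: "\<beta> = - \<alpha>" "\<And>x. x \<in> {0<..<\<beta>} \<Longrightarrow> u x = u (- x)"
    using harmonic_mean_equality[OF hm b0 fc _ _ gc _ Vf Vg _ hle hV] u(2) a0 b0 V(3)
    by (auto simp: less_imp_le)
  have ge: "u s \<le> u' s" if s: "0 < s" "s < \<beta>" for s
  proof -
    have "ennreal (u s powr (s / (s + s)) * u (- s) powr (s / (s + s))) \<le> h (2 * s * s / (s + s))"
      using s E(1) by (intro hle) auto
    moreover have "s / (s + s) = 1/2" "2 * s * s / (s + s) = s" using s by auto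
    moreover have "u (- s) = u s" using E(2)[of s] s by simp
    moreover have "0 \<le> u' s" by (simp add: u'_def)
    ultimately show ?thesis using s u(2)[of s] a0 by (simp add: h_def flip: powr_add)
  qed
  have eq: "u' s = u s" if s: "0 < s" "s < \<beta>" for s
  proof -
    have "emeasure lborel K' \<noteq> 0"
    proof
      assume "emeasure lborel K' = 0"
      then have "(\<integral>\<^sup>+s. ennreal (u' s) \<partial>lborel) = 0"
        unfolding eu' using nn_integral_sec1[OF K'(1) _ b, of "\<lambda>_. 1"] K' by simp
      moreover have "ennreal V \<le> (\<integral>\<^sup>+s. ennreal (u' s) \<partial>lborel)"
        unfolding Vf[symmetric] using ge by (intro nn_integral_mono) (auto split: split_indicator intro: ennreal_leI)
      ultimately show False using V(3) by simp
    qed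
    then obtain \<alpha>' \<beta>' where u': "\<And>x. x < \<alpha>' \<or> \<beta>' < x \<Longrightarrow> u' x = 0" "continuous_on {\<alpha>'<..<\<beta>'} u'"
      by (rule rsec1_support[OF K' b _ u'_def]) (rule that; assumption)
    have pos': "0 < u' s" if "s \<in> {0<..<\<beta>}" for s using ge[of s] u(2)[of s] a0 that by fastforce
    \<comment> \<open>Positivity of \<open>u'\<close> places the interval only in the closed
      support; taking interiors gives the open one, where \<open>u'\<close> is continuous.\<close>
    have "{0<..<\<beta>} \<subseteq> {\<alpha>'..\<beta>'}"
      using pos' u'(1) by (metis atLeastAtMost_iff less_irrefl not_less subsetI)
    then have "interior {0<..<\<beta>} \<subseteq> interior {\<alpha>'..\<beta>'}" by (rule interior_mono)
    then have "{0<..<\<beta>} \<subseteq> {\<alpha>'<..<\<beta>'}" by simp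
    with u'(2) have c': "continuous_on {0<..<\<beta>} u'" by (rule continuous_on_subset)
    have upos: "0 < u x" if "x \<in> {0<..<\<beta>}" for x using u(2)[of x] a0 that by auto
    have "u' s / u s = 1"
    proof (rule nn_integral_weight_eq_1[where w = "\<lambda>s. u' s / u s" and x = s, OF fc upos])
      show "continuous_on {0<..<\<beta>} (\<lambda>s. u' s / u s)"
        using c' fc upos by (intro continuous_intros) (auto simp: less_imp_neq[symmetric])
      show "1 \<le> u' x / u x" if "x \<in> {0<..<\<beta>}" for x
        using ge[of x] upos[OF that] that by auto
      have "(\<integral>\<^sup>+x. ennreal (u x * (u' x / u x)) * indicator {0<..<\<beta>} x \<partial>lborel) \<le> (\<integral>\<^sup>+x. h x \<partial>lborel)"
        using upos by (intro nn_integral_mono) (auto simp: h_def split: split_indicator)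
      then show "(\<integral>\<^sup>+x. ennreal (u x * (u' x / u x)) * indicator {0<..<\<beta>} x \<partial>lborel)
         \<le> (\<integral>\<^sup>+x. ennreal (u x) * indicator {0<..<\<beta>} x \<partial>lborel)"
        using hV Vf by simp
    qed (use Vf s in auto)
    then show ?thesis using upos[of s] s by simp
  qed
  show ?thesis
  proof (rule that[OF b0])
    fix s :: real
    show "rsec (Basis - {b}) K ((-s) *\<^sub>R b) = rsec (Basis - {b}) K (s *\<^sub>R b)" if "0 < s" "s < \<beta>"
      using E(2)[of s] that by (simp add: u_def)
    show "rsec (Basis - {b}) K' (s *\<^sub>R b) = rsec (Basis - {b}) K (s *\<^sub>R b)" if "0 < s" "s < \<beta>"
      using eq[OF that] by (simp add: u_def u'_def)
    show "0 < rsec (Basis - {b}) K (s *\<^sub>R b)" if "\<bar>s\<bar> < \<beta>"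
      using u(2)[of s] that E(1) by (simp add: u_def abs_less_iff)
    show "rsec (Basis - {b}) K (s *\<^sub>R b) = 0" if "\<beta> < \<bar>s\<bar>"
      using u(3)[of s] that E(1) by (fastforce simp: u_def abs_if split: if_splits)
  qed
qed

text \<open>Let \<open>p s\<close> be the density in direction \<open>c\<close> of the slice of
  \<open>K\<close> at height \<open>s\<close>, supported between \<open>\<alpha> s\<close> and
  \<open>\<beta> s\<close>. Joining the slices at \<open>s\<close> and \<open>- s\<close> is an
  arithmetic mean without gain of mass, so the second slice is a translate of the first by some
  \<open>e s\<close>. Joining slices at different heights constrains the endpoints of the supports,
  and this forces \<open>e s = D * s\<close>; then the marginal is invariant under the skew
  reflection with skewness \<open>D\<close>.\<close>

lemma axis_reflection:
  fixes K K' :: "'a::euclidean_space set"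
  assumes K: "K \<in> sets borel" "bounded K" "convex K" and K': "K' \<in> sets borel" "bounded K'" "convex K'"
    and j: "harmonic_join b K K'" and b: "b \<in> Basis" "c \<in> Basis" "b \<noteq> c"
    and V: "emeasure lborel (K \<inter> {x. 0 < x \<bullet> b}) = ennreal V" "emeasure lborel (K \<inter> {x. x \<bullet> b < 0}) = ennreal V" "0 < V"
    and V': "emeasure lborel (K' \<inter> {x. 0 < x \<bullet> b}) \<le> ennreal V"
  obtains D where "\<And>G :: real \<Rightarrow> real \<Rightarrow> ennreal. case_prod G \<in> borel_measurable borel \<Longrightarrow>
    (\<integral>\<^sup>+x. G (x \<bullet> b) (x \<bullet> c) * indicator K x \<partial>lborel)
    = (\<integral>\<^sup>+x. G (- (x \<bullet> b)) (x \<bullet> c + D * (x \<bullet> b)) * indicator K x \<partial>lborel)"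
proof -
  define u where "u s = rsec (Basis - {b}) K (s *\<^sub>R b)" for s
  define u' where "u' s = rsec (Basis - {b}) K' (s *\<^sub>R b)" for s
  define p where "p s t = rsec (Basis - {b, c}) K (s *\<^sub>R b + t *\<^sub>R c)" for s t
  define p' where "p' s t = rsec (Basis - {b, c}) K' (s *\<^sub>R b + t *\<^sub>R c)" for s t
  obtain a where a: "0 < a"
    and us: "\<And>s. 0 < s \<Longrightarrow> s < a \<Longrightarrow> u (-s) = u s" "\<And>s. 0 < s \<Longrightarrow> s < a \<Longrightarrow> u' s = u s"
    and up: "\<And>s. \<bar>s\<bar> < a \<Longrightarrow> 0 < u s" and uo: "\<And>s. a < \<bar>s\<bar> \<Longrightarrow> u s = 0"
    by (rule sections_eq_of_harmonic_join[OF K K' j b(1) V V']) (rule that; simp add: u_def u'_def)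
  have dirs: "(s *\<^sub>R b) \<bullet> d = 0" if "d \<in> Basis - {b}" for s d
    using that b by (auto simp: inner_not_same_Basis)
  have dirs2: "(s *\<^sub>R b + t *\<^sub>R c) \<bullet> d = 0" if "d \<in> Basis - {b, c}" for s t d
    using that b by (auto simp: inner_not_same_Basis inner_add_left)
  have ep: "ennreal (p s t) = sec (Basis - {b, c}) (indicator K) (s *\<^sub>R b + t *\<^sub>R c)" for s t
    unfolding p_def by (intro ennreal_rsec K dirs2) auto
  have ep': "ennreal (p' s t) = sec (Basis - {b, c}) (indicator K') (s *\<^sub>R b + t *\<^sub>R c)" for s t
    unfolding p'_def by (intro ennreal_rsec K' dirs2) auto
  have pu: "(\<integral>\<^sup>+t. ennreal (p s t) \<partial>lborel) = ennreal (u s)" for s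
  proof -
    have "ennreal (u s) = sec (Basis - {b}) (indicator K) (s *\<^sub>R b)"
      unfolding u_def by (intro ennreal_rsec K dirs) auto
    then show ?thesis unfolding ep using sec1_eq_sec2[OF _ b(2,3), of "indicator K"] K by simp
  qed
  have pu': "(\<integral>\<^sup>+t. ennreal (p' s t) \<partial>lborel) = ennreal (u' s)" for s
  proof -
    have "ennreal (u' s) = sec (Basis - {b}) (indicator K') (s *\<^sub>R b)"
      unfolding u'_def by (intro ennreal_rsec K' dirs) auto
    then show ?thesis unfolding ep' using sec1_eq_sec2[OF _ b(2,3), of "indicator K'"] K' by simp
  qed
  have pnn: "0 \<le> p s t" "0 \<le> p' s t" for s t by (auto simp: p_def p'_def)
  have comb: "l *\<^sub>R (s *\<^sub>R b + t *\<^sub>R c) + (1 - l) *\<^sub>R (s' *\<^sub>R b + t' *\<^sub>R c)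
     = (l * s + (1 - l) * s') *\<^sub>R b + (l * t + (1 - l) * t') *\<^sub>R c" for l s t s' t'
    by (simp add: scaleR_add_left scaleR_add_right)
  have plc: "p s t powr l * p s' t' powr (1 - l) \<le> p (l * s + (1 - l) * s') (l * t + (1 - l) * t')"
    if "0 < l" "l < 1" for l s t s' t'
    unfolding p_def comb[symmetric] by (intro rsec_logconcave K that dirs2) auto
  have plc': "p' s t powr l * p' s t' powr (1 - l) \<le> p' s (l * t + (1 - l) * t')"
    if l: "0 < l" "l < 1" for l s t t'
  proof -
    have "p' s t powr l * p' s t' powr (1 - l) \<le> p' (l * s + (1 - l) * s) (l * t + (1 - l) * t')"
      unfolding p'_def comb[symmetric] by (intro rsec_logconcave K' l dirs2) auto
    moreover have "l * s + (1 - l) * s = s" by (simp add: algebra_simps)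
    ultimately show ?thesis by simp
  qed
  obtain R1 where R1: "\<And>x. x \<in> K \<Longrightarrow> norm x \<le> R1" using K(2) bounded_iff by metis
  obtain R2 where R2: "\<And>x. x \<in> K' \<Longrightarrow> norm x \<le> R2" using K'(2) bounded_iff by metis
  have c_in: "c \<in> Basis - (Basis - {b, c})" using b by auto
  have zc: "(s *\<^sub>R b + t *\<^sub>R c) \<bullet> c = t" for s t using b by (simp add: inner_add_left inner_not_same_Basis)
  have pout: "p s t = 0" if "R1 < \<bar>t\<bar>" for s t
    unfolding p_def by (rule rsec_eq_0_outside[OF _ R1 c_in]) (auto simp: zc that)
  have pout': "p' s t = 0" if "R2 < \<bar>t\<bar>" for s t
    unfolding p'_def by (rule rsec_eq_0_outside[OF _ R2 c_in]) (auto simp: zc that)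
  define \<alpha> where "\<alpha> s = Inf {t. 0 < p s t}" for s
  define \<beta> where "\<beta> s = Sup {t. 0 < p s t}" for s
  define \<alpha>' where "\<alpha>' s = Inf {t. 0 < p' s t}" for s
  define \<beta>' where "\<beta>' s = Sup {t. 0 < p' s t}" for s
  have S: "\<alpha> s < \<beta> s" "\<And>t. \<alpha> s < t \<Longrightarrow> t < \<beta> s \<Longrightarrow> 0 < p s t" "\<And>t. t < \<alpha> s \<or> \<beta> s < t \<Longrightarrow> p s t = 0"
    "continuous_on {\<alpha> s<..<\<beta> s} (p s)"
    "(\<integral>\<^sup>+t. ennreal (p s t) * indicator {\<alpha> s<..<\<beta> s} t \<partial>lborel) = ennreal (u s)"
    if s: "\<bar>s\<bar> < a" for s
  proof -
    have "(\<integral>\<^sup>+t. ennreal (p s t) \<partial>lborel) \<noteq> 0" unfolding pu using up[OF s] by simp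
    moreover have "p s x powr l * p s y powr (1 - l) \<le> p s (l * x + (1 - l) * y)" if "0 < l" "l < 1" for x y l
      using plc[OF that, of s x s y] by (simp add: algebra_simps)
    ultimately have L: "\<And>P. ((\<And>x. 0 \<le> p s x) \<Longrightarrow> (\<And>x y l. 0 < l \<Longrightarrow> l < 1 \<Longrightarrow> p s x powr l * p s y powr (1 - l) \<le> p s (l * x + (1 - l) * y))
       \<Longrightarrow> (\<And>x. R1 < \<bar>x\<bar> \<Longrightarrow> p s x = 0) \<Longrightarrow> (\<integral>\<^sup>+t. ennreal (p s t) \<partial>lborel) \<noteq> 0 \<Longrightarrow> P) \<Longrightarrow> P"
      using pnn pout by blast
    show "\<alpha> s < \<beta> s" unfolding \<alpha>_def \<beta>_def by (rule L) (rule logconcave_support(1); assumption)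
    show "0 < p s t" if "\<alpha> s < t" "t < \<beta> s" for t
      by (rule L, rule logconcave_support(2)[of "p s" R1]) (use that in \<open>auto simp: \<alpha>_def \<beta>_def\<close>)
    show "p s t = 0" if "t < \<alpha> s \<or> \<beta> s < t" for t
      by (rule L, rule logconcave_support(3)[of "p s" R1]) (use that in \<open>auto simp: \<alpha>_def \<beta>_def\<close>)
    show "continuous_on {\<alpha> s<..<\<beta> s} (p s)" unfolding \<alpha>_def \<beta>_def by (rule L) (rule logconcave_support(4); assumption)
    show "(\<integral>\<^sup>+t. ennreal (p s t) * indicator {\<alpha> s<..<\<beta> s} t \<partial>lborel) = ennreal (u s)"
      unfolding pu[symmetric] \<alpha>_def \<beta>_def by (rule L) (rule logconcave_support(5)[symmetric]; assumption)
  qed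
  have S': "\<alpha>' s < \<beta>' s" "\<And>t. \<alpha>' s < t \<Longrightarrow> t < \<beta>' s \<Longrightarrow> 0 < p' s t" "\<And>t. t < \<alpha>' s \<or> \<beta>' s < t \<Longrightarrow> p' s t = 0"
    "continuous_on {\<alpha>' s<..<\<beta>' s} (p' s)"
    "(\<integral>\<^sup>+t. ennreal (p' s t) * indicator {\<alpha>' s<..<\<beta>' s} t \<partial>lborel) = ennreal (u s)"
    if s: "0 < s" "s < a" for s
  proof -
    have "(\<integral>\<^sup>+t. ennreal (p' s t) \<partial>lborel) \<noteq> 0" unfolding pu' using up[of s] us(2)[OF s] s by simp
    then have L: "\<And>P. ((\<And>x. 0 \<le> p' s x) \<Longrightarrow> (\<And>x y l. 0 < l \<Longrightarrow> l < 1 \<Longrightarrow> p' s x powr l * p' s y powr (1 - l) \<le> p' s (l * x + (1 - l) * y))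
       \<Longrightarrow> (\<And>x. R2 < \<bar>x\<bar> \<Longrightarrow> p' s x = 0) \<Longrightarrow> (\<integral>\<^sup>+t. ennreal (p' s t) \<partial>lborel) \<noteq> 0 \<Longrightarrow> P) \<Longrightarrow> P"
      using pnn pout' plc' by blast
    show "\<alpha>' s < \<beta>' s" unfolding \<alpha>'_def \<beta>'_def by (rule L) (rule logconcave_support(1); assumption)
    show "0 < p' s t" if "\<alpha>' s < t" "t < \<beta>' s" for t
      by (rule L, rule logconcave_support(2)[of "p' s" R2]) (use that in \<open>auto simp: \<alpha>'_def \<beta>'_def\<close>)
    show "p' s t = 0" if "t < \<alpha>' s \<or> \<beta>' s < t" for t
      by (rule L, rule logconcave_support(3)[of "p' s" R2]) (use that in \<open>auto simp: \<alpha>'_def \<beta>'_def\<close>)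
    show "continuous_on {\<alpha>' s<..<\<beta>' s} (p' s)" unfolding \<alpha>'_def \<beta>'_def by (rule L) (rule logconcave_support(4); assumption)
    show "(\<integral>\<^sup>+t. ennreal (p' s t) * indicator {\<alpha>' s<..<\<beta>' s} t \<partial>lborel) = ennreal (u s)"
      unfolding us(2)[OF s, symmetric] pu'[symmetric] \<alpha>'_def \<beta>'_def by (rule L) (rule logconcave_support(5)[symmetric]; assumption)
  qed
  have join: "p s x powr (t / (s + t)) * p (- t) y powr (s / (s + t))
     \<le> p' (2 * s * t / (s + t)) (t / (s + t) * x + s / (s + t) * y)" if "0 < s" "0 < t" for s t x y
    unfolding p_def p'_def by (rule harmonic_join_rsec2[OF K(1,2) K'(1,2) j b that])
  have join1: "sqrt (p s x * p (- s) y) \<le> p' s ((x + y) / 2)" if "0 < s" for s x y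
  proof -
    have h: "s / (s + s) = 1/2" "2 * s * s / (s + s) = s" using that by auto
    have "p s x powr (1/2) * p (- s) y powr (1/2) \<le> p' s (1/2 * x + 1/2 * y)"
      using join[OF that that, of x y] unfolding h .
    then show ?thesis using pnn by (simp add: powr_half_sqrt real_sqrt_mult add_divide_distrib)
  qed
  have pm: "p' s \<in> borel_measurable borel" "p s \<in> borel_measurable borel" for s
  proof -
    have [measurable]: "sec (Basis - {b, c}) (indicator K') \<in> borel_measurable borel"
      "sec (Basis - {b, c}) (indicator K) \<in> borel_measurable borel" using K K' by measurable
    have "(\<lambda>t. rsec (Basis - {b, c}) K' (s *\<^sub>R b + t *\<^sub>R c)) \<in> borel_measurable borel"
      "(\<lambda>t. rsec (Basis - {b, c}) K (s *\<^sub>R b + t *\<^sub>R c)) \<in> borel_measurable borel" unfolding rsec_def by measurable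
    then show "p' s \<in> borel_measurable borel" "p s \<in> borel_measurable borel"
      by (simp_all add: p_def[abs_def] p'_def[abs_def])
  qed
  \<comment> \<open>All three slices, at \<open>s\<close> and \<open>- s\<close> in \<open>K\<close>
    and at \<open>s\<close> in \<open>K'\<close>, have mass \<open>u s\<close>, so the equality case
    of the arithmetic mean applies.\<close>
  have "\<exists>e. \<alpha> (- s) = \<alpha> s + e \<and> \<beta> (- s) = \<beta> s + e \<and> (\<forall>x. \<alpha> s < x \<longrightarrow> x < \<beta> s \<longrightarrow> p (- s) (x + e) = p s x)"
    if s: "0 < s" "s < a" for s
  proof -
    have s1: "\<bar>s\<bar> < a" "\<bar>- s\<bar> < a" using s by auto
    have m: "(\<lambda>t. ennreal (p' s t)) \<in> borel_measurable borel" using pm by measurable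
    show ?thesis
    proof (rule arithmetic_mean_equality[OF m S(1)[OF s1(1)] S(4)[OF s1(1)] _ S(1)[OF s1(2)] S(4)[OF s1(2)] _ S(5)[OF s1(1)]])
      show "(\<integral>\<^sup>+x. ennreal (p (- s) x) * indicator {\<alpha> (- s)<..<\<beta> (- s)} x \<partial>lborel) = ennreal (u s)"
        using S(5)[OF s1(2)] us(1)[OF s] by simp
      show "0 \<le> u s" using up[OF s1(1)] by simp
      show "0 < p s x" if "x \<in> {\<alpha> s<..<\<beta> s}" for x using S(2)[OF s1(1)] that by auto
      show "0 < p (- s) x" if "x \<in> {\<alpha> (- s)<..<\<beta> (- s)}" for x using S(2)[OF s1(2)] that by auto
      show "ennreal (sqrt (p s x * p (- s) y)) \<le> ennreal (p' s ((x + y) / 2))" for x y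
        using join1[OF s(1)] by (rule ennreal_leI)
      show "(\<integral>\<^sup>+x. ennreal (p' s x) \<partial>lborel) \<le> ennreal (u s)" unfolding pu' us(2)[OF s] by simp
    qed auto
  qed
  then have "\<forall>s. \<exists>e. 0 < s \<longrightarrow> s < a \<longrightarrow> \<alpha> (- s) = \<alpha> s + e \<and> \<beta> (- s) = \<beta> s + e \<and> (\<forall>x. \<alpha> s < x \<longrightarrow> x < \<beta> s \<longrightarrow> p (- s) (x + e) = p s x)"
    by blast
  from choice[OF this] obtain e where
    "\<forall>s. 0 < s \<longrightarrow> s < a \<longrightarrow> \<alpha> (- s) = \<alpha> s + e s \<and> \<beta> (- s) = \<beta> s + e s \<and> (\<forall>x. \<alpha> s < x \<longrightarrow> x < \<beta> s \<longrightarrow> p (- s) (x + e s) = p s x)" ..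
  then have e: "\<And>s. 0 < s \<Longrightarrow> s < a \<Longrightarrow> \<alpha> (- s) = \<alpha> s + e s"
    "\<And>s. 0 < s \<Longrightarrow> s < a \<Longrightarrow> \<beta> (- s) = \<beta> s + e s"
    "\<And>s x. 0 < s \<Longrightarrow> s < a \<Longrightarrow> \<alpha> s < x \<Longrightarrow> x < \<beta> s \<Longrightarrow> p (- s) (x + e s) = p s x"
    by blast+
  \<comment> \<open>The slice of \<open>K'\<close> dominates the slice of \<open>K\<close> moved by
    half the shift. The moved interval therefore already carries the whole mass \<open>u s\<close>,
    and by continuity \<open>p' s\<close> cannot be positive on an open interval outside it.\<close>
  have ab': "\<beta>' s \<le> \<beta> s + e s / 2" "\<alpha> s + e s / 2 \<le> \<alpha>' s" if s: "0 < s" "s < a" for s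
  proof -
    have s1: "\<bar>s\<bar> < a" using s by auto
    define A where "A = \<alpha> s + e s / 2"
    define B where "B = \<beta> s + e s / 2"
    have ge: "p s (t - e s / 2) \<le> p' s t" if t: "A < t" "t < B" for t
    proof -
      have t': "\<alpha> s < t - e s / 2" "t - e s / 2 < \<beta> s" using t by (auto simp: A_def B_def)
      have "sqrt (p s (t - e s / 2) * p (- s) (t - e s / 2 + e s)) \<le> p' s ((t - e s / 2 + (t - e s / 2 + e s)) / 2)"
        by (rule join1[OF s(1)])
      then show ?thesis using e(3)[OF s t'] pnn by simp
    qed
    let ?M = "\<lambda>X. (\<integral>\<^sup>+t. ennreal (p' s t) * indicator X t \<partial>lborel)"
    have [measurable]: "p' s \<in> borel_measurable borel" "p s \<in> borel_measurable borel" by (rule pm)+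
    have "ennreal (u s) = (\<integral>\<^sup>+t. ennreal (p s t) * indicator {\<alpha> s<..<\<beta> s} t \<partial>lborel)"
      using S(5)[OF s1] by simp
    also have "\<dots> = (\<integral>\<^sup>+t. ennreal (p s (- (e s / 2) + 1 * t)) * indicator {\<alpha> s<..<\<beta> s} (- (e s / 2) + 1 * t) \<partial>lborel)"
      by (subst nn_integral_real_affine[where c = 1 and t = "- (e s / 2)"]) auto
    also have "\<dots> \<le> ?M {A<..<B}"
      using ge by (intro nn_integral_mono) (auto split: split_indicator intro!: ennreal_leI simp: A_def B_def)
    finally have M1: "ennreal (u s) \<le> ?M {A<..<B}" .
    have zero: "?M X = 0" if X: "X \<in> sets borel" "X \<inter> {A<..<B} = {}" for X
    proof -
      have "?M X + ?M {A<..<B} = (\<integral>\<^sup>+t. ennreal (p' s t) * indicator X t + ennreal (p' s t) * indicator {A<..<B} t \<partial>lborel)"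
      proof (intro nn_integral_add[symmetric])
        have [measurable]: "X \<in> sets borel" by (rule X(1))
        show "(\<lambda>t. ennreal (p' s t) * indicator X t) \<in> borel_measurable lborel"
          "(\<lambda>t. ennreal (p' s t) * indicator {A<..<B} t) \<in> borel_measurable lborel" by measurable
      qed
      also have "\<dots> \<le> (\<integral>\<^sup>+t. ennreal (p' s t) \<partial>lborel)"
        using X(2) by (intro nn_integral_mono) (auto split: split_indicator)
      also have "\<dots> = ennreal (u s)" unfolding pu' us(2)[OF s] ..
      finally have "?M X + ?M {A<..<B} \<le> 0 + ennreal (u s)" by simp
      moreover have "?M X + ennreal (u s) \<le> ?M X + ?M {A<..<B}" using M1 by (rule add_left_mono)
      ultimately have "?M X + ennreal (u s) \<le> 0 + ennreal (u s)" by (rule order_trans[rotated])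
      then have "ennreal (u s) + ?M X \<le> ennreal (u s) + 0" by (simp add: add.commute)
      then show ?thesis by (subst (asm) ennreal_add_left_cancel_le) auto
    qed
    have pos: "p' s x \<le> 0" if "{v<..<w} \<inter> {A<..<B} = {}" "\<alpha>' s \<le> v" "w \<le> \<beta>' s" "x \<in> {v<..<w}" for v w x
    proof (rule continuous_nn_integral_eq_0[OF _ zero])
      show "continuous_on {v<..<w} (p' s)" using S'(4)[OF s] by (rule continuous_on_subset) (use that in auto)
    qed (use that in auto)
    have AB: "A < B" using S(1)[OF s1] by (simp add: A_def B_def)
    show "\<beta>' s \<le> \<beta> s + e s / 2"
    proof (rule ccontr)
      assume n: "\<not> \<beta>' s \<le> \<beta> s + e s / 2"
      define v where "v = max B (\<alpha>' s)"
      have v: "v < \<beta>' s" using n S'(1)[OF s] by (auto simp: v_def B_def)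
      define x where "x = (v + \<beta>' s) / 2"
      have x: "v < x" "x < \<beta>' s" using v by (auto simp: x_def)
      then have "0 < p' s x" by (intro S'(2)[OF s]) (auto simp: v_def)
      moreover have "p' s x \<le> 0" using x by (intro pos[of v "\<beta>' s"]) (auto simp: v_def)
      ultimately show False by simp
    qed
    show "\<alpha> s + e s / 2 \<le> \<alpha>' s"
    proof (rule ccontr)
      assume n: "\<not> \<alpha> s + e s / 2 \<le> \<alpha>' s"
      define v where "v = min A (\<beta>' s)"
      have v: "\<alpha>' s < v" using n S'(1)[OF s] by (auto simp: v_def A_def)
      define x where "x = (\<alpha>' s + v) / 2"
      have x: "\<alpha>' s < x" "x < v" using v by (auto simp: x_def)
      then have "0 < p' s x" by (intro S'(2)[OF s]) (auto simp: v_def)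
      moreover have "p' s x \<le> 0" using x by (intro pos[of "\<alpha>' s" v]) (auto simp: v_def)
      ultimately show False by simp
    qed
  qed
  \<comment> \<open>Joined points of the two open supports have positive density in
    \<open>K'\<close>, so they lie in the support just located. Endpoints are reached as limits,
    because the densities may vanish there.\<close>
  have H: "t / (s + t) * \<beta> s + s / (s + t) * \<beta> (- t) \<le> \<beta> r + e r / 2"
          "\<alpha> r + e r / 2 \<le> t / (s + t) * \<alpha> s + s / (s + t) * \<alpha> (- t)"
    if st: "0 < s" "s < a" "0 < t" "t < a" and r: "r = 2 * s * t / (s + t)" for s t r
  proof -
    have l: "0 < t / (s + t)" "0 < s / (s + t)" "t / (s + t) + s / (s + t) = 1"
      using st by (auto simp: add_divide_distrib[symmetric])
    have "r = t / (s + t) * s + s / (s + t) * t" unfolding r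
      by (simp add: mult.commute[of t s] flip: add_divide_distrib)
    moreover have "\<dots> < t / (s + t) * a + s / (s + t) * a"
      using st l by (intro add_strict_mono mult_strict_left_mono) auto
    moreover have "\<dots> = a" by (simp only: distrib_right[symmetric] l(3) mult_1_left)
    ultimately have ra: "0 < r" "r < a" using st by (auto simp: r)
    have in': "t / (s + t) * x + s / (s + t) * y \<in> {\<alpha>' r..\<beta>' r}"
      if xy: "\<alpha> s < x" "x < \<beta> s" "\<alpha> (- t) < y" "y < \<beta> (- t)" for x y
    proof -
      have "0 < p s x" "0 < p (- t) y" using S(2)[of s x] S(2)[of "-t" y] xy st by auto
      then have "0 < p s x powr (t / (s + t)) * p (- t) y powr (s / (s + t))" by simp
      also have "\<dots> \<le> p' r (t / (s + t) * x + s / (s + t) * y)" unfolding r using st by (intro join) auto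
      finally show ?thesis using S'(3)[OF ra] by (metis atLeastAtMost_iff less_irrefl not_less)
    qed
    have ls: "\<alpha> s < \<beta> s" "\<alpha> (- t) < \<beta> (- t)" using S(1)[of s] S(1)[of "- t"] st by auto
    \<comment> \<open>The denominator \<open>n + 2\<close> keeps these points strictly between the
      endpoints also for \<open>n = 0\<close>.\<close>
    define x where "x n = \<beta> s - (\<beta> s - \<alpha> s) / (real n + 2)" for n :: nat
    define y where "y n = \<beta> (- t) - (\<beta> (- t) - \<alpha> (- t)) / (real n + 2)" for n :: nat
    define x' where "x' n = \<alpha> s + (\<beta> s - \<alpha> s) / (real n + 2)" for n :: nat
    define y' where "y' n = \<alpha> (- t) + (\<beta> (- t) - \<alpha> (- t)) / (real n + 2)" for n :: nat
    have fr: "0 < (v - w) / (real n + 2) \<and> (v - w) / (real n + 2) < v - w" if "w < v" for v w :: real and n :: nat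
      using that by (simp add: divide_less_eq mult_less_cancel_left1)
    have xy: "\<alpha> s < x n" "x n < \<beta> s" "\<alpha> (- t) < y n" "y n < \<beta> (- t)" for n
      using fr[OF ls(1), of n] fr[OF ls(2), of n] by (auto simp: x_def y_def)
    have xy': "\<alpha> s < x' n" "x' n < \<beta> s" "\<alpha> (- t) < y' n" "y' n < \<beta> (- t)" for n
      using fr[OF ls(1), of n] fr[OF ls(2), of n] by (auto simp: x'_def y'_def)
    have z: "(\<lambda>n. k / (real n + 2)) \<longlonglongrightarrow> 0" for k :: real by real_asymp
    have lim: "x \<longlonglongrightarrow> \<beta> s - 0" "y \<longlonglongrightarrow> \<beta> (- t) - 0" "x' \<longlonglongrightarrow> \<alpha> s + 0" "y' \<longlonglongrightarrow> \<alpha> (- t) + 0"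
      unfolding x_def[abs_def] y_def[abs_def] x'_def[abs_def] y'_def[abs_def]
      by (intro tendsto_diff tendsto_add tendsto_const z)+
    have "(\<lambda>n. t / (s + t) * x n + s / (s + t) * y n) \<longlonglongrightarrow> t / (s + t) * (\<beta> s - 0) + s / (s + t) * (\<beta> (- t) - 0)"
      by (intro tendsto_intros lim)
    then have "t / (s + t) * (\<beta> s - 0) + s / (s + t) * (\<beta> (- t) - 0) \<le> \<beta>' r"
      by (rule LIMSEQ_le_const2) (use in'[OF xy] in auto)
    then show "t / (s + t) * \<beta> s + s / (s + t) * \<beta> (- t) \<le> \<beta> r + e r / 2" using ab'(1)[OF ra] by simp
    have "(\<lambda>n. t / (s + t) * x' n + s / (s + t) * y' n) \<longlonglongrightarrow> t / (s + t) * (\<alpha> s + 0) + s / (s + t) * (\<alpha> (- t) + 0)"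
      by (intro tendsto_intros lim)
    then have "\<alpha>' r \<le> t / (s + t) * (\<alpha> s + 0) + s / (s + t) * (\<alpha> (- t) + 0)"
      by (rule LIMSEQ_le_const) (use in'[OF xy'] in auto)
    then show "\<alpha> r + e r / 2 \<le> t / (s + t) * \<alpha> s + s / (s + t) * \<alpha> (- t)" using ab'(2)[OF ra] by simp
  qed
  \<comment> \<open>Log-concavity of the marginal makes \<open>\<beta>\<close> concave and
    \<open>\<alpha>\<close> convex; this is needed for their continuity.\<close>
  have conv: "l * \<beta> s + (1 - l) * \<beta> t \<le> \<beta> (l * s + (1 - l) * t)" "\<alpha> (l * s + (1 - l) * t) \<le> l * \<alpha> s + (1 - l) * \<alpha> t"
    if st: "\<bar>s\<bar> < a" "\<bar>t\<bar> < a" and l: "0 < l" "l < 1" for s t l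
  proof -
    let ?r = "l * s + (1 - l) * t"
    have "s \<in> {-a<..<a}" "t \<in> {-a<..<a}" using st by auto
    then have "?r \<in> {-a<..<a}"
      using convexD_alt[of "{-a<..<a}" t s l] l by (simp add: algebra_simps)
    then have ra: "\<bar>?r\<bar> < a" by auto
    have in': "l * x + (1 - l) * y \<in> {\<alpha> ?r..\<beta> ?r}"
      if xy: "\<alpha> s < x" "x < \<beta> s" "\<alpha> t < y" "y < \<beta> t" for x y
    proof -
      have "0 < p s x" "0 < p t y" using S(2)[of s x] S(2)[of t y] xy st by auto
      then have "0 < p s x powr l * p t y powr (1 - l)" by simp
      also have "\<dots> \<le> p ?r (l * x + (1 - l) * y)" using l by (intro plc) auto
      finally show ?thesis using S(3)[OF ra] by (metis atLeastAtMost_iff less_irrefl not_less)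
    qed
    have ls: "\<alpha> s < \<beta> s" "\<alpha> t < \<beta> t" using S(1)[of s] S(1)[of t] st by auto
    define x where "x n = \<beta> s - (\<beta> s - \<alpha> s) / (real n + 2)" for n :: nat
    define y where "y n = \<beta> t - (\<beta> t - \<alpha> t) / (real n + 2)" for n :: nat
    define x' where "x' n = \<alpha> s + (\<beta> s - \<alpha> s) / (real n + 2)" for n :: nat
    define y' where "y' n = \<alpha> t + (\<beta> t - \<alpha> t) / (real n + 2)" for n :: nat
    have fr: "0 < (v - w) / (real n + 2) \<and> (v - w) / (real n + 2) < v - w" if "w < v" for v w :: real and n :: nat
      using that by (simp add: divide_less_eq mult_less_cancel_left1)
    have xy: "\<alpha> s < x n" "x n < \<beta> s" "\<alpha> t < y n" "y n < \<beta> t" for n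
      using fr[OF ls(1), of n] fr[OF ls(2), of n] by (auto simp: x_def y_def)
    have xy': "\<alpha> s < x' n" "x' n < \<beta> s" "\<alpha> t < y' n" "y' n < \<beta> t" for n
      using fr[OF ls(1), of n] fr[OF ls(2), of n] by (auto simp: x'_def y'_def)
    have z: "(\<lambda>n. k / (real n + 2)) \<longlonglongrightarrow> 0" for k :: real by real_asymp
    have lim: "x \<longlonglongrightarrow> \<beta> s - 0" "y \<longlonglongrightarrow> \<beta> t - 0" "x' \<longlonglongrightarrow> \<alpha> s + 0" "y' \<longlonglongrightarrow> \<alpha> t + 0"
      unfolding x_def[abs_def] y_def[abs_def] x'_def[abs_def] y'_def[abs_def]
      by (intro tendsto_diff tendsto_add tendsto_const z)+
    have "(\<lambda>n. l * x n + (1 - l) * y n) \<longlonglongrightarrow> l * (\<beta> s - 0) + (1 - l) * (\<beta> t - 0)"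
      by (intro tendsto_intros lim)
    then have "l * (\<beta> s - 0) + (1 - l) * (\<beta> t - 0) \<le> \<beta> ?r"
      by (rule LIMSEQ_le_const2) (use in'[OF xy] in auto)
    then show "l * \<beta> s + (1 - l) * \<beta> t \<le> \<beta> ?r" by simp
    have "(\<lambda>n. l * x' n + (1 - l) * y' n) \<longlonglongrightarrow> l * (\<alpha> s + 0) + (1 - l) * (\<alpha> t + 0)"
      by (intro tendsto_intros lim)
    then have "\<alpha> ?r \<le> l * (\<alpha> s + 0) + (1 - l) * (\<alpha> t + 0)"
      by (rule LIMSEQ_le_const) (use in'[OF xy'] in auto)
    then show "\<alpha> ?r \<le> l * \<alpha> s + (1 - l) * \<alpha> t" by simp
  qed
  have "convex_on {-a<..<a} (\<lambda>s. - \<beta> s)" "convex_on {-a<..<a} \<alpha>"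
  proof (safe intro!: convex_onI)
    fix t x y :: real assume t: "0 < t" "t < 1" and xy: "x \<in> {-a<..<a}" "y \<in> {-a<..<a}"
    show "- \<beta> ((1 - t) *\<^sub>R x + t *\<^sub>R y) \<le> (1 - t) * - \<beta> x + t * - \<beta> y"
      using conv(1)[of x y "1 - t"] t xy by (simp add: abs_less_iff)
    show "\<alpha> ((1 - t) *\<^sub>R x + t *\<^sub>R y) \<le> (1 - t) * \<alpha> x + t * \<alpha> y"
      using conv(2)[of x y "1 - t"] t xy by (simp add: abs_less_iff)
  qed
  then have "continuous_on {-a<..<a} (\<lambda>s. - \<beta> s)" and ac: "continuous_on {-a<..<a} \<alpha>"
    by (auto intro: convex_on_continuous)
  from continuous_on_minus[OF this(1)] have bc: "continuous_on {-a<..<a} \<beta>" by simp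
  \<comment> \<open>In the reciprocal variable the harmonic mean becomes the midpoint. The weights
    \<open>t / (s + t)\<close> and \<open>s / (s + t)\<close> become proportional to the reciprocals
    themselves, which explains the factor \<open>r\<close> in the rescaled width \<open>w\<close>
    and the rescaled shift \<open>d\<close>.\<close>
  define w where "w r = r * (\<beta> (1 / r) - \<alpha> (1 / r))" for r
  define d where "d r = r * e (1 / r)" for r
  have dw: "\<bar>d q - d r\<bar> \<le> 2 * w ((q + r) / 2) - w q - w r" if q: "1 / a < q" and r: "1 / a < r" for q r
  proof -
    have qr: "0 < q" "0 < r" "1 / q < a" "1 / r < a"
    proof -
      have "0 < 1 / a" using a by simp
      then show qr0: "0 < q" "0 < r" using q r by linarith+
      show "1 / q < a" "1 / r < a" using q r qr0 a by (auto simp: field_simps)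
    qed
    define m where "m = (q + r) / 2"
    have m: "0 < m" "m \<noteq> 0" using qr by (auto simp: m_def)
    have hm: "2 * (1 / q) * (1 / r) / (1 / q + 1 / r) = 1 / m" "2 * (1 / r) * (1 / q) / (1 / r + 1 / q) = 1 / m"
      unfolding m_def using qr by (auto simp: field_simps)
    have hq: "(1 / r) / (1 / q + 1 / r) = q / (2 * m)" "(1 / q) / (1 / q + 1 / r) = r / (2 * m)"
       "(1 / r) / (1 / r + 1 / q) = q / (2 * m)" "(1 / q) / (1 / r + 1 / q) = r / (2 * m)"
      unfolding m_def using qr by (auto simp: field_simps)
    have e1: "\<beta> (- (1 / r)) = \<beta> (1 / r) + e (1 / r)" "\<beta> (- (1 / q)) = \<beta> (1 / q) + e (1 / q)"
       "\<alpha> (- (1 / r)) = \<alpha> (1 / r) + e (1 / r)" "\<alpha> (- (1 / q)) = \<alpha> (1 / q) + e (1 / q)"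
      using e(1,2)[of "1 / r"] e(1,2)[of "1 / q"] qr by auto
    have h1: "q / (2 * m) * \<beta> (1 / q) + r / (2 * m) * \<beta> (- (1 / r)) \<le> \<beta> (1 / m) + e (1 / m) / 2"
      "\<alpha> (1 / m) + e (1 / m) / 2 \<le> q / (2 * m) * \<alpha> (1 / q) + r / (2 * m) * \<alpha> (- (1 / r))"
      using H[of "1 / q" "1 / r" "1 / m"] qr unfolding hm hq by auto
    have h2: "r / (2 * m) * \<beta> (1 / r) + q / (2 * m) * \<beta> (- (1 / q)) \<le> \<beta> (1 / m) + e (1 / m) / 2"
      "\<alpha> (1 / m) + e (1 / m) / 2 \<le> r / (2 * m) * \<alpha> (1 / r) + q / (2 * m) * \<alpha> (- (1 / q))"
      using H[of "1 / r" "1 / q" "1 / m"] qr unfolding hm hq by auto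
    have mul: "q * X + r * Y \<le> 2 * m * Z" if "q / (2 * m) * X + r / (2 * m) * Y \<le> Z" for X Y Z
    proof -
      have "2 * m * (q / (2 * m) * X + r / (2 * m) * Y) \<le> 2 * m * Z"
        using that m by (intro mult_left_mono) auto
      then show ?thesis using m by (simp add: distrib_left)
    qed
    have mul': "2 * m * Z \<le> q * X + r * Y" if "Z \<le> q / (2 * m) * X + r / (2 * m) * Y" for X Y Z
    proof -
      have "2 * m * Z \<le> 2 * m * (q / (2 * m) * X + r / (2 * m) * Y)"
        using that m by (intro mult_left_mono) auto
      then show ?thesis using m by (simp add: distrib_left)
    qed
    have k1: "q * \<beta> (1 / q) + r * (\<beta> (1 / r) + e (1 / r)) \<le> 2 * m * (\<beta> (1 / m) + e (1 / m) / 2)"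
      using mul[OF h1(1)] unfolding e1 .
    have k2: "2 * m * (\<alpha> (1 / m) + e (1 / m) / 2) \<le> q * \<alpha> (1 / q) + r * (\<alpha> (1 / r) + e (1 / r))"
      using mul'[OF h1(2)] unfolding e1 .
    have k3: "q * (\<beta> (1 / q) + e (1 / q)) + r * \<beta> (1 / r) \<le> 2 * m * (\<beta> (1 / m) + e (1 / m) / 2)"
      using mul[of "\<beta> (- (1 / q))" "\<beta> (1 / r)"] h2(1) unfolding e1 by (simp add: add.commute)
    have k4: "2 * m * (\<alpha> (1 / m) + e (1 / m) / 2) \<le> q * (\<alpha> (1 / q) + e (1 / q)) + r * \<alpha> (1 / r)"
      using mul'[of _ "\<alpha> (- (1 / q))" "\<alpha> (1 / r)"] h2(2) unfolding e1 by (simp add: add.commute)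
    \<comment> \<open>Subtracting \<open>k4\<close> from \<open>k1\<close>, and \<open>k2\<close>
      from \<open>k3\<close>, gives the same bound for the two signs of \<open>d q - d r\<close>;
      the shift at the midpoint cancels each time.\<close>
    show ?thesis
      unfolding m_def[symmetric] w_def d_def using k1 k2 k3 k4 by (simp add: abs_le_iff algebra_simps)
  qed
  have dconst: "d q = d r" if q: "1 / a < q" and r: "q < r" for q r
  proof (rule constant_of_second_difference_bound[OF r])
    have "0 < 1 / a" using a by simp
    then have q0: "0 < q" using q by linarith
    have in_a: "1 / x \<in> {-a<..<a}" if "x \<in> {q..r}" for x
    proof -
      have "1 / a < x" "0 < x" using that q q0 by auto
      then show ?thesis using a by (auto simp: field_simps) 
    qed
    have c1: "continuous_on {q..r} (\<lambda>x. 1 / x)" using q0 by (intro continuous_intros) auto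
    show "continuous_on {q..r} w"
      unfolding w_def using in_a
      by (intro continuous_intros continuous_on_compose2[OF bc c1] continuous_on_compose2[OF ac c1]) auto
    show "\<bar>d x - d y\<bar> \<le> 2 * w ((x + y) / 2) - w x - w y" if "x \<in> {q..r}" "y \<in> {q..r}" for x y
      using that q by (intro dw) auto
  qed
  \<comment> \<open>Since \<open>d\<close> is constant beyond \<open>1 / a\<close>, any argument
    there serves; \<open>2 / a\<close> is one.\<close>
  define D where "D = d (2 / a)"
  have eD: "e s = D * s" if s: "0 < s" "s < a" for s
  proof -
    have "1 / a < 2 / a" using a by (simp add: divide_strict_right_mono)
    moreover have "1 / a < 1 / s" using s by (simp add: field_simps)
    ultimately have "d (1 / s) = D" using dconst[of "1 / s" "2 / a"] dconst[of "2 / a" "1 / s"] unfolding D_def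
      by (metis linorder_neqE)
    then show ?thesis using s by (simp add: d_def field_simps)
  qed
  have sym_pos: "AE t in lborel. p (- s) (t + D * s) = p s t" if s: "0 < s" "s < a" for s
    using AE_lborel_singleton[of "\<alpha> s"] AE_lborel_singleton[of "\<beta> s"]
  proof eventually_elim
    case (elim t)
    have s1: "\<bar>s\<bar> < a" "\<bar>- s\<bar> < a" using s by auto
    show ?case
    proof (cases "\<alpha> s < t \<and> t < \<beta> s")
      case True
      then show ?thesis using e(3)[OF s, of t] eD[OF s] by simp
    next
      case False
      then have "t < \<alpha> s \<or> \<beta> s < t" using elim by auto
      then have "p s t = 0" "p (- s) (t + D * s) = 0"
        using S(3)[OF s1(1), of t] S(3)[OF s1(2), of "t + D * s"] e(1,2)[OF s] eD[OF s] by auto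
      then show ?thesis by simp
    qed
  qed
  have sym: "AE t in lborel. p (- s) (t + D * s) = p s t" if s: "s \<noteq> 0" "\<bar>s\<bar> < a" for s
  proof (cases "0 < s")
    case True
    then show ?thesis using sym_pos s by auto
  next
    case False
    then have s': "0 < - s" "- s < a" using s by auto
    have "AE t in lborel. p s (t + D * - s) = p (- s) t" using sym_pos[OF s'] by simp
    then have "AE t in distr lborel borel (\<lambda>t. D * s + t). p s (t + D * - s) = p (- s) t"
      by (subst lborel_distr_plus)
    moreover have "Measurable.pred borel (\<lambda>t. p s (t + D * - s) = p (- s) t)"
    proof -
      have [measurable]: "p s \<in> borel_measurable borel" "p (- s) \<in> borel_measurable borel" by (rule pm)+
      show ?thesis by measurable
    qed
    ultimately have "AE t in lborel. p s (D * s + t + D * - s) = p (- s) (D * s + t)"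
      by (subst (asm) AE_distr_iff) auto
    then show ?thesis by (simp add: add_ac) (auto elim: eventually_mono)
  qed
  show ?thesis
  proof (rule that[of D])
    fix G :: "real \<Rightarrow> real \<Rightarrow> ennreal" assume G[measurable]: "case_prod G \<in> borel_measurable borel"
    define J where "J s = (\<integral>\<^sup>+t. G s t * ennreal (p s t) \<partial>lborel)" for s
    have Gm: "(\<lambda>t. G s (f t)) \<in> borel_measurable borel" if [measurable]: "f \<in> borel_measurable borel" for s and f :: "real \<Rightarrow> real"
    proof -
      have "(\<lambda>t. case_prod G (s, f t)) \<in> borel_measurable borel" by measurable
      then show ?thesis by simp
    qed
    have pj: "(\<lambda>(s, t). p s t) \<in> borel_measurable (borel \<Otimes>\<^sub>M borel)"
    proof -
      have [measurable]: "sec (Basis - {b, c}) (indicator K) \<in> borel_measurable borel" using K by measurable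
      show ?thesis unfolding p_def rsec_def by measurable
    qed
    have G': "case_prod (\<lambda>s t. G (- s) (t + D * s)) \<in> borel_measurable borel"
    proof -
      have "(\<lambda>x::real \<times> real. (- fst x, snd x + D * fst x)) \<in> borel \<rightarrow>\<^sub>M borel"
        by (intro borel_measurable_continuous_onI continuous_intros)
      from measurable_compose[OF this G] show ?thesis by (simp add: case_prod_beta')
    qed
    have Jm: "J \<in> borel_measurable borel"
    proof -
      have [measurable]: "case_prod G \<in> borel_measurable (borel \<Otimes>\<^sub>M borel)" using G by (simp add: borel_prod)
      note [measurable] = pj
      show ?thesis unfolding J_def by measurable
    qed
    have L: "(\<integral>\<^sup>+x. G (x \<bullet> b) (x \<bullet> c) * indicator K x \<partial>lborel) = (\<integral>\<^sup>+s. J s \<partial>lborel)"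
      unfolding J_def ep by (rule nn_integral_sec2[OF K(1) G b])
    have "(\<integral>\<^sup>+x. G (- (x \<bullet> b)) (x \<bullet> c + D * (x \<bullet> b)) * indicator K x \<partial>lborel)
       = (\<integral>\<^sup>+s. (\<integral>\<^sup>+t. G (- s) (t + D * s) * ennreal (p s t) \<partial>lborel) \<partial>lborel)"
      unfolding ep by (rule nn_integral_sec2[OF K(1) G' b])
    also have "\<dots> = (\<integral>\<^sup>+s. J (- s) \<partial>lborel)"
    proof (rule nn_integral_cong_AE)
      show "AE s in lborel. (\<integral>\<^sup>+t. G (- s) (t + D * s) * ennreal (p s t) \<partial>lborel) = J (- s)"
        \<comment> \<open>The symmetry of slices is known for \<open>0 < \<bar>s\<bar>\<close> below
          \<open>a\<close>, and their vanishing above \<open>a\<close>; the three heights left over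
          form a null set.\<close>
        using AE_lborel_singleton[of 0] AE_lborel_singleton[of a] AE_lborel_singleton[of "-a"]
      proof eventually_elim
        case (elim s)
        show ?case
        proof (cases "\<bar>s\<bar> < a")
          case True
          have "(\<integral>\<^sup>+t. G (- s) (t + D * s) * ennreal (p s t) \<partial>lborel)
            = (\<integral>\<^sup>+t. G (- s) (t + D * s) * ennreal (p (- s) (t + D * s)) \<partial>lborel)"
          proof (rule nn_integral_cong_AE)
            show "AE t in lborel. G (- s) (t + D * s) * ennreal (p s t) = G (- s) (t + D * s) * ennreal (p (- s) (t + D * s))"
              using sym[OF elim(1) True] by eventually_elim simp
          qed
          also have "\<dots> = J (- s)"
            unfolding J_def using pm Gm
            by (subst nn_integral_real_affine[where c = 1 and t = "D * s"]) (auto simp: add.commute)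
          finally show ?thesis .
        next
          case False
          then have "u s = 0" "u (- s) = 0" using uo[of s] uo[of "-s"] elim by auto
          then have z: "(\<integral>\<^sup>+t. ennreal (p s t) \<partial>lborel) = 0" "(\<integral>\<^sup>+t. ennreal (p (- s) t) \<partial>lborel) = 0"
            unfolding pu by auto
          have [measurable]: "p s \<in> borel_measurable borel" "p (- s) \<in> borel_measurable borel" by (rule pm)+
          have ae: "AE t in lborel. ennreal (p s t) = 0" "AE t in lborel. ennreal (p (- s) t) = 0"
            using z nn_integral_0_iff_AE[of "\<lambda>t. ennreal (p s t)" lborel]
              nn_integral_0_iff_AE[of "\<lambda>t. ennreal (p (- s) t)" lborel] by auto
          have "(\<integral>\<^sup>+t. G (- s) (t + D * s) * ennreal (p s t) \<partial>lborel) = (\<integral>\<^sup>+t. 0 \<partial>(lborel :: real measure))"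
          proof (rule nn_integral_cong_AE)
            show "AE t in lborel. G (- s) (t + D * s) * ennreal (p s t) = 0" using ae(1) by eventually_elim simp
          qed
          moreover have "J (- s) = (\<integral>\<^sup>+t. 0 \<partial>(lborel :: real measure))"
            unfolding J_def
          proof (rule nn_integral_cong_AE)
            show "AE t in lborel. G (- s) t * ennreal (p (- s) t) = 0" using ae(2) by eventually_elim simp
          qed
          ultimately show ?thesis by simp
        qed
      qed
    qed
    also have "\<dots> = (\<integral>\<^sup>+s. J s \<partial>lborel)"
      using nn_integral_real_affine[OF Jm, of "-1" 0] by simp
    finally show "(\<integral>\<^sup>+x. G (x \<bullet> b) (x \<bullet> c) * indicator K x \<partial>lborel)
    = (\<integral>\<^sup>+x. G (- (x \<bullet> b)) (x \<bullet> c + D * (x \<bullet> b)) * indicator K x \<partial>lborel)" unfolding L by simp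
  qed
qed

section \<open>Support functions and the polar of the difference body\<close>

definition support :: "'a::euclidean_space set \<Rightarrow> 'a \<Rightarrow> real" where
  "support K u = (SUP x\<in>K. x \<bullet> u)"

lemma bdd_above_inner:
  fixes K :: "'a::euclidean_space set"
  assumes "bounded K"
  shows "bdd_above ((\<lambda>x. x \<bullet> u) ` K)"
proof -
  obtain R where R: "\<And>x. x \<in> K \<Longrightarrow> norm x \<le> R" using assms bounded_iff by metis
  have "x \<bullet> u \<le> R * norm u" if "x \<in> K" for x
    using norm_cauchy_schwarz[of x u] mult_right_mono[OF R[OF that], of "norm u"] by simp
  then show ?thesis by (auto intro!: bdd_aboveI2)
qed

lemma support_upper: "bounded K \<Longrightarrow> x \<in> K \<Longrightarrow> x \<bullet> u \<le> support K u"
  unfolding support_def by (intro cSUP_upper bdd_above_inner)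

lemma support_le_iff:
  assumes "bounded K" "K \<noteq> {}"
  shows "support K u \<le> r \<longleftrightarrow> (\<forall>x\<in>K. x \<bullet> u \<le> r)"
  unfolding support_def using assms by (intro cSUP_le_iff bdd_above_inner)

lemma support_attained:
  assumes "compact K" "K \<noteq> {}"
  obtains x where "x \<in> K" "support K u = x \<bullet> u"
proof -
  have "continuous_on K (\<lambda>x. x \<bullet> u)" by (intro continuous_intros)
  from continuous_attains_sup[OF assms this] obtain x where x: "x \<in> K" "\<And>y. y \<in> K \<Longrightarrow> y \<bullet> u \<le> x \<bullet> u" by blast
  then have "support K u = x \<bullet> u"
    using assms by (intro antisym) (auto simp: support_le_iff compact_imp_bounded intro: support_upper)
  with x show ?thesis using that by blast
qed

lemma support_scaleR:
  assumes "bounded K" "K \<noteq> {}" "0 \<le> c"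
  shows "support K (c *\<^sub>R u) = c * support K u"
proof (cases "c = 0")
  case True
  then show ?thesis using assms(2) by (simp add: support_def)
next
  case False
  then have c: "0 < c" using assms(3) by simp
  have "support K (c *\<^sub>R u) \<le> r \<longleftrightarrow> c * support K u \<le> r" for r
  proof -
    have "c * support K u \<le> r \<longleftrightarrow> support K u \<le> r / c" using c by (simp add: field_simps)
    also have "\<dots> \<longleftrightarrow> (\<forall>x\<in>K. x \<bullet> u \<le> r / c)" using assms by (simp add: support_le_iff)
    also have "\<dots> \<longleftrightarrow> support K (c *\<^sub>R u) \<le> r" using assms c by (simp add: support_le_iff field_simps)
    finally show ?thesis ..
  qed
  then show ?thesis by (meson order_antisym order_refl)
qed

lemma support_add_le:
  assumes "bounded K" "K \<noteq> {}"
  shows "support K (u + v) \<le> support K u + support K v"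
  using assms by (auto simp: support_le_iff inner_add_right intro!: add_mono support_upper)

lemma support_le_norm:
  assumes "K \<noteq> {}" "K \<subseteq> cball 0 R"
  shows "support K u \<le> R * norm u"
proof -
  have "x \<bullet> u \<le> R * norm u" if "x \<in> K" for x
    using norm_cauchy_schwarz[of x u] mult_right_mono[of "norm x" R "norm u"] that assms(2) by (auto simp: subset_iff)
  then show ?thesis using assms bounded_subset[OF bounded_cball assms(2)] by (auto simp: support_le_iff)
qed

lemma support_lipschitz:
  assumes "K \<noteq> {}" "K \<subseteq> cball 0 R"
  shows "\<bar>support K u - support K v\<bar> \<le> R * norm (u - v)"
proof -
  have b: "bounded K" using bounded_subset[OF bounded_cball assms(2)] .
  have "support K u \<le> support K v + R * norm (u - v)" for u v
    using support_add_le[OF b assms(1), of v "u - v"] support_le_norm[OF assms, of "u - v"] by simp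
  from this[of u v] this[of v u] show ?thesis by (simp add: norm_minus_commute abs_le_iff)
qed

lemma continuous_on_support [continuous_intros]:
  assumes "bounded K" "K \<noteq> {}" "continuous_on S f"
  shows "continuous_on S (\<lambda>x. support K (f x))"
proof -
  obtain R where "\<And>x. x \<in> K \<Longrightarrow> norm x \<le> R" using assms(1) bounded_iff by metis
  then have R: "K \<subseteq> cball 0 R" by auto
  have "R-lipschitz_on UNIV (support K)" if "0 \<le> R"
    using support_lipschitz[OF assms(2) R] that by (intro lipschitz_onI) (auto simp: dist_norm dist_real_def)
  moreover have "0 \<le> R"
  proof -
    obtain x where "x \<in> K" using assms(2) by blast
    then have "norm x \<le> R" using R by auto
    then show ?thesis using norm_ge_zero[of x] by linarith
  qed
  ultimately have "continuous_on UNIV (support K)" using lipschitz_on_continuous_on by blast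
  then show ?thesis using assms(3) by (rule continuous_on_compose2) auto
qed

lemma support_ge_ball:
  assumes "bounded K" "cball p r \<subseteq> K" "0 \<le> r"
  shows "p \<bullet> u + r * norm u \<le> support K u"
proof (cases "u = 0")
  case True
  have "p \<in> K" using assms by auto
  then show ?thesis using support_upper[OF assms(1), of p u] True by simp
next
  case False
  let ?x = "p + (r / norm u) *\<^sub>R u"
  have "?x \<in> K" using assms False by (intro subsetD[OF assms(2)]) (auto simp: dist_norm)
  from support_upper[OF assms(1) this, of u] show ?thesis
    using False by (simp add: inner_add_left power2_norm_eq_inner[symmetric] power2_eq_square)
qed

lemma support_translation:
  assumes "bounded K" "K \<noteq> {}"
  shows "support ((+) v ` K) u = v \<bullet> u + support K u"
proof -
  have "support ((+) v ` K) u \<le> r \<longleftrightarrow> v \<bullet> u + support K u \<le> r" for r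
  proof -
    have "support ((+) v ` K) u \<le> r \<longleftrightarrow> (\<forall>x\<in>K. x \<bullet> u \<le> r - v \<bullet> u)"
      using assms(2) by (subst support_le_iff[OF bounded_translation[OF assms(1)]]) (auto simp: inner_add_left algebra_simps)
    also have "\<dots> \<longleftrightarrow> support K u \<le> r - v \<bullet> u" using assms by (simp add: support_le_iff)
    finally show ?thesis by linarith
  qed
  then show ?thesis by (meson order_antisym order_refl)
qed

text \<open>The \<open>m + 1\<close> components sum to zero, and the polar of the difference body is symmetric in them.\<close>

definition component :: "'a::euclidean_space^'m \<Rightarrow> 'm option \<Rightarrow> 'a" where
  "component \<theta> k = (case k of None \<Rightarrow> (\<Sum>i\<in>UNIV. \<theta> $ i) | Some i \<Rightarrow> - \<theta> $ i)"

text \<open>The support function of the difference body, hence the gauge of its polar.\<close>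

definition diff_norm :: "'a::euclidean_space set \<Rightarrow> 'a^'m \<Rightarrow> real" where
  "diff_norm K \<theta> = (\<Sum>k\<in>UNIV. support K (component \<theta> k))"

definition dpolar :: "'a::euclidean_space set \<Rightarrow> ('a^'m) set" where
  "dpolar K = {\<theta>. diff_norm K \<theta> \<le> 1}"

lemma UNIV_option_sum:
  "(\<Sum>k\<in>(UNIV :: 'm::finite option set). f k) = f None + (\<Sum>i\<in>UNIV. f (Some i))"
  by (simp add: UNIV_option_conv sum.reindex)

lemma sum_component: "(\<Sum>k\<in>UNIV. component \<theta> k) = 0"
  by (simp add: UNIV_option_sum component_def sum_negf)

lemma component_scaleR: "component (c *\<^sub>R \<theta>) k = c *\<^sub>R component \<theta> k"
  by (simp add: component_def scaleR_sum_right split: option.split)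

lemma continuous_on_component [continuous_intros]:
  "continuous_on S f \<Longrightarrow> continuous_on S (\<lambda>x. component (f x) k)"
  by (cases k) (auto simp: component_def intro!: continuous_intros)

lemma inner_vec_difference:
  fixes \<theta> :: "'a::euclidean_space^'m"
  shows "\<theta> \<bullet> (\<chi> i. y - z i) = y \<bullet> (\<Sum>i\<in>UNIV. \<theta> $ i) + (\<Sum>i\<in>UNIV. z i \<bullet> (- \<theta> $ i))"
  by (simp add: inner_vec_def inner_diff_right inner_sum_right sum_subtractf inner_commute sum_negf)

text \<open>The points of the difference body are the tuples of differences \<open>y - z i\<close>
  with \<open>y\<close> and all \<open>z i\<close> in \<open>K\<close>. These \<open>m + 1\<close>
  points are chosen independently, so maximizing the inner product splits into \<open>m + 1\<close>
  support functions.\<close>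

lemma polar_diff_body:
  fixes K :: "(real^'n) set"
  assumes "compact K" "K \<noteq> {}"
  shows "polar (diff_body K :: (real^'n^'m) set) = dpolar K"
proof (intro set_eqI iffI)
  have bK: "bounded K" using assms(1) by (rule compact_imp_bounded)
  fix \<theta> :: "real^'n^'m"
  have in_db: "(\<chi> i. y - z i) \<in> diff_body K" if "y \<in> K" "\<And>i. z i \<in> K" for y and z :: "'m \<Rightarrow> real^'n"
  proof -
    have "y \<in> (\<lambda>x. x + (\<chi> i. y - z i) $ i) ` K" for i
      by (rule image_eqI[of _ _ "z i"]) (use that in auto)
    then show ?thesis using that(1) unfolding diff_body_def by blast
  qed
  {
    assume \<theta>: "\<theta> \<in> polar (diff_body K)"
    obtain y where y: "y \<in> K" "support K (\<Sum>i\<in>UNIV. \<theta> $ i) = y \<bullet> (\<Sum>i\<in>UNIV. \<theta> $ i)"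
      using support_attained[OF assms] by blast
    have "\<forall>i. \<exists>z. z \<in> K \<and> support K (- \<theta> $ i) = z \<bullet> (- \<theta> $ i)"
      using support_attained[OF assms] by blast
    from choice[OF this] obtain z where z: "\<And>i. z i \<in> K" "\<And>i. support K (- \<theta> $ i) = z i \<bullet> (- \<theta> $ i)" by blast
    have "diff_norm K \<theta> = \<theta> \<bullet> (\<chi> i. y - z i)"
      unfolding diff_norm_def UNIV_option_sum component_def inner_vec_difference by (simp add: y z)
    also have "\<dots> \<le> 1" using \<theta> in_db[OF y(1) z(1)] unfolding polar_def by auto
    finally show "\<theta> \<in> dpolar K" by (simp add: dpolar_def)
  }
  {
    assume \<theta>: "\<theta> \<in> dpolar K"
    show "\<theta> \<in> polar (diff_body K)"
      unfolding polar_def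
    proof safe
      fix x :: "real^'n^'m" assume "x \<in> diff_body K"
      then obtain y where y: "y \<in> K" "\<And>i. y \<in> (\<lambda>z. z + x $ i) ` K" unfolding diff_body_def by blast
      have yx: "y - x $ i \<in> K" for i using y(2)[of i] by auto
      have "\<theta> \<bullet> x = y \<bullet> (\<Sum>i\<in>UNIV. \<theta> $ i) + (\<Sum>i\<in>UNIV. (y - x $ i) \<bullet> (- \<theta> $ i))"
        using inner_vec_difference[of \<theta> y "\<lambda>i. y - x $ i"] by simp
      also have "\<dots> \<le> diff_norm K \<theta>"
        unfolding diff_norm_def UNIV_option_sum component_def option.case
        by (intro add_mono sum_mono support_upper[OF bK] y(1) yx)
      also have "\<dots> \<le> 1" using \<theta> by (simp add: dpolar_def)
      finally show "\<theta> \<bullet> x \<le> 1" .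
    qed
  }
qed

lemma continuous_on_diff_norm [continuous_intros]:
  assumes "bounded K" "K \<noteq> {}" "continuous_on S f"
  shows "continuous_on S (\<lambda>x. diff_norm K (f x))"
  unfolding diff_norm_def using assms by (intro continuous_intros) auto

lemma diff_norm_scaleR:
  assumes "bounded K" "K \<noteq> {}" "0 \<le> c"
  shows "diff_norm K (c *\<^sub>R \<theta>) = c * diff_norm K \<theta>"
  unfolding diff_norm_def component_scaleR using assms by (simp add: support_scaleR sum_distrib_left)

lemma diff_norm_translation:
  assumes "bounded K" "K \<noteq> {}"
  shows "diff_norm ((+) v ` K) \<theta> = diff_norm K \<theta>"
proof -
  have "diff_norm ((+) v ` K) \<theta> = v \<bullet> (\<Sum>k\<in>UNIV. component \<theta> k) + diff_norm K \<theta>"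
    unfolding diff_norm_def using assms by (simp add: support_translation sum.distrib inner_sum_right)
  then show ?thesis by (simp add: sum_component)
qed

text \<open>Each summand is bounded below by the support function of the ball. The terms linear in
  the centre \<open>p\<close> add up to zero because the components do, so the ball need not be
  centered at the origin.\<close>

lemma diff_norm_ge:
  assumes "bounded K" "cball p r \<subseteq> K" "0 \<le> r"
  shows "r * norm (\<theta> $ i) \<le> diff_norm K \<theta>"
proof -
  have "r * norm (\<theta> $ i) = r * norm (component \<theta> (Some i))" by (simp add: component_def)
  also have "\<dots> \<le> (\<Sum>k\<in>UNIV. r * norm (component \<theta> k))"
    using assms(3) by (intro member_le_sum[of "Some i" UNIV "\<lambda>k. r * norm (component \<theta> k)"]) auto
  also have "\<dots> = (\<Sum>k\<in>UNIV. p \<bullet> component \<theta> k + r * norm (component \<theta> k))"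
    by (simp add: sum.distrib flip: inner_sum_right) (simp add: sum_component)
  also have "\<dots> \<le> diff_norm K \<theta>"
    unfolding diff_norm_def using assms by (intro sum_mono support_ge_ball)
  finally show ?thesis .
qed

lemma norm_vec_le_sum: "norm (x :: 'a::euclidean_space^'m) \<le> (\<Sum>i\<in>UNIV. norm (x $ i))"
  unfolding norm_vec_def by (rule L2_set_le_sum) auto

lemma convex_body_ball:
  assumes "convex_body K"
  obtains p r where "0 < r" "cball p r \<subseteq> K"
proof -
  obtain p where "p \<in> interior K" using assms by (auto simp: convex_body_def)
  then show ?thesis using that mem_interior_cball by metis
qed

lemma convex_bodyD:
  assumes "convex_body K"
  shows "compact K" "convex K" "interior K \<noteq> {}" "bounded K" "closed K" "K \<noteq> {}" "K \<in> sets borel"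
  using assms by (auto simp: convex_body_def compact_imp_bounded compact_imp_closed)

lemma compact_dpolar:
  assumes "convex_body K"
  shows "compact (dpolar K :: ('a::euclidean_space^'m) set)"
  unfolding compact_eq_bounded_closed
proof
  note K = convex_bodyD[OF assms]
  obtain p r where r: "0 < r" "cball p r \<subseteq> K" using convex_body_ball[OF assms] .
  have "norm \<theta> \<le> real CARD('m) * (1 / r)" if "\<theta> \<in> dpolar K" for \<theta> :: "'a^'m"
  proof -
    have "norm (\<theta> $ i) \<le> 1 / r" for i
      using diff_norm_ge[OF K(4) r(2), of \<theta> i] r that by (simp add: dpolar_def field_simps)
    then have "(\<Sum>i\<in>UNIV. norm (\<theta> $ i)) \<le> (\<Sum>i\<in>(UNIV::'m set). 1 / r)" by (intro sum_mono)
    then show ?thesis using norm_vec_le_sum[of \<theta>] by simp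
  qed
  then show "bounded (dpolar K :: ('a^'m) set)" unfolding bounded_iff by blast
  show "closed (dpolar K :: ('a^'m) set)"
    unfolding dpolar_def using K by (intro closed_Collect_le continuous_intros) auto
qed

lemma measure_dpolar_pos:
  assumes "convex_body K"
  shows "0 < measure lborel (dpolar K :: ('a::euclidean_space^'m) set)"
proof -
  note K = convex_bodyD[OF assms]
  have "open {\<theta> :: 'a^'m. diff_norm K \<theta> < 1}"
    using K by (intro open_Collect_less continuous_intros) auto
  moreover have "diff_norm K (0 :: 'a^'m) = 0" using diff_norm_scaleR[OF K(4,6), of 0 0] by simp
  ultimately have "0 \<in> interior (dpolar K :: ('a^'m) set)"
    by (intro interiorI[of "{\<theta>. diff_norm K \<theta> < 1}"]) (auto simp: dpolar_def)
  then obtain e where e: "0 < e" "ball 0 e \<subseteq> (dpolar K :: ('a^'m) set)" by (auto simp: mem_interior)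
  have "0 < measure lebesgue (ball (0::'a^'m) e)" using e content_ball_pos by auto
  also have "\<dots> = measure lborel (ball (0::'a^'m) e)" by simp
  also have "\<dots> \<le> measure lborel (dpolar K :: ('a^'m) set)"
    using e(2) compact_dpolar[OF assms] by (intro measure_mono_fmeasurable fmeasurable_compact) auto
  finally show ?thesis .
qed

section \<open>The volume of the polar as an exponential integral, and its layers\<close>

lemma emeasure_scaleR_image:
  fixes S :: "'a::euclidean_space set"
  assumes [measurable]: "S \<in> sets borel" and r: "0 < r"
  shows "emeasure lborel ((\<lambda>x. (1 / r) *\<^sub>R x) -` S) = ennreal (r ^ DIM('a)) * emeasure lborel S"
proof -
  have ne: "1 / r \<noteq> 0" using r by simp
  have [measurable]: "(\<lambda>x. (1 / r) *\<^sub>R x) -` S \<in> sets borel"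
    using measurable_sets[of "\<lambda>x. (1 / r) *\<^sub>R x" borel borel S] by auto
  have "emeasure lborel S = emeasure (density (distr lborel borel (\<lambda>x. 0 + (1 / r) *\<^sub>R x)) (\<lambda>_. ennreal (\<bar>1 / r\<bar> ^ DIM('a)))) S"
    using lborel_affine[OF ne, of "0::'a"] by simp
  also have "\<dots> = ennreal ((1 / r) ^ DIM('a)) * emeasure lborel ((\<lambda>x. (1 / r) *\<^sub>R x) -` S)"
    using r by (simp add: emeasure_density_const emeasure_distr)
  finally have "ennreal (r ^ DIM('a)) * emeasure lborel S = ennreal (r ^ DIM('a)) * ennreal ((1 / r) ^ DIM('a)) * emeasure lborel ((\<lambda>x. (1 / r) *\<^sub>R x) -` S)"
    by (simp add: mult.assoc)
  also have "ennreal (r ^ DIM('a)) * ennreal ((1 / r) ^ DIM('a)) = 1"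
    using r by (simp add: ennreal_mult[symmetric] power_one_over del: ennreal_power)
  finally show ?thesis by simp
qed

text \<open>The exponential turns the sum of support functions into a product. The type argument
  carries \<open>m\<close>, which the type of \<open>K\<close> does not determine.\<close>

definition exp_integral :: "'m::finite itself \<Rightarrow> 'a::euclidean_space set \<Rightarrow> ennreal" where
  "exp_integral _ K = (\<integral>\<^sup>+\<theta>. ennreal (exp (- diff_norm K (\<theta> :: 'a^'m))) \<partial>lborel)"

lemma nn_integral_exp_tail: "(\<integral>\<^sup>+r. ennreal (exp (- r)) * indicator {t..} r \<partial>lborel) = ennreal (exp (- t))"
proof -
  have "(\<integral>\<^sup>+x. ennreal (exp (- x)) * indicator {t..} x \<partial>lborel) = ennreal (0 - (- exp (- t)))"
  proof (rule nn_integral_FTC_atLeast)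
    show "((\<lambda>x::real. - exp (- x)) \<longlongrightarrow> 0) at_top" by real_asymp
  qed (auto intro!: derivative_eq_intros)
  then show ?thesis by simp
qed

text \<open>By homogeneity the level set at \<open>r\<close> has \<open>r\<close> to the power of
  the dimension times the volume of the unit ball of the gauge; integrating against
  \<open>exp (- r)\<close> leaves a Gamma integral, which is the factorial.\<close>

lemma exp_integral_eq:
  fixes K :: "'a::euclidean_space set"
  assumes "convex_body K"
  shows "exp_integral TYPE('m::finite) K = ennreal (fact (DIM('a^'m))) * emeasure lborel (dpolar K :: ('a^'m) set)"
proof -
  note K = convex_bodyD[OF assms]
  let ?N = "diff_norm K :: 'a^'m \<Rightarrow> real"
  obtain p r where r: "0 < r" "cball p r \<subseteq> K" using convex_body_ball[OF assms] .
  have N0: "0 \<le> ?N \<theta>" for \<theta>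
    using diff_norm_ge[OF K(4) r(2), of \<theta> undefined] r(1) by (meson mult_nonneg_nonneg less_imp_le norm_ge_zero order_trans)
  have Nc: "continuous_on UNIV ?N" using K by (intro continuous_intros) auto
  have [measurable]: "?N \<in> borel_measurable borel" using Nc by (rule borel_measurable_continuous_onI)
  have lev: "emeasure lborel {\<theta>. ?N \<theta> \<le> r} = ennreal (r ^ DIM('a^'m)) * emeasure lborel (dpolar K :: ('a^'m) set)" if "0 < r" for r
  proof -
    have "{\<theta>. ?N \<theta> \<le> r} = (\<lambda>x. (1 / r) *\<^sub>R x) -` dpolar K"
      using that K by (auto simp: dpolar_def diff_norm_scaleR field_simps)
    then show ?thesis
      using emeasure_scaleR_image[OF borel_compact[OF compact_dpolar[OF assms]] that] by simp
  qed
  have "exp_integral TYPE('m) K = (\<integral>\<^sup>+\<theta>. (\<integral>\<^sup>+r. ennreal (exp (- r)) * indicator {?N \<theta>..} r \<partial>lborel) \<partial>lborel)"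
    unfolding exp_integral_def nn_integral_exp_tail ..
  also have "\<dots> = (\<integral>\<^sup>+\<theta>. (\<integral>\<^sup>+r. ennreal (exp (- r)) * indicator {\<theta>. ?N \<theta> \<le> r} \<theta> \<partial>lborel) \<partial>lborel)"
    by (intro nn_integral_cong) (auto simp: indicator_def)
  also have "\<dots> = (\<integral>\<^sup>+r. (\<integral>\<^sup>+\<theta>. ennreal (exp (- r)) * indicator {\<theta>. ?N \<theta> \<le> r} \<theta> \<partial>lborel) \<partial>lborel)"
    by (rule lborel_pair.Fubini'[symmetric]) measurable
  also have "\<dots> = (\<integral>\<^sup>+r. ennreal (exp (- r)) * emeasure lborel {\<theta>. ?N \<theta> \<le> r} \<partial>lborel)"
    by (intro nn_integral_cong) (simp add: nn_integral_cmult)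
  also have "\<dots> = (\<integral>\<^sup>+r. ennreal (r ^ DIM('a^'m) * exp (- r)) * indicator {0..} r * emeasure lborel (dpolar K :: ('a^'m) set) \<partial>lborel)"
  proof (rule nn_integral_cong_AE)
    show "AE r in lborel. ennreal (exp (- r)) * emeasure lborel {\<theta>. ?N \<theta> \<le> r}
      = ennreal (r ^ DIM('a^'m) * exp (- r)) * indicator {0..} r * emeasure lborel (dpolar K :: ('a^'m) set)"
      using AE_lborel_singleton[of 0]
    proof eventually_elim
      case (elim r)
      show ?case
      proof (cases "0 < r")
        case True
        have "ennreal (r ^ DIM('a^'m) * exp (- r)) = ennreal (r ^ DIM('a^'m)) * ennreal (exp (- r))"
          using True by (intro ennreal_mult) auto
        moreover have "indicator {0..} r = (1 :: ennreal)" using True by simp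
        ultimately show ?thesis
          unfolding lev[OF True] by (simp only: mult.assoc mult.left_commute mult_1_left)
      next
        case False
        then have "r < 0" using elim by simp
        then have "\<not> ?N \<theta> \<le> r" for \<theta> using N0[of \<theta>] by linarith
        then have "{\<theta>. ?N \<theta> \<le> r} = {}" by blast
        then show ?thesis using False elim by simp
      qed
    qed
  qed
  also have "\<dots> = (\<integral>\<^sup>+r. ennreal (r ^ DIM('a^'m) * exp (- r)) * indicator {0..} r \<partial>lborel) * emeasure lborel (dpolar K :: ('a^'m) set)"
    by (intro nn_integral_multc) measurable
  also have "(\<integral>\<^sup>+r. ennreal (r ^ DIM('a^'m) * exp (- r)) * indicator {0..} r \<partial>lborel) = ennreal (fact (DIM('a^'m)))"
    by (subst nn_intergal_power_times_exp_Ici) simp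
  finally show ?thesis .
qed

text \<open>Each factor \<open>exp (- support K (component \<theta> k))\<close> is written as a tail
  integral with its own threshold \<open>\<rho> k\<close>. A single common threshold would only give
  back the level sets of the sum, which do not symmetrize.\<close>

lemma exp_integral_layers:
  fixes K :: "'a::euclidean_space set"
  assumes "bounded K" "K \<noteq> {}"
  shows "exp_integral TYPE('m::finite) K
     = (\<integral>\<^sup>+\<rho>. (\<Prod>k\<in>UNIV. ennreal (exp (- \<rho> k))) * emeasure lborel {\<theta> :: 'a^'m. \<forall>k. support K (component \<theta> k) \<le> \<rho> k} \<partial>Pi\<^sub>M (UNIV :: 'm option set) (\<lambda>_. lborel))"
proof -
  interpret product_sigma_finite "\<lambda>_::'m option. lborel :: real measure" by (rule product_sigma_finite_lborel)
  interpret P: sigma_finite_measure "Pi\<^sub>M (UNIV :: 'm option set) (\<lambda>_. lborel :: real measure)"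
    by (rule sigma_finite) simp
  interpret PP: pair_sigma_finite "lborel :: ('a^'m) measure" "Pi\<^sub>M (UNIV :: 'm option set) (\<lambda>_. lborel :: real measure)" ..
  have [measurable]: "(\<lambda>\<theta>. support K (component \<theta> k)) \<in> borel_measurable (borel :: ('a^'m) measure)" for k
    using assms by (intro borel_measurable_continuous_onI continuous_intros)
  let ?E = "\<lambda>(\<theta> :: 'a^'m) (\<rho> :: 'm option \<Rightarrow> real). (\<Prod>k\<in>UNIV. if support K (component \<theta> k) \<le> \<rho> k then ennreal (exp (- \<rho> k)) else 0)"
  have E: "?E \<theta> \<rho> = (\<Prod>k\<in>UNIV. ennreal (exp (- \<rho> k))) * indicator {\<theta>. \<forall>k. support K (component \<theta> k) \<le> \<rho> k} \<theta>" for \<theta> \<rho>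
    by (auto simp: indicator_def intro!: prod.cong)
  have tail: "(\<integral>\<^sup>+r. (if t \<le> r then ennreal (exp (- r)) else 0) \<partial>lborel) = ennreal (exp (- t))" for t :: real
    by (rule trans[OF _ nn_integral_exp_tail], rule nn_integral_cong) (simp split: split_indicator)
  have "exp_integral TYPE('m) K = (\<integral>\<^sup>+\<theta>. (\<Prod>k\<in>UNIV. ennreal (exp (- support K (component (\<theta> :: 'a^'m) k)))) \<partial>lborel)"
    unfolding exp_integral_def diff_norm_def by (simp add: sum_negf[symmetric] exp_sum prod_ennreal)
  also have "\<dots> = (\<integral>\<^sup>+\<theta>. (\<integral>\<^sup>+\<rho>. ?E \<theta> \<rho> \<partial>Pi\<^sub>M UNIV (\<lambda>_. lborel)) \<partial>lborel)"
    by (subst product_nn_integral_prod) (auto simp: tail)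
  also have "\<dots> = (\<integral>\<^sup>+\<rho>. (\<integral>\<^sup>+\<theta>. ?E \<theta> \<rho> \<partial>lborel) \<partial>Pi\<^sub>M UNIV (\<lambda>_. lborel))"
    by (rule PP.Fubini'[symmetric]) measurable
  also have "\<dots> = (\<integral>\<^sup>+\<rho>. (\<Prod>k\<in>UNIV. ennreal (exp (- \<rho> k))) * emeasure lborel {\<theta> :: 'a^'m. \<forall>k. support K (component \<theta> k) \<le> \<rho> k} \<partial>Pi\<^sub>M (UNIV :: 'm option set) (\<lambda>_. lborel))"
    unfolding E by (intro nn_integral_cong) (simp add: nn_integral_cmult)
  finally show ?thesis .
qed

section \<open>The polar of the Steiner symmetral of the polar\<close>

text \<open>For \<open>u\<close> and \<open>v\<close> that agree off \<open>b\<close>, this is the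
  midpoint of \<open>u\<close> and the mirror image of \<open>v\<close>. As \<open>u\<close> and
  \<open>v\<close> range over a convex set, these midpoints fill its Steiner symmetral.\<close>

definition sym_mid :: "'a::euclidean_space \<Rightarrow> 'a \<Rightarrow> 'a \<Rightarrow> 'a" where
  "sym_mid b u v = u - ((u \<bullet> b + v \<bullet> b) / 2) *\<^sub>R b"

text \<open>The Steiner symmetral, in direction \<open>b\<close>, of the polar of \<open>K\<close>.\<close>

definition polar_symmetral :: "'a::euclidean_space \<Rightarrow> 'a set \<Rightarrow> 'a set" where
  "polar_symmetral b K = {sym_mid b u v | u v. u \<in> polar K \<and> v \<in> polar K \<and> (\<forall>d\<in>Basis - {b}. u \<bullet> d = v \<bullet> d)}"

lemma sym_mid_inner:
  assumes "b \<in> Basis" "d \<in> Basis"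
  shows "sym_mid b u v \<bullet> d = (if d = b then (u \<bullet> b - v \<bullet> b) / 2 else u \<bullet> d)"
  using assms by (auto simp: sym_mid_def inner_diff_left inner_Basis field_simps)

lemma sym_mid_scaleR: "sym_mid b (c *\<^sub>R u) (c *\<^sub>R v) = c *\<^sub>R sym_mid b u v"
  by (simp add: sym_mid_def scaleR_diff_right flip: distrib_left)

lemma polar_eq_halfspaces: "polar K = (\<Inter>w\<in>K. {x. w \<bullet> x \<le> 1})"
  by (auto simp: polar_def inner_commute)

lemma closed_polar: "closed (polar (K :: 'a::euclidean_space set))"
  unfolding polar_eq_halfspaces by (intro closed_INT ballI closed_halfspace_le)

lemma convex_polar: "convex (polar (K :: 'a::euclidean_space set))"
  unfolding polar_eq_halfspaces by (intro convex_INT convex_halfspace_le)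

lemma polar_cball:
  fixes K :: "'a::euclidean_space set"
  shows "0 < r \<Longrightarrow> cball 0 r \<subseteq> K \<Longrightarrow> polar K \<subseteq> cball 0 (1 / r)"
    and "0 < r \<Longrightarrow> K \<subseteq> cball 0 r \<Longrightarrow> cball 0 (1 / r) \<subseteq> polar K"
proof -
  assume r: "0 < r" "cball 0 r \<subseteq> K"
  show "polar K \<subseteq> cball 0 (1 / r)"
  proof
    fix u assume u: "u \<in> polar K"
    show "u \<in> cball 0 (1 / r)"
    proof (cases "u = 0")
      case False
      have "(r / norm u) *\<^sub>R u \<in> K" using r False by (intro subsetD[OF r(2)]) auto
      then have "u \<bullet> ((r / norm u) *\<^sub>R u) \<le> 1" using u by (auto simp: polar_def)
      then have "r * norm u \<le> 1" using False by (simp add: power2_norm_eq_inner[symmetric] power2_eq_square)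
      then show ?thesis using r by (simp add: field_simps)
    qed (use r in auto)
  qed
next
  assume r: "0 < r" "K \<subseteq> cball 0 r"
  show "cball 0 (1 / r) \<subseteq> polar K"
  proof
    fix u :: 'a assume "u \<in> cball 0 (1 / r)"
    then have u: "norm u \<le> 1 / r" by simp
    show "u \<in> polar K" unfolding polar_def
    proof safe
      fix y assume "y \<in> K"
      then have y: "norm y \<le> r" using r by auto
      have "u \<bullet> y \<le> norm u * norm y" by (rule norm_cauchy_schwarz)
      also have "\<dots> \<le> 1 / r * r" using u y r by (intro mult_mono) auto
      finally show "u \<bullet> y \<le> 1" using r by simp
    qed
  qed
qed

definition reflect :: "'a::euclidean_space \<Rightarrow> 'a \<Rightarrow> 'a" where
  "reflect b x = x - (2 * (x \<bullet> b)) *\<^sub>R b"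

lemma reflect_inner:
  assumes "b \<in> Basis" "d \<in> Basis"
  shows "reflect b x \<bullet> d = (if d = b then - (x \<bullet> b) else x \<bullet> d)"
  using assms by (auto simp: reflect_def inner_diff_left inner_Basis)

lemma norm_reflect:
  assumes "b \<in> Basis" shows "norm (reflect b x) = norm x"
  unfolding norm_eq_sqrt_inner by (subst (1 2) euclidean_inner) (auto simp: reflect_inner assms intro!: sum.cong)

lemma reflect_reflect: "b \<in> Basis \<Longrightarrow> reflect b (reflect b x) = x"
  by (rule euclidean_eqI) (auto simp: reflect_inner)

lemma inner_reflect:
  assumes "b \<in> Basis" shows "reflect b x \<bullet> y = x \<bullet> reflect b y"
  by (subst (1 2) euclidean_inner) (auto simp: reflect_inner assms intro!: sum.cong)

lemma emeasure_reflect_vimage: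
  fixes S :: "'a::euclidean_space set"
  assumes [measurable]: "S \<in> sets borel" and b: "b \<in> Basis"
  shows "emeasure lborel (reflect b -` S) = emeasure lborel S"
proof -
  let ?c = "\<lambda>j. if j = b then - 1 else (1::real)"
  have T: "0 + (\<Sum>j\<in>Basis. (?c j * (x \<bullet> j)) *\<^sub>R j) = reflect b x" for x
    by (rule euclidean_eqI) (auto simp: reflect_inner b)
  have 1: "lborel = density (distr lborel borel (reflect b)) (\<lambda>_. (\<Prod>j\<in>Basis. \<bar>?c j\<bar>))"
    using lborel_affine_euclidean[of ?c 0] unfolding T by simp
  have "(\<Prod>j\<in>(Basis::'a set). \<bar>?c j\<bar>) = 1" by (intro prod.neutral) auto
  then have 2: "lborel = distr lborel borel (reflect b)" using 1 by (simp add: density_1)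
  have [measurable]: "reflect b \<in> borel_measurable borel" unfolding reflect_def by measurable
  have "emeasure lborel S = emeasure (distr lborel borel (reflect b)) S" using 2 by simp
  also have "\<dots> = emeasure lborel (reflect b -` S)" by (subst emeasure_distr) auto
  finally show ?thesis ..
qed

context
  fixes K :: "'a::euclidean_space set" and b :: 'a and r R :: real
  assumes K: "compact K" "convex K" and r: "0 < r" "cball 0 r \<subseteq> K" and R: "0 < R" "K \<subseteq> cball 0 R" and b: "b \<in> Basis"
begin

text \<open>Some positive radii are enough to make the polar of the symmetral a convex body;
  \<open>2 / r\<close> is what the triangle inequality gives for \<open>sym_mid\<close>.\<close>

lemma polar_symmetral_bounds: "polar_symmetral b K \<subseteq> cball 0 (2 / r)" "cball 0 (1 / R) \<subseteq> polar_symmetral b K"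
proof -
  show "polar_symmetral b K \<subseteq> cball 0 (2 / r)"
  proof
    fix w assume "w \<in> polar_symmetral b K"
    then obtain u v where uv: "w = sym_mid b u v" "u \<in> polar K" "v \<in> polar K" by (auto simp: polar_symmetral_def)
    have n: "norm u \<le> 1 / r" "norm v \<le> 1 / r" using uv polar_cball(1)[OF r] by auto
    have "norm w \<le> norm u + norm (((u \<bullet> b + v \<bullet> b) / 2) *\<^sub>R b)" unfolding uv sym_mid_def by (rule norm_triangle_ineq4)
    also have "norm (((u \<bullet> b + v \<bullet> b) / 2) *\<^sub>R b) = \<bar>u \<bullet> b + v \<bullet> b\<bar> / 2" using b by simp
    also have "\<dots> \<le> (norm u + norm v) / 2"
      using Basis_le_norm[OF b, of u] Basis_le_norm[OF b, of v] abs_triangle_ineq[of "u \<bullet> b" "v \<bullet> b"] by simp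
    finally have "norm w \<le> norm u + (norm u + norm v) / 2" by simp
    also have "\<dots> \<le> 1 / r + (1 / r + 1 / r) / 2" using n by (intro add_mono divide_right_mono) auto
    also have "\<dots> = 2 / r" by simp
    finally have "norm w \<le> 2 / r" .
    then show "w \<in> cball 0 (2 / r)" by simp
  qed
  show "cball 0 (1 / R) \<subseteq> polar_symmetral b K"
  proof
    fix u :: 'a assume u: "u \<in> cball 0 (1 / R)"
    then have "u \<in> polar K" "reflect b u \<in> polar K" using polar_cball(2)[OF R] norm_reflect[OF b] by (auto simp: subset_iff)
    \<comment> \<open>The small ball is symmetric, so each of its points is the symmetrized midpoint
      of itself and its mirror image.\<close>
    moreover have "sym_mid b u (reflect b u) = u"
      by (rule euclidean_eqI) (auto simp: sym_mid_inner reflect_inner b)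
    moreover have "\<forall>d\<in>Basis - {b}. u \<bullet> d = reflect b u \<bullet> d" by (auto simp: reflect_inner b)
    ultimately show "u \<in> polar_symmetral b K" unfolding polar_symmetral_def
      by (intro CollectI exI[of _ u] exI[of _ "reflect b u"] conjI) simp_all
  qed
qed

lemma polar_polar_symmetral_bounds:
  "cball 0 (r / 2) \<subseteq> polar (polar_symmetral b K)" "polar (polar_symmetral b K) \<subseteq> cball 0 R"
  using polar_cball(2)[of "2 / r", OF _ polar_symmetral_bounds(1)] polar_cball(1)[of "1 / R", OF _ polar_symmetral_bounds(2)] r R
  by auto

lemma convex_body_symmetral: "convex_body (polar (polar_symmetral b K))"
  unfolding convex_body_def
proof (intro conjI)
  show "compact (polar (polar_symmetral b K))"
    using polar_polar_symmetral_bounds(2) closed_polar by (meson bounded_cball bounded_subset compact_eq_bounded_closed)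
  have "ball 0 (r / 2) \<subseteq> interior (polar (polar_symmetral b K))"
    using polar_polar_symmetral_bounds(1) by (intro interior_maximal) auto
  then show "interior (polar (polar_symmetral b K)) \<noteq> {}" using r by auto
qed (rule convex_polar)

text \<open>Dividing by \<open>\<rho>\<close> puts \<open>u\<close> and \<open>v\<close> into the
  polar of \<open>K\<close>, hence their midpoint into the symmetral, whose polar pairs with it to
  at most 1. The argument needs one threshold common to \<open>u\<close> and \<open>v\<close>. For
  \<open>\<rho> = 0\<close> both vectors vanish, since \<open>K\<close> contains a ball around the
  origin.\<close>

lemma support_symmetral_le:
  assumes "support K u \<le> \<rho>" "support K v \<le> \<rho>" "\<forall>d\<in>Basis - {b}. u \<bullet> d = v \<bullet> d"
  shows "support (polar (polar_symmetral b K)) (sym_mid b u v) \<le> \<rho>"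
proof -
  have bK: "bounded K" using K compact_imp_bounded by blast
  have K0: "K \<noteq> {}" using r by auto
  have ge: "r * norm w \<le> support K w" for w using support_ge_ball[OF bK r(2), of w] r by simp
  have b': "bounded (polar (polar_symmetral b K))" "polar (polar_symmetral b K) \<noteq> {}"
    using convex_bodyD[OF convex_body_symmetral] by auto
  have "0 \<le> r * norm u" using r by simp
  then have "0 \<le> \<rho>" using ge[of u] assms(1) by linarith
  then consider "\<rho> = 0" | "0 < \<rho>" by linarith
  then show ?thesis
  proof cases
    case 1
    then have "r * norm u \<le> 0" "r * norm v \<le> 0" using ge[of u] ge[of v] assms by auto
    then have "u = 0" "v = 0" using r by (auto simp: mult_le_0_iff)
    then have "sym_mid b u v = 0" by (simp add: sym_mid_def)
    then show ?thesis using 1 b' by (auto simp: support_le_iff)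
  next
    case 2
    have "w \<in> polar K \<longleftrightarrow> support K w \<le> 1" for w
      using bK r by (subst support_le_iff) (auto simp: polar_def inner_commute)
    then have "(1 / \<rho>) *\<^sub>R u \<in> polar K" "(1 / \<rho>) *\<^sub>R v \<in> polar K"
      using assms 2 support_scaleR[OF bK K0, of "1 / \<rho>"] by (auto simp: pos_divide_le_eq)
    moreover have "\<forall>d\<in>Basis - {b}. ((1 / \<rho>) *\<^sub>R u) \<bullet> d = ((1 / \<rho>) *\<^sub>R v) \<bullet> d" using assms(3) by simp
    ultimately have "(1 / \<rho>) *\<^sub>R sym_mid b u v \<in> polar_symmetral b K"
      unfolding polar_symmetral_def sym_mid_scaleR[symmetric] by blast
    then have "x \<bullet> ((1 / \<rho>) *\<^sub>R sym_mid b u v) \<le> 1" if "x \<in> polar (polar_symmetral b K)" for x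
      using that by (auto simp: polar_def)
    then show ?thesis using 2 b' by (auto simp: support_le_iff field_simps)
  qed
qed

text \<open>The symmetrization acts on direction \<open>b\<close> in all \<open>m\<close> vector
  components at once, which is the coordinate set \<open>J\<close>. Because \<open>sym_mid\<close>
  is linear in the pair of its vectors, the sum of the components is transformed in the same way, so
  all \<open>m + 1\<close> constraints carry over to \<open>K'\<close>.\<close>

lemma exp_integral_symmetral: "exp_integral TYPE('m::finite) K \<le> exp_integral TYPE('m) (polar (polar_symmetral b K))"
proof -
  let ?K' = "polar (polar_symmetral b K)"
  have bK: "bounded K" "K \<noteq> {}" using K compact_imp_bounded r by auto
  have b': "bounded ?K'" "?K' \<noteq> {}" using convex_bodyD[OF convex_body_symmetral] by auto
  define J where "J = range (\<lambda>i. axis i b :: 'a^'m)"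
  have J: "J \<subseteq> Basis" using b by (auto simp: J_def axis_in_Basis_iff)
  show ?thesis unfolding exp_integral_layers[OF bK] exp_integral_layers[OF b']
  proof (intro nn_integral_mono mult_left_mono)
    fix \<rho> :: "'m option \<Rightarrow> real"
    let ?A = "\<lambda>K. {\<theta> :: 'a^'m. \<forall>k. support K (component \<theta> k) \<le> \<rho> k}"
    show "emeasure lborel (?A K) \<le> emeasure lborel (?A ?K')"
    proof (rule emeasure_le_symmetrization[OF J])
      have cl: "closed (?A X)" if "bounded X" "X \<noteq> {}" for X :: "'a set"
        using that by (intro closed_Collect_all closed_Collect_le continuous_intros)
      show "?A K \<in> sets borel" "?A ?K' \<in> sets borel" using cl[OF bK] cl[OF b'] by auto
      show "bounded (?A K)"
        unfolding bounded_iff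
      proof (intro exI ballI)
        fix \<theta> assume \<theta>: "\<theta> \<in> ?A K"
        have "norm (\<theta> $ i) \<le> \<rho> (Some i) / r" for i
        proof -
          have "r * norm (\<theta> $ i) \<le> support K (component \<theta> (Some i))"
            using support_ge_ball[OF bK(1) r(2), of "component \<theta> (Some i)"] r by (simp add: component_def)
          also have "\<dots> \<le> \<rho> (Some i)" using \<theta> by auto
          finally show ?thesis using r by (simp add: field_simps)
        qed
        then show "norm \<theta> \<le> (\<Sum>i\<in>UNIV. \<rho> (Some i) / r)"
          using norm_vec_le_sum[of \<theta>] by (meson order_trans sum_mono)
      qed
      fix x y p :: "'a^'m"
      assume xy: "x \<in> ?A K" "y \<in> ?A K"
        and 1: "\<And>d. d \<in> Basis - J \<Longrightarrow> x \<bullet> d = y \<bullet> d \<and> p \<bullet> d = x \<bullet> d"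
        and 2: "\<And>d. d \<in> J \<Longrightarrow> p \<bullet> d = (x \<bullet> d - y \<bullet> d) / 2"
      have off: "x $ i \<bullet> d = y $ i \<bullet> d \<and> p $ i \<bullet> d = x $ i \<bullet> d" if "d \<in> Basis - {b}" for i d
      proof -
        have "axis i d \<in> (Basis :: ('a^'m) set) - J"
          using that b by (auto simp: J_def axis_in_Basis_iff axis_eq_axis)
        from 1[OF this] show ?thesis by (simp add: inner_axis)
      qed
      have on: "p $ i \<bullet> b = (x $ i \<bullet> b - y $ i \<bullet> b) / 2" for i
        using 2[of "axis i b"] by (simp add: J_def inner_axis)
      have cx: "component x k \<bullet> d = component y k \<bullet> d" if "d \<in> Basis - {b}" for k d
        using off[OF that] by (cases k) (auto simp: component_def inner_sum_left)
      have cp: "component p k = sym_mid b (component x k) (component y k)" for k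
      proof (rule euclidean_eqI)
        fix d :: 'a assume d: "d \<in> Basis"
        show "component p k \<bullet> d = sym_mid b (component x k) (component y k) \<bullet> d"
        proof (cases "d = b")
          case True
          show ?thesis
          proof (cases k)
            case None
            then show ?thesis by (simp add: on True component_def inner_sum_left sum_subtractf sym_mid_inner[OF b b] flip: sum_divide_distrib)
          next
            case (Some i)
            then show ?thesis using on[of i] by (simp add: True component_def sym_mid_inner[OF b b] field_simps)
          qed
        next
          case False
          then show ?thesis unfolding sym_mid_inner[OF b d]
            using off[of d] d by (cases k) (auto simp: component_def inner_sum_left)
        qed
      qed
      show "p \<in> ?A ?K'" unfolding cp mem_Collect_eq
        using xy cx by (intro allI support_symmetral_le) auto
    qed
  qed simp
qed

lemma harmonic_join_symmetral: "harmonic_join b K (polar (polar_symmetral b K))"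
  unfolding harmonic_join_def
proof (intro ballI allI impI, elim conjE)
  fix x y s t p
  assume xy: "x \<in> K" "y \<in> K" "x \<bullet> b = s" "y \<bullet> b = - t" "0 < s" "0 < t" "p \<bullet> b = 2 * s * t / (s + t)"
    and off: "\<forall>d\<in>Basis - {b}. p \<bullet> d = t / (s + t) * (x \<bullet> d) + s / (s + t) * (y \<bullet> d)"
  have "p \<bullet> sym_mid b u v \<le> 1" if uv: "u \<in> polar K" "v \<in> polar K" "\<forall>d\<in>Basis - {b}. u \<bullet> d = v \<bullet> d" for u v
  proof -
    have "p \<bullet> sym_mid b u v = (\<Sum>d\<in>Basis. p \<bullet> d * (sym_mid b u v \<bullet> d))" by (rule euclidean_inner)
    also have "\<dots> = (\<Sum>d\<in>Basis. t / (s + t) * (x \<bullet> d * (u \<bullet> d)) + s / (s + t) * (y \<bullet> d * (v \<bullet> d)))"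
    proof (rule sum.cong[OF refl])
      fix d :: 'a assume d: "d \<in> Basis"
      show "p \<bullet> d * (sym_mid b u v \<bullet> d) = t / (s + t) * (x \<bullet> d * (u \<bullet> d)) + s / (s + t) * (y \<bullet> d * (v \<bullet> d))"
      proof (cases "d = b")
        case True
        \<comment> \<open>The weights are such that \<open>s\<close> and \<open>- t\<close>
          contribute with the same factor up to sign, \<open>q\<close> and \<open>- q\<close>. Since
          the symmetrized coordinate is half of \<open>u \<bullet> b - v \<bullet> b\<close>, the
          point \<open>p\<close> needs the coordinate \<open>2 * q\<close>, the harmonic
          mean.\<close>
        define q where "q = s * t / (s + t)"
        have q: "t / (s + t) * (s * X) = q * X" "s / (s + t) * (- t * X) = - (q * X)" "p \<bullet> b = 2 * q" for X
          using xy(7) by (simp_all add: q_def)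
        show ?thesis unfolding True sym_mid_inner[OF b b] xy(3,4) q by (simp add: field_simps)
      next
        case False
        then show ?thesis using off uv(3) d b by (simp add: sym_mid_inner distrib_right mult.assoc)
      qed
    qed
    also have "\<dots> = t / (s + t) * (x \<bullet> u) + s / (s + t) * (y \<bullet> v)"
      by (simp add: sum.distrib euclidean_inner[of x u] euclidean_inner[of y v] sum_distrib_left sum_divide_distrib)
    also have "\<dots> \<le> t / (s + t) * 1 + s / (s + t) * 1"
      using uv xy by (intro add_mono mult_left_mono) (auto simp: polar_def inner_commute)
    also have "\<dots> = 1" using xy by (simp flip: add_divide_distrib)
    finally show ?thesis .
  qed
  then have "p \<bullet> w \<le> 1" if "w \<in> polar_symmetral b K" for w
    using that by (auto simp: polar_symmetral_def)
  then show "p \<in> polar (polar_symmetral b K)"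
    unfolding polar_def[of "polar_symmetral b K"] by blast
qed

text \<open>Exchanging \<open>u\<close> and \<open>v\<close> reflects their symmetrized midpoint,
  and the symmetry passes to the polar.\<close>

lemma reflect_symmetral: "reflect b -` (polar (polar_symmetral b K)) = polar (polar_symmetral b K)"
proof -
  have 1: "reflect b w \<in> polar_symmetral b K" if "w \<in> polar_symmetral b K" for w
  proof -
    obtain u v where uv: "w = sym_mid b u v" "u \<in> polar K" "v \<in> polar K" "\<forall>d\<in>Basis - {b}. u \<bullet> d = v \<bullet> d"
      using \<open>w \<in> polar_symmetral b K\<close> by (auto simp: polar_symmetral_def)
    have "reflect b w = sym_mid b v u"
      unfolding uv(1) by (rule euclidean_eqI) (use uv(4) in \<open>auto simp: reflect_inner sym_mid_inner b field_simps\<close>)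
    then show ?thesis using uv unfolding polar_symmetral_def by force
  qed
  have 2: "reflect b x \<in> polar (polar_symmetral b K)" if "x \<in> polar (polar_symmetral b K)" for x
    using that 1 by (auto simp: polar_def inner_reflect[OF b])
  show ?thesis using 2 reflect_reflect[OF b] by (auto simp: vimage_def) metis
qed

end

section \<open>Half-volumes cut off by a hyperplane\<close>

lemma emeasure_half_reflect:
  fixes K :: "'a::euclidean_space set"
  assumes K[measurable]: "K \<in> sets borel" and b: "b \<in> Basis" and refl: "reflect b -` K = K"
  shows "2 * emeasure lborel (K \<inter> {x. 0 < x \<bullet> b}) \<le> emeasure lborel K"
proof -
  have "reflect b -` (K \<inter> {x. 0 < x \<bullet> b}) = K \<inter> {x. x \<bullet> b < 0}"
    using refl by (auto simp: reflect_inner b)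
  then have "emeasure lborel (K \<inter> {x. x \<bullet> b < 0}) = emeasure lborel (K \<inter> {x. 0 < x \<bullet> b})"
    using emeasure_reflect_vimage[OF _ b, of "K \<inter> {x. 0 < x \<bullet> b}"] by simp
  then have "2 * emeasure lborel (K \<inter> {x. 0 < x \<bullet> b}) = emeasure lborel (K \<inter> {x. 0 < x \<bullet> b}) + emeasure lborel (K \<inter> {x. x \<bullet> b < 0})"
    by (simp add: mult_2)
  also have "\<dots> = emeasure lborel ((K \<inter> {x. 0 < x \<bullet> b}) \<union> (K \<inter> {x. x \<bullet> b < 0}))"
    by (rule plus_emeasure) auto
  also have "\<dots> \<le> emeasure lborel K" by (rule emeasure_mono) auto
  finally show ?thesis .
qed

lemma emeasure_hyperplane_0:
  fixes b :: "'a::euclidean_space"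
  assumes "b \<noteq> 0"
  shows "emeasure lborel {x. x \<bullet> b = c} = 0"
proof -
  have "negligible {x. b \<bullet> x = c}" using assms by (intro negligible_hyperplane) auto
  moreover have "closed {x. b \<bullet> x = c}" by (rule closed_hyperplane)
  ultimately have "emeasure lborel {x. b \<bullet> x = c} = 0" by (simp add: negligible_iff_emeasure0)
  then show ?thesis by (simp add: inner_commute)
qed

text \<open>The distribution function of \<open>x \<bullet> b\<close> on \<open>K\<close> is
  continuous because hyperplanes are null, so it takes the value of half the volume.\<close>

lemma bisecting_hyperplane:
  fixes K :: "'a::euclidean_space set"
  assumes K: "K \<in> sets borel" "bounded K" and b: "b \<noteq> 0"
  obtains c where "emeasure lborel (K \<inter> {x. c < x \<bullet> b}) = ennreal (measure lborel K / 2)"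
    "emeasure lborel (K \<inter> {x. x \<bullet> b < c}) = ennreal (measure lborel K / 2)"
proof -
  note [measurable] = K(1)
  obtain R where R: "\<And>x. x \<in> K \<Longrightarrow> norm x \<le> R" using K(2) bounded_iff by metis
  have fin: "emeasure lborel K < \<infinity>" using K emeasure_bounded_finite by (metis infinity_ennreal_def)
  have eK: "emeasure lborel K = ennreal (measure lborel K)" using fin by (simp add: emeasure_eq_ennreal_measure)
  define M where "M = distr (density lborel (indicator K)) borel (\<lambda>x. x \<bullet> b)"
  have em: "emeasure M A = emeasure lborel (K \<inter> {x. x \<bullet> b \<in> A})" if [measurable]: "A \<in> sets borel" for A
  proof -
    have "emeasure M A = (\<integral>\<^sup>+x. indicator K x * indicator {x. x \<bullet> b \<in> A} x \<partial>lborel)"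
      unfolding M_def by (subst emeasure_distr) (auto simp: emeasure_density vimage_def)
    also have "\<dots> = (\<integral>\<^sup>+x. indicator (K \<inter> {x. x \<bullet> b \<in> A}) x \<partial>lborel)"
      by (intro nn_integral_cong) (auto simp: indicator_def)
    also have "\<dots> = emeasure lborel (K \<inter> {x. x \<bullet> b \<in> A})" by (intro nn_integral_indicator) measurable
    finally show ?thesis .
  qed
  interpret M: finite_borel_measure M
    using em[of UNIV] fin
    by (intro finite_borel_measure.intro finite_borel_measure_axioms.intro finite_measureI) (auto simp: M_def)
  have null: "emeasure lborel (K \<inter> {x. x \<bullet> b = c}) = 0" for c
  proof -
    have "emeasure lborel (K \<inter> {x. x \<bullet> b = c}) \<le> emeasure lborel {x. x \<bullet> b = c}" by (intro emeasure_mono) auto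
    then show ?thesis using emeasure_hyperplane_0[OF b, of c] by simp
  qed
  have cont: "isCont (cdf M) c" for c
    using em[of "{c}"] null[of c] by (simp add: M.isCont_cdf measure_def)
  define Q where "Q = R * norm b + 1"
  have Q: "\<bar>x \<bullet> b\<bar> < Q" if "x \<in> K" for x
    using Cauchy_Schwarz_ineq2[of x b] mult_right_mono[OF R[OF that], of "norm b"] by (auto simp: Q_def)
  have "cdf M (- Q) = 0"
  proof -
    have "K \<inter> {x. x \<bullet> b \<in> {..- Q}} = {}" using Q by fastforce
    then show ?thesis using em[of "{..-Q}"] by (simp add: cdf_def measure_def)
  qed
  moreover have "cdf M Q = measure lborel K"
  proof -
    have "K \<inter> {x. x \<bullet> b \<in> {..Q}} = K" using Q by fastforce
    then show ?thesis using em[of "{..Q}"] by (simp add: cdf_def measure_def)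
  qed
  moreover have "- Q \<le> Q \<or> measure lborel K = 0"
  proof (cases "K = {}")
    case False
    then obtain x where "x \<in> K" by blast
    then show ?thesis using Q[of x] by linarith
  qed simp
  ultimately have "\<exists>c. cdf M c = measure lborel K / 2"
    using IVT'[of "cdf M" "-Q" "measure lborel K / 2" Q] cont
    by (auto simp: continuous_at_imp_continuous_on)
  then obtain c where c: "cdf M c = measure lborel K / 2" ..
  have le: "emeasure lborel (K \<inter> {x. x \<bullet> b \<le> c}) = ennreal (measure lborel K / 2)"
  proof -
    have "emeasure lborel (K \<inter> {x. x \<bullet> b \<le> c}) = emeasure M {..c}" using em[of "{..c}"] by simp
    also have "\<dots> = ennreal (measure M {..c})" by (rule M.emeasure_eq_measure)
    finally show ?thesis using c by (simp only: cdf_def)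
  qed
  have lt: "emeasure lborel (K \<inter> {x. x \<bullet> b < c}) = ennreal (measure lborel K / 2)"
  proof -
    have "emeasure lborel (K \<inter> {x. x \<bullet> b \<le> c}) = emeasure lborel ((K \<inter> {x. x \<bullet> b < c}) \<union> (K \<inter> {x. x \<bullet> b = c}))"
      by (rule arg_cong[where f = "emeasure lborel"]) auto
    also have "\<dots> = emeasure lborel (K \<inter> {x. x \<bullet> b < c}) + emeasure lborel (K \<inter> {x. x \<bullet> b = c})"
      by (intro plus_emeasure[symmetric]) auto
    finally show ?thesis using le null by simp
  qed
  have "emeasure lborel K = emeasure lborel ((K \<inter> {x. c < x \<bullet> b}) \<union> (K \<inter> {x. x \<bullet> b \<le> c}))"
    by (rule arg_cong[where f = "emeasure lborel"]) auto
  also have "\<dots> = emeasure lborel (K \<inter> {x. c < x \<bullet> b}) + emeasure lborel (K \<inter> {x. x \<bullet> b \<le> c})"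
    by (intro plus_emeasure[symmetric]) auto
  finally have "ennreal (measure lborel K / 2) + emeasure lborel (K \<inter> {x. c < x \<bullet> b}) = ennreal (measure lborel K / 2) + ennreal (measure lborel K / 2)"
    unfolding le eK by (simp add: add.commute flip: ennreal_plus)
  then have "emeasure lborel (K \<inter> {x. c < x \<bullet> b}) = ennreal (measure lborel K / 2)"
    by (subst (asm) ennreal_add_left_cancel) auto
  with lt that show ?thesis by blast
qed

section \<open>Maximizers are reflection invariant\<close>

definition body_value :: "'m::finite itself \<Rightarrow> 'a::euclidean_space set \<Rightarrow> real" where
  "body_value _ K = measure lborel (dpolar K :: ('a^'m) set) * measure lborel K ^ CARD('m)"

definition body_maximizer :: "'m::finite itself \<Rightarrow> 'a::euclidean_space set \<Rightarrow> bool" where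
  "body_maximizer m K \<longleftrightarrow> convex_body K \<and> (\<forall>K' :: 'a set. convex_body K' \<longrightarrow> body_value m K' \<le> body_value m K)"

lemma nn_integral_translation:
  fixes f :: "'a::euclidean_space \<Rightarrow> ennreal"
  assumes [measurable]: "f \<in> borel_measurable borel"
  shows "(\<integral>\<^sup>+x. f (c + x) \<partial>lborel) = (\<integral>\<^sup>+x. f x \<partial>lborel)"
  by (subst (2) lborel_distr_plus[of c, symmetric]) (simp add: nn_integral_distr)

lemma convex_body_translation: "convex_body K \<Longrightarrow> convex_body ((+) v ` K)"
  unfolding convex_body_def by (auto simp: compact_translation convex_translation interior_translation)

lemma measure_lborel_pos:
  assumes "convex_body K"
  shows "0 < measure lborel K"
proof -
  obtain p r where r: "0 < r" "cball p r \<subseteq> K" using convex_body_ball[OF assms] .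
  have "0 < measure lebesgue (ball p r)" using r content_ball_pos by auto
  also have "\<dots> = measure lborel (ball p r)" by simp
  also have "\<dots> \<le> measure lborel K"
    using order_trans[OF ball_subset_cball r(2)] convex_bodyD(1)[OF assms]
    by (intro measure_mono_fmeasurable fmeasurable_compact) auto
  finally show ?thesis .
qed

lemma emeasure_lborel_eq:
  assumes "convex_body K"
  shows "emeasure lborel K = ennreal (measure lborel K)"
  using emeasure_bounded_finite[OF convex_bodyD(4)[OF assms]] by (simp add: emeasure_eq_ennreal_measure)

lemma body_value_translation:
  fixes K :: "'a::euclidean_space set" and m :: "'m::finite itself"
  assumes "convex_body K"
  shows "body_value m ((+) v ` K) = body_value m K"
proof -
  have "dpolar ((+) v ` K) = (dpolar K :: ('a^'m) set)"
    unfolding dpolar_def using convex_bodyD[OF assms] by (simp add: diff_norm_translation)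
  moreover have "measure lborel ((+) v ` K) = measure lborel K"
  proof -
    have "measure lebesgue ((+) v ` K) = measure lebesgue K" by (rule measure_translation)
    then show ?thesis
      using convex_bodyD(7)[OF assms] convex_bodyD(7)[OF convex_body_translation[OF assms], of v] by simp
  qed
  ultimately show ?thesis by (simp add: body_value_def)
qed

lemma nn_integral_translated_set:
  fixes K :: "'a::euclidean_space set"
  assumes [measurable]: "K \<in> sets borel" "g \<in> borel_measurable borel"
  shows "(\<integral>\<^sup>+y. g y * indicator ((+) v ` K) y \<partial>lborel) = (\<integral>\<^sup>+x. g (v + x) * indicator K x \<partial>lborel)"
proof -
  have v: "(+) v ` K = (\<lambda>x. - v + x) -` K" by (auto simp: image_iff intro!: bexI[of _ "x - v" for x])
  have "(\<lambda>x. - v + x) \<in> borel \<rightarrow>\<^sub>M borel" by measurable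
  from measurable_sets[OF this assms(1)] have [measurable]: "(+) v ` K \<in> sets borel"
    by (simp only: v space_borel Int_UNIV_right)
  have "(\<integral>\<^sup>+y. g y * indicator ((+) v ` K) y \<partial>lborel) = (\<integral>\<^sup>+x. g (v + x) * indicator ((+) v ` K) (v + x) \<partial>lborel)"
    by (rule nn_integral_translation[symmetric]) measurable
  also have "\<dots> = (\<integral>\<^sup>+x. g (v + x) * indicator K x \<partial>lborel)"
    unfolding v by (intro nn_integral_cong) (auto split: split_indicator)
  finally show ?thesis .
qed

text \<open>The origin has to be moved to a point that lies on the bisecting hyperplane and also
  inside the body, since the polar of \<open>K\<close> must be bounded. As the frontier is null,
  both sides contain interior points, and the segment between two of them crosses the
  hyperplane.\<close>

lemma exists_interior_on_bisector:
  fixes K :: "'a::euclidean_space set"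
  assumes K: "convex_body K"
    and pos: "emeasure lborel (K \<inter> {x. c < x \<bullet> b}) \<noteq> 0" "emeasure lborel (K \<inter> {x. x \<bullet> b < c}) \<noteq> 0"
  obtains z where "z \<in> interior K" "z \<bullet> b = c"
proof -
  note KD = convex_bodyD[OF K]
  have null: "emeasure lborel (frontier K) = 0"
    using negligible_convex_frontier[OF KD(2)] frontier_closed[of K] by (simp add: negligible_iff_emeasure0)
  have ex: "\<exists>x\<in>interior K. x \<in> S" if "emeasure lborel (K \<inter> S) \<noteq> 0" for S
  proof (rule ccontr)
    assume "\<not> (\<exists>x\<in>interior K. x \<in> S)"
    then have "K \<inter> S \<subseteq> frontier K" using KD(5) by (auto simp: frontier_def)
    then have "emeasure lborel (K \<inter> S) \<le> emeasure lborel (frontier K)" by (intro emeasure_mono) auto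
    then show False using null that by simp
  qed
  obtain x where x: "x \<in> interior K" "c < x \<bullet> b" using ex[OF pos(1)] by auto
  obtain y where y: "y \<in> interior K" "y \<bullet> b < c" using ex[OF pos(2)] by auto
  define t where "t = (c - y \<bullet> b) / (x \<bullet> b - y \<bullet> b)"
  have t: "0 \<le> t" "t \<le> 1" using x y by (auto simp: t_def field_simps)
  have "(1 - t) *\<^sub>R y + t *\<^sub>R x \<in> interior K"
    using convexD_alt[OF convex_interior[OF KD(2)] y(1) x(1) t] .
  moreover have "((1 - t) *\<^sub>R y + t *\<^sub>R x) \<bullet> b = c"
  proof -
    have "((1 - t) *\<^sub>R y + t *\<^sub>R x) \<bullet> b = y \<bullet> b + t * (x \<bullet> b - y \<bullet> b)" by (simp add: inner_add_left algebra_simps)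
    also have "\<dots> = c" using x y by (simp add: t_def)
    finally show ?thesis .
  qed
  ultimately show ?thesis using that by blast
qed

text \<open>Maximality bounds the volume of the polar of the symmetral by that of \<open>K\<close>, which is the equality case
  of the harmonic-mean inequality for the sections.\<close>

lemma maximizer_axis_reflection_centered:
  fixes K :: "'a::euclidean_space set"
  assumes K: "body_maximizer TYPE('m::finite) K" and b: "b \<in> Basis" "c \<in> Basis" "b \<noteq> c"
    and z: "0 \<in> interior K"
    and V: "emeasure lborel (K \<inter> {x. 0 < x \<bullet> b}) = ennreal (measure lborel K / 2)"
      "emeasure lborel (K \<inter> {x. x \<bullet> b < 0}) = ennreal (measure lborel K / 2)"
  obtains D where "\<And>G :: real \<Rightarrow> real \<Rightarrow> ennreal. case_prod G \<in> borel_measurable borel \<Longrightarrow>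
    (\<integral>\<^sup>+x. G (x \<bullet> b) (x \<bullet> c) * indicator K x \<partial>lborel)
    = (\<integral>\<^sup>+x. G (- (x \<bullet> b)) (x \<bullet> c + D * (x \<bullet> b)) * indicator K x \<partial>lborel)"
proof -
  have cK: "convex_body K" using K by (simp add: body_maximizer_def)
  note KD = convex_bodyD[OF cK]
  obtain r where r: "0 < r" "cball 0 r \<subseteq> K" using z mem_interior_cball by metis
  obtain R0 where R0: "\<And>x. x \<in> K \<Longrightarrow> norm x \<le> R0" using KD(4) bounded_iff by metis
  define R where "R = \<bar>R0\<bar> + 1"
  have R: "0 < R" "K \<subseteq> cball 0 R" using R0 by (force simp: R_def)+
  let ?K' = "polar (polar_symmetral b K)"
  note P = KD(1,2) r R b(1)
  have cK': "convex_body ?K'" by (rule convex_body_symmetral[OF P])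
  note KD' = convex_bodyD[OF cK']
  have "measure lborel ?K' \<le> measure lborel K"
  proof (rule ccontr)
    assume "\<not> measure lborel ?K' \<le> measure lborel K"
    then have lt: "measure lborel K ^ CARD('m) < measure lborel ?K' ^ CARD('m)"
      by (intro power_strict_mono) auto
    have em: "emeasure lborel (dpolar X :: ('a^'m) set) = ennreal (measure lborel (dpolar X :: ('a^'m) set))"
      if "convex_body X" for X :: "'a set"
      using emeasure_bounded_finite[OF compact_imp_bounded[OF compact_dpolar[OF that, where 'm = 'm]]]
      by (intro emeasure_eq_ennreal_measure) auto
    have "ennreal (fact (DIM('a^'m))) * emeasure lborel (dpolar K :: ('a^'m) set)
       \<le> ennreal (fact (DIM('a^'m))) * emeasure lborel (dpolar ?K' :: ('a^'m) set)"
      using exp_integral_symmetral[OF P, where 'm = 'm] unfolding exp_integral_eq[OF cK] exp_integral_eq[OF cK'] .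
    then have "ennreal (fact (DIM('a^'m)) * measure lborel (dpolar K :: ('a^'m) set))
        \<le> ennreal (fact (DIM('a^'m)) * measure lborel (dpolar ?K' :: ('a^'m) set))"
      unfolding em[OF cK] em[OF cK'] by (simp add: ennreal_mult)
    then have le: "measure lborel (dpolar K :: ('a^'m) set) \<le> measure lborel (dpolar ?K' :: ('a^'m) set)"
      by simp
    have "body_value TYPE('m) K < measure lborel (dpolar K :: ('a^'m) set) * measure lborel ?K' ^ CARD('m)"
      unfolding body_value_def using lt measure_dpolar_pos[OF cK, where 'm = 'm] by (intro mult_strict_left_mono)
    also have "\<dots> \<le> body_value TYPE('m) ?K'"
      unfolding body_value_def using le by (intro mult_right_mono) auto
    finally show False using K cK' by (auto simp: body_maximizer_def not_less)
  qed
  then have "emeasure lborel ?K' \<le> ennreal (measure lborel K)"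
    unfolding emeasure_lborel_eq[OF cK'] by (rule ennreal_leI)
  \<comment> \<open>The new body is symmetric in the hyperplane, so the bound on its volume becomes
    the bound on its upper half that the slice comparison needs.\<close>
  moreover have "2 * emeasure lborel (?K' \<inter> {x. 0 < x \<bullet> b}) \<le> emeasure lborel ?K'"
    by (rule emeasure_half_reflect[OF KD'(7) b(1) reflect_symmetral[OF P]])
  ultimately have h: "2 * emeasure lborel (?K' \<inter> {x. 0 < x \<bullet> b}) \<le> ennreal (measure lborel K)" by (rule order_trans[rotated])
  have V': "emeasure lborel (?K' \<inter> {x. 0 < x \<bullet> b}) \<le> ennreal (measure lborel K / 2)"
  proof (cases "emeasure lborel (?K' \<inter> {x. 0 < x \<bullet> b})" rule: ennreal_cases)
    case (real v)
    have "ennreal (2 * v) \<le> ennreal (measure lborel K)" using h real by (simp add: ennreal_mult)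
    then show ?thesis using real by (simp add: ennreal_leI)
  next
    case top
    then show ?thesis using h by (simp add: ennreal_mult_top top_unique)
  qed
  have V0: "0 < measure lborel K / 2" using measure_lborel_pos[OF cK] by simp
  show ?thesis
    by (rule axis_reflection[OF KD(7,4,2) KD'(7,4,2) harmonic_join_symmetral[OF P] b V V0 V']) (rule that)
qed

lemma maximizer_axis_reflection:
  fixes K :: "'a::euclidean_space set"
  assumes K: "body_maximizer TYPE('m::finite) K" and b: "b \<in> Basis" "c \<in> Basis" "b \<noteq> c"
  obtains s D where "\<And>G :: real \<Rightarrow> real \<Rightarrow> ennreal. case_prod G \<in> borel_measurable borel \<Longrightarrow>
    (\<integral>\<^sup>+x. G (x \<bullet> b - s) (x \<bullet> c) * indicator K x \<partial>lborel)
    = (\<integral>\<^sup>+x. G (- (x \<bullet> b - s)) (x \<bullet> c + D * (x \<bullet> b - s)) * indicator K x \<partial>lborel)"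
proof -
  have cK: "convex_body K" using K by (simp add: body_maximizer_def)
  note KD = convex_bodyD[OF cK]
  have b0: "b \<noteq> 0" using b by auto
  obtain s where s: "emeasure lborel (K \<inter> {x. s < x \<bullet> b}) = ennreal (measure lborel K / 2)"
    "emeasure lborel (K \<inter> {x. x \<bullet> b < s}) = ennreal (measure lborel K / 2)"
    using bisecting_hyperplane[OF KD(7,4) b0] .
  have pos: "0 < measure lborel K" by (rule measure_lborel_pos[OF cK])
  obtain z where z: "z \<in> interior K" "z \<bullet> b = s"
    by (rule exists_interior_on_bisector[OF cK, of s b]) (use s pos in auto)
  let ?K = "(+) (- z) ` K"
  have cK': "convex_body ?K" by (rule convex_body_translation[OF cK])
  have mK': "body_maximizer TYPE('m) ?K"
    using K cK' body_value_translation[OF cK, of "TYPE('m)" "- z"] by (simp add: body_maximizer_def)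
  have ind: "emeasure lborel (?K \<inter> {x. P x}) = emeasure lborel (K \<inter> {x. P (- z + x)})"
    if [measurable]: "Measurable.pred borel P" for P
  proof -
    have [measurable]: "K \<in> sets borel" "?K \<in> sets borel" using KD(7) convex_bodyD(7)[OF cK'] by auto
    have [measurable]: "Measurable.pred borel (\<lambda>x. P (- z + x))" by measurable
    have "emeasure lborel (?K \<inter> {x. P x}) = (\<integral>\<^sup>+y. indicator (?K \<inter> {x. P x}) y \<partial>lborel)"
      by (rule nn_integral_indicator[symmetric]) measurable
    also have "\<dots> = (\<integral>\<^sup>+y. indicator {x. P x} y * indicator ?K y \<partial>lborel)"
      by (simp only: indicator_inter_arith mult.commute)
    also have "\<dots> = (\<integral>\<^sup>+x. indicator {x. P x} (- z + x) * indicator K x \<partial>lborel)"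
      by (rule nn_integral_translated_set) measurable
    also have "\<dots> = (\<integral>\<^sup>+x. indicator (K \<inter> {x. P (- z + x)}) x \<partial>lborel)"
      by (intro nn_integral_cong) (auto simp: indicator_def)
    also have "\<dots> = emeasure lborel (K \<inter> {x. P (- z + x)})"
      by (rule nn_integral_indicator) measurable
    finally show ?thesis .
  qed
  have mv: "measure lborel ?K = measure lborel K"
    using ind[of "\<lambda>_. True"] by (simp add: measure_def)
  have Vp: "emeasure lborel (?K \<inter> {x. 0 < x \<bullet> b}) = ennreal (measure lborel ?K / 2)"
    using ind[of "\<lambda>x. 0 < x \<bullet> b"] s(1) z(2) mv by (simp add: inner_diff_left)
  have Vn: "emeasure lborel (?K \<inter> {x. x \<bullet> b < 0}) = ennreal (measure lborel ?K / 2)"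
    using ind[of "\<lambda>x. x \<bullet> b < 0"] s(2) z(2) mv by (simp add: inner_diff_left)
  have z0: "0 \<in> interior ?K" unfolding interior_translation using z(1) by force
  obtain D where D: "\<And>G :: real \<Rightarrow> real \<Rightarrow> ennreal. case_prod G \<in> borel_measurable borel \<Longrightarrow>
    (\<integral>\<^sup>+x. G (x \<bullet> b) (x \<bullet> c) * indicator ?K x \<partial>lborel)
    = (\<integral>\<^sup>+x. G (- (x \<bullet> b)) (x \<bullet> c + D * (x \<bullet> b)) * indicator ?K x \<partial>lborel)"
    by (rule maximizer_axis_reflection_centered[OF mK' b z0 Vp Vn]) (rule that)
  show ?thesis
  proof (rule that[of s D])
    fix G :: "real \<Rightarrow> real \<Rightarrow> ennreal" assume G: "case_prod G \<in> borel_measurable borel"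
    \<comment> \<open>Moving \<open>z\<close> to the origin also shifts the coordinate along
      \<open>c\<close>; \<open>?G\<close> undoes that shift, and only the offset \<open>s\<close>
      along \<open>b\<close> survives.\<close>
    let ?G = "\<lambda>x y. G x (y + z \<bullet> c)"
    have shift: "case_prod (\<lambda>x y. G (f (x, y)) (g (x, y))) \<in> borel_measurable borel"
      if "continuous_on UNIV f" "continuous_on UNIV g" for f g :: "real \<times> real \<Rightarrow> real"
    proof -
      have "(\<lambda>x. (f x, g x)) \<in> borel \<rightarrow>\<^sub>M borel" using that by (intro borel_measurable_continuous_onI continuous_intros)
      from measurable_compose[OF this G] show ?thesis by (simp add: case_prod_beta')
    qed
    have shift': "(\<lambda>x. G (f x) (g x)) \<in> borel_measurable borel"
      if "continuous_on UNIV f" "continuous_on UNIV g" for f g :: "'a \<Rightarrow> real"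
    proof -
      have "(\<lambda>x. (f x, g x)) \<in> borel \<rightarrow>\<^sub>M borel" using that by (intro borel_measurable_continuous_onI continuous_intros)
      from measurable_compose[OF this G] show ?thesis by simp
    qed
    have "case_prod ?G \<in> borel_measurable borel"
      using shift[of fst "\<lambda>x. snd x + z \<bullet> c"] by (simp add: continuous_intros)
    from D[OF this]
    have "(\<integral>\<^sup>+x. G (x \<bullet> b) (x \<bullet> c + z \<bullet> c) * indicator ?K x \<partial>lborel)
      = (\<integral>\<^sup>+x. G (- (x \<bullet> b)) (x \<bullet> c + D * (x \<bullet> b) + z \<bullet> c) * indicator ?K x \<partial>lborel)" .
    moreover have "(\<integral>\<^sup>+x. G (x \<bullet> b) (x \<bullet> c + z \<bullet> c) * indicator ?K x \<partial>lborel)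
      = (\<integral>\<^sup>+x. G ((- z + x) \<bullet> b) ((- z + x) \<bullet> c + z \<bullet> c) * indicator K x \<partial>lborel)"
      by (intro nn_integral_translated_set KD(7) shift' continuous_intros)
    moreover have "(\<integral>\<^sup>+x. G (- (x \<bullet> b)) (x \<bullet> c + D * (x \<bullet> b) + z \<bullet> c) * indicator ?K x \<partial>lborel)
      = (\<integral>\<^sup>+x. G (- ((- z + x) \<bullet> b)) ((- z + x) \<bullet> c + D * ((- z + x) \<bullet> b) + z \<bullet> c) * indicator K x \<partial>lborel)"
      by (intro nn_integral_translated_set KD(7) shift' continuous_intros)
    moreover have "(- z + x) \<bullet> b = x \<bullet> b - s" "(- z + x) \<bullet> c + z \<bullet> c = x \<bullet> c"
      "(- z + x) \<bullet> c + D * (x \<bullet> b - s) + z \<bullet> c = x \<bullet> c + D * (x \<bullet> b - s)" for x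
      using z(2) by (auto simp: inner_diff_left)
    ultimately show "(\<integral>\<^sup>+x. G (x \<bullet> b - s) (x \<bullet> c) * indicator K x \<partial>lborel)
      = (\<integral>\<^sup>+x. G (- (x \<bullet> b - s)) (x \<bullet> c + D * (x \<bullet> b - s)) * indicator K x \<partial>lborel)"
      by (simp only:)
  qed
qed

section \<open>Linear invariance\<close>

lemma Basis_vec_image: "(Basis :: ('a::euclidean_space^'m) set) = (\<lambda>(i, b). axis i b) ` (UNIV \<times> Basis)"
  by (auto simp: Basis_vec_def)

lemma inj_axis_pair: "inj_on (\<lambda>(i, b). axis i b :: 'a::euclidean_space^'m) (UNIV \<times> Basis)"
  by (rule inj_onI) (auto simp: axis_eq_axis)

lemma measurable_vec_lambda [measurable]:
  "(\<lambda>f. (\<chi> i. f i) :: 'a::euclidean_space^'m) \<in> Pi\<^sub>M UNIV (\<lambda>_. lborel) \<rightarrow>\<^sub>M borel"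
proof (subst borel_measurable_euclidean_space, rule ballI)
  fix d :: "'a^'m" assume "d \<in> Basis"
  then obtain i b where "d = axis i b" by (auto simp: Basis_vec_image)
  then show "(\<lambda>f. (\<chi> i. f i) \<bullet> d) \<in> borel_measurable (Pi\<^sub>M UNIV (\<lambda>_. lborel))"
    by (simp add: inner_axis) measurable
qed

text \<open>Seen as a product of \<open>m\<close> copies, the measure lets a map of
  \<open>\<real>^n\<close> act on all components with its Jacobian factor raised to the power
  \<open>m\<close>.\<close>

lemma lborel_vec_eq:
  "(lborel :: ('a::euclidean_space^'m) measure) = distr (Pi\<^sub>M (UNIV :: 'm set) (\<lambda>_. lborel)) borel (\<lambda>f. \<chi> i. f i)"
proof (rule lborel_eqI)
  interpret product_sigma_finite "\<lambda>_::'m. lborel :: 'a measure" by (rule product_sigma_finite_lborel)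
  fix l u :: "'a^'m" assume le: "\<And>b. b \<in> Basis \<Longrightarrow> l \<bullet> b \<le> u \<bullet> b"
  have le': "l $ i \<bullet> b \<le> u $ i \<bullet> b" if "b \<in> Basis" for i b
    using le[of "axis i b"] that by (simp add: axis_in_Basis_iff inner_axis)
  have "(\<lambda>f. \<chi> i. f i) -` box l u = Pi\<^sub>E UNIV (\<lambda>i. box (l $ i) (u $ i))"
    by (auto simp: box_def Basis_vec_image inner_axis PiE_iff)
  then have "emeasure (distr (Pi\<^sub>M (UNIV :: 'm set) (\<lambda>_. lborel)) borel (\<lambda>f. \<chi> i. f i)) (box l u)
     = emeasure (Pi\<^sub>M (UNIV :: 'm set) (\<lambda>_. lborel)) (Pi\<^sub>E UNIV (\<lambda>i. box (l $ i) (u $ i)))"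
    by (subst emeasure_distr) (auto simp: space_PiM)
  also have "\<dots> = (\<Prod>i\<in>UNIV. emeasure lborel (box (l $ i) (u $ i)))"
    by (rule emeasure_PiM) auto
  also have "\<dots> = (\<Prod>i\<in>UNIV. ennreal (\<Prod>b\<in>Basis. (u $ i - l $ i) \<bullet> b))"
    using le' by (intro prod.cong refl emeasure_lborel_box)
  also have "\<dots> = ennreal (\<Prod>i\<in>UNIV. \<Prod>b\<in>Basis. (u $ i - l $ i) \<bullet> b)"
    using le' by (intro prod_ennreal prod_nonneg) (auto simp: inner_diff_left)
  also have "(\<Prod>i\<in>UNIV. \<Prod>b\<in>Basis. (u $ i - l $ i) \<bullet> b) = (\<Prod>b\<in>Basis. (u - l) \<bullet> b)"
    unfolding Basis_vec_image by (subst prod.reindex[OF inj_axis_pair])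
      (auto simp: prod.cartesian_product inner_axis intro!: prod.cong)
  finally show "emeasure (distr (Pi\<^sub>M (UNIV :: 'm set) (\<lambda>_. lborel)) borel (\<lambda>f. \<chi> i. f i)) (box l u)
     = ennreal (\<Prod>b\<in>Basis. (u - l) \<bullet> b)" .
qed simp

lemma nn_integral_vec_map:
  fixes S :: "'a::euclidean_space \<Rightarrow> 'a" and g :: "'a^'m \<Rightarrow> ennreal"
  assumes [measurable]: "S \<in> borel \<rightarrow>\<^sub>M borel" "g \<in> borel_measurable borel"
    and S: "\<And>f. f \<in> borel_measurable borel \<Longrightarrow> (\<integral>\<^sup>+x. f (S x) \<partial>lborel) = c * (\<integral>\<^sup>+x. f x \<partial>lborel)"
  shows "(\<integral>\<^sup>+\<theta>. g (\<chi> i. S (\<theta> $ i)) \<partial>lborel) = c ^ CARD('m) * (\<integral>\<^sup>+\<theta>. g \<theta> \<partial>lborel)"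
proof -
  have [measurable]: "(\<lambda>\<theta>::'a^'m. \<theta> $ i) \<in> borel_measurable borel" for i
    by (intro borel_measurable_continuous_onI continuous_intros)
  have [measurable]: "(\<lambda>\<theta>::'a^'m. \<chi> i. S (\<theta> $ i)) \<in> borel_measurable borel"
  proof (subst borel_measurable_euclidean_space, rule ballI)
    fix d :: "'a^'m" assume "d \<in> Basis"
    then obtain i b where "d = axis i b" by (auto simp: Basis_vec_image)
    then show "(\<lambda>\<theta>::'a^'m. (\<chi> i. S (\<theta> $ i)) \<bullet> d) \<in> borel_measurable borel"
      by (simp add: inner_axis) measurable
  qed
  have "(\<integral>\<^sup>+\<theta>. g (\<chi> i. S (\<theta> $ i)) \<partial>lborel) = (\<integral>\<^sup>+f. g (\<chi> i. (\<lambda>i\<in>UNIV. S (f i)) i) \<partial>Pi\<^sub>M UNIV (\<lambda>_. lborel))"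
    by (subst lborel_vec_eq) (simp add: nn_integral_distr restrict_UNIV)
  also have "\<dots> = c ^ CARD('m) * (\<integral>\<^sup>+f. g (\<chi> i. f i) \<partial>Pi\<^sub>M UNIV (\<lambda>_. lborel))"
    by (rule nn_integral_PiM_map[OF product_sigma_finite_lborel, where F = "\<lambda>f. g (\<chi> i. f i)"]) (auto simp: S)
  also have "(\<integral>\<^sup>+f. g (\<chi> i. f i) \<partial>Pi\<^sub>M UNIV (\<lambda>_. lborel)) = (\<integral>\<^sup>+\<theta>. g \<theta> \<partial>lborel)"
    by (subst lborel_vec_eq) (simp add: nn_integral_distr)
  finally show ?thesis .
qed

lemma measurable_matrix_vector_mult [measurable]: "(*v) (A :: real^'n^'m) \<in> borel \<rightarrow>\<^sub>M borel"
  by (intro borel_measurable_continuous_onI linear_continuous_on linear_conv_bounded_linear[THEN iffD1]) simp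

section \<open>Change of variables under an invertible matrix\<close>

lemma Basis_real_vec: "(Basis :: (real^'n) set) = range (\<lambda>i. axis i 1)"
  by (auto simp: Basis_vec_def)

lemma nn_integral_diagonal_substitution:
  fixes A :: "real^'n^'n"
  assumes diag: "\<And>i j. i \<noteq> j \<Longrightarrow> A $ i $ j = 0" and d: "det A \<noteq> 0" and [measurable]: "f \<in> borel_measurable borel"
  shows "(\<integral>\<^sup>+x. f x \<partial>lborel) = ennreal \<bar>det A\<bar> * (\<integral>\<^sup>+x. f (A *v x) \<partial>lborel)"
proof -
  have det: "det A = (\<Prod>i\<in>UNIV. A $ i $ i)" using diag by (rule det_diagonal)
  \<comment> \<open>The diagonal entry belonging to the basis vector \<open>v\<close>, expressed
    without naming its index.\<close>
  define c where "c v = v \<bullet> (A *v v)" for v :: "real^'n"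
  have cA: "c (axis i 1) = A $ i $ i" for i
    by (simp add: c_def inner_axis' matrix_vector_mult_basis column_def)
  have c0: "c v \<noteq> 0" if "v \<in> Basis" for v
    using that d cA unfolding det by (auto simp: Basis_real_vec)
  have T: "0 + (\<Sum>v\<in>Basis. (c v * (x \<bullet> v)) *\<^sub>R v) = A *v x" for x
  proof (rule euclidean_eqI)
    fix v :: "real^'n" assume v: "v \<in> Basis"
    then obtain i where i: "v = axis i 1" by (auto simp: Basis_real_vec)
    have "(A *v x) $ i = (\<Sum>j\<in>UNIV. A $ i $ j * x $ j)" by (simp add: matrix_vector_mult_def)
    also have "\<dots> = (\<Sum>j\<in>UNIV. if j = i then A $ i $ i * x $ i else 0)"
      by (intro sum.cong) (auto simp: diag)
    finally have "(A *v x) $ i = A $ i $ i * x $ i" by simp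
    moreover have "(0 + (\<Sum>v\<in>Basis. (c v * (x \<bullet> v)) *\<^sub>R v)) \<bullet> v = c v * (x \<bullet> v)" using v by simp
    ultimately show "(0 + (\<Sum>v\<in>Basis. (c v * (x \<bullet> v)) *\<^sub>R v)) \<bullet> v = (A *v x) \<bullet> v"
      using cA[of i] by (simp add: i inner_axis)
  qed
  have "(\<Prod>v\<in>Basis. \<bar>c v\<bar>) = \<bar>det A\<bar>"
    unfolding det Basis_real_vec abs_prod by (subst prod.reindex) (auto simp: inj_on_def axis_eq_axis cA)
  then have "(lborel :: (real^'n) measure) = density (distr lborel borel ((*v) A)) (\<lambda>_. ennreal \<bar>det A\<bar>)"
    using lborel_affine_euclidean[of c 0, OF c0] unfolding T by simp
  then have "(\<integral>\<^sup>+x. f x \<partial>lborel) = (\<integral>\<^sup>+x. f x \<partial>density (distr lborel borel ((*v) A)) (\<lambda>_. ennreal \<bar>det A\<bar>))"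
    by (rule arg_cong)
  then show ?thesis by (simp add: nn_integral_density nn_integral_distr nn_integral_cmult)
qed

lemma nn_integral_swap_substitution:
  fixes f :: "real^'n \<Rightarrow> ennreal"
  assumes p: "p permutes (UNIV :: 'n set)" and [measurable]: "f \<in> borel_measurable borel"
  shows "(\<integral>\<^sup>+x. f (\<chi> i. x $ p i) \<partial>lborel) = (\<integral>\<^sup>+x. f x \<partial>lborel)"
proof -
  let ?T = "\<lambda>x::real^'n. \<chi> i. x $ p i"
  have [measurable]: "?T \<in> borel \<rightarrow>\<^sub>M borel"
    by (intro borel_measurable_continuous_onI continuous_intros)
  have "(lborel :: (real^'n) measure) = distr lborel borel ?T"
  proof (rule lborel_eqI)
    fix l u :: "real^'n" assume le: "\<And>b. b \<in> Basis \<Longrightarrow> l \<bullet> b \<le> u \<bullet> b"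
    let ?q = "inv p"
    have pq: "p (?q i) = i" "?q (p i) = i" for i using permutes_inverses[OF p] by auto
    have "?T -` box l u = box (\<chi> i. l $ ?q i) (\<chi> i. u $ ?q i)"
      by (auto simp: mem_box_cart) (metis pq)+
    moreover have le': "l $ i \<le> u $ i" for i using le[of "axis i 1"] by (simp add: inner_axis Basis_real_vec)
    have "emeasure lborel (box (\<chi> i. l $ ?q i) (\<chi> i. u $ ?q i)) = ennreal (\<Prod>b\<in>Basis. ((\<chi> i. u $ ?q i) - (\<chi> i. l $ ?q i)) \<bullet> b)"
      by (rule emeasure_lborel_box) (use le' in \<open>auto simp: Basis_real_vec inner_axis\<close>)
    ultimately have "emeasure (distr lborel borel ?T) (box l u) = ennreal (\<Prod>b\<in>Basis. ((\<chi> i. u $ ?q i) - (\<chi> i. l $ ?q i)) \<bullet> b)"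
      by (subst emeasure_distr) simp_all
    also have "(\<Prod>b\<in>Basis. ((\<chi> i. u $ ?q i) - (\<chi> i. l $ ?q i)) \<bullet> b) = (\<Prod>i\<in>UNIV. u $ ?q i - l $ ?q i)"
      unfolding Basis_real_vec by (subst prod.reindex) (auto simp: inj_on_def axis_eq_axis inner_axis)
    also have "\<dots> = (\<Prod>i\<in>UNIV. u $ i - l $ i)"
      using prod.permute[OF permutes_inv[OF p], of "\<lambda>i. u $ i - l $ i"] by (simp add: o_def)
    also have "\<dots> = (\<Prod>b\<in>Basis. (u - l) \<bullet> b)"
      unfolding Basis_real_vec by (subst prod.reindex) (auto simp: inj_on_def axis_eq_axis inner_axis)
    finally show "emeasure (distr lborel borel ?T) (box l u) = ennreal (\<Prod>b\<in>Basis. (u - l) \<bullet> b)" .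
  qed simp
  then have "(\<integral>\<^sup>+x. f x \<partial>lborel) = (\<integral>\<^sup>+x. f x \<partial>distr lborel borel ?T)" by simp
  then show ?thesis by (simp add: nn_integral_distr)
qed

text \<open>A shear along \<open>b\<close> moves each line in direction \<open>b\<close> by a
  constant, so the integral over that line does not change.\<close>

lemma nn_integral_shear_substitution:
  fixes f :: "'a::euclidean_space \<Rightarrow> ennreal"
  assumes b: "b \<in> Basis" "c \<in> Basis" "b \<noteq> c" and [measurable]: "f \<in> borel_measurable borel"
  shows "(\<integral>\<^sup>+x. f (x + (k * (x \<bullet> c)) *\<^sub>R b) \<partial>lborel) = (\<integral>\<^sup>+x. f x \<partial>lborel)"
proof -
  have split: "(\<integral>\<^sup>+x. g x \<partial>lborel) = sec (Basis - {b}) (sec {b} g) 0" if "g \<in> borel_measurable borel" for g :: "'a \<Rightarrow> ennreal"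
  proof -
    have "(Basis - {b}) \<union> {b} = Basis" using b by auto
    then show ?thesis using nn_integral_eq_sec_Basis[OF that] sec_Un[of "Basis - {b}" "{b}" g 0] that by simp
  qed
  have one: "sec {b} g z = (\<integral>\<^sup>+s. g (z + s *\<^sub>R b) \<partial>lborel)" if "g \<in> borel_measurable borel" for g :: "'a \<Rightarrow> ennreal" and z
    using sec_insert[of "{}" b g z] that by simp
  have "sec {b} (\<lambda>x. f (x + (k * (x \<bullet> c)) *\<^sub>R b)) z = sec {b} f z" for z
  proof -
    have "sec {b} (\<lambda>x. f (x + (k * (x \<bullet> c)) *\<^sub>R b)) z = (\<integral>\<^sup>+s. f (z + s *\<^sub>R b + (k * ((z + s *\<^sub>R b) \<bullet> c)) *\<^sub>R b) \<partial>lborel)"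
      by (rule one) measurable
    also have "\<dots> = (\<integral>\<^sup>+s. f (z + (k * (z \<bullet> c) + s) *\<^sub>R b) \<partial>lborel)"
      using b by (intro nn_integral_cong) (simp add: inner_add_left inner_not_same_Basis scaleR_add_left add_ac)
    also have "\<dots> = (\<integral>\<^sup>+s. f (z + s *\<^sub>R b) \<partial>lborel)"
      by (rule nn_integral_translation) measurable
    also have "\<dots> = sec {b} f z" by (rule one[symmetric]) measurable
    finally show ?thesis .
  qed
  then have "sec {b} (\<lambda>x. f (x + (k * (x \<bullet> c)) *\<^sub>R b)) = sec {b} f" by (rule ext)
  then show ?thesis by (simp add: split)
qed

text \<open>The library's measure of a linear image needs a well-ordered index type, hence this direct proof.\<close>

lemma nn_integral_det_substitution:
  fixes A :: "real^'n^'n"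
  assumes "det A \<noteq> 0" and "f \<in> borel_measurable borel"
  shows "(\<integral>\<^sup>+x. f x \<partial>lborel) = ennreal \<bar>det A\<bar> * (\<integral>\<^sup>+x. f (A *v x) \<partial>lborel)"
  using assms
proof (induction A arbitrary: f rule: induct_matrix_elementary)
  case (1 A B)
  have d: "det A \<noteq> 0" "det B \<noteq> 0" using 1(3) by (auto simp: det_mul)
  note [measurable] = 1(4)
  have "(\<integral>\<^sup>+x. f x \<partial>lborel) = ennreal \<bar>det A\<bar> * (\<integral>\<^sup>+x. f (A *v x) \<partial>lborel)" by (rule 1(1)[OF d(1) 1(4)])
  also have "(\<integral>\<^sup>+x. f (A *v x) \<partial>lborel) = ennreal \<bar>det B\<bar> * (\<integral>\<^sup>+x. f (A *v (B *v x)) \<partial>lborel)"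
    by (rule 1(2)[OF d(2)]) measurable
  finally show ?case by (simp add: det_mul abs_mult ennreal_mult mult.assoc matrix_vector_mul_assoc)
next
  case (2 A i)
  then show ?case by (simp add: det_zero_row)
next
  case (3 A)
  then show ?case by (intro nn_integral_diagonal_substitution)
next
  case (4 m n)
  let ?A = "(\<chi> i j. mat 1 $ i $ Transposition.transpose m n j) :: real^'n^'n"
  let ?p = "Transposition.transpose m n"
  have p: "?p permutes UNIV" by (rule permutes_swap_id) auto
  have "\<bar>det ?A\<bar> = 1"
    using det_permute_columns[OF p, of "mat 1 :: real^'n^'n"] 4 by (simp add: sign_swap_id)
  moreover have "?A *v x = (\<chi> i. x $ ?p i)" for x
  proof -
    have "(\<Sum>j\<in>UNIV. (mat 1 :: real^'n^'n) $ i $ ?p j * x $ j) = x $ ?p i" for i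
    proof -
      have "(\<Sum>j\<in>UNIV. (mat 1 :: real^'n^'n) $ i $ ?p j * x $ j) = (\<Sum>j\<in>UNIV. if j = ?p i then x $ ?p i else 0)"
        by (intro sum.cong) (auto simp: mat_def)
      then show ?thesis by simp
    qed
    then show ?thesis by (simp add: matrix_vector_mult_def)
  qed
  ultimately show ?case using nn_integral_swap_substitution[OF p 4(3)] by simp
next
  case (5 m n c)
  let ?A = "(\<chi> i j. if i = m \<and> j = n then c else of_bool (i = j)) :: real^'n^'n"
  have "det (\<chi> k. if k = m then row m (mat 1 :: real^'n^'n) + c *s row n (mat 1) else row k (mat 1)) = 1"
    using det_row_operation[OF 5(1), of "mat 1 :: real^'n^'n" c] by simp
  moreover have "(\<chi> k. if k = m then row m (mat 1 :: real^'n^'n) + c *s row n (mat 1) else row k (mat 1)) = ?A"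
    using 5(1) by (auto simp: vec_eq_iff row_def mat_def)
  ultimately have "det ?A = 1" by simp
  moreover have "?A *v x = x + (c * (x \<bullet> axis n 1)) *\<^sub>R axis m 1" for x
  proof -
    have "(\<Sum>j\<in>UNIV. (if i = m \<and> j = n then c else of_bool (i = j)) * x $ j) = x $ i + (if i = m then c * x $ n else 0)" for i
    proof -
      have "(\<Sum>j\<in>UNIV. (if i = m \<and> j = n then c else of_bool (i = j)) * x $ j)
        = (\<Sum>j\<in>UNIV. (if j = i then x $ i else 0) + (if j = n then (if i = m then c * x $ n else 0) else 0))"
        using 5(1) by (intro sum.cong) auto
      then show ?thesis by (simp add: sum.distrib)
    qed
    then show ?thesis unfolding inner_axis by (auto simp: matrix_vector_mult_def vec_eq_iff axis_def)
  qed
  moreover have "(\<integral>\<^sup>+x. f (x + (c * (x \<bullet> axis n 1)) *\<^sub>R axis m 1) \<partial>lborel) = (\<integral>\<^sup>+x. f x \<partial>lborel)"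
    by (rule nn_integral_shear_substitution) (use 5 in \<open>auto simp: Basis_real_vec axis_eq_axis\<close>)
  ultimately show ?case by simp
qed

lemma nn_integral_linear_substitution:
  fixes A :: "real^'n^'n"
  assumes A: "invertible A" and f: "f \<in> borel_measurable borel"
  shows "(\<integral>\<^sup>+x. f (A *v x) \<partial>lborel) = ennreal (1 / \<bar>det A\<bar>) * (\<integral>\<^sup>+x. f x \<partial>lborel)"
proof -
  have d: "det A \<noteq> 0" using A by (simp add: invertible_det_nz)
  have "ennreal (1 / \<bar>det A\<bar>) * (\<integral>\<^sup>+x. f x \<partial>lborel) = (ennreal (1 / \<bar>det A\<bar>) * ennreal \<bar>det A\<bar>) * (\<integral>\<^sup>+x. f (A *v x) \<partial>lborel)"
    using nn_integral_det_substitution[OF d f] by (simp add: mult.assoc)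
  also have "ennreal (1 / \<bar>det A\<bar>) * ennreal \<bar>det A\<bar> = 1" using d by (simp flip: ennreal_mult)
  finally show ?thesis by simp
qed

section \<open>Linear maps acting on support functions and on volumes\<close>

lemma inner_transpose_mult:
  fixes A :: "real^'n^'n"
  shows "(A *v x) \<bullet> y = x \<bullet> (transpose A *v y)"
  using adjoint_works[of "(*v) A" x y] by (simp add: adjoint_matrix)

lemma support_linear_image:
  fixes A :: "real^'n^'n"
  shows "support ((*v) A ` K) u = support K (transpose A *v u)"
  unfolding support_def by (simp add: image_image inner_transpose_mult)

lemma convex_body_linear_image:
  fixes A :: "real^'n^'n"
  assumes A: "invertible A" and K: "convex_body K"
  shows "convex_body ((*v) A ` K)"
proof -
  have lin: "linear ((*v) A)" by simp
  have inj: "inj ((*v) A)" using A by (simp add: inj_matrix_vector_mult)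
  have "interior ((*v) A ` K) = (*v) A ` interior K"
    by (rule interior_injective_linear_image[OF lin inj])
  then show ?thesis using K lin
    unfolding convex_body_def by (auto intro!: convex_linear_image compact_continuous_image linear_continuous_on simp: linear_conv_bounded_linear[symmetric])
qed

lemma nn_integral_linear_image_set:
  fixes A :: "real^'n^'n"
  assumes A: "invertible A" and K: "convex_body K" and g[measurable]: "g \<in> borel_measurable borel"
  shows "(\<integral>\<^sup>+x. g (A *v x) * indicator K x \<partial>lborel) = ennreal (1 / \<bar>det A\<bar>) * (\<integral>\<^sup>+y. g y * indicator ((*v) A ` K) y \<partial>lborel)"
proof -
  have [measurable]: "(*v) A ` K \<in> sets borel" using convex_bodyD(7)[OF convex_body_linear_image[OF A K]] .
  have "inj ((*v) A)" using A by (simp add: inj_matrix_vector_mult)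
  then have "(\<integral>\<^sup>+x. g (A *v x) * indicator K x \<partial>lborel) = (\<integral>\<^sup>+x. g (A *v x) * indicator ((*v) A ` K) (A *v x) \<partial>lborel)"
    by (intro nn_integral_cong) (simp add: indicator_def inj_image_mem_iff)
  also have "\<dots> = ennreal (1 / \<bar>det A\<bar>) * (\<integral>\<^sup>+y. g y * indicator ((*v) A ` K) y \<partial>lborel)"
    by (rule nn_integral_linear_substitution[OF A]) measurable
  finally show ?thesis .
qed

text \<open>The volume is multiplied by the modulus of \<open>det A\<close>. The polar is the
  preimage under the transpose acting on each of the \<open>m\<close> components, so its volume is
  divided by the \<open>m\<close>th power of that modulus, which the exponent \<open>m\<close> of
  the volume compensates.\<close>

lemma body_value_linear_image:
  fixes A :: "real^'n^'n"
  assumes A: "invertible A" and K: "convex_body K"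
  shows "body_value TYPE('m::finite) ((*v) A ` K) = body_value TYPE('m) K"
proof -
  let ?K = "(*v) A ` K"
  have cK: "convex_body ?K" by (rule convex_body_linear_image[OF A K])
  have d: "0 < \<bar>det A\<bar>" using A by (simp add: invertible_det_nz)
  have At: "invertible (transpose A)" using A by (simp add: invertible_det_nz det_transpose)
  have tm: "(*v) (transpose A) \<in> borel \<rightarrow>\<^sub>M borel" by (rule measurable_matrix_vector_mult)
  have comp: "transpose A *v component \<theta> k = component (\<chi> i. transpose A *v (\<theta> $ i)) k" for \<theta> :: "(real^'n)^'m" and k
    using linear_sum[OF matrix_vector_mul_linear[of "transpose A"]] linear_neg[OF matrix_vector_mul_linear[of "transpose A"]]
    by (cases k) (simp_all add: component_def)
  have dn: "diff_norm ?K \<theta> = diff_norm K (\<chi> i. transpose A *v (\<theta> $ i))" for \<theta> :: "(real^'n)^'m"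
    unfolding diff_norm_def support_linear_image comp ..
  have m1: "emeasure lborel (dpolar ?K :: ((real^'n)^'m) set) = ennreal (1 / \<bar>det A\<bar>) ^ CARD('m) * emeasure lborel (dpolar K :: ((real^'n)^'m) set)"
  proof -
    have b: "(dpolar K :: ((real^'n)^'m) set) \<in> sets borel" "(dpolar ?K :: ((real^'n)^'m) set) \<in> sets borel"
      using compact_dpolar[OF K] compact_dpolar[OF cK] borel_compact by blast+
    have "emeasure lborel (dpolar ?K :: ((real^'n)^'m) set) = (\<integral>\<^sup>+\<theta>. indicator (dpolar ?K) \<theta> \<partial>(lborel :: ((real^'n)^'m) measure))"
      using b by simp
    also have "\<dots> = (\<integral>\<^sup>+\<theta>. indicator (dpolar K) (\<chi> i. transpose A *v (\<theta> $ i)) \<partial>(lborel :: ((real^'n)^'m) measure))"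
      by (intro nn_integral_cong) (simp add: indicator_def dpolar_def dn)
    also have "\<dots> = ennreal (1 / \<bar>det A\<bar>) ^ CARD('m) * (\<integral>\<^sup>+\<theta>. indicator (dpolar K) \<theta> \<partial>(lborel :: ((real^'n)^'m) measure))"
      using nn_integral_linear_substitution[OF At] b(1) det_transpose[of A]
      by (intro nn_integral_vec_map tm) (auto simp del: transpose_matrix_vector)
    finally show ?thesis using b by simp
  qed
  have "measure lborel (dpolar ?K :: ((real^'n)^'m) set) = (1 / \<bar>det A\<bar>) ^ CARD('m) * measure lborel (dpolar K :: ((real^'n)^'m) set)"
    unfolding measure_def m1 by (simp add: enn2real_mult ennreal_power)
  moreover have "measure lborel K = (1 / \<bar>det A\<bar>) * measure lborel ?K"
  proof -
    have "emeasure lborel K = ennreal (1 / \<bar>det A\<bar>) * emeasure lborel ?K"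
      using nn_integral_linear_image_set[OF A K, of "\<lambda>_. 1"] convex_bodyD(7)[OF K] convex_bodyD(7)[OF cK] by simp
    then show ?thesis unfolding measure_def by (simp add: enn2real_mult)
  qed
  ultimately show ?thesis
    unfolding body_value_def using d by (simp add: power_mult_distrib power_divide)
qed

lemma body_maximizer_linear_image:
  fixes A :: "real^'n^'n"
  assumes A: "invertible A" and K: "body_maximizer TYPE('m::finite) K"
  shows "body_maximizer TYPE('m) ((*v) A ` K)"
  using K body_value_linear_image[OF A, where 'm = 'm] convex_body_linear_image[OF A]
  by (auto simp: body_maximizer_def)

lemma body_maximizer_translation:
  "body_maximizer TYPE('m::finite) K \<Longrightarrow> body_maximizer TYPE('m) ((+) v ` K)"
  using body_value_translation[of K "TYPE('m)" v] convex_body_translation[of K v]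
  by (auto simp: body_maximizer_def)

section \<open>Existence of a maximizer\<close>

lemma mem_convex_body_iff_support:
  fixes K :: "'a::euclidean_space set"
  assumes K: "closed K" "convex K" "bounded K" "K \<noteq> {}"
  shows "x \<in> K \<longleftrightarrow> (\<forall>u\<in>sphere 0 1. x \<bullet> u \<le> support K u)"
proof
  show "\<forall>u\<in>sphere 0 1. x \<bullet> u \<le> support K u" if "x \<in> K"
    using that K by (auto intro: support_upper)
  show "x \<in> K" if le: "\<forall>u\<in>sphere 0 1. x \<bullet> u \<le> support K u"
  proof (rule ccontr)
    assume "x \<notin> K"
    then obtain a b where ab: "a \<bullet> x < b" "\<And>y. y \<in> K \<Longrightarrow> b < a \<bullet> y"
      using separating_hyperplane_closed_point[OF K(2,1)] by blast
    obtain y where "y \<in> K" using K by auto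
    then have "a \<noteq> 0" using ab(1) ab(2)[of y] by auto
    then have n: "0 < norm a" by simp
    define u where "u = - (1 / norm a) *\<^sub>R a"
    have "u \<in> sphere 0 1" using n by (simp add: u_def)
    have "support K u \<le> - b / norm a"
      using ab(2) n K by (auto simp: support_le_iff u_def inner_commute divide_right_mono less_imp_le)
    also have "\<dots> < x \<bullet> u" using ab(1) n by (simp add: u_def inner_commute divide_strict_right_mono)
    finally show False using le \<open>u \<in> sphere 0 1\<close> by force
  qed
qed

lemma continuous_on_det [continuous_intros]:
  fixes f :: "'a::topological_space \<Rightarrow> real^'n^'n"
  assumes "continuous_on S f"
  shows "continuous_on S (\<lambda>x. det (f x))"
  unfolding det_def using assms by (intro continuous_intros)

text \<open>The rows of \<open>A\<close> are the edges of a simplex in \<open>K\<close> issuing from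
  the vertex \<open>v\<close>, and the modulus of its determinant is the volume of the simplex up to
  a factorial. The set of such pairs is compact, and a ball inside \<open>K\<close> supplies a
  nondegenerate one, with edges of length \<open>r\<close> along the axes.\<close>

lemma max_simplex:
  fixes K :: "(real^'n) set"
  assumes "convex_body K"
  obtains v A where "v \<in> K" "\<And>i. v + A $ i \<in> K" "det A \<noteq> 0"
    "\<And>w B. w \<in> K \<Longrightarrow> (\<And>i. w + B $ i \<in> K) \<Longrightarrow> \<bar>det (B :: real^'n^'n)\<bar> \<le> \<bar>det A\<bar>"
proof -
  note K = convex_bodyD[OF assms]
  obtain R where R: "\<And>x. x \<in> K \<Longrightarrow> norm x \<le> R" using K(4) bounded_iff by metis
  define C where "C = {(v, A :: real^'n^'n). v \<in> K \<and> (\<forall>i. v + A $ i \<in> K)}"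
  have "C = fst -` K \<inter> (\<Inter>i. (\<lambda>p. fst p + snd p $ i) -` K)" by (auto simp: C_def)
  moreover have "closed (fst -` K \<inter> (\<Inter>i. (\<lambda>p::(real^'n) \<times> (real^'n^'n). fst p + snd p $ i) -` K))"
    by (intro closed_Int closed_INT ballI closed_vimage K(5) continuous_intros)
  ultimately have "closed C" by simp
  moreover have "bounded C"
  proof -
    have "norm p \<le> R + (\<Sum>i\<in>(UNIV::'n set). 2 * R)" if "p \<in> C" for p
    proof -
      obtain v A where p: "p = (v, A)" "v \<in> K" "\<And>i. v + A $ i \<in> K" using \<open>p \<in> C\<close> by (auto simp: C_def)
      have "norm (A $ i) \<le> 2 * R" for i
        using norm_triangle_ineq4[of "v + A $ i" v] R[OF p(2)] R[OF p(3)[of i]] by simp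
      then have "norm A \<le> (\<Sum>i\<in>(UNIV::'n set). 2 * R)"
        using norm_vec_le_sum[of A] by (meson order_trans sum_mono)
      moreover have "norm p \<le> norm v + norm A" unfolding p(1) by (rule norm_Pair_le)
      ultimately show ?thesis using R[OF p(2)] by linarith
    qed
    then show ?thesis unfolding bounded_iff by blast
  qed
  ultimately have cC: "compact C" by (simp add: compact_eq_bounded_closed)
  obtain p r where r: "0 < r" "cball p r \<subseteq> K" using convex_body_ball[OF assms] .
  have in1: "(p, mat r) \<in> C"
  proof -
    have "mat r $ i = r *\<^sub>R (axis i 1 :: real^'n)" for i by (simp add: vec_eq_iff mat_def axis_def)
    then have "p + mat r $ i \<in> cball p r" for i using r by (simp add: dist_norm)
    then show ?thesis using r by (auto simp: C_def)
  qed
  have "continuous_on C (\<lambda>p. \<bar>det (snd p)\<bar>)" by (intro continuous_intros)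
  from continuous_attains_sup[OF cC _ this] in1 obtain q where q: "q \<in> C" "\<And>y. y \<in> C \<Longrightarrow> \<bar>det (snd y)\<bar> \<le> \<bar>det (snd q)\<bar>"
    by blast
  have "det (mat r :: real^'n^'n) = r ^ CARD('n)"
    by (subst det_diagonal) (auto simp: mat_def)
  then have "0 < \<bar>det (snd (p, mat r :: real^'n^'n))\<bar>" using r by simp
  also have "\<dots> \<le> \<bar>det (snd q)\<bar>" using in1 by (rule q(2))
  finally have "det (snd q) \<noteq> 0" by simp
  show ?thesis
  proof (rule that[of "fst q" "snd q"])
    show "\<bar>det B\<bar> \<le> \<bar>det (snd q)\<bar>" if "w \<in> K" "\<And>i. w + B $ i \<in> K" for w and B :: "real^'n^'n"
      using q(2)[of "(w, B)"] that by (simp add: C_def)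
  qed (use q(1) \<open>det (snd q) \<noteq> 0\<close> in \<open>auto simp: C_def case_prod_beta\<close>)
qed

text \<open>With \<open>s = 1 / (2 * n)\<close> for the dimension \<open>n\<close>, each coordinate
  of a point in the ball lies between 0 and \<open>2 * s\<close>, so the coordinates sum to at most
  1. What is missing to 1 becomes the weight of the vertex 0.\<close>

lemma cball_subset_simplex:
  fixes K :: "(real^'n) set"
  assumes K: "convex K" "0 \<in> K" "\<And>i. axis i 1 \<in> K"
  defines "s \<equiv> 1 / (2 * real CARD('n))"
  shows "cball (\<chi> i. s) s \<subseteq> K"
proof
  fix x :: "real^'n" assume x: "x \<in> cball (\<chi> i. s) s"
  have s: "0 < s" by (simp add: s_def)
  have xi: "\<bar>x $ i - s\<bar> \<le> s" for i
    using component_le_norm_cart[of "x - (\<chi> i. s)" i] x by (simp add: dist_norm norm_minus_commute)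
  then have nn: "0 \<le> x $ i" "x $ i \<le> 2 * s" for i using xi[of i] by (auto simp: abs_le_iff)
  have "(\<Sum>i\<in>UNIV. x $ i) \<le> (\<Sum>i\<in>(UNIV::'n set). 2 * s)" by (intro sum_mono nn)
  then have le1: "(\<Sum>i\<in>UNIV. x $ i) \<le> 1" by (simp add: s_def)
  have "x = (\<Sum>i\<in>UNIV. x $ i *\<^sub>R axis i 1)"
    by (simp add: vec_eq_iff axis_def if_distrib cong: if_cong)
  also have "\<dots> = (\<Sum>k\<in>UNIV. (case k of None \<Rightarrow> 1 - (\<Sum>i\<in>UNIV. x $ i) | Some i \<Rightarrow> x $ i) *\<^sub>R (case k of None \<Rightarrow> 0 | Some i \<Rightarrow> axis i 1))"
    by (simp add: UNIV_option_sum)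
  also have "\<dots> \<in> K"
  proof (rule convex_sum)
    show "(\<Sum>k\<in>UNIV. (case k of None \<Rightarrow> 1 - (\<Sum>i\<in>UNIV. x $ i) | Some i \<Rightarrow> x $ i)) = 1"
      by (simp add: UNIV_option_sum)
  qed (use K nn le1 in \<open>auto split: option.split\<close>)
  finally show "x \<in> K" .
qed

text \<open>After an affine map, a largest simplex in \<open>K\<close> is the standard one; its maximality bounds the coordinates on \<open>K\<close>.\<close>

lemma normal_position:
  obtains r R :: real where "0 < r" "0 < R"
    "\<And>K :: (real^'n) set. convex_body K \<Longrightarrow> \<exists>K' :: (real^'n) set. convex_body K' \<and> cball 0 r \<subseteq> K' \<and> K' \<subseteq> cball 0 R
       \<and> body_value TYPE('m::finite) K' = body_value TYPE('m) K"
proof -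
  define s where "s = 1 / (2 * real CARD('n))"
  define p where "p = (\<chi> i::'n. s)"
  \<comment> \<open>Coordinates of modulus at most 1 bound the norm by the dimension;
    \<open>norm p\<close> accounts for moving the centre \<open>p\<close> of the inscribed ball to
    the origin.\<close>
  define R where "R = real CARD('n) + norm p"
  have s: "0 < s" by (simp add: s_def)
  have R: "0 < R" by (simp add: R_def add_pos_nonneg)
  show ?thesis
  proof (rule that[OF s R])
    fix K :: "(real^'n) set" assume cK: "convex_body K"
    obtain v A where vA: "v \<in> K" "\<And>i. v + A $ i \<in> K" "det A \<noteq> 0"
      "\<And>w B. w \<in> K \<Longrightarrow> (\<And>i. w + B $ i \<in> K) \<Longrightarrow> \<bar>det (B :: real^'n^'n)\<bar> \<le> \<bar>det A\<bar>"
      using max_simplex[OF cK] by blast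
    let ?M = "transpose A"
    have "invertible ?M" using vA(3) by (simp add: invertible_det_nz det_transpose)
    then obtain N where N: "?M ** N = mat 1" "N ** ?M = mat 1" by (auto simp: invertible_def)
    have iN: "invertible N" using N by (auto simp: invertible_def)
    let ?K0 = "(+) (- v) ` K"
    have cK0: "convex_body ?K0" by (rule convex_body_translation[OF cK])
    let ?K1 = "(*v) N ` ?K0"
    have cK1: "convex_body ?K1" by (rule convex_body_linear_image[OF iN cK0])
    have Mc: "?M *v y = (\<Sum>i\<in>UNIV. y $ i *s row i A)" for y
      by (simp add: matrix_mult_sum[of "?M"] del: transpose_matrix_vector)
    have NM: "N *v (?M *v y) = y" for y by (simp only: matrix_vector_mul_assoc N matrix_vector_mul_lid)
    have MN: "?M *v (N *v y) = y" for y by (simp only: matrix_vector_mul_assoc N matrix_vector_mul_lid)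
    have zero: "0 \<in> ?K1" using vA(1) by (force simp: image_iff)
    have ax: "axis i 1 \<in> ?K1" for i
    proof -
      have "?M *v axis i 1 = A $ i"
      proof -
        have "(axis i 1 :: real^'n) $ j *s row j A = (if j = i then A $ i else 0)" for j
          by (simp add: axis_def row_def vec_eq_iff)
        then show ?thesis unfolding Mc by simp
      qed
      then have "axis i 1 = N *v (A $ i)" using NM[of "axis i 1"] by simp
      moreover have "A $ i \<in> ?K0" using vA(2)[of i] by (force simp: image_iff)
      ultimately show ?thesis by blast
    qed
    have bd: "\<bar>y $ i\<bar> \<le> 1" if "y \<in> ?K1" for y i
    proof -
      obtain x where x: "x \<in> K" "y = N *v (x - v)" using \<open>y \<in> ?K1\<close> by auto
      then have xv: "x - v = (\<Sum>i\<in>UNIV. y $ i *s row i A)" using MN[of "x - v"] Mc[of y] by simp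
      \<comment> \<open>By Cramer's rule, exchanging the edge \<open>i\<close> for
        \<open>x - v\<close> multiplies the determinant by the coordinate \<open>y $ i\<close>. The
        new simplex still lies in \<open>K\<close>, so maximality bounds this coordinate by 1 in
        modulus.\<close>
      let ?B = "\<chi> k. if k = i then (\<Sum>i\<in>UNIV. y $ i *s row i A) else row k A"
      have "det ?B = y $ i * det A" by (rule cramer_lemma_transpose)
      moreover have "\<bar>det ?B\<bar> \<le> \<bar>det A\<bar>"
      proof (rule vA(4)[OF vA(1)])
        have "?B $ k = (if k = i then x - v else A $ k)" for k
          unfolding xv by (simp add: row_def)
        then show "v + ?B $ k \<in> K" for k
          using x(1) vA(2)[of k] by simp
      qed
      ultimately show ?thesis using vA(3) by (simp add: abs_mult)
    qed
    have sub: "cball p s \<subseteq> ?K1" unfolding p_def s_def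
      using convex_bodyD(2)[OF cK1] zero ax by (rule cball_subset_simplex)
    let ?K2 = "(+) (- p) ` ?K1"
    have cK2: "convex_body ?K2" by (rule convex_body_translation[OF cK1])
    have in2: "cball 0 s \<subseteq> ?K2"
    proof
      fix x :: "real^'n" assume "x \<in> cball 0 s"
      then have "p + x \<in> cball p s" by (simp add: dist_norm)
      then have "p + x \<in> ?K1" using sub by blast
      then have "- p + (p + x) \<in> ?K2" by (rule imageI)
      then show "x \<in> ?K2" by simp
    qed
    have out2: "?K2 \<subseteq> cball 0 R"
    proof
      fix x assume "x \<in> ?K2"
      then obtain y where y: "y \<in> ?K1" "x = - p + y" by blast
      have "norm y \<le> (\<Sum>i\<in>UNIV. \<bar>y $ i\<bar>)" by (rule norm_le_l1_cart)
      also have "\<dots> \<le> (\<Sum>i\<in>(UNIV::'n set). 1)" by (intro sum_mono bd[OF y(1)])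
      finally have "norm y \<le> real CARD('n)" by simp
      then have "norm x \<le> R" using norm_triangle_ineq[of "-p" y] by (simp add: y(2) R_def)
      then show "x \<in> cball 0 R" by simp
    qed
    have bv2: "body_value TYPE('m) ?K2 = body_value TYPE('m) K"
      by (simp only: body_value_translation[OF cK1] body_value_linear_image[OF iN cK0] body_value_translation[OF cK])
    show "\<exists>K' :: (real^'n) set. convex_body K' \<and> cball 0 s \<subseteq> K' \<and> K' \<subseteq> cball 0 R
       \<and> body_value TYPE('m) K' = body_value TYPE('m) K"
      by (rule exI[of _ ?K2]) (intro conjI cK2 in2 out2 bv2)
  qed
qed

section \<open>Multiplicative comparison of bodies and a selection theorem\<close>

lemma measure_scaled_superset:
  fixes S T :: "'a::euclidean_space set"
  assumes S: "S \<in> sets borel" and T: "compact T" and q: "0 < q" and sub: "\<And>x. x \<in> S \<Longrightarrow> (1 / q) *\<^sub>R x \<in> T"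
  shows "measure lborel S \<le> q ^ DIM('a) * measure lborel T"
proof -
  have fT: "emeasure lborel T < \<infinity>" using emeasure_bounded_finite[OF compact_imp_bounded[OF T]] by simp
  have "(\<lambda>x. (1 / q) *\<^sub>R x) -` T \<in> sets borel"
    using measurable_sets[of "\<lambda>x. (1 / q) *\<^sub>R x" borel borel T] borel_compact[OF T] by auto
  then have "emeasure lborel S \<le> emeasure lborel ((\<lambda>x. (1 / q) *\<^sub>R x) -` T)"
    using sub by (intro emeasure_mono) auto
  also have "\<dots> = ennreal (q ^ DIM('a)) * emeasure lborel T"
    by (rule emeasure_scaleR_image[OF borel_compact[OF T] q])
  also have "\<dots> = ennreal (q ^ DIM('a) * measure lborel T)"
    using fT q by (simp add: emeasure_eq_ennreal_measure ennreal_mult)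
  finally show ?thesis using q unfolding measure_def
    by (metis enn2real_leI enn2real_nonneg mult_nonneg_nonneg zero_le_power less_imp_le)
qed

text \<open>Serves as continuity of the volume product: the factor tends to 1 with \<open>q\<close>.
  Both comparisons of support functions are needed, since the volume grows with the body and the
  polar shrinks.\<close>

lemma body_value_le_scaled:
  fixes K L :: "'a::euclidean_space set"
  assumes K: "convex_body K" and L: "convex_body L" and q: "0 < q"
    and KL: "\<And>u. u \<in> sphere 0 1 \<Longrightarrow> support K u \<le> q * support L u" "\<And>u. u \<in> sphere 0 1 \<Longrightarrow> support L u \<le> q * support K u"
  shows "body_value TYPE('m::finite) L \<le> (q ^ DIM('a^'m) * (q ^ DIM('a)) ^ CARD('m)) * body_value TYPE('m) K"
proof -
  note KD = convex_bodyD[OF K] and LD = convex_bodyD[OF L]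
  have ex: "support K u \<le> q * support L u" for u
  proof (cases "u = 0")
    case True
    then show ?thesis using support_scaleR[OF KD(4,6), of 0 u] support_scaleR[OF LD(4,6), of 0 u] by simp
  next
    case False
    have u: "u = norm u *\<^sub>R ((1 / norm u) *\<^sub>R u)" using False by simp
    have "support K u = norm u * support K ((1 / norm u) *\<^sub>R u)"
      by (subst u, subst support_scaleR[OF KD(4,6)]) auto
    also have "\<dots> \<le> norm u * (q * support L ((1 / norm u) *\<^sub>R u))"
      using False by (intro mult_left_mono KL) auto
    also have "\<dots> = q * support L u"
      by (subst (2) u, subst support_scaleR[OF LD(4,6)]) auto
    finally show ?thesis .
  qed
  have "measure lborel L \<le> q ^ DIM('a) * measure lborel K"
  proof (rule measure_scaled_superset[OF LD(7) KD(1) q])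
    fix x assume x: "x \<in> L"
    show "(1 / q) *\<^sub>R x \<in> K"
      unfolding mem_convex_body_iff_support[OF KD(5,2,4,6)]
    proof
      fix u :: 'a assume "u \<in> sphere 0 1"
      then have "x \<bullet> u \<le> q * support K u" using support_upper[OF LD(4) x, of u] KL(2)[of u] by linarith
      then show "(1 / q) *\<^sub>R x \<bullet> u \<le> support K u" using q by (simp add: field_simps)
    qed
  qed
  then have 1: "measure lborel L ^ CARD('m) \<le> (q ^ DIM('a) * measure lborel K) ^ CARD('m)"
    by (intro power_mono) auto
  have 2: "measure lborel (dpolar L :: ('a^'m) set) \<le> q ^ DIM('a^'m) * measure lborel (dpolar K :: ('a^'m) set)"
  proof (rule measure_scaled_superset[OF borel_compact[OF compact_dpolar[OF L]] compact_dpolar[OF K] q])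
    fix \<theta> :: "'a^'m" assume "\<theta> \<in> dpolar L"
    then have "diff_norm L \<theta> \<le> 1" by (simp add: dpolar_def)
    moreover have "diff_norm K \<theta> \<le> q * diff_norm L \<theta>"
      unfolding diff_norm_def sum_distrib_left by (intro sum_mono ex)
    ultimately have "diff_norm K \<theta> \<le> q * 1" using q by (meson mult_left_mono less_imp_le order_trans)
    then show "(1 / q) *\<^sub>R \<theta> \<in> dpolar K"
      using q diff_norm_scaleR[OF KD(4,6), of "1 / q" \<theta>] by (simp add: dpolar_def pos_divide_le_eq)
  qed
  have "body_value TYPE('m) L \<le> (q ^ DIM('a^'m) * measure lborel (dpolar K :: ('a^'m) set)) * (q ^ DIM('a) * measure lborel K) ^ CARD('m)"
    unfolding body_value_def using 1 2 q by (intro mult_mono) auto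
  then show ?thesis by (simp add: body_value_def power_mult_distrib mult_ac)
qed

text \<open>A form of Blaschke selection: support functions of bodies between two fixed balls are
  bounded and equicontinuous on the sphere, so Arzela--Ascoli gives a uniform limit
  \<open>g\<close>. The limit body is the intersection of the half-spaces given by
  \<open>g\<close>.\<close>

lemma support_limit_body:
  fixes Ks :: "nat \<Rightarrow> 'a::euclidean_space set"
  assumes Ks: "\<And>n. convex_body (Ks n)" "\<And>n. cball 0 r \<subseteq> Ks n" "\<And>n. Ks n \<subseteq> cball 0 R" and r: "0 < r"
  obtains K k where "convex_body K" "strict_mono (k :: nat \<Rightarrow> nat)"
    "\<And>q. 1 < q \<Longrightarrow> \<exists>N. \<forall>n\<ge>N. \<forall>u\<in>sphere 0 1. support K u \<le> q * support (Ks (k n)) u \<and> support (Ks (k n)) u \<le> q * support K u"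
proof -
  note KD = convex_bodyD[OF Ks(1)]
  have "(0::'a) \<in> cball 0 R" by (rule subsetD[OF Ks(3)[of 0]], rule subsetD[OF Ks(2)[of 0]]) (use r in simp)
  then have R0: "0 \<le> R" by simp
  have lip: "\<bar>support (Ks n) u - support (Ks n) v\<bar> \<le> R * norm (u - v)" for n u v
    using support_lipschitz[OF KD(6) Ks(3)] .
  have up: "support (Ks n) u \<le> R * norm u" for n u by (rule support_le_norm[OF KD(6) Ks(3)])
  have low: "r * norm u \<le> support (Ks n) u" for n u
    using support_ge_ball[OF KD(4) Ks(2), of u n] r by simp
  obtain g k where gk: "continuous_on (sphere (0::'a) 1) g" "strict_mono (k :: nat \<Rightarrow> nat)"
    "\<And>e. 0 < e \<Longrightarrow> \<exists>N. \<forall>n x. N \<le> n \<and> x \<in> sphere 0 1 \<longrightarrow> norm (support (Ks (k n)) x - g x) < e"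
  proof (rule Arzela_Ascoli[of "sphere (0::'a) 1" "\<lambda>n. support (Ks n)" R])
    show "norm (support (Ks n) x) \<le> R" if "x \<in> sphere 0 1" for n x
    proof -
      have "0 \<le> r * norm x" using r by simp
      then show ?thesis using up[of n x] low[of x n] that by simp
    qed
    show "\<exists>d>0. \<forall>n y. y \<in> sphere 0 1 \<and> norm (x - y) < d \<longrightarrow> norm (support (Ks n) x - support (Ks n) y) < e"
      if "x \<in> sphere 0 1" "0 < e" for x e
    proof (intro exI[of _ "e / (R + 1)"] conjI allI impI)
      show "0 < e / (R + 1)" using that R0 by simp
      fix n y assume y: "y \<in> sphere 0 1 \<and> norm (x - y) < e / (R + 1)"
      have "norm (support (Ks n) x - support (Ks n) y) \<le> R * norm (x - y)" using lip[of n x y] by simp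
      also have "\<dots> \<le> (R + 1) * norm (x - y)" by (intro mult_right_mono) auto
      also have "\<dots> < e" using y R0 by (simp add: pos_less_divide_eq mult.commute)
      finally show "norm (support (Ks n) x - support (Ks n) y) < e" .
    qed
  qed auto
  have lim: "(\<lambda>n. support (Ks (k n)) u) \<longlonglongrightarrow> g u" if "u \<in> sphere 0 1" for u
    unfolding LIMSEQ_iff using gk(3) that by blast
  have gl: "r \<le> g u" if "u \<in> sphere 0 1" for u
    using low[of u] that by (intro LIMSEQ_le_const[OF lim[OF that]]) auto
  have gu: "g u \<le> R" if "u \<in> sphere 0 1" for u
    using up[of _ u] that by (intro LIMSEQ_le_const2[OF lim[OF that]]) auto
  define K where "K = (\<Inter>u\<in>sphere 0 1. {x. u \<bullet> x \<le> g u})"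
  have K1: "cball 0 r \<subseteq> K"
  proof (unfold K_def, intro subsetI INT_I CollectI)
    fix x u :: 'a assume x: "x \<in> cball 0 r" and u: "u \<in> sphere 0 1"
    have "u \<bullet> x \<le> norm u * norm x" by (rule norm_cauchy_schwarz)
    also have "\<dots> \<le> r" using x u by simp
    finally show "u \<bullet> x \<le> g u" using gl[OF u] by linarith
  qed
  have K2: "K \<subseteq> cball 0 R"
  proof
    fix x assume x: "x \<in> K"
    show "x \<in> cball 0 R"
    proof (cases "x = 0")
      case False
      let ?u = "(1 / norm x) *\<^sub>R x"
      have u: "?u \<in> sphere 0 1" using False by simp
      have "?u \<bullet> x \<le> g ?u" using x u unfolding K_def by blast
      also have "\<dots> \<le> R" by (rule gu[OF u])
      finally show ?thesis using False by (simp add: power2_norm_eq_inner[symmetric] power2_eq_square)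
    qed (use R0 in simp)
  qed
  have "closed K" unfolding K_def by (intro closed_INT ballI closed_halfspace_le)
  then have cK: "convex_body K"
    unfolding convex_body_def
  proof (intro conjI)
    show "compact K" using \<open>closed K\<close> K2 by (meson bounded_cball bounded_subset compact_eq_bounded_closed)
    show "convex K" unfolding K_def by (intro convex_INT convex_halfspace_le)
    have "ball 0 r \<subseteq> interior K" using K1 ball_subset_cball by (intro interior_maximal) auto
    then show "interior K \<noteq> {}" using r by auto
  qed
  note D = convex_bodyD[OF cK]
  have sg: "support K u \<le> g u" if "u \<in> sphere 0 1" for u
    using that D by (auto simp: support_le_iff K_def inner_commute)
  show ?thesis
  proof (rule that[OF cK gk(2)])
    fix q :: real assume q: "1 < q"
    \<comment> \<open>All support values and all values of \<open>g\<close> on the sphere are at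
      least \<open>r\<close>, so an additive error below this \<open>e\<close> is at most the
      fraction \<open>q - 1\<close> of any of them.\<close>
    define e where "e = (q - 1) * r"
    have e: "0 < e" using q r by (simp add: e_def)
    from gk(3)[OF e] obtain N where N: "\<And>n u. N \<le> n \<Longrightarrow> u \<in> sphere 0 1 \<Longrightarrow> \<bar>support (Ks (k n)) u - g u\<bar> < e"
      by auto
    have a: "support K u \<le> q * support (Ks (k n)) u" if "N \<le> n" "u \<in> sphere 0 1" for n u
    proof -
      have "support K u \<le> support (Ks (k n)) u + e" using sg[OF that(2)] N[OF that] by linarith
      also have "e \<le> (q - 1) * support (Ks (k n)) u"
        unfolding e_def using low[of u "k n"] that q by (intro mult_left_mono) auto
      finally show ?thesis by (simp add: algebra_simps)
    qed
    \<comment> \<open>It suffices to place the shrunken body inside \<open>K\<close>, which is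
      tested against \<open>g\<close> alone. This spares the proof that \<open>g\<close> is itself
      the support function of \<open>K\<close>.\<close>
    have b: "support (Ks (k n)) u \<le> q * support K u" if n: "N \<le> n" "u \<in> sphere 0 1" for n u
    proof -
      have "x \<bullet> u \<le> q * support K u" if x: "x \<in> Ks (k n)" for x
      proof -
        have "(1 / q) *\<^sub>R x \<in> K"
          unfolding K_def
        proof (intro INT_I CollectI)
          fix v :: 'a assume v: "v \<in> sphere 0 1"
          have "x \<bullet> v \<le> g v + e" using support_upper[OF KD(4) x, of v] N[OF n(1) v] by linarith
          also have "e \<le> (q - 1) * g v" unfolding e_def using gl[OF v] q by (intro mult_left_mono) auto
          finally have "x \<bullet> v \<le> q * g v" by (simp add: algebra_simps)
          then show "v \<bullet> ((1 / q) *\<^sub>R x) \<le> g v" using q by (simp add: field_simps inner_commute)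
        qed
        from support_upper[OF D(4) this, of u] show ?thesis using q by (simp add: field_simps)
      qed
      then show ?thesis using KD by (simp add: support_le_iff)
    qed
    show "\<exists>N. \<forall>n\<ge>N. \<forall>u\<in>sphere 0 1. support K u \<le> q * support (Ks (k n)) u \<and> support (Ks (k n)) u \<le> q * support K u"
      using a b by blast
  qed
qed

text \<open>In normal position every body is comparable with one fixed ball, so the values are
  bounded. A limit \<open>K\<close> of a maximizing sequence satisfies
  \<open>S \<le> d q * ?V K\<close> for every \<open>q > 1\<close>, and \<open>q\<close> tends to
  1.\<close>

lemma exists_body_maximizer: "\<exists>K :: (real^'n) set. body_maximizer TYPE('m::finite) K"
proof -
  let ?V = "body_value TYPE('m) :: (real^'n) set \<Rightarrow> real"
  obtain r R where rR: "0 < r" "0 < R"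
    and norm: "\<And>K :: (real^'n) set. convex_body K \<Longrightarrow> \<exists>K' :: (real^'n) set. convex_body K' \<and> cball 0 r \<subseteq> K' \<and> K' \<subseteq> cball 0 R \<and> ?V K' = ?V K"
    using normal_position[where 'n = 'n and 'm = 'm] by blast
  define X where "X = ?V ` {K. convex_body K}"
  have cb: "convex_body (cball (0::real^'n) r)" using rR by (simp add: convex_body_def)
  have ne: "X \<noteq> {}" using cb by (auto simp: X_def)
  \<comment> \<open>On the sphere the normalised support functions lie between \<open>r\<close> and
    \<open>R\<close>, so \<open>R / r\<close> compares them with the ball of radius
    \<open>r\<close>; the maximum with 1 serves the opposite comparison.\<close>
  define q where "q = max (R / r) 1"
  have q: "0 < q" "R \<le> q * r" "r \<le> q * R"
  proof -
    show "0 < q" by (simp add: q_def)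
    have "R / r * r \<le> q * r" using rR by (intro mult_right_mono) (auto simp: q_def)
    then show "R \<le> q * r" using rR by simp
    show "r \<le> q * R"
    proof (cases "r \<le> R")
      case True
      then show ?thesis using mult_right_mono[of 1 q R] rR by (simp add: q_def)
    next
      case False
      obtain K' :: "(real^'n) set" where "convex_body K'" "cball 0 r \<subseteq> K'" "K' \<subseteq> cball 0 R" using norm[OF cb] by blast
      then have "cball 0 r \<subseteq> cball (0::real^'n) R" by blast
      then have "r \<le> R" using rR by (simp add: cball_subset_cball_iff)
      then show ?thesis using False by simp
    qed
  qed
  have bdd: "bdd_above X"
  proof (rule bdd_aboveI)
    fix y assume "y \<in> X"
    then obtain K where K: "convex_body K" "y = ?V K" by (auto simp: X_def)
    obtain K' where K': "convex_body K'" "cball 0 r \<subseteq> K'" "K' \<subseteq> cball 0 R" "?V K' = ?V K"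
      using norm[OF K(1)] by blast
    note D = convex_bodyD[OF K'(1)] and B = convex_bodyD[OF cb]
    have "?V K' \<le> (q ^ DIM((real^'n)^'m) * (q ^ DIM(real^'n)) ^ CARD('m)) * ?V (cball 0 r)"
    proof (rule body_value_le_scaled[OF cb K'(1) q(1)])
      fix u :: "real^'n" assume u: "u \<in> sphere 0 1"
      have 1: "r * norm u \<le> support K' u" using support_ge_ball[OF D(4) K'(2), of u] rR by simp
      have 2: "support K' u \<le> R * norm u" by (rule support_le_norm[OF D(6) K'(3)])
      have 3: "support (cball 0 r) u \<le> r * norm u" by (rule support_le_norm[OF B(6)]) simp
      have 4: "r * norm u \<le> support (cball 0 r) u" using support_ge_ball[OF B(4), of 0 r u] rR by simp
      have "1 * support K' u \<le> q * support K' u"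
        using 1 u rR by (intro mult_right_mono) (auto simp: q_def)
      then show "support (cball 0 r) u \<le> q * support K' u" using 1 3 by linarith
      have "q * r \<le> q * support (cball 0 r) u" using 4 u q by (intro mult_left_mono) auto
      then show "support K' u \<le> q * support (cball 0 r) u" using 2 q(2) u by simp
    qed
    then show "y \<le> (q ^ DIM((real^'n)^'m) * (q ^ DIM(real^'n)) ^ CARD('m)) * ?V (cball 0 r)" using K' K by simp
  qed
  define S where "S = Sup X"
  have "\<exists>K :: (real^'n) set. convex_body K \<and> cball 0 r \<subseteq> K \<and> K \<subseteq> cball 0 R \<and> S - 1 / real (Suc n) < ?V K" for n
  proof -
    have "S - 1 / real (Suc n) < S" by simp
    then obtain x where "x \<in> X" "S - 1 / real (Suc n) < x"
      unfolding S_def less_cSup_iff[OF ne bdd] by blast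
    then obtain K where "convex_body K" "S - 1 / real (Suc n) < ?V K" by (auto simp: X_def)
    then show ?thesis using norm[of K] by metis
  qed
  then have "\<forall>n. \<exists>K :: (real^'n) set. convex_body K \<and> cball 0 r \<subseteq> K \<and> K \<subseteq> cball 0 R \<and> S - 1 / real (Suc n) < ?V K" by blast
  from choice[OF this] obtain Ks where Ks: "\<And>n. convex_body (Ks n)" "\<And>n. cball 0 r \<subseteq> Ks n"
    "\<And>n. Ks n \<subseteq> cball 0 R" "\<And>n. S - 1 / real (Suc n) < ?V (Ks n)" by blast
  obtain K k where K: "convex_body K" "strict_mono (k :: nat \<Rightarrow> nat)"
    "\<And>q. 1 < q \<Longrightarrow> \<exists>N. \<forall>n\<ge>N. \<forall>u\<in>sphere 0 1. support K u \<le> q * support (Ks (k n)) u \<and> support (Ks (k n)) u \<le> q * support K u"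
    by (rule support_limit_body[OF Ks(1-3) rR(1)]) (rule that; assumption)
  define d where "d q = q ^ DIM((real^'n)^'m) * (q ^ DIM(real^'n)) ^ CARD('m)" for q :: real
  have le: "S \<le> d q * ?V K" if q: "1 < q" for q
  proof -
    from K(3)[OF q] obtain N where N: "\<And>n u. N \<le> n \<Longrightarrow> u \<in> sphere 0 1 \<Longrightarrow> support K u \<le> q * support (Ks (k n)) u \<and> support (Ks (k n)) u \<le> q * support K u"
      by blast
    have ev: "S - 1 / real (Suc n) \<le> d q * ?V K" if "N \<le> n" for n
    proof -
      have "n \<le> k n" using K(2) by (rule seq_suble)
      then have "1 / real (Suc (k n)) \<le> 1 / real (Suc n)" by (intro divide_left_mono) auto
      then have "S - 1 / real (Suc n) \<le> ?V (Ks (k n))" using Ks(4)[of "k n"] by linarith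
      also have "\<dots> \<le> d q * ?V K"
        unfolding d_def using N[OF that] q by (intro body_value_le_scaled K(1) Ks(1)) auto
      finally show ?thesis .
    qed
    have "(\<lambda>n. S - 1 / real (Suc n)) \<longlonglongrightarrow> S - 0"
      by (intro tendsto_diff tendsto_const LIMSEQ_Suc[OF lim_1_over_n])
    then have "S - 0 \<le> d q * ?V K" by (rule LIMSEQ_le_const2) (use ev in blast)
    then show ?thesis by simp
  qed
  have "S \<le> ?V K"
  proof -
    have "((\<lambda>q. d q * ?V K) \<longlongrightarrow> d 1 * ?V K) (at_right 1)"
      unfolding d_def by (intro tendsto_intros)
    moreover have "\<forall>\<^sub>F q in at_right 1. S \<le> d q * ?V K"
      using le by (auto simp: eventually_at_filter)
    ultimately have "S \<le> d 1 * ?V K" by (intro tendsto_lowerbound) auto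
    then show ?thesis by (simp add: d_def)
  qed
  moreover have "?V K' \<le> S" if "convex_body K'" for K' :: "(real^'n) set"
    unfolding S_def using that bdd by (intro cSup_upper) (auto simp: X_def)
  ultimately have "body_maximizer TYPE('m) K" using K(1) unfolding body_maximizer_def by (meson order_trans)
  then show ?thesis ..
qed

section \<open>Maximizers are ellipsoids\<close>

text \<open>Linear invariance turns the pair \<open>e\<close>, \<open>u\<close> into two coordinate
  directions. Independence gives a nonvanishing minor in columns \<open>k\<close> and
  \<open>l\<close>; placing \<open>e\<close> and \<open>u\<close> in rows \<open>k\<close> and
  \<open>l\<close> of the identity matrix then gives an invertible \<open>A\<close>.\<close>

lemma two_direction_reflection:
  fixes K :: "(real^'n) set"
  assumes K: "body_maximizer TYPE('m::finite) K" and e: "e \<noteq> 0" and u: "\<And>c. u \<noteq> c *\<^sub>R e"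
  obtains s D where "\<And>G :: real \<Rightarrow> real \<Rightarrow> ennreal. case_prod G \<in> borel_measurable borel \<Longrightarrow>
    (\<integral>\<^sup>+x. G (x \<bullet> e - s) (x \<bullet> u) * indicator K x \<partial>lborel)
    = (\<integral>\<^sup>+x. G (- (x \<bullet> e - s)) (x \<bullet> u + D * (x \<bullet> e - s)) * indicator K x \<partial>lborel)"
proof -
  have cK: "convex_body K" using K by (simp add: body_maximizer_def)
  obtain k where k: "e $ k \<noteq> 0" using e by (auto simp: vec_eq_iff)
  have "\<exists>l. e $ k * u $ l \<noteq> e $ l * u $ k"
  proof (rule ccontr)
    assume "\<not> (\<exists>l. e $ k * u $ l \<noteq> e $ l * u $ k)"
    then have "u = (u $ k / e $ k) *\<^sub>R e" using k by (simp add: vec_eq_iff field_simps)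
    then show False using u by blast
  qed
  then obtain l where l: "e $ k * u $ l \<noteq> e $ l * u $ k" ..
  have kl: "k \<noteq> l" using l by auto
  define A :: "real^'n^'n" where "A = (\<chi> i. if i = k then e else if i = l then u else axis i 1)"
  have Ax: "(A *v x) $ i = (if i = k then x \<bullet> e else if i = l then x \<bullet> u else x $ i)" for x i
    by (simp add: A_def matrix_vector_mul_component inner_axis inner_commute[of _ x])
  have "x = 0" if x: "A *v x = 0" for x
  proof -
    have off: "x $ i = 0" if "i \<noteq> k" "i \<noteq> l" for i using Ax[of x i] that x by simp
    have in2: "x \<bullet> w = x $ k * w $ k + x $ l * w $ l" for w
    proof -
      have "x \<bullet> w = (\<Sum>i\<in>UNIV. x $ i * w $ i)" by (simp add: inner_vec_def)
      also have "\<dots> = (\<Sum>i\<in>{k, l}. x $ i * w $ i)"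
        using off by (intro sum.mono_neutral_right) auto
      finally show ?thesis using kl by simp
    qed
    have 1: "x $ k * e $ k + x $ l * e $ l = 0" "x $ k * u $ k + x $ l * u $ l = 0"
      using Ax[of x k] Ax[of x l] x kl unfolding in2 by auto
    have "x $ l * (e $ k * u $ l - e $ l * u $ k) = e $ k * (x $ k * u $ k + x $ l * u $ l) - u $ k * (x $ k * e $ k + x $ l * e $ l)"
      by (simp add: algebra_simps)
    then have "x $ l = 0" using l unfolding 1 by simp
    moreover have "x $ k = 0" using 1(1) \<open>x $ l = 0\<close> k by simp
    ultimately show "x = 0" using off by (metis vec_eq_iff zero_index)
  qed
  then have "invertible A" using invertible_left_inverse[of A] matrix_left_invertible_ker[of A] by blast
  note A = this
  have ax: "axis k 1 \<in> (Basis :: (real^'n) set)" "axis l 1 \<in> (Basis :: (real^'n) set)" "axis k 1 \<noteq> (axis l 1 :: real^'n)"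
    using kl by (auto simp: axis_in_Basis_iff axis_eq_axis)
  obtain s D where sD: "\<And>G :: real \<Rightarrow> real \<Rightarrow> ennreal. case_prod G \<in> borel_measurable borel \<Longrightarrow>
    (\<integral>\<^sup>+x. G (x \<bullet> axis k 1 - s) (x \<bullet> axis l 1) * indicator ((*v) A ` K) x \<partial>lborel)
    = (\<integral>\<^sup>+x. G (- (x \<bullet> axis k 1 - s)) (x \<bullet> axis l 1 + D * (x \<bullet> axis k 1 - s)) * indicator ((*v) A ` K) x \<partial>lborel)"
    by (rule maximizer_axis_reflection[OF body_maximizer_linear_image[OF A K] ax]) (rule that)
  show ?thesis
  proof (rule that[of s D])
    fix G :: "real \<Rightarrow> real \<Rightarrow> ennreal" assume G: "case_prod G \<in> borel_measurable borel"
    have shift: "(\<lambda>x. G (f x) (g x)) \<in> borel_measurable borel"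
      if "continuous_on UNIV f" "continuous_on UNIV g" for f g :: "real^'n \<Rightarrow> real"
    proof -
      have "(\<lambda>x. (f x, g x)) \<in> borel \<rightarrow>\<^sub>M borel" using that by (intro borel_measurable_continuous_onI continuous_intros)
      from measurable_compose[OF this G] show ?thesis by simp
    qed
    have in': "(A *v x) \<bullet> axis k 1 = x \<bullet> e" "(A *v x) \<bullet> axis l 1 = x \<bullet> u" for x
      using Ax[of x k] Ax[of x l] kl by (auto simp: inner_axis)
    have "(\<integral>\<^sup>+x. G ((A *v x) \<bullet> axis k 1 - s) ((A *v x) \<bullet> axis l 1) * indicator K x \<partial>lborel)
      = (\<integral>\<^sup>+x. G (- ((A *v x) \<bullet> axis k 1 - s)) ((A *v x) \<bullet> axis l 1 + D * ((A *v x) \<bullet> axis k 1 - s)) * indicator K x \<partial>lborel)"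
      using nn_integral_linear_image_set[OF A cK shift, of "\<lambda>x. x \<bullet> axis k 1 - s" "\<lambda>x. x \<bullet> axis l 1"]
        nn_integral_linear_image_set[OF A cK shift, of "\<lambda>x. - (x \<bullet> axis k 1 - s)" "\<lambda>x. x \<bullet> axis l 1 + D * (x \<bullet> axis k 1 - s)"]
        sD[OF G] by (simp add: continuous_intros)
    then show "(\<integral>\<^sup>+x. G (x \<bullet> e - s) (x \<bullet> u) * indicator K x \<partial>lborel)
      = (\<integral>\<^sup>+x. G (- (x \<bullet> e - s)) (x \<bullet> u + D * (x \<bullet> e - s)) * indicator K x \<partial>lborel)"
      unfolding in' .
  qed
qed

section \<open>Barycentre and second moments\<close>

definition centered :: "'a::euclidean_space set \<Rightarrow> bool" where
  "centered K \<longleftrightarrow> (\<forall>e. (\<integral>x. indicator K x *\<^sub>R (x \<bullet> e) \<partial>lborel) = 0)"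

lemma exists_centering:
  fixes K :: "'a::euclidean_space set"
  assumes cK: "convex_body K"
  obtains z where "centered ((+) (- z) ` K)"
proof -
  note K = convex_bodyD[OF cK]
  define V where "V = measure lborel K"
  have V: "0 < V" unfolding V_def by (rule measure_lborel_pos[OF cK])
  have int: "integrable lborel (\<lambda>x. indicator K x *\<^sub>R x)"
    using K by (intro borel_integrable_compact) (auto intro: continuous_intros)
  have int1: "integrable lborel (\<lambda>x. indicator K x *\<^sub>R (x \<bullet> e))" for e
    using K by (intro borel_integrable_compact) (auto intro: continuous_intros)
  have int2: "integrable lborel (\<lambda>x. indicator K x *\<^sub>R (z \<bullet> e))" for z e :: 'a
    using K by (intro borel_integrable_compact) (auto intro: continuous_intros)
  define z where "z = (1 / V) *\<^sub>R (\<integral>x. indicator K x *\<^sub>R x \<partial>lborel)"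
  have "(\<integral>x. indicator ((+) (- z) ` K) x *\<^sub>R (x \<bullet> e) \<partial>lborel) = 0" for e
  proof -
    have m: "(+) (- z) ` K \<in> sets borel" using convex_bodyD(7)[OF convex_body_translation[OF cK]] .
    have "(\<integral>x. indicator ((+) (- z) ` K) x *\<^sub>R (x \<bullet> e) \<partial>lborel)
      = (\<integral>x. indicator ((+) (- z) ` K) x *\<^sub>R (x \<bullet> e) \<partial>distr lborel borel ((+) (- z)))"
      by (subst lborel_distr_plus) simp
    also have "\<dots> = (\<integral>x. indicator ((+) (- z) ` K) (- z + x) *\<^sub>R ((- z + x) \<bullet> e) \<partial>lborel)"
      using m by (intro integral_distr) (auto intro!: borel_measurable_scaleR borel_measurable_indicator)
    also have "\<dots> = (\<integral>x. indicator K x *\<^sub>R (x \<bullet> e) - indicator K x *\<^sub>R (z \<bullet> e) \<partial>lborel)"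
      by (intro Bochner_Integration.integral_cong) (auto simp: indicator_def inner_diff_left)
    also have "\<dots> = (\<integral>x. indicator K x *\<^sub>R (x \<bullet> e) \<partial>lborel) - (\<integral>x. indicator K x *\<^sub>R (z \<bullet> e) \<partial>lborel)"
      by (rule Bochner_Integration.integral_diff[OF int1 int2])
    also have "(\<integral>x. indicator K x *\<^sub>R (z \<bullet> e) \<partial>lborel) = V * (z \<bullet> e)"
      using K by (simp add: V_def)
    also have "\<dots> = (\<integral>x. indicator K x *\<^sub>R x \<partial>lborel) \<bullet> e" using V by (simp add: z_def)
    also have "\<dots> = (\<integral>x. (indicator K x *\<^sub>R x) \<bullet> e \<partial>lborel)" by (rule integral_inner_left[symmetric]) (use int in auto)
    finally show ?thesis by simp
  qed
  then have "centered ((+) (- z) ` K)" unfolding centered_def by blast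
  then show ?thesis by (rule that)
qed

definition moment :: "'a::euclidean_space set \<Rightarrow> 'a \<Rightarrow> 'a \<Rightarrow> real" where
  "moment K u v = (\<integral>x. indicator K x *\<^sub>R ((x \<bullet> u) * (x \<bullet> v)) \<partial>lborel)"

context
  fixes K :: "'a::euclidean_space set"
  assumes cK: "convex_body K"
begin

lemma integrable_moment: "integrable lborel (\<lambda>x. indicator K x *\<^sub>R ((x \<bullet> u) * (x \<bullet> v)))"
  using convex_bodyD[OF cK] by (intro borel_integrable_compact continuous_intros) auto

lemma moment_commute: "moment K u v = moment K v u"
  by (simp add: moment_def mult.commute)

lemma bilinear_moment: "bilinear (moment K)"
proof -
  have add: "moment K (u + v) w = moment K u w + moment K v w" for u v w
    unfolding moment_def Bochner_Integration.integral_add[OF integrable_moment integrable_moment, symmetric]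
    by (intro Bochner_Integration.integral_cong) (auto simp: inner_add_right algebra_simps)
  have scale: "moment K (c *\<^sub>R u) w = c *\<^sub>R moment K u w" for c u w
    unfolding moment_def integral_scaleR_right[symmetric]
    by (intro Bochner_Integration.integral_cong) (auto simp: mult_ac)
  have add': "moment K w (u + v) = moment K w u + moment K w v" for u v w
    using add[of u v w] by (simp only: moment_commute[of w])
  have scale': "moment K w (c *\<^sub>R u) = c *\<^sub>R moment K w u" for c u w
    using scale[of c u w] by (simp only: moment_commute[of w])
  show ?thesis unfolding bilinear_def using add scale add' scale' by (auto intro!: linearI)
qed

lemma nn_integral_moment: "(\<integral>\<^sup>+x. ennreal ((x \<bullet> u)\<^sup>2) * indicator K x \<partial>lborel) = ennreal (moment K u u)"
proof -
  have "(\<integral>\<^sup>+x. ennreal ((x \<bullet> u)\<^sup>2) * indicator K x \<partial>lborel) = (\<integral>\<^sup>+x. ennreal (indicator K x *\<^sub>R ((x \<bullet> u) * (x \<bullet> u))) \<partial>lborel)"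
    by (intro nn_integral_cong) (auto simp: indicator_def power2_eq_square)
  also have "\<dots> = ennreal (moment K u u)"
    unfolding moment_def by (intro nn_integral_eq_integral integrable_moment) auto
  finally show ?thesis .
qed

lemma moment_nonneg: "0 \<le> moment K u u"
  unfolding moment_def by (intro integral_nonneg_AE) auto

text \<open>If the moment vanished, almost all of \<open>K\<close> would lie in the null set
  orthogonal to \<open>u\<close>.\<close>

lemma moment_pos:
  assumes "u \<noteq> 0"
  shows "0 < moment K u u"
proof (rule ccontr)
  assume "\<not> 0 < moment K u u"
  then have "moment K u u = 0" using moment_nonneg[of u] by simp
  have [measurable]: "K \<in> sets borel" by (rule convex_bodyD(7)[OF cK])
  have "(\<integral>\<^sup>+x. ennreal ((x \<bullet> u)\<^sup>2) * indicator K x \<partial>lborel) = 0" unfolding nn_integral_moment by (simp add: \<open>moment K u u = 0\<close>)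
  then have "AE x in lborel. ennreal ((x \<bullet> u)\<^sup>2) * indicator K x = 0"
    by (subst (asm) nn_integral_0_iff_AE) auto
  then have "AE x in lborel. x \<notin> K \<inter> - {x. x \<bullet> u = 0}"
    by eventually_elim (auto simp: indicator_def split: if_splits)
  then have z: "emeasure lborel (K \<inter> - {x. x \<bullet> u = 0}) = 0"
    using AE_iff_null_sets[of "K \<inter> - {x. x \<bullet> u = 0}" lborel] by auto
  have "emeasure lborel K \<le> emeasure lborel ((K \<inter> - {x. x \<bullet> u = 0}) \<union> {x. x \<bullet> u = 0})"
    by (intro emeasure_mono) auto
  also have "\<dots> \<le> emeasure lborel (K \<inter> - {x. x \<bullet> u = 0}) + emeasure lborel {x. x \<bullet> u = 0}"
    by (intro emeasure_subadditive) auto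
  finally have "emeasure lborel K = 0" using z emeasure_hyperplane_0[OF assms, of 0] by simp
  then show False using measure_lborel_pos[OF cK] by (simp add: measure_def)
qed

text \<open>Shows that the support function at \<open>u\<close> is determined by the distribution of
  \<open>x \<bullet> u\<close> on \<open>K\<close>. A nonempty cap contains interior points of
  \<open>K\<close>, hence has positive measure.\<close>

lemma support_le_iff_measure: "support K u \<le> c \<longleftrightarrow> emeasure lborel (K \<inter> {x. c < x \<bullet> u}) = 0"
proof
  note D = convex_bodyD[OF cK]
  show "support K u \<le> c \<Longrightarrow> emeasure lborel (K \<inter> {x. c < x \<bullet> u}) = 0"
  proof -
    assume "support K u \<le> c"
    then have "K \<inter> {x. c < x \<bullet> u} = {}" using support_upper[OF D(4), of _ u] by fastforce
    then show ?thesis by simp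
  qed
  assume z: "emeasure lborel (K \<inter> {x. c < x \<bullet> u}) = 0"
  show "support K u \<le> c"
  proof (rule ccontr)
    assume "\<not> support K u \<le> c"
    then obtain x where x: "x \<in> K" "c < x \<bullet> u" using D by (auto simp: support_le_iff not_le)
    have op: "open {x. c < x \<bullet> u}" by (intro open_Collect_less continuous_intros)
    have "x \<in> closure (interior K)" using convex_closure_interior[OF D(2,3)] closure_subset x(1) by blast
    then have "interior K \<inter> {x. c < x \<bullet> u} \<noteq> {}"
      using open_Int_closure_eq_empty[OF op, of "interior K"] x(2) by auto
    moreover have op2: "open (interior K \<inter> {x. c < x \<bullet> u})" using op by auto
    ultimately have "\<not> negligible (interior K \<inter> {x. c < x \<bullet> u})" by (intro open_not_negligible)
    moreover have "emeasure lborel (interior K \<inter> {x. c < x \<bullet> u}) \<le> emeasure lborel (K \<inter> {x. c < x \<bullet> u})"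
      using D(7) op interior_subset by (intro emeasure_mono) auto
    then have "emeasure lborel (interior K \<inter> {x. c < x \<bullet> u}) = 0" using z by simp
    then have "negligible (interior K \<inter> {x. c < x \<bullet> u})" using op2 by (simp add: negligible_iff_emeasure0)
    ultimately show False by blast
  qed
qed

end

text \<open>The reflection supplied by maximality sends \<open>x \<bullet> \<theta>\<close> to \<open>x \<bullet> \<eta>\<close>: its shift \<open>s\<close> vanishes because
  \<open>K\<close> is centered, its skewness \<open>d\<close> because \<open>\<theta> - \<eta>\<close> and \<open>\<theta> + \<eta>\<close> are orthogonal for the moment form.\<close>

lemma support_eq_of_moment_eq_independent:
  fixes K :: "(real^'n) set"
  assumes K: "body_maximizer TYPE('m::finite) K" "centered K"
    and \<theta>: "moment K \<theta> \<theta> = moment K \<eta> \<eta>" and e: "\<theta> - \<eta> \<noteq> 0" "\<And>c. \<theta> + \<eta> \<noteq> c *\<^sub>R (\<theta> - \<eta>)"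
  shows "support K \<theta> = support K \<eta>"
proof -
  have cK: "convex_body K" using K by (simp add: body_maximizer_def)
  note D = convex_bodyD[OF cK] and B = bilinear_moment[OF cK]
  have [measurable]: "K \<in> sets borel" by (rule D(7))
  \<comment> \<open>Since \<open>\<theta>\<close> and \<open>\<eta>\<close> are half of
    \<open>?u + ?e\<close> and half of \<open>?u - ?e\<close>, a reflection that negates
    \<open>x \<bullet> ?e\<close> and fixes \<open>x \<bullet> ?u\<close> exchanges their
    distributions.\<close>
  let ?e = "\<theta> - \<eta>" and ?u = "\<theta> + \<eta>"
  obtain s d where sD: "\<And>G :: real \<Rightarrow> real \<Rightarrow> ennreal. case_prod G \<in> borel_measurable borel \<Longrightarrow>
    (\<integral>\<^sup>+x. G (x \<bullet> ?e - s) (x \<bullet> ?u) * indicator K x \<partial>lborel)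
    = (\<integral>\<^sup>+x. G (- (x \<bullet> ?e - s)) (x \<bullet> ?u + d * (x \<bullet> ?e - s)) * indicator K x \<partial>lborel)"
    by (rule two_direction_reflection[OF K(1) e]) (rule that)
  have fst_m: "case_prod (\<lambda>s (t::real). ennreal s) \<in> borel_measurable (borel :: (real \<times> real) measure)"
    unfolding case_prod_beta'
    by (rule measurable_compose[OF _ measurable_ennreal])
       (intro borel_measurable_continuous_onI continuous_intros)
  \<comment> \<open>The test function is the positive part of its first argument, because
    \<open>ennreal\<close> truncates. Thus the positive and negative parts of
    \<open>x \<bullet> ?e - s\<close> have equal integrals, and for centered \<open>K\<close> its
    total integral is minus \<open>s\<close> times the volume.\<close>
  have "s = 0"
  proof -
    let ?f = "\<lambda>x. indicator K x *\<^sub>R (x \<bullet> ?e - s)"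
    have If: "integrable lborel ?f" using D by (intro borel_integrable_compact continuous_intros) auto
    have eq: "(\<integral>\<^sup>+x. ennreal (?f x) \<partial>lborel) = (\<integral>\<^sup>+x. ennreal (- ?f x) \<partial>lborel)"
    proof -
      have "(\<integral>\<^sup>+x. ennreal (?f x) \<partial>lborel) = (\<integral>\<^sup>+x. ennreal (x \<bullet> ?e - s) * indicator K x \<partial>lborel)"
        by (intro nn_integral_cong) (auto simp: indicator_def)
      also have "\<dots> = (\<integral>\<^sup>+x. ennreal (- (x \<bullet> ?e - s)) * indicator K x \<partial>lborel)" by (rule sD[OF fst_m])
      also have "\<dots> = (\<integral>\<^sup>+x. ennreal (- ?f x) \<partial>lborel)"
        by (intro nn_integral_cong) (auto simp: indicator_def)
      finally show ?thesis .
    qed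
    have I1: "integrable lborel (\<lambda>x. indicator K x *\<^sub>R (x \<bullet> ?e))" and I2: "integrable lborel (\<lambda>x. indicator K x *\<^sub>R s)"
      using D by (intro borel_integrable_compact continuous_intros; auto)+
    have "(\<integral>x. ?f x \<partial>lborel) = 0" unfolding real_lebesgue_integral_def[OF If] eq by simp
    moreover have "(\<integral>x. ?f x \<partial>lborel) = (\<integral>x. indicator K x *\<^sub>R (x \<bullet> ?e) \<partial>lborel) - (\<integral>x. indicator K x *\<^sub>R s \<partial>lborel)"
      unfolding Bochner_Integration.integral_diff[OF I1 I2, symmetric]
      by (intro Bochner_Integration.integral_cong) (auto simp: algebra_simps)
    moreover have "(\<integral>x. indicator K x *\<^sub>R s \<partial>lborel) = measure lborel K * s" by simp
    ultimately have "measure lborel K * s = 0" using K(2) unfolding centered_def by simp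
    then show "s = 0" using measure_lborel_pos[OF cK] by simp
  qed
  note sD = sD[unfolded this diff_0_right]
  have "d = 0"
  proof -
    have "case_prod (\<lambda>s t::real. ennreal (t\<^sup>2)) \<in> borel_measurable (borel :: (real \<times> real) measure)"
      unfolding case_prod_beta'
      by (rule measurable_compose[OF _ measurable_ennreal])
         (intro borel_measurable_continuous_onI continuous_intros)
    from sD[OF this] have "(\<integral>\<^sup>+x. ennreal ((x \<bullet> ?u)\<^sup>2) * indicator K x \<partial>lborel) = (\<integral>\<^sup>+x. ennreal ((x \<bullet> (?u + d *\<^sub>R ?e))\<^sup>2) * indicator K x \<partial>lborel)"
      by (simp only: inner_add_right inner_scaleR_right)
    then have "moment K ?u ?u = moment K (?u + d *\<^sub>R ?e) (?u + d *\<^sub>R ?e)"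
      unfolding nn_integral_moment[OF cK] using moment_nonneg[OF cK] by simp
    also have "\<dots> = moment K ?u ?u + 2 * d * moment K ?u ?e + d\<^sup>2 * moment K ?e ?e"
    proof -
      have "moment K (a + d *\<^sub>R b) (a + d *\<^sub>R b) = moment K a a + 2 * d * moment K a b + d\<^sup>2 * moment K b b" for a b
        using moment_commute[OF cK, of b a]
        by (simp add: bilinear_ladd[OF B] bilinear_radd[OF B] bilinear_lmul[OF B] bilinear_rmul[OF B]
          algebra_simps power2_eq_square)
      then show ?thesis .
    qed
    also have "moment K ?u ?e = moment K \<theta> \<theta> - moment K \<eta> \<eta>"
      using moment_commute[OF cK, of \<theta> \<eta>]
      by (simp only: bilinear_ladd[OF B] bilinear_rsub[OF B])
    finally have "d\<^sup>2 * moment K ?e ?e = 0" using \<theta> by simp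
    then show "d = 0" using moment_pos[OF cK e(1)] by simp
  qed
  have "support K \<theta> \<le> c \<longleftrightarrow> support K \<eta> \<le> c" for c
  proof -
    let ?G = "\<lambda>s t :: real. indicator {p :: real \<times> real. c < (fst p + snd p) / 2} (s, t) :: ennreal"
    have G: "case_prod ?G \<in> borel_measurable borel"
    proof -
      have "open {p :: real \<times> real. c < (fst p + snd p) / 2}" by (intro open_Collect_less continuous_intros) auto
      then show ?thesis by (simp add: case_prod_eta)
    qed
    have h: "(x \<bullet> ?e + x \<bullet> ?u) / 2 = x \<bullet> \<theta>" "(- (x \<bullet> ?e) + (x \<bullet> ?u + 0 * (x \<bullet> ?e))) / 2 = x \<bullet> \<eta>" for x
      by (simp_all add: inner_diff_right inner_add_right)
    have em: "(\<integral>\<^sup>+x. indicator {x. c < x \<bullet> v} x * indicator K x \<partial>lborel) = emeasure lborel (K \<inter> {x. c < x \<bullet> v})" for v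
    proof -
      have "(\<integral>\<^sup>+x. indicator {x. c < x \<bullet> v} x * indicator K x \<partial>lborel) = (\<integral>\<^sup>+x. indicator (K \<inter> {x. c < x \<bullet> v}) x \<partial>lborel)"
        by (intro nn_integral_cong) (auto simp: indicator_def)
      also have "\<dots> = emeasure lborel (K \<inter> {x. c < x \<bullet> v})" by (rule nn_integral_indicator) measurable
      finally show ?thesis .
    qed
    have "emeasure lborel (K \<inter> {x. c < x \<bullet> \<theta>}) = (\<integral>\<^sup>+x. ?G (x \<bullet> ?e) (x \<bullet> ?u) * indicator K x \<partial>lborel)"
      unfolding em[symmetric] unfolding h(1)[symmetric] by (intro nn_integral_cong) (simp add: indicator_def)
    also have "\<dots> = (\<integral>\<^sup>+x. ?G (- (x \<bullet> ?e)) (x \<bullet> ?u + d * (x \<bullet> ?e)) * indicator K x \<partial>lborel)"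
      by (rule sD[OF G])
    also have "\<dots> = emeasure lborel (K \<inter> {x. c < x \<bullet> \<eta>})"
      unfolding em[symmetric] unfolding h(2)[symmetric] \<open>d = 0\<close> by (intro nn_integral_cong) (simp add: indicator_def)
    finally show ?thesis by (simp add: support_le_iff_measure[OF cK])
  qed
  then show ?thesis by (meson order_antisym order_refl)
qed

lemma moment_scaleR:
  assumes "convex_body K"
  shows "moment K (c *\<^sub>R u) (c *\<^sub>R u) = c\<^sup>2 * moment K u u"
  by (simp add: bilinear_lmul[OF bilinear_moment[OF assms]] bilinear_rmul[OF bilinear_moment[OF assms]] power2_eq_square)

text \<open>The vectors left over are \<open>\<eta> = \<theta>\<close> and
  \<open>\<eta> = - \<theta>\<close>, to which no reflection applies directly. In dimension at least
  2 there is a multiple \<open>t *\<^sub>R v\<close> of a coordinate vector that is independent of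
  both and has the same moment, and each of them is compared with it.\<close>

lemma support_eq_of_moment_eq:
  fixes K :: "(real^'n) set"
  assumes K: "body_maximizer TYPE('m::finite) K" "centered K" and n: "2 \<le> CARD('n)"
    and \<theta>: "moment K \<theta> \<theta> = moment K \<eta> \<eta>"
  shows "support K \<theta> = support K \<eta>"
proof -
  have cK: "convex_body K" using K by (simp add: body_maximizer_def)
  show ?thesis
  proof (cases "\<exists>c. \<theta> = c *\<^sub>R \<eta> \<or> \<eta> = c *\<^sub>R \<theta>")
    case False
    show ?thesis
    proof (rule support_eq_of_moment_eq_independent[OF K \<theta>])
      show "\<theta> - \<eta> \<noteq> 0" using False by (metis right_minus_eq scaleR_one)
      show "\<theta> + \<eta> \<noteq> c *\<^sub>R (\<theta> - \<eta>)" for c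
      proof
        assume "\<theta> + \<eta> = c *\<^sub>R (\<theta> - \<eta>)"
        then have eq: "(1 + c) *\<^sub>R \<eta> = (c - 1) *\<^sub>R \<theta>" by (simp add: algebra_simps)
        show False
        proof (cases "1 + c = 0")
          case True
          then have "c - 1 \<noteq> 0" by simp
          then have "\<theta> = 0" using eq True by simp
          then show False using False by (metis scaleR_zero_left)
        next
          case nz: False
          have "\<eta> = (1 / (1 + c)) *\<^sub>R ((1 + c) *\<^sub>R \<eta>)" using nz by simp
          also have "\<dots> = ((c - 1) / (1 + c)) *\<^sub>R \<theta>" unfolding eq by simp
          finally show False using False by blast
        qed
      qed
    qed
  next
    case par: True
    show ?thesis
    proof (cases "\<theta> = 0 \<or> \<eta> = 0")
      case True
      then have "\<theta> = 0 \<and> \<eta> = 0" using \<theta> moment_pos[OF cK, of \<theta>] moment_pos[OF cK, of \<eta>] moment_scaleR[OF cK, of 0 \<theta>] by (cases "\<theta> = 0"; cases "\<eta> = 0") auto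
      then show ?thesis by simp
    next
      case nz: False
      then obtain c where c: "\<eta> = c *\<^sub>R \<theta>"
        using par by (metis scaleR_one scaleR_scaleR scaleR_zero_left left_inverse)
      have "c\<^sup>2 = 1" using \<theta> moment_pos[OF cK, of \<theta>] nz unfolding c moment_scaleR[OF cK] by simp
      then have c1: "c = 1 \<or> c = -1" by (simp add: power2_eq_1_iff)
      obtain i where i: "\<theta> $ i \<noteq> 0" using nz by (auto simp: vec_eq_iff)
      have "\<exists>j. j \<noteq> i"
      proof (rule ccontr)
        assume "\<nexists>j. j \<noteq> i"
        then have "(UNIV :: 'n set) = {i}" by auto
        then have "CARD('n) = card {i}" by (rule arg_cong)
        then show False using n by simp
      qed
      then obtain j where j: "j \<noteq> i" ..
      define v where "v = (axis j 1 :: real^'n)"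
      have v0: "v \<noteq> 0" by (simp add: v_def axis_eq_0_iff)
      have vi: "v $ i = 0" "v $ j = 1" using j by (auto simp: v_def axis_def)
      define t where "t = sqrt (moment K \<theta> \<theta> / moment K v v)"
      have t: "0 < t" using moment_pos[OF cK] nz v0 by (simp add: t_def)
      have mt: "moment K (t *\<^sub>R v) (t *\<^sub>R v) = moment K \<theta> \<theta>"
        using moment_pos[OF cK v0] moment_nonneg[OF cK, of \<theta>] unfolding moment_scaleR[OF cK] by (simp add: t_def)
      have st: "support K w = support K (t *\<^sub>R v)" if w: "moment K w w = moment K \<theta> \<theta>" "w $ i \<noteq> 0" for w
      proof (rule support_eq_of_moment_eq_independent[OF K])
        show "moment K w w = moment K (t *\<^sub>R v) (t *\<^sub>R v)" using w mt by simp
        show "w - t *\<^sub>R v \<noteq> 0" 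
        proof
          assume "w - t *\<^sub>R v = 0"
          then have "(w - t *\<^sub>R v) $ i = 0" by (simp only: zero_index)
          then show False using w(2) vi by simp
        qed
        show "w + t *\<^sub>R v \<noteq> k *\<^sub>R (w - t *\<^sub>R v)" for k
        proof
          assume eq: "w + t *\<^sub>R v = k *\<^sub>R (w - t *\<^sub>R v)"
          have "w $ i = k * w $ i" using arg_cong[OF eq, of "\<lambda>x. x $ i"] vi by simp
          then have "k = 1" using w(2) by simp
          then have "(w + t *\<^sub>R v) $ j = (w - t *\<^sub>R v) $ j" using eq by (simp only: scaleR_one)
          then show False using t vi by simp
        qed
      qed
      have "support K \<theta> = support K (t *\<^sub>R v)" using i by (intro st) auto
      moreover have "support K \<eta> = support K (t *\<^sub>R v)" using i \<theta> c c1 by (intro st) auto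
      ultimately show ?thesis by simp
    qed
  qed
qed

text \<open>Maximize the modulus of the determinant over matrices whose rows have
  \<open>q\<close>-length at most 1. A shorter row could be stretched, so every maximizer has unit
  rows. Subtracting from one row its projection on another keeps the determinant and leaves squared
  length \<open>1 - b^2\<close>; as this matrix is again a maximizer, \<open>b = 0\<close>.\<close>

lemma orthonormal_rows:
  fixes q :: "real^'n \<Rightarrow> real^'n \<Rightarrow> real"
  assumes B: "bilinear q" and sym: "\<And>u v. q u v = q v u" and pos: "\<And>u. u \<noteq> 0 \<Longrightarrow> 0 < q u u"
  obtains W :: "real^'n^'n" where "det W \<noteq> 0" "\<And>i j. q (W $ i) (W $ j) = (if i = j then 1 else 0)"
proof -
  note bil = bilinear_ladd[OF B] bilinear_radd[OF B] bilinear_lmul[OF B] bilinear_rmul[OF B]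
  have q0: "q 0 v = 0" for v by (rule bilinear_lzero[OF B])
  have nn: "0 \<le> q u u" for u using pos[of u] q0[of 0] by (cases "u = 0") auto
  have BB: "bounded_bilinear q" using B by (simp add: bilinear_conv_bounded_bilinear)
  have qc: "continuous_on S (\<lambda>x. q (f x) (f x))" if "continuous_on S f" for S and f :: "'x::topological_space \<Rightarrow> real^'n"
    using that by (intro bounded_bilinear.continuous_on[OF BB])
  have sc: "q (c *\<^sub>R u) (c *\<^sub>R u) = c\<^sup>2 * q u u" for c u by (simp add: bil power2_eq_square)
  have "axis undefined 1 \<in> sphere (0::real^'n) 1" by simp
  then have "sphere (0::real^'n) 1 \<noteq> {}" by blast
  from continuous_attains_inf[OF compact_sphere this qc[OF continuous_on_id]]
  obtain w where w: "w \<in> sphere 0 1" "\<And>y. y \<in> sphere 0 1 \<Longrightarrow> q w w \<le> q y y" by auto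
  have qw: "0 < q w w" using w(1) by (intro pos) auto
  have low: "q w w * (norm y)\<^sup>2 \<le> q y y" for y
  proof (cases "y = 0")
    case False
    have "q w w \<le> q ((1 / norm y) *\<^sub>R y) ((1 / norm y) *\<^sub>R y)" using False by (intro w(2)) simp
    then show ?thesis using False unfolding sc by (simp add: field_simps)
  qed (simp add: q0)
  define C where "C = {W :: real^'n^'n. \<forall>i. q (W $ i) (W $ i) \<le> 1}"
  have "closed C" unfolding C_def
    by (intro closed_Collect_all closed_Collect_le qc continuous_intros)
  moreover have "bounded C"
  proof -
    have "norm W \<le> (\<Sum>i\<in>(UNIV::'n set). sqrt (1 / q w w))" if "W \<in> C" for W
    proof -
      have "norm (W $ i) \<le> sqrt (1 / q w w)" for i
      proof (rule real_le_rsqrt)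
        have "q w w * (norm (W $ i))\<^sup>2 \<le> 1" using low[of "W $ i"] that by (auto simp: C_def intro: order_trans)
        then show "(norm (W $ i))\<^sup>2 \<le> 1 / q w w" using qw by (simp add: field_simps)
      qed
      then show ?thesis using norm_vec_le_sum[of W] by (meson order_trans sum_mono)
    qed
    then show ?thesis unfolding bounded_iff by blast
  qed
  ultimately have cC: "compact C" by (simp add: compact_eq_bounded_closed)
  define M where "M = 1 + (\<Sum>i\<in>UNIV. q (axis i 1) (axis i 1))"
  have M: "1 \<le> M" "q (axis i 1) (axis i 1) \<le> M" for i
    using sum_nonneg[of UNIV "\<lambda>i. q (axis i 1) (axis i 1)"] member_le_sum[of i UNIV "\<lambda>i. q (axis i 1) (axis i 1)"] nn
    by (auto simp: M_def)
  \<comment> \<open>Small enough for \<open>t\<close> times each coordinate vector to have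
    \<open>q\<close>-length at most 1, which shows that the maximal determinant is nonzero.\<close>
  define t where "t = sqrt (1 / M)"
  have t: "0 < t" "t\<^sup>2 = 1 / M" using M by (auto simp: t_def)
  have in1: "mat t \<in> C"
  proof -
    have "mat t $ i = t *\<^sub>R (axis i 1 :: real^'n)" for i by (simp add: vec_eq_iff mat_def axis_def)
    then show ?thesis using M unfolding C_def by (auto simp: sc t(2) field_simps)
  qed
  have "continuous_on C (\<lambda>W. \<bar>det W\<bar>)" by (intro continuous_intros)
  from continuous_attains_sup[OF cC _ this] in1 obtain W where W: "W \<in> C" "\<And>Y. Y \<in> C \<Longrightarrow> \<bar>det Y\<bar> \<le> \<bar>det W\<bar>"
    by blast
  have "det (mat t :: real^'n^'n) = t ^ CARD('n)" by (subst det_diagonal) (auto simp: mat_def)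
  then have "0 < \<bar>det (mat t :: real^'n^'n)\<bar>" using t by simp
  then have dW: "0 < \<bar>det W\<bar>" using W(2)[OF in1] by linarith
  have row: "row i Y = Y $ i" for i and Y :: "real^'n^'n" by (simp add: row_def)
  have unit: "q (Y $ i) (Y $ i) = 1" if Y: "Y \<in> C" "\<bar>det Y\<bar> = \<bar>det W\<bar>" for Y i
  proof (rule ccontr)
    assume ne: "q (Y $ i) (Y $ i) \<noteq> 1"
    define a where "a = q (Y $ i) (Y $ i)"
    have "Y $ i \<noteq> 0" using det_zero_row(1)[of i Y] dW Y(2) row[of i Y] by force
    then have a: "0 < a" "a < 1" using pos Y(1) ne by (auto simp: a_def C_def less_le)
    let ?Z = "\<chi> k. if k = i then (1 / sqrt a) *s (Y $ i) else Y $ k"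
    have "?Z \<in> C" using Y(1) a unfolding C_def
      by (auto simp: scalar_mult_eq_scaleR sc a_def[symmetric] power_divide)
    moreover have "det ?Z = (1 / sqrt a) * det Y"
    proof -
      have "det ?Z = (1 / sqrt a) * det (\<chi> k. if k = i then Y $ i else Y $ k)" by (rule det_row_mul)
      also have "(\<chi> k. if k = i then Y $ i else Y $ k) = Y" by (simp add: vec_eq_iff)
      finally show ?thesis .
    qed
    ultimately have "(1 / sqrt a) * \<bar>det W\<bar> \<le> \<bar>det W\<bar>" using W(2)[of ?Z] Y(2) a by (simp add: abs_mult)
    then have "1 / sqrt a \<le> 1" using mult_right_le_imp_le[of "1 / sqrt a" "\<bar>det W\<bar>" 1] dW by simp
    then have "1 \<le> sqrt a" using a by (simp add: field_simps)
    then show False using a by simp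
  qed
  have orth: "q (W $ i) (W $ j) = 0" if ij: "i \<noteq> j" for i j
  proof -
    define b where "b = q (W $ i) (W $ j)"
    let ?Y = "\<chi> k. if k = i then row i W + (- b) *s row j W else row k W"
    have d: "det ?Y = det W" by (rule det_row_operation[OF ij])
    have u: "q (W $ k) (W $ k) = 1" for k by (rule unit[OF W(1) refl])
    have Yi: "?Y $ i = W $ i + (- b) *\<^sub>R (W $ j)" by (simp add: row scalar_mult_eq_scaleR)
    have qY: "q (?Y $ i) (?Y $ i) = 1 - b\<^sup>2"
      unfolding Yi bil u using sym[of "W $ j" "W $ i"] by (simp add: b_def[symmetric] power2_eq_square)
    have "?Y \<in> C" unfolding C_def mem_Collect_eq
    proof
      fix k show "q (?Y $ k) (?Y $ k) \<le> 1"
        using qY u[of k] by (cases "k = i") (auto simp: row)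
    qed
    from unit[OF this, of i] qY d show ?thesis by (simp add: b_def)
  qed
  show ?thesis
  proof (rule that[of W])
    show "q (W $ i) (W $ j) = (if i = j then 1 else 0)" for i j
      using orth[of i j] unit[OF W(1) refl, of i] by auto
  qed (use dW in auto)
qed

section \<open>Ellipsoids and the characterization of maximizers\<close>

lemma ellipsoid_translation:
  fixes E :: "(real^'n) set"
  assumes "ellipsoid E"
  shows "ellipsoid ((+) z ` E)"
proof -
  obtain A :: "real^'n^'n" and b where A: "invertible A" "E = (\<lambda>x. A *v x + b) ` cball 0 1" using assms unfolding ellipsoid_def by blast
  have "(+) z ` E = (\<lambda>x. A *v x + (z + b)) ` cball 0 1" unfolding A(2) image_image by (simp add: add_ac)
  then show ?thesis using A(1) unfolding ellipsoid_def by blast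
qed

text \<open>On the line every convex body is a segment. This case stands apart because the
  reflections need a second direction.\<close>

lemma ellipsoid_dimension_one:
  fixes K :: "(real^'n) set"
  assumes K: "convex_body K" and n: "CARD('n) = 1"
  shows "ellipsoid K"
proof -
  note D = convex_bodyD[OF K]
  obtain i :: 'n where i: "UNIV = {i}" using n by (metis card_1_singletonE)
  have eq: "x = y \<longleftrightarrow> x $ i = y $ i" for x y :: "real^'n"
    unfolding vec_eq_iff using i by (metis UNIV_I singletonD)
  have c: "continuous_on K (\<lambda>x. x $ i)" by (intro continuous_intros)
  obtain p where p: "p \<in> K" "\<And>x. x \<in> K \<Longrightarrow> p $ i \<le> x $ i" using continuous_attains_inf[OF D(1,6) c] by blast
  obtain q where q: "q \<in> K" "\<And>x. x \<in> K \<Longrightarrow> x $ i \<le> q $ i" using continuous_attains_sup[OF D(1,6) c] by blast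
  define r where "r = (q $ i - p $ i) / 2"
  define m where "m = (1/2) *\<^sub>R (p + q)"
  have r: "0 < r"
  proof (rule ccontr)
    assume "\<not> 0 < r"
    then have "x = p" if "x \<in> K" for x using p(2)[OF that] q(2)[OF that] unfolding eq r_def by simp
    then have "K \<subseteq> {p}" by auto
    then have "interior K \<subseteq> interior {p}" by (rule interior_mono)
    then show False using D(3) by simp
  qed
  have nx: "norm x = \<bar>x $ i\<bar>" for x :: "real^'n"
    unfolding norm_vec_def L2_set_def i by simp
  have Ax: "(mat r *v x) $ i = r * x $ i" for x :: "real^'n"
    by (simp add: matrix_vector_mult_def mat_def i)
  have "K = (\<lambda>x. mat r *v x + m) ` cball 0 1"
  proof (intro set_eqI iffI)
    fix x assume x: "x \<in> K"
    let ?y = "(1 / r) *\<^sub>R (x - m)"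
    have "\<bar>x $ i - m $ i\<bar> \<le> r" using p(2)[OF x] q(2)[OF x] by (auto simp: r_def m_def abs_le_iff field_simps)
    then have "?y \<in> cball 0 1" using r by (simp add: nx abs_mult)
    moreover have "x = mat r *v ?y + m" unfolding eq using r by (simp add: Ax)
    ultimately show "x \<in> (\<lambda>x. mat r *v x + m) ` cball 0 1" by blast
  next
    fix x assume "x \<in> (\<lambda>x. mat r *v x + m) ` cball 0 1"
    then obtain y where y: "\<bar>y $ i\<bar> \<le> 1" "x = mat r *v y + m" by (auto simp: nx)
    define t where "t = (1 + y $ i) / 2"
    have t: "0 \<le> t" "t \<le> 1" using y(1) by (auto simp: t_def abs_le_iff)
    have "x = (1 - t) *\<^sub>R p + t *\<^sub>R q" unfolding eq y(2) vector_add_component Ax by (simp add: t_def r_def m_def field_simps)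
    then show "x \<in> K" using convexD_alt[OF D(2) p(1) q(1) t] by simp
  qed
  moreover have "invertible (mat r :: real^'n^'n)"
  proof -
    have "det (mat r :: real^'n^'n) = r ^ CARD('n)" by (subst det_diagonal) (auto simp: mat_def)
    then show ?thesis using r by (simp add: invertible_det_nz)
  qed
  ultimately show ?thesis unfolding ellipsoid_def by blast
qed

text \<open>In coordinates orthonormal for the moment form, all unit vectors have the same moment,
  so the support function of the image is constant on the sphere and the image is a ball.\<close>

lemma body_maximizer_ellipsoid:
  fixes K :: "(real^'n) set"
  assumes K: "body_maximizer TYPE('m::finite) K"
  shows "ellipsoid K"
proof (cases "2 \<le> CARD('n)")
  case False
  have "0 < CARD('n)" by simp
  then have "CARD('n) = 1" using False by linarith
  then show ?thesis using K by (intro ellipsoid_dimension_one) (auto simp: body_maximizer_def)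
next
  case n: True
  have cK0: "convex_body K" using K by (simp add: body_maximizer_def)
  obtain z where z: "centered ((+) (- z) ` K)" using exists_centering[OF cK0] .
  let ?K = "(+) (- z) ` K"
  have mK: "body_maximizer TYPE('m) ?K" by (rule body_maximizer_translation[OF K])
  then have cK: "convex_body ?K" by (simp add: body_maximizer_def)
  let ?q = "moment ?K"
  note B = bilinear_moment[OF cK]
  obtain W where W: "det W \<noteq> 0" "\<And>i j. ?q (W $ i) (W $ j) = (if i = j then 1 else 0)"
    using orthonormal_rows[OF B moment_commute[OF cK] moment_pos[OF cK]] by blast
  have iW: "invertible W" using W(1) by (simp add: invertible_det_nz)
  have qW: "?q (transpose W *v c) (transpose W *v c) = (norm c)\<^sup>2" for c
  proof -
    have T: "transpose W *v c = (\<Sum>i\<in>UNIV. c $ i *\<^sub>R W $ i)"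
      by (simp add: matrix_mult_sum[of "transpose W"] row_def scalar_mult_eq_scaleR del: transpose_matrix_vector)
    have "?q (transpose W *v c) (transpose W *v c) = (\<Sum>(i, j)\<in>UNIV \<times> UNIV. ?q (c $ i *\<^sub>R W $ i) (c $ j *\<^sub>R W $ j))"
      unfolding T by (rule bilinear_sum[OF B])
    also have "\<dots> = (\<Sum>i\<in>UNIV. \<Sum>j\<in>UNIV. if j = i then (c $ i)\<^sup>2 else 0)"
      unfolding sum.cartesian_product[symmetric]
      by (intro sum.cong refl) (simp only: bilinear_lmul[OF B] bilinear_rmul[OF B] W(2), auto simp: power2_eq_square)
    also have "\<dots> = (norm c)\<^sup>2" by (simp add: norm_vec_def L2_set_def sum_nonneg)
    finally show ?thesis .
  qed
  let ?L = "(*v) W ` ?K"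
  have cL: "convex_body ?L" by (rule convex_body_linear_image[OF iW cK])
  note L = convex_bodyD[OF cL]
  define \<kappa> where "\<kappa> = support ?L (axis undefined 1)"
  have sL: "support ?L u = \<kappa>" if u: "u \<in> sphere 0 1" for u
    unfolding \<kappa>_def support_linear_image
    by (rule support_eq_of_moment_eq[OF mK z n]) (use u in \<open>simp only: qW, simp\<close>)
  have \<kappa>: "0 < \<kappa>"
  proof -
    obtain p r where r: "0 < r" "cball p r \<subseteq> ?L" using convex_body_ball[OF cL] .
    let ?u = "axis undefined 1 :: real^'n"
    \<comment> \<open>The centre \<open>p\<close> of the inscribed ball is unknown; adding the
      bounds for opposite directions eliminates it.\<close>
    have "p \<bullet> ?u + r * norm ?u \<le> \<kappa>" "p \<bullet> (- ?u) + r * norm (- ?u) \<le> \<kappa>"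
      using support_ge_ball[OF L(4) r(2), of ?u] support_ge_ball[OF L(4) r(2), of "- ?u"] sL[of ?u] sL[of "- ?u"] r by auto
    then show ?thesis using r(1) by simp
  qed
  have Lb: "?L = cball 0 \<kappa>"
  proof (intro set_eqI)
    fix x
    have "x \<in> ?L \<longleftrightarrow> (\<forall>u\<in>sphere 0 1. x \<bullet> u \<le> \<kappa>)"
      unfolding mem_convex_body_iff_support[OF L(5,2,4,6)] using sL by auto
    also have "\<dots> \<longleftrightarrow> norm x \<le> \<kappa>"
    proof
      assume a: "\<forall>u\<in>sphere 0 1. x \<bullet> u \<le> \<kappa>"
      show "norm x \<le> \<kappa>"
      proof (cases "x = 0")
        case False
        then have "x \<bullet> ((1 / norm x) *\<^sub>R x) \<le> \<kappa>" using a by (intro bspec[OF a]) simp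
        then show ?thesis using False by (simp add: power2_norm_eq_inner[symmetric] power2_eq_square)
      qed (use \<kappa> in simp)
    next
      assume "norm x \<le> \<kappa>"
      then show "\<forall>u\<in>sphere 0 1. x \<bullet> u \<le> \<kappa>" using norm_cauchy_schwarz[of x] by (fastforce intro: order_trans)
    qed
    finally show "x \<in> ?L \<longleftrightarrow> x \<in> cball 0 \<kappa>" by simp
  qed
  obtain V where V: "W ** V = mat 1" "V ** W = mat 1" using iW by (auto simp: invertible_def)
  have "?K = (\<lambda>x. (\<kappa> *\<^sub>R V) *v x + 0) ` cball 0 1"
  proof -
    have "?K = (*v) V ` ?L" unfolding image_image[of "(*v) V" "(*v) W"] by (simp add: matrix_vector_mul_assoc V)
    also have "cball (0::real^'n) \<kappa> = (*\<^sub>R) \<kappa> ` cball 0 1" using \<kappa> by (simp add: cball_scale)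
    then have "(*v) V ` ?L = (\<lambda>x. (\<kappa> *\<^sub>R V) *v x + 0) ` cball 0 1"
      unfolding Lb by (simp add: image_image matrix_vector_mult_scaleR scaleR_matrix_vector_assoc)
    finally show ?thesis .
  qed
  moreover have "invertible (\<kappa> *\<^sub>R V)"
    unfolding invertible_def using V \<kappa>
    by (intro exI[of _ "(1 / \<kappa>) *\<^sub>R W"]) (simp add: scalar_matrix_assoc[symmetric] matrix_scalar_ac)
  ultimately have "ellipsoid ?K" unfolding ellipsoid_def by blast
  then have "ellipsoid ((+) z ` ?K)" by (rule ellipsoid_translation)
  then show ?thesis by (simp add: image_image)
qed

lemma body_value_ellipsoid:
  fixes E :: "(real^'n) set"
  assumes "ellipsoid E"
  shows "body_value TYPE('m::finite) E = body_value TYPE('m) (cball (0::real^'n) 1)"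
proof -
  obtain A :: "real^'n^'n" and b where A: "invertible A" "E = (\<lambda>x. A *v x + b) ` cball 0 1" using assms unfolding ellipsoid_def by blast
  have cB: "convex_body (cball (0::real^'n) 1)" by (simp add: convex_body_def)
  have "E = (+) b ` (*v) A ` cball 0 1" unfolding A(2) by (simp add: image_image add.commute)
  then show ?thesis
    using body_value_translation[OF convex_body_linear_image[OF A(1) cB]] body_value_linear_image[OF A(1) cB] by metis
qed

theorem theorem1p1:
  fixes K :: "(real^'n) set"
  assumes "convex_body K"
  shows "measure lebesgue (polar (diff_body K :: (real^'n^'m) set)) * measure lebesgue K ^ CARD('m)
           \<le> measure lebesgue (polar (diff_body (cball (0::real^'n) 1) :: (real^'n^'m) set))
              * measure lebesgue (cball (0::real^'n) 1) ^ CARD('m)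
       \<and> (measure lebesgue (polar (diff_body K :: (real^'n^'m) set)) * measure lebesgue K ^ CARD('m)
           = measure lebesgue (polar (diff_body (cball (0::real^'n) 1) :: (real^'n^'m) set))
              * measure lebesgue (cball (0::real^'n) 1) ^ CARD('m)
          \<longleftrightarrow> ellipsoid K)"
proof -
  let ?B = "cball (0::real^'n) 1"
  have cB: "convex_body ?B" by (simp add: convex_body_def)
  have val: "measure lebesgue (polar (diff_body L :: (real^'n^'m) set)) * measure lebesgue L ^ CARD('m) = body_value TYPE('m) L"
    if L: "convex_body L" for L :: "(real^'n) set"
  proof -
    note D = convex_bodyD[OF L]
    have "(dpolar L :: (real^'n^'m) set) \<in> sets borel" by (rule borel_compact[OF compact_dpolar[OF L]])
    then show ?thesis using D by (simp add: polar_diff_body body_value_def)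
  qed
  \<comment> \<open>All ellipsoids share the value of the ball, so a single maximizer, being an
    ellipsoid, identifies the maximum.\<close>
  obtain M :: "(real^'n) set" where M: "body_maximizer TYPE('m) M" using exists_body_maximizer by blast
  have eq: "body_value TYPE('m) M = body_value TYPE('m) ?B"
    by (rule body_value_ellipsoid[OF body_maximizer_ellipsoid[OF M]])
  have le: "body_value TYPE('m) L \<le> body_value TYPE('m) ?B" if "convex_body L" for L :: "(real^'n) set"
    using M that unfolding body_maximizer_def eq by blast
  have "body_value TYPE('m) K = body_value TYPE('m) ?B \<longleftrightarrow> ellipsoid K"
  proof
    assume "body_value TYPE('m) K = body_value TYPE('m) ?B"
    \<comment> \<open>In the equality case \<open>K\<close> attains the maximum itself, so the
      characterization of maximizers applies to it.\<close>
    then have "body_maximizer TYPE('m) K" using assms le by (simp add: body_maximizer_def)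
    then show "ellipsoid K" by (rule body_maximizer_ellipsoid)
  qed (rule body_value_ellipsoid)
  then show ?thesis unfolding val[OF assms] val[OF cB] using le[OF assms] by blast
qed

end
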